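(* For every $\pi\in[0,1]$, the strategy pair $(\hat\tau^*,\tau^* )$ is optimal for the quickest detection problem with costly observations written in the form $V(\pi)=\inf_{\hat\tau\in\mathcal T}\inf_{\tau\in\mathcal S^{\hat\tau}_0}K_\pi(\hat\tau,\tau)$; that is, it attains the infimum: $$V(\pi)=K_\pi(\hat\tau^*,\tau^* )=\mathbb E_\pi\Big[F(\Pi_{\tau^*})+c\tau^*-\frac c\lambda\sum_{k=0}^{n^*-1}(1-\Pi_{\tau^*_k})\big(1-e^{-\lambda(\tau^*_{k+1}-\tau^*_k)}\big)+d\,n^*\Big].$$
   Context: Constants: $\lambda>0$, $c>0$, $d>0$, $\alpha\in\mathbb R$. For $\pi\in[0,1]$, $(\Omega,\mathcal F,\mathbb P_\pi)$ carries a standard Brownian motion $W$ and an independent random variable $\Theta\ge0$ with $\mathbb P_\pi(\Theta=0)=\pi$ and $\mathbb P_\pi(\Theta>t)=(1-\pi)e^{-\lambda t}$, $t\ge0$; $\mathbb E_\pi$ is the expectation under $\mathbb P_\pi$. The observed process is $X_t=\alpha(t-\Theta)^++W_t$. Observation sequences: $\mathcal T$ is the set of strictly increasing sequences $\hat\tau=\{\tau_1,\tau_2,\dots\}$ of random variables with $\tau_1$ positive and deterministic and $\tau_j$ measurable with respect to $\sigma(X_{\tau_1},\dots,X_{\tau_{j-1}},\tau_1,\dots,\tau_{j-1})$ for $j\ge2$. The value $+\infty$ is allowed (meaning no further observation; once $\tau_j=\infty$ all later terms are $\infty$, and strict increase is required only as long as the terms are finite; by convention $X_\infty:=0$). Set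 $\tau_0:=0$. Filtration: $\mathcal F^{\hat\tau}_t=\sigma(X_{\tau_1},\dots,X_{\tau_j},\tau_1,\dots,\tau_j;\ j=\sup\{k:\tau_k\le t\})$, i.e. the information generated by the observation times up to $t$ and the values of $X$ observed at them; $\mathbb F^{\hat\tau}=(\mathcal F^{\hat\tau}_t)_{t\ge0}$. $\mathcal S^{\hat\tau}$ is the set of $\mathbb F^{\hat\tau}$-stopping times, and $\mathcal S^{\hat\tau}_0\subseteq\mathcal S^{\hat\tau}$ the subset of those $\tau$ such that $\mathbb P_\pi$-a.s. $\tau=\tau_k$ for some $k=k(\omega)\in\{0,1,2,\dots\}$. One may restrict to stopping times with $\mathbb E_\pi[\tau]<\infty$. Posterior process: $\Pi^{\hat\tau}_t:=\mathbb P_\pi(\Theta\le t\mid\mathcal F^{\hat\tau}_t)$. Value function: $$V(\pi)=\inf_{\hat\tau\in\mathcal T}\inf_{\tau\in\mathcal S^{\hat\tau}}\Big\{\mathbb P_\pi(\tau<\Theta)+\mathbb E_\pi\Big[c(\tau-\Theta)^++d\sum_{k=1}^\infty\mathbf 1_{\{\tau_k\le\tau\}}\Big]\Big\}.$$ Cost of never observing: $$F(\pi)=\inf_{t\ge0}\Big\{(1-\pi)e^{-\lambda t}+ct-c(1-\pi)\frac{1-e^{-\lambda t}}\lambda\Big\},$$ which equals $\frac c\lambda\big(\pi+\log\frac{(\lambda+c)(1-\pi)}c\big)$ if $\pi<\frac\lambda{c+\lambda}$ and $1-\pi$ if $\pi\ge\frac\lambda{c+\lambda}$. Equivalent form of the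 problem: $V(\pi)=\inf_{\hat\tau\in\mathcal T}\inf_{\tau\in\mathcal S_0^{\hat\tau}}K_\pi(\hat\tau,\tau)$, where $$K_\pi(\hat\tau,\tau)=\mathbb E_\pi\Big[F(\Pi^{\hat\tau}_\tau)+c\tau-\frac c\lambda\sum_{k=0}^\infty(1-\Pi^{\hat\tau}_{\tau_k})\big(1-e^{-\lambda(\tau_{k+1}-\tau_k)}\big)\mathbf 1_{\{\tau_{k+1}\le\tau\}}+d\sum_{k=1}^\infty\mathbf 1_{\{\tau_k\le\tau\}}\Big].$$ Auxiliary functions: for $t>0$, $\pi\in[0,1)$, $x\in\mathbb R$, $$j(t,\pi,x)=\exp\Big\{\alpha x+\Big(\lambda-\frac{\alpha^2}2\Big)t\Big\}\frac\pi{1-\pi}+\lambda\int_0^t\exp\Big\{\Big(\lambda+\frac{\alpha x}t\Big)u-\frac{\alpha^2u^2}{2t}\Big\}\,du,$$ and for $\pi=1$ the quotient $j/(1+j)$ is interpreted as $1$. For $t>0$, $$\mathcal J_0V(\pi,t)=d+\mathbb E_\pi\Big[V\Big(\frac{j(t,\pi,X_t)}{1+j(t,\pi,X_t)}\Big)\Big]+ct-c(1-\pi)\frac{1-e^{-\lambda t}}\lambda,$$ and $\mathcal J_0V(\pi,0)=d+V(\pi)$. The strategy: let $\mathcal C:=\{\pi\in[0,1]:V(\pi)<F(\pi)\}$, let $t(\pi):=\inf\{t\ge0:\inf_{s\ge0}\mathcal J_0V(\pi,s)=\mathcal J_0V(\pi,t)\}$ (which is positive on $\mathcal C$), and set $t^*(\pi)=t(\pi)$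 for $\pi\in\mathcal C$, $t^*(\pi)=\infty$ for $\pi\notin\mathcal C$. Put $\tau^*_0=0$, $\Pi_{\tau_0^*}=\pi$, and recursively for $k=1,2,\dots$ $$\tau^*_k:=\tau^*_{k-1}+t^*(\Pi_{\tau^*_{k-1}}),\qquad \Pi_{\tau^*_k}:=\frac{j(\tau^*_k-\tau^*_{k-1},\Pi_{\tau^*_{k-1}},X_{\tau^*_k}-X_{\tau^*_{k-1}})}{1+j(\tau^*_k-\tau^*_{k-1},\Pi_{\tau^*_{k-1}},X_{\tau^*_k}-X_{\tau^*_{k-1}})}$$ (the latter as long as $\tau^*_k<\infty$; once $\tau^*_k=\infty$ all later times are $\infty$). Let $\hat\tau^*:=\{\tau^*_k\}_{k\ge1}\in\mathcal T$, let $$n^*:=\min\{k\ge0:\Pi_{\tau^*_k}\notin\mathcal C\}=\min\{k\ge0:\tau^*_{k+1}=\infty\}$$ (with $\min\emptyset=\infty$; $n^*$ is the total number of finite observation times in $\hat\tau^*$), and $\tau^*:=\tau^*_{n^*}$; on $\{n^*=\infty\}$ the cost inside the expectation is understood as $+\infty$. *)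

theory Defs
  imports "HOL-Probability.Probability"
begin

text \<open>
  The family of measures \<open>\<P>\<^sub>\<pi>\<close> lives on one measurable space that carries one process \<open>W\<close> and one
  variable \<open>\<Theta>\<close>, so the strategies do not depend on \<open>\<pi>\<close>. Brownian paths start at 0 and are continuous
  for every sample point; this makes \<open>X\<close> measurable at random times on a space that need not be
  complete, and \<open>X\<^sub>0 = 0\<close>.
\<close>

definition std_brownian_motion :: "'a measure \<Rightarrow> (real \<Rightarrow> 'a \<Rightarrow> real) \<Rightarrow> bool" where
  "std_brownian_motion M W \<longleftrightarrow>
     (\<forall>t\<ge>0. W t \<in> borel_measurable M) \<and>
     (\<forall>\<omega>\<in>space M. W 0 \<omega> = 0 \<and> continuous_on {0..} (\<lambda>t. W t \<omega>)) \<and>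
     (\<forall>s t. 0 \<le> s \<and> s < t \<longrightarrow>
        distributed M lborel (\<lambda>\<omega>. W t \<omega> - W s \<omega>) (\<lambda>x. ennreal (normal_density 0 (sqrt (t - s)) x))) \<and>
     (\<forall>(n::nat) t. 0 \<le> t 0 \<and> (\<forall>i<n. t i < t (Suc i)) \<longrightarrow>
        prob_space.indep_vars M (\<lambda>_. borel) (\<lambda>i \<omega>. W (t (Suc i)) \<omega> - W (t i) \<omega>) {..<n})"

record 'a detection_model =
  law :: "real \<Rightarrow> 'a measure"             \<comment> \<open>\<open>\<pi> \<mapsto> \<P>\<^sub>\<pi>\<close>\<close>
  bm :: "real \<Rightarrow> 'a \<Rightarrow> real"               \<comment> \<open>\<open>W\<close>\<close>
  change_time :: "'a \<Rightarrow> real"             \<comment> \<open>\<open>\<Theta>\<close>\<close>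
  rate :: real                            \<comment> \<open>\<open>\<lambda>\<close>\<close>
  delay_cost :: real                      \<comment> \<open>\<open>c\<close>\<close>
  obs_cost :: real                        \<comment> \<open>\<open>d\<close>\<close>
  drift :: real                           \<comment> \<open>\<open>\<alpha>\<close>\<close>

definition quickest_detection :: "'a detection_model \<Rightarrow> bool" where
  "quickest_detection D \<longleftrightarrow>
     rate D > 0 \<and> delay_cost D > 0 \<and> obs_cost D > 0 \<and>
     (\<forall>\<omega>\<in>space (law D 0). change_time D \<omega> \<ge> 0) \<and>
     (\<forall>\<pi>\<in>{0..1}.
        prob_space (law D \<pi>) \<and> sets (law D \<pi>) = sets (law D 0) \<and>
        std_brownian_motion (law D \<pi>) (bm D) \<and>
        change_time D \<in> borel_measurable (law D \<pi>) \<and>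
        measure (law D \<pi>) {\<omega>\<in>space (law D \<pi>). change_time D \<omega> = 0} = \<pi> \<and>
        (\<forall>t\<ge>0. measure (law D \<pi>) {\<omega>\<in>space (law D \<pi>). change_time D \<omega> > t}
                = (1 - \<pi>) * exp (- rate D * t)) \<and>
        prob_space.indep_set (law D \<pi>)
          (sets (vimage_algebra (space (law D \<pi>)) (change_time D) borel))
          (sets (vimage_algebra (space (law D \<pi>)) (\<lambda>\<omega>. \<lambda>t\<in>{0..}. bm D t \<omega>) (PiM {0..} (\<lambda>_. borel)))))"

abbreviation sample_space :: "'a detection_model \<Rightarrow> 'a set" where
  "sample_space D \<equiv> space (law D 0)"

definition X_obs :: "'a detection_model \<Rightarrow> real \<Rightarrow> 'a \<Rightarrow> real" where
  "X_obs D t \<omega> = drift D * max 0 (t - change_time D \<omega>) + bm D t \<omega>"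

definition X_at :: "'a detection_model \<Rightarrow> ennreal \<Rightarrow> 'a \<Rightarrow> real" where
  "X_at D t \<omega> = (if t = \<infinity> then 0 else X_obs D (enn2real t) \<omega>)"

text \<open>
  An observation sequence is indexed from \<open>0\<close>, with \<open>\<tau>\<^sub>0 = 0\<close> as a convention and the actual
  observation times at the indices \<open>k \<ge> 1\<close>; times are extended nonnegative reals.
\<close>

type_synonym 'a time_seq = "nat \<Rightarrow> 'a \<Rightarrow> ennreal"

definition obs_sigma :: "'a detection_model \<Rightarrow> 'a time_seq \<Rightarrow> nat \<Rightarrow> 'a measure" where
  "obs_sigma D \<sigma> n =
     vimage_algebra (sample_space D) (\<lambda>\<omega>. \<lambda>i\<in>{1..n}. (\<sigma> i \<omega>, X_at D (\<sigma> i \<omega>) \<omega>))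
       (PiM {1..n} (\<lambda>_. borel \<Otimes>\<^sub>M borel))"

definition obs_seqs :: "'a detection_model \<Rightarrow> 'a time_seq set" where
  "obs_seqs D = {\<sigma>.
     (\<forall>\<omega>\<in>sample_space D. \<sigma> 0 \<omega> = 0) \<and>
     (\<exists>s>0. \<forall>\<omega>\<in>sample_space D. \<sigma> 1 \<omega> = s) \<and>
     (\<forall>j\<ge>2. \<sigma> j \<in> borel_measurable (obs_sigma D \<sigma> (j - 1))) \<and>
     (\<forall>\<omega>\<in>sample_space D. \<forall>k.
        (\<sigma> k \<omega> < \<infinity> \<longrightarrow> \<sigma> k \<omega> < \<sigma> (Suc k) \<omega>) \<and> (\<sigma> k \<omega> = \<infinity> \<longrightarrow> \<sigma> (Suc k) \<omega> = \<infinity>))}"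

text \<open>
  The \<open>\<sigma>\<close>-algebra generated by the random number of observations made up to time \<open>t\<close> is generated by
  the marked point process stopped at \<open>t\<close>: observations later than \<open>t\<close> are masked by \<open>(\<infinity>, 0)\<close>.
\<close>

definition obs_filtration :: "'a detection_model \<Rightarrow> 'a time_seq \<Rightarrow> ennreal \<Rightarrow> 'a measure" where
  "obs_filtration D \<sigma> t =
     vimage_algebra (sample_space D)
       (\<lambda>\<omega>. \<lambda>k\<in>{1..}. if \<sigma> k \<omega> \<le> t then (\<sigma> k \<omega>, X_at D (\<sigma> k \<omega>) \<omega>) else (\<infinity>, 0))
       (PiM {1..} (\<lambda>_. borel \<Otimes>\<^sub>M borel))"

definition stop_times :: "'a detection_model \<Rightarrow> 'a time_seq \<Rightarrow> ('a \<Rightarrow> ennreal) set" where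
  "stop_times D \<sigma> = {\<tau>. stopping_time (obs_filtration D \<sigma>) \<tau>}"

definition stop_times0 :: "'a detection_model \<Rightarrow> real \<Rightarrow> 'a time_seq \<Rightarrow> ('a \<Rightarrow> ennreal) set" where
  "stop_times0 D \<pi> \<sigma> = {\<tau>\<in>stop_times D \<sigma>. AE \<omega> in law D \<pi>. \<exists>k. \<tau> \<omega> = \<sigma> k \<omega>}"

text \<open>
  The posterior at a stopping time \<open>\<tau>\<close> is \<open>\<P>\<^sub>\<pi>(\<Theta> \<le> \<tau> | \<F>\<^sub>\<tau>)\<close>; for constant \<open>\<tau> = t\<close> this is \<open>\<Pi>\<^sub>t\<close>. Conditional
  probabilities given each single \<open>\<F>\<^sub>t\<close> are unique only up to a null set depending on \<open>t\<close> and do not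
  determine the process at a random time, so the conditioning is done at the stopping time.
\<close>

definition posterior ::
    "'a detection_model \<Rightarrow> real \<Rightarrow> 'a time_seq \<Rightarrow> ('a \<Rightarrow> ennreal) \<Rightarrow> 'a \<Rightarrow> real" where
  "posterior D \<pi> \<sigma> \<tau> =
     real_cond_exp (law D \<pi>) (filtration.pre_sigma (sample_space D) (obs_filtration D \<sigma>) \<tau>)
       (indicator {\<omega>\<in>sample_space D. ennreal (change_time D \<omega>) \<le> \<tau> \<omega>})"

text \<open>Subtraction on \<^typ>\<open>ennreal\<close> is truncated at \<open>0\<close>, so \<open>\<tau> - \<Theta>\<close> below is \<open>(\<tau> - \<Theta>)\<^sup>+\<close>.\<close>

definition detection_cost ::
    "'a detection_model \<Rightarrow> real \<Rightarrow> 'a time_seq \<Rightarrow> ('a \<Rightarrow> ennreal) \<Rightarrow> ennreal" where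
  "detection_cost D \<pi> \<sigma> \<tau> =
     emeasure (law D \<pi>) {\<omega>\<in>sample_space D. \<tau> \<omega> < ennreal (change_time D \<omega>)} +
     (\<integral>\<^sup>+\<omega>. ennreal (delay_cost D) * (\<tau> \<omega> - ennreal (change_time D \<omega>)) +
            ennreal (obs_cost D) * (\<Sum>k. of_bool (\<sigma> (Suc k) \<omega> \<le> \<tau> \<omega>)) \<partial>law D \<pi>)"

definition V_fun :: "'a detection_model \<Rightarrow> real \<Rightarrow> ennreal" where
  "V_fun D \<pi> = (INF \<sigma>\<in>obs_seqs D. INF \<tau>\<in>stop_times D \<sigma>. detection_cost D \<pi> \<sigma> \<tau>)"

definition F_fun :: "'a detection_model \<Rightarrow> real \<Rightarrow> real" where
  "F_fun D \<pi> = (INF t\<in>{0..}. (1 - \<pi>) * exp (- rate D * t) + delay_cost D * t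
              - delay_cost D * (1 - \<pi>) * ((1 - exp (- rate D * t)) / rate D))"

text \<open>
  The real number inside \<^const>\<open>ennreal\<close> is nonnegative almost surely, because
  \<open>(1 - e\<^bsup>-\<lambda>s\<^esup>) / \<lambda> \<le> s\<close> bounds the subtracted sum by \<open>c\<tau>\<close>; no truncation takes place. A strategy that
  never stops costs \<open>\<infinity>\<close>, as it does in \<^const>\<open>detection_cost\<close>.
\<close>

definition K_fun :: "'a detection_model \<Rightarrow> real \<Rightarrow> 'a time_seq \<Rightarrow> ('a \<Rightarrow> ennreal) \<Rightarrow> ennreal" where
  "K_fun D \<pi> \<sigma> \<tau> =
     (\<integral>\<^sup>+\<omega>. (if \<tau> \<omega> = \<infinity> then \<infinity> else
        ennreal (F_fun D (posterior D \<pi> \<sigma> \<tau> \<omega>) + delay_cost D * enn2real (\<tau> \<omega>)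
          - delay_cost D / rate D *
              (\<Sum>k. (1 - posterior D \<pi> \<sigma> (\<sigma> k) \<omega>) *
                    (1 - exp (- rate D * (enn2real (\<sigma> (Suc k) \<omega>) - enn2real (\<sigma> k \<omega>)))) *
                    of_bool (\<sigma> (Suc k) \<omega> \<le> \<tau> \<omega>))) +
        ennreal (obs_cost D) * (\<Sum>k. of_bool (\<sigma> (Suc k) \<omega> \<le> \<tau> \<omega>))) \<partial>law D \<pi>)"

definition j_fun :: "'a detection_model \<Rightarrow> real \<Rightarrow> real \<Rightarrow> real \<Rightarrow> real" where
  "j_fun D t \<pi> x =
     exp (drift D * x + (rate D - (drift D)\<^sup>2 / 2) * t) * (\<pi> / (1 - \<pi>)) +
     rate D * integral {0..t} (\<lambda>u. exp ((rate D + drift D * x / t) * u - (drift D)\<^sup>2 * u\<^sup>2 / (2 * t)))"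

definition posterior_update :: "'a detection_model \<Rightarrow> real \<Rightarrow> real \<Rightarrow> real \<Rightarrow> real" where
  "posterior_update D t \<pi> x = (if \<pi> = 1 then 1 else j_fun D t \<pi> x / (1 + j_fun D t \<pi> x))"

definition J0V :: "'a detection_model \<Rightarrow> real \<Rightarrow> real \<Rightarrow> ennreal" where
  "J0V D \<pi> t =
     (if t = 0 then ennreal (obs_cost D) + V_fun D \<pi>
      else ennreal (obs_cost D) + (\<integral>\<^sup>+\<omega>. V_fun D (posterior_update D t \<pi> (X_obs D t \<omega>)) \<partial>law D \<pi>) +
           ennreal (delay_cost D * t - delay_cost D * (1 - \<pi>) * ((1 - exp (- rate D * t)) / rate D)))"

definition continuation_set :: "'a detection_model \<Rightarrow> real set" where
  "continuation_set D = {\<pi>\<in>{0..1}. V_fun D \<pi> < ennreal (F_fun D \<pi>)}"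

definition t_opt :: "'a detection_model \<Rightarrow> real \<Rightarrow> real" where
  "t_opt D \<pi> = Inf {t. 0 \<le> t \<and> (INF s\<in>{0..}. J0V D \<pi> s) = J0V D \<pi> t}"

definition t_star :: "'a detection_model \<Rightarrow> real \<Rightarrow> ennreal" where
  "t_star D \<pi> = (if \<pi> \<in> continuation_set D then ennreal (t_opt D \<pi>) else \<infinity>)"

text \<open>
  The state after \<open>k\<close> steps is \<open>(\<tau>\<^sup>*\<^sub>k, \<Pi>\<^bsub>\<tau>*k\<^esub>)\<close>. The second component is meaningful only while
  \<open>\<tau>\<^sup>*\<^sub>k < \<infinity>\<close>; afterwards it keeps its last value.
\<close>

primrec opt_state :: "'a detection_model \<Rightarrow> real \<Rightarrow> nat \<Rightarrow> 'a \<Rightarrow> ennreal \<times> real" where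
  "opt_state D \<pi> 0 \<omega> = (0, \<pi>)"
| "opt_state D \<pi> (Suc k) \<omega> =
     (let (s, p) = opt_state D \<pi> k \<omega>; s' = s + t_star D p
      in (s', if s' = \<infinity> then p
              else posterior_update D (enn2real s' - enn2real s) p (X_at D s' \<omega> - X_at D s \<omega>)))"

definition opt_seq :: "'a detection_model \<Rightarrow> real \<Rightarrow> 'a time_seq" where
  "opt_seq D \<pi> k \<omega> = fst (opt_state D \<pi> k \<omega>)"

definition opt_post :: "'a detection_model \<Rightarrow> real \<Rightarrow> nat \<Rightarrow> 'a \<Rightarrow> real" where
  "opt_post D \<pi> k \<omega> = snd (opt_state D \<pi> k \<omega>)"

text \<open>In \<^typ>\<open>enat\<close> the infimum of a nonempty set is its minimum and that of the empty set is \<open>\<infinity>\<close>.\<close>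

definition n_star :: "'a detection_model \<Rightarrow> real \<Rightarrow> 'a \<Rightarrow> enat" where
  "n_star D \<pi> \<omega> = (INF k\<in>{k. opt_post D \<pi> k \<omega> \<notin> continuation_set D}. enat k)"

definition opt_stop :: "'a detection_model \<Rightarrow> real \<Rightarrow> 'a \<Rightarrow> ennreal" where
  "opt_stop D \<pi> \<omega> = (case n_star D \<pi> \<omega> of enat n \<Rightarrow> opt_seq D \<pi> n \<omega> | \<infinity> \<Rightarrow> \<infinity>)"

end

theory Submission
  imports Defs
begin

text \<open>
  Why the strategy is optimal. Let \<open>p\<close> be the posterior probability that the change has happened by the
  time of an observation. Given the observations, the time left until the change is \<open>0\<close> with
  probability \<open>p\<close> and, since the exponential law has no memory, exponential otherwise. After a wait of
  length \<open>s\<close> the next increment of the observed process has an explicit density \<open>lik s p\<close>, and Bayes'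
  formula replaces \<open>p\<close> by \<open>bayes s p x = j / (1 + j)\<close> (\<open>one_step_bayes\<close>, \<open>posterior_update_eq_bayes\<close>). Hence
  the posterior at the observation times is a controlled Markov chain. As the waiting times are themselves
  functions of earlier observations, this needs Brownian increments that start at a random time and
  are independent of everything seen before (\<open>fresh_step\<close>); the induction over the observations is
  \<open>filter_law\<close>.

  The control problem of this chain is solved by value iteration. The limit \<open>val\<close> satisfies
  \<open>val p = min (F p) (INF s>0. obs_value val s p)\<close> (\<open>val_fixed_point\<close>), where \<open>obs_value val s p\<close> is the cost
  of one observation after time \<open>s\<close> followed by \<open>val\<close>. It is concave, because \<open>lik\<close> is affine in the prior.
  Concavity gives continuity inside the unit interval and a continuous minorant that touches \<open>val\<close> at \<open>p\<close>; this
  minorant shows that observing almost immediately wastes the observation cost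
  (\<open>obs_value_near_zero\<close>). Where \<open>val < F\<close>, the infimum over \<open>s\<close> is therefore attained, the least minimiser
  \<open>wait_time\<close> is positive, and it depends measurably on \<open>p\<close>.

  Both forms of the cost are now compared with \<open>val\<close>. Conditioning the cost observation by observation
  gives a series of stopping parts and moving parts. By the fixed point equation its
  partial sums together with the value still to be paid never drop below \<open>val \<pi>\<close>. The remainder
  vanishes: every observation costs the same positive amount, so a finite total cost makes late
  observations improbable (\<open>reach_vanishes\<close>). Thus every strategy costs at least \<open>val \<pi>\<close>
  (\<open>val_le_detection_cost\<close>, \<open>val_le_K\<close>).

  The feedback strategy that waits \<open>wait_time\<close> while \<open>val < F\<close> turns all these inequalities into equalities
  (\<open>fb_total\<close>). If it stops at the last observation, its cost \<open>K\<close> is \<open>val \<pi>\<close>. If it idles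
  for the minimising time in \<open>F\<close> after the last observation, its detection cost is \<open>val \<pi>\<close>, so
  \<open>V = val\<close> (\<open>V_fun_eq_val\<close>). The continuation set and the least minimisers of \<open>V\<close> are then those of
  \<open>val\<close>, and the strategy of the theorem is the feedback strategy (\<open>opt_eq\<close>).
\<close>

section \<open>Brownian increments after a predictable time\<close>

abbreviation std_gauss :: "real measure" where
  "std_gauss \<equiv> density lborel std_normal_density"

lemma prob_space_std_gauss: "prob_space std_gauss"
  by (rule prob_space_normal_density) simp

lemma sets_std_gauss [simp, measurable_cong]: "sets std_gauss = sets borel"
  by simp

text \<open>
  The bound by \<open>1\<close> is inherited by products, so the constant \<open>1\<close> dominates in every passage to the limit.
\<close>

definition test_fun :: "(real \<Rightarrow> real) \<Rightarrow> bool" where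
  "test_fun h \<longleftrightarrow> continuous_on UNIV h \<and> (\<forall>x. 0 \<le> h x \<and> h x \<le> 1)"

lemma test_funD:
  assumes "test_fun h"
  shows "continuous_on UNIV h" "0 \<le> h x" "h x \<le> 1" "h \<in> borel_measurable borel"
  using assms unfolding test_fun_def by (auto intro: borel_measurable_continuous_onI)

text \<open>
  Ramps that fall from \<open>1\<close> to \<open>0\<close> on \<open>[a, a + 1/m]\<close> are test functions, and they decrease to the indicator of
  \<open>{..a}\<close>; so test functions determine the distribution function.
\<close>

lemma measure_eqI_test_fun:
  fixes M N :: "real measure"
  assumes "finite_measure M" "finite_measure N" and [simp]: "sets M = sets borel" "sets N = sets borel"
  assumes eq: "\<And>h. test_fun h \<Longrightarrow> (\<integral>\<^sup>+x. ennreal (h x) \<partial>M) = (\<integral>\<^sup>+x. ennreal (h x) \<partial>N)"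
  shows "M = N"
proof (rule cdf_unique')
  interpret M: finite_measure M by fact
  interpret N: finite_measure N by fact
  have [simp]: "space M = UNIV" "space N = UNIV"
    using sets_eq_imp_space_eq[OF assms(3)] sets_eq_imp_space_eq[OF assms(4)] by simp_all
  show "finite_borel_measure M" "finite_borel_measure N"
    by (auto intro!: finite_borel_measure.intro finite_borel_measure_axioms.intro assms)
  \<comment> \<open>the ramp that is \<open>1\<close> up to \<open>a\<close> and \<open>0\<close> from \<open>a + 1/m\<close> on\<close>
  define h where "h a m x = max 0 (min 1 (1 - real m * (x - a)))" for a :: real and m x
  have th: "test_fun (h a m)" for a m
    unfolding test_fun_def h_def by (auto intro!: continuous_intros)
  have lim: "(\<lambda>m. h a m x) \<longlonglongrightarrow> indicator {..a} x" for a x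
  proof (cases "x \<le> a")
    case True
    have "h a m x = 1" for m
    proof -
      have "real m * (x - a) \<le> 0" using True by (simp add: mult_nonneg_nonpos)
      then show ?thesis by (simp add: h_def)
    qed
    then show ?thesis using True by simp
  next
    case False
    then obtain n where n: "1 < real n * (x - a)" using reals_Archimedean3[of "x - a"] by auto
    have "h a m x = 0" if "m \<ge> n" for m
    proof -
      have "real n * (x - a) \<le> real m * (x - a)" using False that by (intro mult_right_mono) auto
      then show ?thesis using n by (simp add: h_def)
    qed
    then have "eventually (\<lambda>m. h a m x = 0) sequentially" by (auto simp: eventually_sequentially)
    then show ?thesis using False by (auto intro: tendsto_eventually)
  qed
  have conv: "(\<lambda>m. \<integral>\<^sup>+x. ennreal (h a m x) \<partial>L) \<longlonglongrightarrow> emeasure L {..a}"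
    if L: "finite_measure L" "sets L = sets borel" for L :: "real measure" and a
  proof -
    interpret L: finite_measure L by fact
    have [measurable]: "h a m \<in> borel_measurable L" for m
      using test_funD(4)[OF th] L(2) by (simp cong: measurable_cong_sets)
    have "(\<lambda>m. \<integral>\<^sup>+x. ennreal (h a m x) \<partial>L) \<longlonglongrightarrow> (\<integral>\<^sup>+x. ennreal (indicator {..a} x) \<partial>L)"
    proof (rule nn_integral_dominated_convergence[where w="\<lambda>_. 1"])
      show "(\<lambda>x. ennreal (indicator {..a} x)) \<in> borel_measurable L"
        using L(2) by (intro measurable_compose[OF _ measurable_ennreal] borel_measurable_indicator) auto
      show "AE x in L. (\<lambda>m. ennreal (h a m x)) \<longlonglongrightarrow> ennreal (indicator {..a} x)"
        by (intro AE_I2 tendsto_ennrealI lim)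
      show "(\<integral>\<^sup>+x. 1 \<partial>L) < \<infinity>" using L.emeasure_finite[of "space L"] by (simp add: less_top[symmetric])
      show "AE x in L. ennreal (h a m x) \<le> 1" for m
        using test_funD(3)[OF th] by (auto simp: ennreal_le_1)
    qed auto
    also have "(\<integral>\<^sup>+x. ennreal (indicator {..a} x) \<partial>L) = emeasure L {..a}"
      using L(2) by (simp add: ennreal_indicator)
    finally show ?thesis .
  qed
  have "emeasure M {..a} = emeasure N {..a}" for a
    using LIMSEQ_unique[OF conv[of M a] ] conv[of N a] eq[OF th] assms by auto
  then show "cdf M = cdf N" unfolding cdf_def by (auto simp: measure_def)
qed

locale brownian = prob_space M for M :: "'a measure" +
  fixes W :: "real \<Rightarrow> 'a \<Rightarrow> real"
  assumes bm: "std_brownian_motion M W"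
begin

lemma bm_measurable: "0 \<le> t \<Longrightarrow> W t \<in> borel_measurable M"
  and bm_0: "\<omega> \<in> space M \<Longrightarrow> W 0 \<omega> = 0"
  and bm_cont: "\<omega> \<in> space M \<Longrightarrow> continuous_on {0..} (\<lambda>t. W t \<omega>)"
  and bm_distr: "0 \<le> s \<Longrightarrow> s < t \<Longrightarrow>
        distributed M lborel (\<lambda>\<omega>. W t \<omega> - W s \<omega>) (\<lambda>x. ennreal (normal_density 0 (sqrt (t - s)) x))"
  and bm_indep: "0 \<le> u 0 \<Longrightarrow> (\<And>i. i < n \<Longrightarrow> u i < u (Suc i)) \<Longrightarrow>
        indep_vars (\<lambda>_. borel) (\<lambda>i \<omega>. W (u (Suc i)) \<omega> - W (u i) \<omega>) {..<n}"
  using bm unfolding std_brownian_motion_def by auto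

lemma bm_tendsto:
  assumes "\<omega> \<in> space M" "0 \<le> t" "\<And>m. 0 \<le> f m" "f \<longlonglongrightarrow> t"
  shows "(\<lambda>m. W (f m) \<omega>) \<longlonglongrightarrow> W t \<omega>"
  using bm_cont[OF assms(1)] assms(2-4) unfolding continuous_on_sequentially comp_def by auto

end

text \<open>
  The least multiple of \<open>1 / (m + 1)\<close> strictly above a time \<open>r \<ge> 0\<close>. Applied to a random time it gives a time with
  countably many values that uses no further information and stays positive.
\<close>

definition grid_above :: "nat \<Rightarrow> real \<Rightarrow> real" where
  "grid_above m r = real (nat \<lfloor>r * real (Suc m)\<rfloor> + 1) / real (Suc m)"

lemma grid_above_gt: "0 \<le> r \<Longrightarrow> r < grid_above m r"
proof -
  assume "0 \<le> r"
  then have "r * real (Suc m) < real (nat \<lfloor>r * real (Suc m)\<rfloor> + 1)"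
    by (simp add: of_nat_nat) linarith
  then show ?thesis unfolding grid_above_def by (subst pos_less_divide_eq) auto
qed

lemma grid_above_le: "0 \<le> r \<Longrightarrow> grid_above m r \<le> r + 1 / real (Suc m)"
proof -
  assume r: "0 \<le> r"
  have "real (nat \<lfloor>r * real (Suc m)\<rfloor> + 1) \<le> r * real (Suc m) + 1"
    using r by (simp add: of_nat_nat)
  then have "grid_above m r \<le> (r * real (Suc m) + 1) / real (Suc m)"
    unfolding grid_above_def by (intro divide_right_mono) auto
  also have "\<dots> = r + 1 / real (Suc m)" by (simp add: add_divide_distrib)
  finally show ?thesis .
qed

lemma grid_above_tendsto: "0 \<le> r \<Longrightarrow> (\<lambda>m. grid_above m r) \<longlonglongrightarrow> r"
proof (rule tendsto_sandwich[where f="\<lambda>_. r" and h="\<lambda>m. r + 1 / real (Suc m)"])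
  assume r: "0 \<le> r"
  show "\<forall>\<^sub>F m in sequentially. r \<le> grid_above m r"
    by (auto intro: always_eventually less_imp_le[OF grid_above_gt[OF r]])
  show "\<forall>\<^sub>F m in sequentially. grid_above m r \<le> r + 1 / real (Suc m)"
    using grid_above_le[OF r] by (auto intro: always_eventually)
  have "(\<lambda>m. r + 1 / real (Suc m)) \<longlonglongrightarrow> r + 0"
    by (intro tendsto_add tendsto_const LIMSEQ_Suc lim_const_over_n)
  then show "(\<lambda>m. r + 1 / real (Suc m)) \<longlonglongrightarrow> r" by simp
qed auto

text \<open>
  By continuity of the paths the value at \<open>S\<close> is a limit of values at times with countably many values.
\<close>

lemma (in brownian) bm_at_measurable:
  assumes [measurable]: "S \<in> borel_measurable M" and S: "\<And>\<omega>. \<omega> \<in> space M \<Longrightarrow> 0 \<le> S \<omega>"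
  shows "(\<lambda>\<omega>. W (S \<omega>) \<omega>) \<in> borel_measurable M"
proof (rule borel_measurable_LIMSEQ_metric)
  show "(\<lambda>m. W (grid_above m (S \<omega>)) \<omega>) \<longlonglongrightarrow> W (S \<omega>) \<omega>" if "\<omega> \<in> space M" for \<omega>
    using that S grid_above_gt[OF S[OF that]]
    by (intro bm_tendsto grid_above_tendsto) (auto intro: less_imp_le order.strict_trans1)
  show "(\<lambda>\<omega>. W (grid_above m (S \<omega>)) \<omega>) \<in> borel_measurable M" for m
  proof -
    have "(\<lambda>\<omega>. (\<lambda>i \<omega>. W (real (i + 1) / real (Suc m)) \<omega>) (nat \<lfloor>S \<omega> * real (Suc m)\<rfloor>) \<omega>) \<in> borel_measurable M"
      by (rule measurable_compose_countable) (auto intro!: bm_measurable)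
    then show ?thesis unfolding grid_above_def by simp
  qed
qed

lemma nn_integral_split_countable:
  fixes N :: "'a \<Rightarrow> nat"
  assumes [measurable]: "N \<in> measurable M (count_space UNIV)" "f \<in> borel_measurable M"
  shows "(\<integral>\<^sup>+x. f x \<partial>M) = (\<Sum>i. \<integral>\<^sup>+x. indicator {i} (N x) * f x \<partial>M)"
proof -
  have "(\<integral>\<^sup>+x. f x \<partial>M) = (\<integral>\<^sup>+x. (\<Sum>i. indicator {i} (N x) * f x) \<partial>M)"
  proof (rule nn_integral_cong)
    fix x
    have "(\<Sum>i. indicator {i} (N x) * f x) = (\<Sum>i\<in>{N x}. indicator {i} (N x) * f x)"
      by (rule suminf_finite) auto
    then show "f x = (\<Sum>i. indicator {i} (N x) * f x)" by simp
  qed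
  also have "\<dots> = (\<Sum>i. \<integral>\<^sup>+x. indicator {i} (N x) * f x \<partial>M)"
    by (intro nn_integral_suminf borel_measurable_times_ennreal assms
          measurable_compose[OF assms(1)]) simp
  finally show ?thesis .
qed

text \<open>
  The strong Markov property in the form needed here: the increments after \<open>S\<close> are independent of the
  history \<open>G\<close> and Gaussian. It is tested by products of continuous functions, because these pass to
  limits in \<open>S\<close>. The grid starts at \<open>0\<close>, so that a waiting time can be prepended to it as a further grid point.
\<close>

definition fresh_after :: "'a measure \<Rightarrow> (real \<Rightarrow> 'a \<Rightarrow> real) \<Rightarrow> 'a measure \<Rightarrow> ('a \<Rightarrow> real) \<Rightarrow> bool" where
  "fresh_after M W G S \<longleftrightarrow>
     subalgebra M G \<and> S \<in> borel_measurable G \<and> (\<forall>\<omega>\<in>space M. 0 \<le> S \<omega>) \<and>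
     (\<forall>n t g A. t 0 = 0 \<longrightarrow> (\<forall>i<n. t i < t (Suc i)) \<longrightarrow> (\<forall>i. test_fun (g i)) \<longrightarrow> A \<in> sets G \<longrightarrow>
        (\<integral>\<^sup>+\<omega>. indicator A \<omega> * ennreal (\<Prod>i<(n::nat). g i (W (S \<omega> + t (Suc i)) \<omega> - W (S \<omega> + t i) \<omega>)) \<partial>M) =
        emeasure M A * ennreal (\<Prod>i<n. \<integral>x. g i (sqrt (t (Suc i) - t i) * x) \<partial>std_gauss))"

lemma test_fun_gauss:
  assumes "test_fun h"
  shows "0 \<le> (\<integral>x. h (r * x) \<partial>std_gauss)" "(\<integral>x. h (r * x) \<partial>std_gauss) \<le> 1"
    "ennreal (\<integral>x. h (r * x) \<partial>std_gauss) = (\<integral>\<^sup>+x. ennreal (h (r * x)) \<partial>std_gauss)"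
proof -
  interpret N: prob_space std_gauss by (rule prob_space_std_gauss)
  note test_funD[OF assms, simp]
  have [measurable]: "h \<in> borel_measurable borel" by simp
  have int: "integrable std_gauss (\<lambda>x. h (r * x))"
    by (rule N.integrable_const_bound[where B=1]) auto
  show "0 \<le> (\<integral>x. h (r * x) \<partial>std_gauss)" by (rule integral_nonneg_AE) simp
  show "(\<integral>x. h (r * x) \<partial>std_gauss) \<le> 1" by (rule N.integral_le_const[OF int]) simp
  show "ennreal (\<integral>x. h (r * x) \<partial>std_gauss) = (\<integral>\<^sup>+x. ennreal (h (r * x)) \<partial>std_gauss)"
    by (rule nn_integral_eq_integral[symmetric, OF int]) simp
qed

lemma test_fun_gauss_tendsto:
  assumes "test_fun h" "f \<longlonglongrightarrow> r"
  shows "(\<lambda>m. \<integral>x. h (sqrt (f m) * x) \<partial>std_gauss) \<longlonglongrightarrow> (\<integral>x. h (sqrt r * x) \<partial>std_gauss)"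
proof -
  interpret N: prob_space std_gauss by (rule prob_space_std_gauss)
  note test_funD[OF assms(1), simp]
  have [measurable]: "h \<in> borel_measurable borel" by simp
  have h: "isCont h x" for x
    using test_funD(1)[OF assms(1)] continuous_on_eq_continuous_at[OF open_UNIV] by blast
  show ?thesis
  proof (rule integral_dominated_convergence[where w="\<lambda>_. 1"])
    show "AE x in std_gauss. (\<lambda>m. h (sqrt (f m) * x)) \<longlonglongrightarrow> h (sqrt r * x)"
      by (intro AE_I2 isCont_tendsto_compose[OF h] tendsto_intros assms)
  qed auto
qed

text \<open>
  All Gaussian integrals are brought to the standard law, so that a random variance enters only through the
  integrand.
\<close>

lemma nn_integral_normal_affine:
  assumes \<sigma>: "0 < \<sigma>" and [measurable]: "f \<in> borel_measurable borel"
  shows "(\<integral>\<^sup>+x. ennreal (normal_density \<mu> \<sigma> x) * f x \<partial>lborel) = (\<integral>\<^sup>+u. f (\<mu> + \<sigma> * u) \<partial>std_gauss)"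
proof -
  have "(\<integral>\<^sup>+x. ennreal (normal_density \<mu> \<sigma> x) * f x \<partial>lborel) =
     \<bar>\<sigma>\<bar> * (\<integral>\<^sup>+u. ennreal (normal_density \<mu> \<sigma> (\<mu> + \<sigma> * u)) * f (\<mu> + \<sigma> * u) \<partial>lborel)"
    using \<sigma> by (intro nn_integral_real_affine) auto
  also have "\<dots> = (\<integral>\<^sup>+u. \<bar>\<sigma>\<bar> * (ennreal (normal_density \<mu> \<sigma> (\<mu> + \<sigma> * u)) * f (\<mu> + \<sigma> * u)) \<partial>lborel)"
    by (rule nn_integral_cmult[symmetric]) measurable
  also have "\<dots> = (\<integral>\<^sup>+u. ennreal (std_normal_density u) * f (\<mu> + \<sigma> * u) \<partial>lborel)"
  proof (rule nn_integral_cong)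
    fix u
    have "\<bar>\<sigma>\<bar> * normal_density \<mu> \<sigma> (\<mu> + \<sigma> * u) = std_normal_density u"
      using \<sigma> by (simp add: normal_density_def real_sqrt_mult power_mult_distrib field_simps)
    then show "ennreal \<bar>\<sigma>\<bar> * (ennreal (normal_density \<mu> \<sigma> (\<mu> + \<sigma> * u)) * f (\<mu> + \<sigma> * u)) = ennreal (std_normal_density u) * f (\<mu> + \<sigma> * u)"
      by (metis abs_ge_zero ennreal_mult' mult.assoc)
  qed
  also have "\<dots> = (\<integral>\<^sup>+u. f (\<mu> + \<sigma> * u) \<partial>std_gauss)"
    by (rule nn_integral_density[symmetric]) auto
  finally show ?thesis .
qed

lemma measurable_pair_subalgebra:
  assumes "subalgebra M G" "Z \<in> borel_measurable M"
  shows "(\<lambda>\<omega>. (\<omega>, Z \<omega>)) \<in> measurable M (G \<Otimes>\<^sub>M borel)"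
  using measurable_from_subalg[OF assms(1) measurable_ident] assms(2)
  by (intro measurable_Pair) (simp_all add: id_def)

lemma prod_test_fun:
  assumes "\<And>i. test_fun (g i)"
  shows "0 \<le> (\<Prod>i<n. g i (x i))" "(\<Prod>i<n. g i (x i)) \<le> 1"
  using test_funD[OF assms] by (auto intro!: prod_nonneg prod_le_1)

context brownian begin

text \<open>
  A wait \<open>R\<close> with countably many values reduces to constant waits, for which the claim is freshness
  after \<open>S\<close> with one more grid point. A general \<open>R\<close> is approximated from above on finer and finer
  grids; continuity of the paths and of the test functions permits the limit.
\<close>

lemma fresh_step_continuous:
  assumes fresh: "fresh_after M W G S"
    and R: "R \<in> borel_measurable G" "\<And>\<omega>. \<omega> \<in> space M \<Longrightarrow> 0 < R \<omega>"
    and t: "t 0 = 0" "\<And>i. i < n \<Longrightarrow> t i < t (Suc i)"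
    and g: "\<And>i. test_fun (g i)" and h: "test_fun h" and A: "A \<in> sets G"
  shows "(\<integral>\<^sup>+\<omega>. indicator A \<omega> * ennreal (h (W (S \<omega> + R \<omega>) \<omega> - W (S \<omega>) \<omega>) *
             (\<Prod>i<n. g i (W (S \<omega> + R \<omega> + t (Suc i)) \<omega> - W (S \<omega> + R \<omega> + t i) \<omega>))) \<partial>M) =
         (\<integral>\<^sup>+\<omega>. indicator A \<omega> * ennreal (\<integral>x. h (sqrt (R \<omega>) * x) \<partial>std_gauss) \<partial>M) *
         ennreal (\<Prod>i<n. \<integral>x. g i (sqrt (t (Suc i) - t i) * x) \<partial>std_gauss)"
    (is "?L = ?R")
proof -
  have sub: "subalgebra M G" and SG: "S \<in> borel_measurable G" and S0: "\<And>\<omega>. \<omega> \<in> space M \<Longrightarrow> 0 \<le> S \<omega>"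
    using fresh unfolding fresh_after_def by auto
  have spG: "space G = space M" using sub by (simp add: subalgebra_def)
  note [measurable] = measurable_from_subalg[OF sub SG] measurable_from_subalg[OF sub R(1)]
  have [measurable]: "A \<in> sets M" using sub A by (auto simp: subalgebra_def)
  note test_funD(4)[OF g, measurable] test_funD(4)[OF h, measurable]
  have t0: "0 \<le> t i" if "i \<le> n" for i
    using that
  proof (induction i)
    case (Suc i)
    then show ?case using t(2)[of i] by linarith
  qed (use t in simp)
  have meas: "(\<lambda>\<omega>. W (f \<omega>) \<omega>) \<in> borel_measurable M"
    if "f \<in> borel_measurable M" "\<And>\<omega>. \<omega> \<in> space M \<Longrightarrow> 0 \<le> f \<omega>" for f
    using bm_at_measurable that by blast
  define \<gamma> where "\<gamma> = (\<Prod>i<n. \<integral>x. g i (sqrt (t (Suc i) - t i) * x) \<partial>std_gauss)"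
  have \<gamma>0: "0 \<le> \<gamma>" unfolding \<gamma>_def by (intro prod_nonneg) (auto intro: test_fun_gauss g)
  define \<Phi> where "\<Phi> f \<omega> = h (W (S \<omega> + f \<omega>) \<omega> - W (S \<omega>) \<omega>) *
             (\<Prod>i<n. g i (W (S \<omega> + f \<omega> + t (Suc i)) \<omega> - W (S \<omega> + f \<omega> + t i) \<omega>))" for f \<omega>
  have \<Phi>01: "0 \<le> \<Phi> f \<omega>" "\<Phi> f \<omega> \<le> 1" for f \<omega>
    unfolding \<Phi>_def by (auto intro!: mult_nonneg_nonneg mult_le_one prod_test_fun[of g, OF g] test_funD[OF h])
  have \<Phi>_meas: "\<Phi> f \<in> borel_measurable M"
    if [measurable]: "f \<in> borel_measurable M" and f0: "\<And>\<omega>. \<omega> \<in> space M \<Longrightarrow> 0 \<le> f \<omega>" for f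
  proof -
    have 1: "(\<lambda>\<omega>. W (S \<omega> + f \<omega>) \<omega>) \<in> borel_measurable M" "(\<lambda>\<omega>. W (S \<omega>) \<omega>) \<in> borel_measurable M"
      by (auto intro!: meas add_nonneg_nonneg S0 f0)
    have 2: "(\<lambda>\<omega>. W (S \<omega> + f \<omega> + t i) \<omega>) \<in> borel_measurable M" if "i \<le> n" for i
      by (auto intro!: meas add_nonneg_nonneg S0 f0 t0 that)
    have 3: "(\<lambda>\<omega>. g i (W (S \<omega> + f \<omega> + t (Suc i)) \<omega> - W (S \<omega> + f \<omega> + t i) \<omega>)) \<in> borel_measurable M" if "i < n" for i
      by (rule measurable_compose[OF borel_measurable_diff[OF 2 2] test_funD(4)[OF g]]) (use that in auto)
    have 4: "(\<lambda>\<omega>. h (W (S \<omega> + f \<omega>) \<omega> - W (S \<omega>) \<omega>)) \<in> borel_measurable M"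
      by (rule measurable_compose[OF borel_measurable_diff[OF 1] test_funD(4)[OF h]])
    show ?thesis unfolding \<Phi>_def by (intro borel_measurable_times borel_measurable_prod 3 4) auto
  qed
  \<comment> \<open>the approximating waits, with values in a grid and strictly positive\<close>
  define RR where "RR m \<omega> = grid_above m (R \<omega>)" for m \<omega>
  have RR0: "0 \<le> RR m \<omega>" "0 < RR m \<omega>" if "\<omega> \<in> space M" for m \<omega>
    using grid_above_gt[of "R \<omega>" m] R(2)[OF that] unfolding RR_def by auto
  have RRm [measurable]: "RR m \<in> borel_measurable M" for m
    unfolding RR_def grid_above_def by measurable
  have eq_m: "(\<integral>\<^sup>+\<omega>. indicator A \<omega> * ennreal (\<Phi> (RR m) \<omega>) \<partial>M) =
      (\<integral>\<^sup>+\<omega>. indicator A \<omega> * ennreal (\<integral>x. h (sqrt (RR m \<omega>) * x) \<partial>std_gauss) \<partial>M) * ennreal \<gamma>" for m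
  proof -
    define N where "N \<omega> = nat \<lfloor>R \<omega> * real (Suc m)\<rfloor>" for \<omega>
    have NG: "N \<in> measurable G (count_space UNIV)"
      unfolding N_def using R(1) by measurable
    note [measurable] = measurable_from_subalg[OF sub NG]
    define r where "r i = real (i + 1) / real (Suc m)" for i
    have r0: "0 < r i" for i unfolding r_def by simp
    have RN: "RR m \<omega> = r (N \<omega>)" for \<omega> unfolding RR_def r_def N_def grid_above_def by simp
    have [measurable]: "(\<lambda>\<omega>. \<integral>x. h (sqrt (RR m \<omega>) * x) \<partial>std_gauss) \<in> borel_measurable M"
      unfolding RN by measurable
    have [measurable]: "\<Phi> (RR m) \<in> borel_measurable M" by (rule \<Phi>_meas) (auto simp: RR0)
    have piece: "(\<integral>\<^sup>+\<omega>. indicator {i} (N \<omega>) * (indicator A \<omega> * ennreal (\<Phi> (RR m) \<omega>)) \<partial>M) =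
      (\<integral>\<^sup>+\<omega>. indicator {i} (N \<omega>) * (indicator A \<omega> * ennreal (\<integral>x. h (sqrt (RR m \<omega>) * x) \<partial>std_gauss)) \<partial>M) * ennreal \<gamma>" for i
    proof -
      define B where "B = A \<inter> {\<omega>\<in>space G. N \<omega> = i}"
      have "{\<omega>\<in>space G. N \<omega> = i} \<in> sets G" using NG by measurable
      then have B: "B \<in> sets G" unfolding B_def using A by auto
      have [measurable]: "B \<in> sets M" using sub B by (auto simp: subalgebra_def)
      \<comment> \<open>on \<open>N = i\<close> the wait is the constant \<open>r i\<close>, which becomes the first positive grid point\<close>
      define t' where "t' = case_nat 0 (\<lambda>j. r i + t j)"
      define g' where "g' = case_nat h g"
      have fr: "(\<integral>\<^sup>+\<omega>. indicator B \<omega> * ennreal (\<Prod>j<Suc n. g' j (W (S \<omega> + t' (Suc j)) \<omega> - W (S \<omega> + t' j) \<omega>)) \<partial>M) =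
        emeasure M B * ennreal (\<Prod>j<Suc n. \<integral>x. g' j (sqrt (t' (Suc j) - t' j) * x) \<partial>std_gauss)"
      proof -
        have "t' 0 = 0" by (simp add: t'_def)
        moreover have "\<forall>j<Suc n. t' j < t' (Suc j)"
          using t r0 by (auto simp: t'_def split: nat.split)
        moreover have "\<forall>j. test_fun (g' j)" using g h by (auto simp: g'_def split: nat.split)
        ultimately show ?thesis using fresh B unfolding fresh_after_def by blast
      qed
      have "(\<integral>\<^sup>+\<omega>. indicator {i} (N \<omega>) * (indicator A \<omega> * ennreal (\<Phi> (RR m) \<omega>)) \<partial>M) =
         (\<integral>\<^sup>+\<omega>. indicator B \<omega> * ennreal (\<Prod>j<Suc n. g' j (W (S \<omega> + t' (Suc j)) \<omega> - W (S \<omega> + t' j) \<omega>)) \<partial>M)"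
        unfolding prod.lessThan_Suc_shift
        by (intro nn_integral_cong)
           (auto simp: B_def \<Phi>_def RN g'_def t'_def spG t(1) add.assoc split: split_indicator)
      also note fr
      also have "(\<Prod>j<Suc n. \<integral>x. g' j (sqrt (t' (Suc j) - t' j) * x) \<partial>std_gauss) =
          (\<integral>x. h (sqrt (r i) * x) \<partial>std_gauss) * \<gamma>"
        unfolding prod.lessThan_Suc_shift \<gamma>_def by (simp add: g'_def t'_def t(1))
      also have "emeasure M B * ennreal ((\<integral>x. h (sqrt (r i) * x) \<partial>std_gauss) * \<gamma>) =
         (\<integral>\<^sup>+\<omega>. ennreal (\<integral>x. h (sqrt (r i) * x) \<partial>std_gauss) * indicator B \<omega> \<partial>M) * ennreal \<gamma>"
        by (simp only: nn_integral_cmult_indicator[OF \<open>B \<in> sets M\<close>] ennreal_mult[OF test_fun_gauss(1)[OF h] \<gamma>0])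
           (simp only: ac_simps)
      also have "(\<integral>\<^sup>+\<omega>. ennreal (\<integral>x. h (sqrt (r i) * x) \<partial>std_gauss) * indicator B \<omega> \<partial>M) =
         (\<integral>\<^sup>+\<omega>. indicator {i} (N \<omega>) * (indicator A \<omega> * ennreal (\<integral>x. h (sqrt (RR m \<omega>) * x) \<partial>std_gauss)) \<partial>M)"
        by (intro nn_integral_cong) (auto simp: B_def RN spG split: split_indicator)
      finally show ?thesis .
    qed
    show ?thesis
      by (subst (1 2) nn_integral_split_countable[where N=N]) (simp_all add: piece ennreal_suminf_multc)
  qed
  \<comment> \<open>both sides converge as the grid becomes finer\<close>
  have limL: "(\<lambda>m. \<integral>\<^sup>+\<omega>. indicator A \<omega> * ennreal (\<Phi> (RR m) \<omega>) \<partial>M) \<longlonglongrightarrow> (\<integral>\<^sup>+\<omega>. indicator A \<omega> * ennreal (\<Phi> R \<omega>) \<partial>M)"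
  proof (rule nn_integral_dominated_convergence[where w="\<lambda>_. 1"])
    have [measurable]: "\<Phi> (RR m) \<in> borel_measurable M" for m by (rule \<Phi>_meas) (auto simp: RR0)
    have [measurable]: "\<Phi> R \<in> borel_measurable M" by (rule \<Phi>_meas) (auto intro: less_imp_le[OF R(2)])
    show "(\<lambda>\<omega>. indicator A \<omega> * ennreal (\<Phi> (RR m) \<omega>)) \<in> borel_measurable M" for m by measurable
    show "(\<lambda>\<omega>. indicator A \<omega> * ennreal (\<Phi> R \<omega>)) \<in> borel_measurable M" by measurable
    show "(\<integral>\<^sup>+\<omega>. 1 \<partial>M) < \<infinity>" by (simp add: emeasure_space_1)
    show "AE \<omega> in M. indicator A \<omega> * ennreal (\<Phi> (RR m) \<omega>) \<le> 1" for m
      using \<Phi>01 by (intro AE_I2) (auto split: split_indicator)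
    have "(\<lambda>m. \<Phi> (RR m) \<omega>) \<longlonglongrightarrow> \<Phi> R \<omega>" if \<omega>: "\<omega> \<in> space M" for \<omega>
    proof -
      have RRl: "(\<lambda>m. RR m \<omega>) \<longlonglongrightarrow> R \<omega>"
        unfolding RR_def using R(2)[OF \<omega>] by (intro grid_above_tendsto) simp
      have W1: "(\<lambda>m. W (S \<omega> + RR m \<omega> + c) \<omega>) \<longlonglongrightarrow> W (S \<omega> + R \<omega> + c) \<omega>" if "0 \<le> c" for c
        using S0[OF \<omega>] R(2)[OF \<omega>] RR0[OF \<omega>] that
        by (intro bm_tendsto \<omega> tendsto_intros RRl) (auto intro!: add_nonneg_nonneg)
      have c1: "isCont (g i) x" "isCont h x" for i x
        using test_funD(1)[OF g] test_funD(1)[OF h] by (simp_all add: continuous_on_eq_continuous_at)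
      show ?thesis unfolding \<Phi>_def
        using W1[of 0] t0
        by (intro tendsto_mult tendsto_prod isCont_tendsto_compose[OF c1(1)] isCont_tendsto_compose[OF c1(2)]
             tendsto_diff tendsto_const W1) auto
    qed
    then show "AE \<omega> in M. (\<lambda>m. indicator A \<omega> * ennreal (\<Phi> (RR m) \<omega>)) \<longlonglongrightarrow> indicator A \<omega> * ennreal (\<Phi> R \<omega>)"
      by (intro AE_I2) (auto intro!: tendsto_ennrealI split: split_indicator)
  qed simp
  have limR: "(\<lambda>m. (\<integral>\<^sup>+\<omega>. indicator A \<omega> * ennreal (\<integral>x. h (sqrt (RR m \<omega>) * x) \<partial>std_gauss) \<partial>M)) \<longlonglongrightarrow>
       (\<integral>\<^sup>+\<omega>. indicator A \<omega> * ennreal (\<integral>x. h (sqrt (R \<omega>) * x) \<partial>std_gauss) \<partial>M)"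
  proof (rule nn_integral_dominated_convergence[where w="\<lambda>_. 1"])
    interpret N: prob_space std_gauss by (rule prob_space_std_gauss)
    have [measurable]: "(\<lambda>\<omega>. \<integral>x. h (sqrt (f \<omega>) * x) \<partial>std_gauss) \<in> borel_measurable M"
      if [measurable]: "f \<in> borel_measurable M" for f
      by (rule N.borel_measurable_lebesgue_integral) measurable
    show "(\<lambda>\<omega>. indicator A \<omega> * ennreal (\<integral>x. h (sqrt (RR m \<omega>) * x) \<partial>std_gauss)) \<in> borel_measurable M" for m by measurable
    show "(\<lambda>\<omega>. indicator A \<omega> * ennreal (\<integral>x. h (sqrt (R \<omega>) * x) \<partial>std_gauss)) \<in> borel_measurable M" by measurable
    show "(\<integral>\<^sup>+\<omega>. 1 \<partial>M) < \<infinity>" by (simp add: emeasure_space_1)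
    show "AE \<omega> in M. indicator A \<omega> * ennreal (\<integral>x. h (sqrt (RR m \<omega>) * x) \<partial>std_gauss) \<le> 1" for m
      using test_fun_gauss(2)[OF h] by (intro AE_I2) (auto simp: ennreal_le_1 split: split_indicator)
    show "AE \<omega> in M. (\<lambda>m. indicator A \<omega> * ennreal (\<integral>x. h (sqrt (RR m \<omega>) * x) \<partial>std_gauss)) \<longlonglongrightarrow>
        indicator A \<omega> * ennreal (\<integral>x. h (sqrt (R \<omega>) * x) \<partial>std_gauss)"
    proof (rule AE_I2)
      fix \<omega> assume \<omega>: "\<omega> \<in> space M"
      have RRl: "(\<lambda>m. RR m \<omega>) \<longlonglongrightarrow> R \<omega>"
        unfolding RR_def using R(2)[OF \<omega>] by (intro grid_above_tendsto) simp
      show "(\<lambda>m. indicator A \<omega> * ennreal (\<integral>x. h (sqrt (RR m \<omega>) * x) \<partial>std_gauss)) \<longlonglongrightarrow>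
        indicator A \<omega> * ennreal (\<integral>x. h (sqrt (R \<omega>) * x) \<partial>std_gauss)"
        using test_fun_gauss_tendsto[OF h RRl]
        by (cases "\<omega> \<in> A") (auto intro: tendsto_ennrealI)
    qed
  qed simp
  have "(\<lambda>m. (\<integral>\<^sup>+\<omega>. indicator A \<omega> * ennreal (\<integral>x. h (sqrt (RR m \<omega>) * x) \<partial>std_gauss) \<partial>M) * ennreal \<gamma>) \<longlonglongrightarrow>
       (\<integral>\<^sup>+\<omega>. indicator A \<omega> * ennreal (\<integral>x. h (sqrt (R \<omega>) * x) \<partial>std_gauss) \<partial>M) * ennreal \<gamma>"
    using ennreal_tendsto_cmult[OF ennreal_less_top limR, of \<gamma>] by (simp add: mult.commute)
  from LIMSEQ_unique[OF limL[unfolded eq_m] this] show ?thesis unfolding \<gamma>_def \<Phi>_def .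
qed

text \<open>
  Test functions in the increment determine, for each event of the history, a measure on the line;
  rectangles determine a measure on the product. Both sides are measures in \<open>C\<close>.
\<close>

lemma fresh_step_law:
  assumes fresh: "fresh_after M W G S"
    and R: "R \<in> borel_measurable G" "\<And>\<omega>. \<omega> \<in> space M \<Longrightarrow> 0 < R \<omega>"
    and t: "t 0 = 0" "\<And>i. i < n \<Longrightarrow> t i < t (Suc i)"
    and g: "\<And>i. test_fun (g i)" and C: "C \<in> sets (G \<Otimes>\<^sub>M borel)"
  shows "(\<integral>\<^sup>+\<omega>. indicator C (\<omega>, W (S \<omega> + R \<omega>) \<omega> - W (S \<omega>) \<omega>) *
             ennreal (\<Prod>i<n. g i (W (S \<omega> + R \<omega> + t (Suc i)) \<omega> - W (S \<omega> + R \<omega> + t i) \<omega>)) \<partial>M) =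
         (\<integral>\<^sup>+\<omega>. (\<integral>\<^sup>+x. indicator C (\<omega>, sqrt (R \<omega>) * x) \<partial>std_gauss) \<partial>M) *
         ennreal (\<Prod>i<n. \<integral>x. g i (sqrt (t (Suc i) - t i) * x) \<partial>std_gauss)"
proof -
  interpret N: prob_space std_gauss by (rule prob_space_std_gauss)
  have sub: "subalgebra M G" and SG: "S \<in> borel_measurable G" and S0: "\<And>\<omega>. \<omega> \<in> space M \<Longrightarrow> 0 \<le> S \<omega>"
    using fresh unfolding fresh_after_def by auto
  have spG: "space G = space M" and setsG: "sets G \<subseteq> sets M" using sub by (simp_all add: subalgebra_def)
  note [measurable] = measurable_from_subalg[OF sub SG] measurable_from_subalg[OF sub R(1)]
  have t0: "0 \<le> t i" if "i \<le> n" for i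
    using that
  proof (induction i)
    case (Suc i)
    then show ?case using t(2)[of i] by linarith
  qed (use t in simp)
  define \<gamma> where "\<gamma> = (\<Prod>i<n. \<integral>x. g i (sqrt (t (Suc i) - t i) * x) \<partial>std_gauss)"
  have \<gamma>0: "0 \<le> \<gamma>" unfolding \<gamma>_def by (intro prod_nonneg) (auto intro: test_fun_gauss g)
  define Z where "Z \<omega> = W (S \<omega> + R \<omega>) \<omega> - W (S \<omega>) \<omega>" for \<omega>
  define P where "P \<omega> = (\<Prod>i<n. g i (W (S \<omega> + R \<omega> + t (Suc i)) \<omega> - W (S \<omega> + R \<omega> + t i) \<omega>))" for \<omega>
  have P01: "0 \<le> P \<omega>" "P \<omega> \<le> 1" for \<omega> unfolding P_def by (auto intro!: prod_test_fun[of g, OF g])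
  have SR: "0 \<le> S \<omega> + R \<omega>" if "\<omega> \<in> space M" for \<omega>
    using S0[OF that] R(2)[OF that] by simp
  have 2: "(\<lambda>\<omega>. W (S \<omega> + R \<omega> + t i) \<omega>) \<in> borel_measurable M" if "i \<le> n" for i
    by (auto intro!: bm_at_measurable add_nonneg_nonneg[OF SR] t0 that)
  have 3: "(\<lambda>\<omega>. g i (W (S \<omega> + R \<omega> + t (Suc i)) \<omega> - W (S \<omega> + R \<omega> + t i) \<omega>)) \<in> borel_measurable M" if "i < n" for i
    by (rule measurable_compose[OF borel_measurable_diff[OF 2 2] test_funD(4)[OF g]]) (use that in auto)
  have [measurable]: "P \<in> borel_measurable M" unfolding P_def by (intro borel_measurable_prod 3) auto
  have [measurable]: "Z \<in> borel_measurable M" unfolding Z_def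
    by (intro borel_measurable_diff bm_at_measurable) (auto intro!: SR S0)
  note Zpair = measurable_pair_subalgebra[OF sub \<open>Z \<in> borel_measurable M\<close>]
  have idG: "(\<lambda>x. x) \<in> measurable M G"
    using measurable_from_subalg[OF sub measurable_ident] by (simp add: id_def)
  have Gpair: "(\<lambda>(\<omega>, x). (\<omega>, sqrt (R \<omega>) * x)) \<in> measurable (M \<Otimes>\<^sub>M std_gauss) (G \<Otimes>\<^sub>M borel)"
    unfolding split_beta' by (intro measurable_Pair measurable_compose[OF measurable_fst idG]) measurable
  \<comment> \<open>the two sides as measures on the product of the history and the line\<close>
  define \<mu>1 where "\<mu>1 = distr (density M (\<lambda>\<omega>. ennreal (P \<omega>))) (G \<Otimes>\<^sub>M borel) (\<lambda>\<omega>. (\<omega>, Z \<omega>))"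
  define \<mu>2 where "\<mu>2 = scale_measure (ennreal \<gamma>) (distr (M \<Otimes>\<^sub>M std_gauss) (G \<Otimes>\<^sub>M borel) (\<lambda>(\<omega>, x). (\<omega>, sqrt (R \<omega>) * x)))"
  have e1: "emeasure \<mu>1 C = (\<integral>\<^sup>+\<omega>. indicator C (\<omega>, Z \<omega>) * ennreal (P \<omega>) \<partial>M)"
    if C: "C \<in> sets (G \<Otimes>\<^sub>M borel)" for C
  proof -
    have [measurable]: "(\<lambda>\<omega>. (\<omega>, Z \<omega>)) \<in> measurable M (G \<Otimes>\<^sub>M borel)" "C \<in> sets (G \<Otimes>\<^sub>M borel)" by fact+
    have "emeasure \<mu>1 C = (\<integral>\<^sup>+y. indicator C y \<partial>\<mu>1)" using C by (simp add: \<mu>1_def)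
    also have "\<dots> = (\<integral>\<^sup>+\<omega>. indicator C (\<omega>, Z \<omega>) \<partial>density M (\<lambda>\<omega>. ennreal (P \<omega>)))"
      unfolding \<mu>1_def by (subst nn_integral_distr) auto
    also have "\<dots> = (\<integral>\<^sup>+\<omega>. ennreal (P \<omega>) * indicator C (\<omega>, Z \<omega>) \<partial>M)"
      by (rule nn_integral_density) measurable
    finally show ?thesis by (simp add: mult.commute)
  qed
  have e2: "emeasure \<mu>2 C = (\<integral>\<^sup>+\<omega>. (\<integral>\<^sup>+x. indicator C (\<omega>, sqrt (R \<omega>) * x) \<partial>std_gauss) \<partial>M) * ennreal \<gamma>"
    if C: "C \<in> sets (G \<Otimes>\<^sub>M borel)" for C
  proof -
    have [measurable]: "(\<lambda>(\<omega>, x). (\<omega>, sqrt (R \<omega>) * x)) \<in> measurable (M \<Otimes>\<^sub>M std_gauss) (G \<Otimes>\<^sub>M borel)" "C \<in> sets (G \<Otimes>\<^sub>M borel)" by fact+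
    have "emeasure \<mu>2 C = ennreal \<gamma> * (\<integral>\<^sup>+y. indicator C y \<partial>distr (M \<Otimes>\<^sub>M std_gauss) (G \<Otimes>\<^sub>M borel) (\<lambda>(\<omega>, x). (\<omega>, sqrt (R \<omega>) * x)))"
      using C by (simp add: \<mu>2_def)
    also have "(\<integral>\<^sup>+y. indicator C y \<partial>distr (M \<Otimes>\<^sub>M std_gauss) (G \<Otimes>\<^sub>M borel) (\<lambda>(\<omega>, x). (\<omega>, sqrt (R \<omega>) * x))) =
       (\<integral>\<^sup>+y. indicator C ((\<lambda>(\<omega>, x). (\<omega>, sqrt (R \<omega>) * x)) y) \<partial>(M \<Otimes>\<^sub>M std_gauss))"
      by (subst nn_integral_distr) auto
    also have "\<dots> = (\<integral>\<^sup>+\<omega>. (\<integral>\<^sup>+x. indicator C (\<omega>, sqrt (R \<omega>) * x) \<partial>std_gauss) \<partial>M)"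
      by (subst N.nn_integral_fst[symmetric]) auto
    finally show ?thesis by (simp add: mult.commute)
  qed
  have fin1: "emeasure \<mu>1 C \<noteq> \<infinity>" if "C \<in> sets (G \<Otimes>\<^sub>M borel)" for C
  proof -
    have "emeasure \<mu>1 C \<le> (\<integral>\<^sup>+\<omega>. 1 \<partial>M)"
      unfolding e1[OF that] using P01 by (intro nn_integral_mono) (auto split: split_indicator)
    also have "\<dots> = 1" by (simp add: emeasure_space_1)
    finally show ?thesis by (auto simp: top_unique)
  qed
  \<comment> \<open>for a fixed event \<open>A\<close>, both sides are finite measures in \<open>B\<close>\<close>
  have rect: "emeasure \<mu>1 (A \<times> B) = emeasure \<mu>2 (A \<times> B)" if A: "A \<in> sets G" and B: "B \<in> sets borel" for A B
  proof -
    have [measurable]: "A \<in> sets M" using A setsG by auto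
    define \<nu>1 where "\<nu>1 = distr (density M (\<lambda>\<omega>. indicator A \<omega> * ennreal (P \<omega>))) borel Z"
    define \<nu>2 where "\<nu>2 = scale_measure (ennreal \<gamma>) (distr (density M (indicator A) \<Otimes>\<^sub>M std_gauss) borel (\<lambda>(\<omega>, x). sqrt (R \<omega>) * x))"
    have i1: "(\<integral>\<^sup>+y. f y \<partial>\<nu>1) = (\<integral>\<^sup>+\<omega>. indicator A \<omega> * (ennreal (P \<omega>) * f (Z \<omega>)) \<partial>M)"
      if [measurable]: "f \<in> borel_measurable borel" for f
      unfolding \<nu>1_def by (simp add: nn_integral_distr nn_integral_density mult.assoc)
    have i2: "(\<integral>\<^sup>+y. f y \<partial>\<nu>2) = ennreal \<gamma> * (\<integral>\<^sup>+\<omega>. indicator A \<omega> * (\<integral>\<^sup>+x. f (sqrt (R \<omega>) * x) \<partial>std_gauss) \<partial>M)"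
      if [measurable]: "f \<in> borel_measurable borel" for f
      unfolding \<nu>2_def
      by (simp add: nn_integral_scale_measure nn_integral_distr N.nn_integral_fst[symmetric] nn_integral_density split_beta')
    have eq: "\<nu>1 = \<nu>2"
    proof (rule measure_eqI_test_fun)
      have "emeasure \<nu>1 (space \<nu>1) = (\<integral>\<^sup>+y. 1 \<partial>\<nu>1)" by simp
      also have "\<dots> = (\<integral>\<^sup>+\<omega>. indicator A \<omega> * (ennreal (P \<omega>) * 1) \<partial>M)" by (rule i1) simp
      also have "\<dots> \<le> (\<integral>\<^sup>+\<omega>. 1 \<partial>M)"
        using P01 by (intro nn_integral_mono) (auto split: split_indicator)
      finally show "finite_measure \<nu>1"
        by (intro finite_measureI) (auto simp: emeasure_space_1 top_unique)
      have "emeasure \<nu>2 (space \<nu>2) = (\<integral>\<^sup>+y. 1 \<partial>\<nu>2)" by simp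
      also have "\<dots> = ennreal \<gamma> * (\<integral>\<^sup>+\<omega>. indicator A \<omega> * (\<integral>\<^sup>+x. 1 \<partial>std_gauss) \<partial>M)" by (rule i2) simp
      also have "\<dots> \<le> ennreal \<gamma> * (\<integral>\<^sup>+\<omega>. 1 \<partial>M)"
        using N.emeasure_space_1 by (intro mult_left_mono nn_integral_mono) (auto split: split_indicator)
      finally show "finite_measure \<nu>2"
        by (intro finite_measureI) (auto simp: emeasure_space_1 top_unique)
      fix h assume h: "test_fun h"
      have [measurable]: "h \<in> borel_measurable borel" by (rule test_funD[OF h])
      have "(\<integral>\<^sup>+y. ennreal (h y) \<partial>\<nu>1) = (\<integral>\<^sup>+\<omega>. indicator A \<omega> * ennreal (h (Z \<omega>) * P \<omega>) \<partial>M)"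
        by (subst i1) (simp_all add: ennreal_mult P01 test_funD[OF h] mult.commute)
      also have "\<dots> = (\<integral>\<^sup>+\<omega>. indicator A \<omega> * ennreal (\<integral>x. h (sqrt (R \<omega>) * x) \<partial>std_gauss) \<partial>M) * ennreal \<gamma>"
        unfolding Z_def P_def \<gamma>_def by (rule fresh_step_continuous[OF fresh R t g h A])
      also have "\<dots> = (\<integral>\<^sup>+y. ennreal (h y) \<partial>\<nu>2)"
        by (subst i2) (simp_all add: test_fun_gauss(3)[OF h] mult.commute[of _ "ennreal \<gamma>"])
      finally show "(\<integral>\<^sup>+y. ennreal (h y) \<partial>\<nu>1) = (\<integral>\<^sup>+y. ennreal (h y) \<partial>\<nu>2)" .
    qed (simp_all add: \<nu>1_def \<nu>2_def)
    have AB: "A \<times> B \<in> sets (G \<Otimes>\<^sub>M borel)" using A B by auto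
    have "emeasure \<mu>1 (A \<times> B) = (\<integral>\<^sup>+y. indicator B y \<partial>\<nu>1)"
      unfolding e1[OF AB] using B by (subst i1) (auto intro!: nn_integral_cong split: split_indicator)
    also have "\<dots> = emeasure \<mu>2 (A \<times> B)"
      unfolding e2[OF AB] eq using B
      by (subst i2) (auto intro!: arg_cong2[where f="(*)"] nn_integral_cong simp: mult.commute split: split_indicator)
    finally show ?thesis .
  qed
  have "\<mu>1 = \<mu>2"
  proof (rule measure_eqI_generator_eq[OF Int_stable_pair_measure_generator[of G borel], where \<Omega>="space G \<times> UNIV" and A="\<lambda>_. space G \<times> UNIV"])
    show "{a \<times> b |a b. a \<in> sets G \<and> b \<in> sets (borel::real measure)} \<subseteq> Pow (space G \<times> UNIV)"
      using sets.sets_into_space[of _ G] by auto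
    show "sets \<mu>1 = sigma_sets (space G \<times> UNIV) {a \<times> b |a b. a \<in> sets G \<and> b \<in> sets (borel::real measure)}"
      by (simp add: \<mu>1_def sets_pair_measure)
    show "sets \<mu>2 = sigma_sets (space G \<times> UNIV) {a \<times> b |a b. a \<in> sets G \<and> b \<in> sets (borel::real measure)}"
      by (simp add: \<mu>2_def sets_pair_measure)
    show "range (\<lambda>_. space G \<times> UNIV) \<subseteq> {a \<times> b |a b. a \<in> sets G \<and> b \<in> sets (borel::real measure)}"
      by (intro image_subsetI CollectI exI[of _ "space G"] exI[of _ UNIV]) auto
    show "emeasure \<mu>1 (space G \<times> UNIV) \<noteq> \<infinity>" by (rule fin1) auto
  qed (auto simp: rect)
  then show ?thesis using e1[OF C] e2[OF C] by (simp add: Z_def P_def \<gamma>_def)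
qed

text \<open>
  The induction step of the filter: after one more predictable wait, the history enlarged by the observed
  increment again leaves a fresh Brownian motion, and given the old history the increment is
  Gaussian with variance \<open>R\<close>.
\<close>

lemma fresh_step:
  assumes fresh: "fresh_after M W G S"
    and R: "R \<in> borel_measurable G" "\<And>\<omega>. \<omega> \<in> space M \<Longrightarrow> 0 < R \<omega>"
  shows "fresh_after M W (vimage_algebra (space M) (\<lambda>\<omega>. (\<omega>, W (S \<omega> + R \<omega>) \<omega> - W (S \<omega>) \<omega>)) (G \<Otimes>\<^sub>M borel))
           (\<lambda>\<omega>. S \<omega> + R \<omega>)" (is "fresh_after M W ?G _")
    and "f \<in> borel_measurable (G \<Otimes>\<^sub>M borel) \<Longrightarrow>
           (\<integral>\<^sup>+\<omega>. f (\<omega>, W (S \<omega> + R \<omega>) \<omega> - W (S \<omega>) \<omega>) \<partial>M) =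
           (\<integral>\<^sup>+\<omega>. (\<integral>\<^sup>+x. f (\<omega>, sqrt (R \<omega>) * x) \<partial>std_gauss) \<partial>M)"
proof -
  interpret N: prob_space std_gauss by (rule prob_space_std_gauss)
  have sub: "subalgebra M G" and SG: "S \<in> borel_measurable G" and S0: "\<And>\<omega>. \<omega> \<in> space M \<Longrightarrow> 0 \<le> S \<omega>"
    using fresh unfolding fresh_after_def by auto
  have spG: "space G = space M" and setsG: "sets G \<subseteq> sets M" using sub by (simp_all add: subalgebra_def)
  note [measurable] = measurable_from_subalg[OF sub SG] measurable_from_subalg[OF sub R(1)]
  define Z where "Z \<omega> = W (S \<omega> + R \<omega>) \<omega> - W (S \<omega>) \<omega>" for \<omega>
  have SR: "0 \<le> S \<omega> + R \<omega>" if "\<omega> \<in> space M" for \<omega>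
    using S0[OF that] R(2)[OF that] by simp
  have [measurable]: "Z \<in> borel_measurable M" unfolding Z_def
    by (intro borel_measurable_diff bm_at_measurable) (auto intro!: SR S0)
  note Zpair = measurable_pair_subalgebra[OF sub \<open>Z \<in> borel_measurable M\<close>]
  have idG: "(\<lambda>x. x) \<in> measurable M G"
    using measurable_from_subalg[OF sub measurable_ident] by (simp add: id_def)
  have Gpair: "(\<lambda>(\<omega>, x). (\<omega>, sqrt (R \<omega>) * x)) \<in> measurable (M \<Otimes>\<^sub>M std_gauss) (G \<Otimes>\<^sub>M borel)"
    unfolding split_beta' by (intro measurable_Pair measurable_compose[OF measurable_fst idG]) measurable
  have Zsp: "(\<lambda>\<omega>. (\<omega>, Z \<omega>)) \<in> space M \<rightarrow> space (G \<Otimes>\<^sub>M borel)" by (auto simp: space_pair_measure spG)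
  let ?G' = "vimage_algebra (space M) (\<lambda>\<omega>. (\<omega>, Z \<omega>)) (G \<Otimes>\<^sub>M borel)"
  have sG': "sets ?G' = {(\<lambda>\<omega>. (\<omega>, Z \<omega>)) -` C \<inter> space M | C. C \<in> sets (G \<Otimes>\<^sub>M borel)}"
    by (rule sets_vimage_algebra2[OF Zsp])
  have sub': "subalgebra M ?G'"
    unfolding subalgebra_def sG' using measurable_sets[OF Zpair] by auto
  have "(\<lambda>\<omega>. fst (\<omega>, Z \<omega>)) \<in> measurable ?G' G"
    by (rule measurable_compose[OF measurable_vimage_algebra1[OF Zsp] measurable_fst])
  then have idG': "(\<lambda>\<omega>. \<omega>) \<in> measurable ?G' G" by simp
  have "(\<lambda>\<omega>. S \<omega> + R \<omega>) \<in> borel_measurable ?G'"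
    using measurable_compose[OF idG' SG] measurable_compose[OF idG' R(1)] by measurable
  moreover have "(\<integral>\<^sup>+\<omega>. indicator A \<omega> * ennreal (\<Prod>i<(n::nat). g i (W (S \<omega> + R \<omega> + t (Suc i)) \<omega> - W (S \<omega> + R \<omega> + t i) \<omega>)) \<partial>M) =
        emeasure M A * ennreal (\<Prod>i<n. \<integral>x. g i (sqrt (t (Suc i) - t i) * x) \<partial>std_gauss)"
    if t: "t 0 = 0" "\<forall>i<n. t i < t (Suc i)" "\<forall>i. test_fun (g i)" and A: "A \<in> sets ?G'" for n t g A
  proof -
    obtain C where C: "C \<in> sets (G \<Otimes>\<^sub>M borel)" and AC: "A = (\<lambda>\<omega>. (\<omega>, Z \<omega>)) -` C \<inter> space M"
      using A unfolding sG' by auto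
    have ind: "indicator A \<omega> = (indicator C (\<omega>, Z \<omega>) :: ennreal)" if "\<omega> \<in> space M" for \<omega>
      using that by (auto simp: AC split: split_indicator)
    have "A \<in> sets M" using sub' A by (auto simp: subalgebra_def)
    then have "emeasure M A = (\<integral>\<^sup>+\<omega>. indicator A \<omega> \<partial>M)" by simp
    also have "\<dots> = (\<integral>\<^sup>+\<omega>. indicator C (\<omega>, Z \<omega>) \<partial>M)"
      by (rule nn_integral_cong) (rule ind)
    also have "\<dots> = (\<integral>\<^sup>+\<omega>. (\<integral>\<^sup>+x. indicator C (\<omega>, sqrt (R \<omega>) * x) \<partial>std_gauss) \<partial>M)"
      using fresh_step_law[OF fresh R, of "\<lambda>_. 0" 0 "\<lambda>_ _. 0" C] C
      by (simp add: Z_def test_fun_def)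
    finally have mA: "emeasure M A = (\<integral>\<^sup>+\<omega>. (\<integral>\<^sup>+x. indicator C (\<omega>, sqrt (R \<omega>) * x) \<partial>std_gauss) \<partial>M)" .
    have "(\<integral>\<^sup>+\<omega>. indicator A \<omega> * ennreal (\<Prod>i<n. g i (W (S \<omega> + R \<omega> + t (Suc i)) \<omega> - W (S \<omega> + R \<omega> + t i) \<omega>)) \<partial>M) =
      (\<integral>\<^sup>+\<omega>. indicator C (\<omega>, Z \<omega>) * ennreal (\<Prod>i<n. g i (W (S \<omega> + R \<omega> + t (Suc i)) \<omega> - W (S \<omega> + R \<omega> + t i) \<omega>)) \<partial>M)"
      by (intro nn_integral_cong) (simp add: ind)
    also have "\<dots> = emeasure M A * ennreal (\<Prod>i<n. \<integral>x. g i (sqrt (t (Suc i) - t i) * x) \<partial>std_gauss)"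
      unfolding mA Z_def using t by (intro fresh_step_law[OF fresh R _ _ _ C]) auto
    finally show ?thesis .
  qed
  ultimately show "fresh_after M W ?G (\<lambda>\<omega>. S \<omega> + R \<omega>)"
    using sub' SR unfolding fresh_after_def Z_def by auto
  assume f: "f \<in> borel_measurable (G \<Otimes>\<^sub>M borel)"
  have "distr M (G \<Otimes>\<^sub>M borel) (\<lambda>\<omega>. (\<omega>, Z \<omega>)) = distr (M \<Otimes>\<^sub>M std_gauss) (G \<Otimes>\<^sub>M borel) (\<lambda>(\<omega>, x). (\<omega>, sqrt (R \<omega>) * x))"
    (is "?A = ?B")
  proof (rule measure_eqI)
    fix C assume "C \<in> sets ?A"
    then have C[measurable]: "C \<in> sets (G \<Otimes>\<^sub>M borel)" by simp
    note Zpair[measurable] Gpair[measurable]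
    have "emeasure ?A C = (\<integral>\<^sup>+y. indicator C y \<partial>?A)" by simp
    also have "\<dots> = (\<integral>\<^sup>+\<omega>. indicator C (\<omega>, Z \<omega>) \<partial>M)" by (subst nn_integral_distr) auto
    also have "\<dots> = (\<integral>\<^sup>+\<omega>. (\<integral>\<^sup>+x. indicator C (\<omega>, sqrt (R \<omega>) * x) \<partial>std_gauss) \<partial>M)"
      using fresh_step_law[OF fresh R, of "\<lambda>_. 0" 0 "\<lambda>_ _. 0" C] C
      by (simp add: Z_def test_fun_def)
    also have "\<dots> = (\<integral>\<^sup>+y. indicator C ((\<lambda>(\<omega>, x). (\<omega>, sqrt (R \<omega>) * x)) y) \<partial>(M \<Otimes>\<^sub>M std_gauss))"
      by (subst N.nn_integral_fst[symmetric]) auto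
    also have "\<dots> = (\<integral>\<^sup>+y. indicator C y \<partial>?B)" by (subst nn_integral_distr) auto
    also have "\<dots> = emeasure ?B C" by simp
    finally show "emeasure ?A C = emeasure ?B C" .
  qed simp
  then have "(\<integral>\<^sup>+y. f y \<partial>?A) = (\<integral>\<^sup>+y. f y \<partial>?B)" by simp
  then show "(\<integral>\<^sup>+\<omega>. f (\<omega>, W (S \<omega> + R \<omega>) \<omega> - W (S \<omega>) \<omega>) \<partial>M) =
           (\<integral>\<^sup>+\<omega>. (\<integral>\<^sup>+x. f (\<omega>, sqrt (R \<omega>) * x) \<partial>std_gauss) \<partial>M)"
    using nn_integral_distr[OF Zpair, of f] nn_integral_distr[OF Gpair, of f] f
      N.nn_integral_fst[OF measurable_compose[OF Gpair f]] by (simp add: Z_def)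
qed

text \<open>
  The start of the induction. Independence of the change time and the whole path splits off the
  indicator; independence of the increments evaluates the rest.
\<close>

lemma fresh_initial:
  assumes \<Theta>[measurable]: "\<Theta> \<in> borel_measurable M"
    and ind: "indep_set (sets (vimage_algebra (space M) \<Theta> (borel :: real measure)))
      (sets (vimage_algebra (space M) (\<lambda>\<omega>. \<lambda>t\<in>{0..}. W t \<omega>) (PiM {0..} (\<lambda>_. borel))))"
  shows "fresh_after M W (vimage_algebra (space M) \<Theta> borel) (\<lambda>_. 0)"
  unfolding fresh_after_def
proof (intro conjI allI impI ballI)
  let ?G = "vimage_algebra (space M) \<Theta> (borel :: real measure)"
  have sG: "sets ?G = {\<Theta> -` B \<inter> space M | B. B \<in> sets borel}" by (rule sets_vimage_algebra2) auto
  show "subalgebra M ?G" unfolding subalgebra_def sG using measurable_sets[OF \<Theta>] by auto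
  fix n :: nat and t :: "nat \<Rightarrow> real" and g :: "nat \<Rightarrow> real \<Rightarrow> real" and A
  assume t0: "t 0 = 0" and t: "\<forall>i<n. t i < t (Suc i)" and g: "\<forall>i. test_fun (g i)" and A: "A \<in> sets ?G"
  obtain B where B: "B \<in> sets borel" "A = \<Theta> -` B \<inter> space M" using A unfolding sG by auto
  have tpos: "0 \<le> t i" if "i \<le> n" for i
    using that
  proof (induction i)
    case (Suc i)
    then show ?case using t[rule_format, of i] by linarith
  qed (use t0 in simp)
  let ?path = "\<lambda>\<omega>. \<lambda>t\<in>{0..}. W t \<omega>"
  let ?P = "PiM {0::real..} (\<lambda>_. borel :: real measure)"
  have path: "?path \<in> measurable M ?P" by (intro measurable_restrict bm_measurable) auto
  define Y2 where "Y2 p = ennreal (\<Prod>i<n. g i (p (t (Suc i)) - p (t i)))" for p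
  have gm: "(\<lambda>p. g i (p (t (Suc i)) - p (t i))) \<in> borel_measurable ?P" if "i < n" for i
  proof -
    have "(\<lambda>p. p (t (Suc i)) - p (t i)) \<in> borel_measurable ?P"
      using tpos[of i] tpos[of "Suc i"] that by (intro borel_measurable_diff measurable_component_singleton) auto
    from measurable_compose[OF this test_funD(4)] g show ?thesis by auto
  qed
  have Y2: "Y2 \<in> borel_measurable ?P"
    unfolding Y2_def by (intro measurable_compose[OF _ measurable_ennreal] borel_measurable_prod gm) auto
  have vm: "sigma_sets (space M) {(f \<circ> Z) -` C \<inter> space M |C. C \<in> sets borel} \<subseteq> sets (vimage_algebra (space M) Z N)"
    if f: "f \<in> borel_measurable N" and Z: "Z \<in> measurable M N" for f :: "'c \<Rightarrow> ennreal" and Z N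
  proof -
    have "f \<circ> Z \<in> borel_measurable (vimage_algebra (space M) Z N)"
      using measurable_space[OF Z] by (intro measurable_comp[OF measurable_vimage_algebra1 f]) auto
    from measurable_sets[OF this] show ?thesis
      by (intro sets.sigma_sets_subset[where M="vimage_algebra (space M) Z N", simplified]) auto
  qed
  have "indep_set (sigma_sets (space M) {(indicator B \<circ> \<Theta> :: _ \<Rightarrow> ennreal) -` C \<inter> space M |C. C \<in> sets borel})
    (sigma_sets (space M) {(Y2 \<circ> ?path) -` C \<inter> space M |C. C \<in> sets borel})"
    using ind unfolding indep_set_def
    by (rule indep_sets_mono_sets) (use vm[OF _ \<Theta>, of "indicator B"] vm[OF Y2 path] B in \<open>auto split: bool.split\<close>)
  then have "indep_var borel (indicator B \<circ> \<Theta> :: _ \<Rightarrow> ennreal) borel (Y2 \<circ> ?path)"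
    unfolding indep_var_eq using B by (auto intro!: measurable_comp[OF path Y2] measurable_comp[OF \<Theta>])
  then have "indep_vars (\<lambda>_. borel) (case_bool (indicator B \<circ> \<Theta>) (Y2 \<circ> ?path)) UNIV"
    unfolding indep_var_def by (rule back_subst[where P="\<lambda>x. indep_vars x _ _"]) (auto simp: fun_eq_iff split: bool.split)
  from indep_vars_nn_integral[OF _ this]
  have prod: "(\<integral>\<^sup>+\<omega>. indicator B (\<Theta> \<omega>) * Y2 (?path \<omega>) \<partial>M) = (\<integral>\<^sup>+\<omega>. indicator B (\<Theta> \<omega>) \<partial>M) * (\<integral>\<^sup>+\<omega>. Y2 (?path \<omega>) \<partial>M)"
    by (simp add: UNIV_bool comp_def mult.commute)
  have Y2p: "Y2 (?path \<omega>) = (\<Prod>i<n. ennreal (g i (W (t (Suc i)) \<omega> - W (t i) \<omega>)))" for \<omega>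
    using g tpos unfolding Y2_def by (subst prod_ennreal) (auto simp: test_funD intro!: prod.cong)
  have "(\<integral>\<^sup>+\<omega>. Y2 (?path \<omega>) \<partial>M) = (\<Prod>i<n. \<integral>\<^sup>+\<omega>. ennreal (g i (W (t (Suc i)) \<omega> - W (t i) \<omega>)) \<partial>M)"
    unfolding Y2p
  proof (rule indep_vars_nn_integral)
    show "indep_vars (\<lambda>_. borel) (\<lambda>i \<omega>. ennreal (g i (W (t (Suc i)) \<omega> - W (t i) \<omega>))) {..<n}"
      by (rule indep_vars_compose2[OF bm_indep, where Y="\<lambda>i x. ennreal (g i x)"])
         (use t0 t g in \<open>auto intro: measurable_compose[OF test_funD(4) measurable_ennreal]\<close>)
  qed auto
  also have "\<dots> = (\<Prod>i<n. ennreal (\<integral>x. g i (sqrt (t (Suc i) - t i) * x) \<partial>std_gauss))"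
  proof (rule prod.cong[OF refl])
    fix i assume i: "i \<in> {..<n}"
    have ti: "0 \<le> t i" "t i < t (Suc i)" using i tpos t by auto
    have gi: "test_fun (g i)" using g by simp
    have [measurable]: "g i \<in> borel_measurable borel" by (rule test_funD[OF gi])
    have "(\<integral>\<^sup>+\<omega>. ennreal (g i (W (t (Suc i)) \<omega> - W (t i) \<omega>)) \<partial>M) =
      (\<integral>\<^sup>+x. ennreal (normal_density 0 (sqrt (t (Suc i) - t i)) x) * ennreal (g i x) \<partial>lborel)"
      by (rule distributed_nn_integral[OF bm_distr[OF ti], symmetric]) measurable
    also have "\<dots> = (\<integral>\<^sup>+u. ennreal (g i (0 + sqrt (t (Suc i) - t i) * u)) \<partial>std_gauss)"
      by (rule nn_integral_normal_affine) (use ti in auto)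
    finally show "(\<integral>\<^sup>+\<omega>. ennreal (g i (W (t (Suc i)) \<omega> - W (t i) \<omega>)) \<partial>M) =
        ennreal (\<integral>x. g i (sqrt (t (Suc i) - t i) * x) \<partial>std_gauss)"
      using test_fun_gauss(3)[OF gi] by simp
  qed
  also have "\<dots> = ennreal (\<Prod>i<n. \<integral>x. g i (sqrt (t (Suc i) - t i) * x) \<partial>std_gauss)"
    using g by (intro prod_ennreal) (auto intro: test_fun_gauss)
  finally have e: "(\<integral>\<^sup>+\<omega>. Y2 (?path \<omega>) \<partial>M) = ennreal (\<Prod>i<n. \<integral>x. g i (sqrt (t (Suc i) - t i) * x) \<partial>std_gauss)" .
  have mA: "(\<integral>\<^sup>+\<omega>. indicator B (\<Theta> \<omega>) \<partial>M) = emeasure M A"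
  proof -
    have "A \<in> sets M" using B measurable_sets[OF \<Theta>] by auto
    then have "emeasure M A = (\<integral>\<^sup>+\<omega>. indicator A \<omega> \<partial>M)" by simp
    also have "\<dots> = (\<integral>\<^sup>+\<omega>. indicator B (\<Theta> \<omega>) \<partial>M)"
      by (intro nn_integral_cong) (auto simp: B split: split_indicator)
    finally show ?thesis by simp
  qed
  have "(\<integral>\<^sup>+\<omega>. indicator A \<omega> * ennreal (\<Prod>i<n. g i (W (0 + t (Suc i)) \<omega> - W (0 + t i) \<omega>)) \<partial>M) =
      (\<integral>\<^sup>+\<omega>. indicator B (\<Theta> \<omega>) * Y2 (?path \<omega>) \<partial>M)"
    using tpos by (intro nn_integral_cong) (auto simp: B Y2_def split: split_indicator intro!: arg_cong[where f=ennreal] prod.cong)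
  then show "(\<integral>\<^sup>+\<omega>. indicator A \<omega> * ennreal (\<Prod>i<n. g i (W (0 + t (Suc i)) \<omega> - W (0 + t i) \<omega>)) \<partial>M) =
      emeasure M A * ennreal (\<Prod>i<n. \<integral>x. g i (sqrt (t (Suc i) - t i) * x) \<partial>std_gauss)"
    using prod e mA by simp
qed auto

end

section \<open>Likelihoods and Bayes' formula for one observation\<close>

text \<open>
  The likelihood ratio for a change of the mean of a Gaussian variable.
\<close>

lemma normal_density_shift:
  assumes "0 < s"
  shows "normal_density (a * s * w) (sqrt s) x = normal_density 0 (sqrt s) x * exp (a * x * w - a\<^sup>2 * s * w\<^sup>2 / 2)"
proof -
  have "- (x - a * s * w)\<^sup>2 / (2 * s) = - x\<^sup>2 / (2 * s) + (a * x * w - a\<^sup>2 * s * w\<^sup>2 / 2)"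
    using assms by (simp add: field_simps power2_eq_square)
  then show ?thesis using assms by (simp add: normal_density_def exp_add[symmetric])
qed

text \<open>
  The one-step filter and the dynamic programming equation involve the constants only; the
  probability space enters later.
\<close>

locale detection_params =
  fixes D :: "'a detection_model"
  assumes rate_pos: "0 < rate D" and delay_pos: "0 < delay_cost D" and obs_pos: "0 < obs_cost D"
begin

abbreviation "lam \<equiv> rate D"
abbreviation "al \<equiv> drift D"
abbreviation "cc \<equiv> delay_cost D"
abbreviation "dd \<equiv> obs_cost D"

text \<open>
  The integral in \<open>j\<close> after the substitution \<open>u = s w\<close>. The domain of integration no longer depends on \<open>s\<close>
  and the quotient \<open>x / s\<close> has disappeared, so the term is continuous up to \<open>s = 0\<close>, where it vanishes.
\<close>

definition jump_odds :: "real \<Rightarrow> real \<Rightarrow> real" where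
  "jump_odds s x = lam * s * integral {0..1} (\<lambda>w. exp (lam * s * w + al * x * w - al\<^sup>2 * s * w\<^sup>2 / 2))"

lemma jump_odds_integrable:
  "(\<lambda>w. exp (lam * s * w + al * x * w - al\<^sup>2 * s * w\<^sup>2 / 2)) integrable_on {0..1}"
  by (intro integrable_continuous_real continuous_intros) auto

lemma j_fun_eq:
  assumes s: "0 < s"
  shows "j_fun D s p x = exp (al * x + (lam - al\<^sup>2 / 2) * s) * (p / (1 - p)) + jump_odds s x"
proof -
  let ?f = "\<lambda>u. exp ((lam + al * x / s) * u - al\<^sup>2 * u\<^sup>2 / (2 * s))"
  have "((\<lambda>w. s *\<^sub>R ?f (s * w)) has_integral (integral {s * 0..s * 1} ?f)) {0..1}"
    using s
    by (intro has_integral_substitution[where c="s * 0" and d="s * 1"])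
       (auto intro!: derivative_eq_intros continuous_intros simp: mult_le_cancel_left1)
  moreover have "s *\<^sub>R ?f (s * w) = s * exp (lam * s * w + al * x * w - al\<^sup>2 * s * w\<^sup>2 / 2)" for w
    using s by (simp add: field_simps power2_eq_square)
  ultimately have "((\<lambda>w. s * exp (lam * s * w + al * x * w - al\<^sup>2 * s * w\<^sup>2 / 2)) has_integral (integral {0..s} ?f)) {0..1}"
    by (simp only: mult_zero_right mult_1_right)
  from integral_unique[OF this] show ?thesis
    unfolding j_fun_def jump_odds_def by (simp add: mult.assoc)
qed

lemma jump_odds_nonneg: "0 \<le> s \<Longrightarrow> 0 \<le> jump_odds s x"
  unfolding jump_odds_def using rate_pos
  by (intro mult_nonneg_nonneg integral_nonneg jump_odds_integrable) auto

lemma jump_odds_pos: "0 < s \<Longrightarrow> 0 < jump_odds s x"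
proof -
  assume s: "0 < s"
  let ?f = "\<lambda>w. exp (lam * s * w + al * x * w - al\<^sup>2 * s * w\<^sup>2 / 2)"
  have "integral {0..1::real} ?f \<noteq> 0"
  proof
    assume "integral {0..1::real} ?f = 0"
    moreover have "integral {0..1::real} ?f = 0 \<longleftrightarrow> (\<forall>w\<in>{0..1}. ?f w = 0)"
      by (rule integral_eq_0_iff) (auto intro!: continuous_intros)
    ultimately show False by auto
  qed
  moreover have "0 \<le> integral {0..1::real} ?f" by (intro integral_nonneg jump_odds_integrable) auto
  ultimately show ?thesis unfolding jump_odds_def using s rate_pos by simp
qed

lemma jump_odds_continuous: "continuous_on UNIV (\<lambda>z. jump_odds (fst z) (snd z))"
proof -
  have "continuous_on UNIV (\<lambda>z. integral (cbox 0 1) (\<lambda>w. exp (lam * fst z * w + al * snd z * w - al\<^sup>2 * fst z * w\<^sup>2 / 2)))"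
    by (rule integral_continuous_on_param) (auto intro!: continuous_intros simp: split_beta')
  then show ?thesis unfolding jump_odds_def by (auto intro!: continuous_intros simp: cbox_interval)
qed

lemma jump_odds_tendsto:
  assumes "f \<longlonglongrightarrow> s" "g \<longlonglongrightarrow> x"
  shows "(\<lambda>n. jump_odds (f n) (g n)) \<longlonglongrightarrow> jump_odds s x"
proof -
  have "isCont (\<lambda>z. jump_odds (fst z) (snd z)) (s, x)"
    using jump_odds_continuous continuous_on_eq_continuous_at[OF open_UNIV] by blast
  from isCont_tendsto_compose[OF this tendsto_Pair[OF assms]] show ?thesis by simp
qed

lemma measurable_jump_odds [measurable (raw)]:
  assumes [measurable]: "f \<in> borel_measurable M" "g \<in> borel_measurable M"
  shows "(\<lambda>z. jump_odds (f z) (g z)) \<in> borel_measurable M"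
proof -
  have "(\<lambda>z. jump_odds (fst z) (snd z)) \<in> borel_measurable borel"
    by (rule borel_measurable_continuous_onI[OF jump_odds_continuous])
  from measurable_compose[OF _ this, of "\<lambda>z. (f z, g z)" M] show ?thesis
    by (simp add: borel_prod[symmetric])
qed

text \<open>
  Densities of the observed increment \<open>x\<close> over a time \<open>s\<close>, jointly with the event that the change has
  happened by the end (\<open>lik_after\<close>) or has not (\<open>lik_before\<close>). A change in the middle of the interval
  gives a mean proportional to the time after it; averaging over the exponential time of change
  produces \<open>jump_odds\<close>. That both are affine in \<open>p\<close> is the source of the concavity of all value functions.
\<close>

definition lik_after :: "real \<Rightarrow> real \<Rightarrow> real \<Rightarrow> real" where
  "lik_after s p x = p * normal_density (al * s) (sqrt s) x
     + (1 - p) * (exp (- lam * s) * normal_density 0 (sqrt s) x * jump_odds s x)"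

definition lik_before :: "real \<Rightarrow> real \<Rightarrow> real \<Rightarrow> real" where
  "lik_before s p x = (1 - p) * (exp (- lam * s) * normal_density 0 (sqrt s) x)"

definition lik :: "real \<Rightarrow> real \<Rightarrow> real \<Rightarrow> real" where
  "lik s p x = lik_after s p x + lik_before s p x"

definition bayes :: "real \<Rightarrow> real \<Rightarrow> real \<Rightarrow> real" where
  "bayes s p x = lik_after s p x / lik s p x"

lemma measurable_lik [measurable (raw)]:
  assumes [measurable]: "f \<in> borel_measurable M" "g \<in> borel_measurable M" "h \<in> borel_measurable M"
  shows "(\<lambda>z. lik_after (f z) (g z) (h z)) \<in> borel_measurable M"
    "(\<lambda>z. lik_before (f z) (g z) (h z)) \<in> borel_measurable M"
    "(\<lambda>z. lik (f z) (g z) (h z)) \<in> borel_measurable M"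
    "(\<lambda>z. bayes (f z) (g z) (h z)) \<in> borel_measurable M"
  unfolding bayes_def lik_def lik_after_def lik_before_def normal_density_def by measurable

lemma lik_nonneg:
  assumes "0 < s" "p \<in> {0..1}"
  shows "0 \<le> lik_after s p x" "0 \<le> lik_before s p x" "0 < lik s p x"
proof -
  have n: "0 < normal_density m (sqrt s) x" for m using assms by (intro normal_density_pos) simp
  have J: "0 < jump_odds s x" by (rule jump_odds_pos) fact
  show 1: "0 \<le> lik_after s p x"
    unfolding lik_after_def using assms less_imp_le[OF n] less_imp_le[OF J]
    by (intro add_nonneg_nonneg mult_nonneg_nonneg) auto
  show 2: "0 \<le> lik_before s p x"
    unfolding lik_before_def using assms less_imp_le[OF n] by (intro mult_nonneg_nonneg) auto
  show "0 < lik s p x"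
  proof (cases "p = 1")
    case True
    then show ?thesis using n unfolding lik_def lik_after_def lik_before_def by simp
  next
    case False
    then have "0 < lik_before s p x" unfolding lik_before_def using assms n by simp
    then show ?thesis using 1 unfolding lik_def by simp
  qed
qed

lemma bayes_range: "0 < s \<Longrightarrow> p \<in> {0..1} \<Longrightarrow> bayes s p x \<in> {0..1}"
  using lik_nonneg[of s p x] unfolding bayes_def by (auto simp: lik_def divide_le_eq)

lemma lik_bayes:
  assumes "0 < s" "p \<in> {0..1}"
  shows "lik s p x * bayes s p x = lik_after s p x" "lik s p x * (1 - bayes s p x) = lik_before s p x"
proof -
  show *: "lik s p x * bayes s p x = lik_after s p x"
    using lik_nonneg(3)[OF assms, of x] by (simp add: bayes_def)
  show "lik s p x * (1 - bayes s p x) = lik_before s p x"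
    unfolding right_diff_distrib * by (simp add: lik_def)
qed

lemma lik_after_odds:
  assumes s: "0 < s" and p: "p \<noteq> 1"
  shows "lik_after s p x = lik_before s p x * (exp (al * x + (lam - al\<^sup>2 / 2) * s) * (p / (1 - p)) + jump_odds s x)"
proof -
  have "normal_density (al * s) (sqrt s) x = normal_density 0 (sqrt s) x * exp (al * x - al\<^sup>2 * s / 2)"
    using normal_density_shift[OF s, of al 1 x] by simp
  moreover have "exp (al * x - al\<^sup>2 * s / 2) = exp (- lam * s) * exp (al * x + (lam - al\<^sup>2 / 2) * s)"
    unfolding exp_add[symmetric] by (simp add: field_simps)
  ultimately show ?thesis
    using p unfolding lik_after_def lik_before_def by (simp add: field_simps)
qed

text \<open>
  The ratio of the two joint densities is \<open>j\<close>, so normalising by their sum gives \<open>j / (1 + j)\<close>. At \<open>p = 1\<close> the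
  density before the change vanishes, which agrees with the convention for the quotient.
\<close>

lemma posterior_update_eq_bayes:
  assumes s: "0 < s" and p: "p \<in> {0..1}"
  shows "posterior_update D s p x = bayes s p x"
proof (cases "p = 1")
  case True
  have "0 < normal_density (al * s) (sqrt s) x" using s by (intro normal_density_pos) simp
  then show ?thesis using True by (simp add: posterior_update_def bayes_def lik_def lik_after_def lik_before_def)
next
  case False
  have "0 < lik_before s p x" unfolding lik_before_def using False p s
    by (intro mult_pos_pos normal_density_pos) auto
  moreover have "lik_after s p x = lik_before s p x * j_fun D s p x"
    unfolding j_fun_eq[OF s] by (rule lik_after_odds[OF s False])
  ultimately have "bayes s p x = (lik_before s p x * j_fun D s p x) / (lik_before s p x * (j_fun D s p x + 1))"
    unfolding bayes_def lik_def by (simp add: algebra_simps)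
  then show ?thesis using False \<open>0 < lik_before s p x\<close> by (simp add: posterior_update_def add.commute)
qed

abbreviation exp_law :: "real measure" where
  "exp_law \<equiv> density lborel (\<lambda>x. ennreal (exponential_density lam x))"

lemma prob_space_exp_law: "prob_space exp_law"
  using prob_space_exponential_density[OF rate_pos] by simp

text \<open>
  The mean of \<open>f\<close> over the time left until the change, when the change has already happened with
  probability \<open>p\<close>: an atom at \<open>0\<close> and an exponential part. Observations change \<open>p\<close> only, which makes the
  posterior probability a sufficient statistic.
\<close>

definition state_avg :: "real \<Rightarrow> (real \<Rightarrow> ennreal) \<Rightarrow> ennreal" where
  "state_avg p f = ennreal p * f 0 + ennreal (1 - p) * (\<integral>\<^sup>+y. f y \<partial>exp_law)"

lemma nn_integral_exp_law:
  "f \<in> borel_measurable borel \<Longrightarrow> (\<integral>\<^sup>+y. f y \<partial>exp_law) = (\<integral>\<^sup>+y. ennreal (exponential_density lam y) * f y \<partial>lborel)"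
  by (rule nn_integral_density) auto

lemma state_avg_const: "p \<in> {0..1} \<Longrightarrow> state_avg p (\<lambda>_. k) = k"
proof -
  assume p: "p \<in> {0..1}"
  interpret E: prob_space exp_law by (rule prob_space_exp_law)
  have "(\<integral>\<^sup>+y. k \<partial>exp_law) = k" using E.emeasure_space_1 by simp
  moreover have "ennreal p * k + ennreal (1 - p) * k = (ennreal p + ennreal (1 - p)) * k" by (simp add: distrib_right)
  moreover have "ennreal p + ennreal (1 - p) = 1" using p by (simp add: ennreal_plus[symmetric] del: ennreal_plus)
  ultimately show ?thesis by (simp add: state_avg_def)
qed

text \<open>
  With the change at \<open>y = s - s w\<close>, the number \<open>w\<close> is the fraction of the interval that follows it; the
  likelihood ratio at that \<open>w\<close> is the integrand of \<open>jump_odds\<close>.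
\<close>

lemma nn_integral_jump_odds:
  assumes s: "0 < s"
  shows "(\<integral>\<^sup>+y. ennreal (exponential_density lam y) * (indicator {..<s} y * ennreal (normal_density (al * (s - y)) (sqrt s) x)) \<partial>lborel) =
     ennreal (exp (- lam * s) * normal_density 0 (sqrt s) x * jump_odds s x)"
proof -
  let ?e = "\<lambda>w. exp (lam * s * w + al * x * w - al\<^sup>2 * s * w\<^sup>2 / 2)"
  let ?K = "exp (- lam * s) * normal_density 0 (sqrt s) x * (lam * s)"
  have K: "0 \<le> ?K" using s rate_pos by simp
  have "(\<integral>\<^sup>+y. ennreal (exponential_density lam y) * (indicator {..<s} y * ennreal (normal_density (al * (s - y)) (sqrt s) x)) \<partial>lborel) =
    \<bar>- s\<bar> * (\<integral>\<^sup>+w. ennreal (exponential_density lam (s + - s * w)) * (indicator {..<s} (s + - s * w) * ennreal (normal_density (al * (s - (s + - s * w))) (sqrt s) x)) \<partial>lborel)"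
    using s by (intro nn_integral_real_affine) (auto simp: normal_density_def)
  also have "\<dots> = (\<integral>\<^sup>+w. \<bar>- s\<bar> * (ennreal (exponential_density lam (s + - s * w)) * (indicator {..<s} (s + - s * w) * ennreal (normal_density (al * (s - (s + - s * w))) (sqrt s) x))) \<partial>lborel)"
    by (rule nn_integral_cmult[symmetric]) (auto simp: normal_density_def)
  also have "\<dots> = (\<integral>\<^sup>+w. ennreal ?K * ennreal (indicator {0..1} w * ?e w) \<partial>lborel)"
  proof (rule nn_integral_cong_AE)
    have "AE w in lborel. w \<noteq> (0::real)" by (rule AE_lborel_singleton)
    then show "AE w in lborel. \<bar>- s\<bar> * (ennreal (exponential_density lam (s + - s * w)) * (indicator {..<s} (s + - s * w) * ennreal (normal_density (al * (s - (s + - s * w))) (sqrt s) x))) = ennreal ?K * ennreal (indicator {0..1} w * ?e w)"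
    proof eventually_elim
      case (elim w)
      show ?case
      proof (cases "0 < w \<and> w \<le> 1")
        case True
        have "s * w \<le> s" using True s by (simp add: mult_left_le)
        have "exp (- ((s - s * w) * lam)) * exp (al * x * w - al\<^sup>2 * s * w\<^sup>2 / 2) = exp (- lam * s) * ?e w"
          unfolding exp_add[symmetric] by (simp add: algebra_simps)
        moreover have "normal_density (al * (s * w)) (sqrt s) x = normal_density 0 (sqrt s) x * exp (al * x * w - al\<^sup>2 * s * w\<^sup>2 / 2)"
          using normal_density_shift[OF s, of al w x] by (simp add: mult.assoc)
        ultimately have "s * (lam * exp (- ((s - s * w) * lam)) * normal_density (al * (s * w)) (sqrt s) x) = ?K * ?e w"
          by (simp add: mult_ac)
        moreover define E where "E = exp (- ((s - s * w) * lam))"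
        moreover define m where "m = normal_density (al * (s * w)) (sqrt s) x"
        ultimately have eq: "s * (lam * E * m) = ?K * ?e w" by simp
        have pos: "0 \<le> E" "0 \<le> m" unfolding E_def m_def by simp_all
        have 1: "exponential_density lam (s + - s * w) = lam * E"
          using \<open>s * w \<le> s\<close> by (simp add: exponential_density_def E_def) (simp add: algebra_simps)
        have 2: "normal_density (al * (s - (s + - s * w))) (sqrt s) x = m" by (simp add: m_def)
        have 3: "\<bar>- s\<bar> = s" "indicator {..<s} (s + - s * w) = (1::ennreal)" "indicator {0..1} w = (1::real)"
          using True s by auto
        have "ennreal \<bar>- s\<bar> * (ennreal (lam * E) * (1 * ennreal m)) = ennreal (s * (lam * E * m))"
          using s rate_pos pos by (simp add: ennreal_mult)
        also have "\<dots> = ennreal ?K * ennreal (1 * ?e w)"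
          unfolding eq using K by (simp only: ennreal_mult' mult_1_left)
        finally show ?thesis unfolding 1 2 3 .
      next
        case False
        then have "w < 0 \<or> 1 < w" using elim by auto
        then have "s * w < 0 \<or> s < s * w" using s by (auto simp: mult_less_0_iff)
        then show ?thesis using \<open>w < 0 \<or> 1 < w\<close> s by (auto simp: exponential_density_def split: split_indicator)
      qed
    qed
  qed
  also have "\<dots> = ennreal ?K * (\<integral>\<^sup>+w. ennreal (indicator {0..1} w * ?e w) \<partial>lborel)"
    by (rule nn_integral_cmult) measurable
  also have "(\<integral>\<^sup>+w. ennreal (indicator {0..1} w * ?e w) \<partial>lborel) = ennreal (integral {0..1} ?e)"
  proof (rule nn_integral_has_integral_lborel)
    have "(?e has_integral integral {0..1} ?e) {0..1}"
      using jump_odds_integrable by (rule integrable_integral)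
    then have "((\<lambda>w. if w \<in> {0..1} then ?e w else 0) has_integral integral {0..1} ?e) UNIV"
      by (rule has_integral_restrict_UNIV[THEN iffD2])
    then show "((\<lambda>w. indicator {0..1} w * ?e w) has_integral integral {0..1} ?e) UNIV"
      by (rule has_integral_cong[THEN iffD1, rotated]) (auto split: split_indicator)
  qed auto
  also have "ennreal ?K * \<dots> = ennreal (?K * integral {0..1} ?e)"
    using K by (rule ennreal_mult'[symmetric])
  finally show ?thesis unfolding jump_odds_def by (simp add: mult_ac)
qed

text \<open>
  Bayes' formula as an identity between joint laws of the increment and the time left afterwards. The exponential
  law is split at \<open>s\<close>: the part below \<open>s\<close> has the change inside the interval and leaves time \<open>0\<close>; the part
  above has mass \<open>exp (- lam * s)\<close> and by lack of memory is exponential again after the shift by \<open>s\<close>.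
\<close>

lemma one_step_bayes:
  assumes s: "0 < s" and p: "p \<in> {0..1}" and [measurable]: "g \<in> borel_measurable (borel \<Otimes>\<^sub>M borel)"
  shows "state_avg p (\<lambda>y. \<integral>\<^sup>+u. g (al * max 0 (s - y) + sqrt s * u, max 0 (y - s)) \<partial>std_gauss) =
    (\<integral>\<^sup>+x. ennreal (lik s p x) * state_avg (bayes s p x) (\<lambda>y. g (x, y)) \<partial>lborel)"
proof -
  interpret N: prob_space std_gauss by (rule prob_space_std_gauss)
  interpret E: prob_space exp_law by (rule prob_space_exp_law)
  have ss: "0 < sqrt s" using s by simp
  let ?n = "\<lambda>m x. ennreal (normal_density m (sqrt s) x)"
  have [measurable]: "(\<lambda>z. normal_density (f z) (sqrt s) (h z)) \<in> borel_measurable M"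
    if "f \<in> borel_measurable M" "h \<in> borel_measurable M" for f h and M :: "'m measure"
    unfolding normal_density_def using that by measurable
  have gauss: "(\<integral>\<^sup>+u. f (m + sqrt s * u) \<partial>std_gauss) = (\<integral>\<^sup>+x. ?n m x * f x \<partial>lborel)"
    if "f \<in> borel_measurable borel" for f m
    using nn_integral_normal_affine[OF ss that] by simp
  have gm [measurable]: "(\<lambda>x. g (x, y)) \<in> borel_measurable borel" "(\<lambda>y. g (x, y)) \<in> borel_measurable borel" for x y
    by measurable
  \<comment> \<open>\<open>H y\<close> averages over the increment when the change is \<open>y\<close> after the start\<close>
  define H where "H y = (\<integral>\<^sup>+x. ?n (al * max 0 (s - y)) x * g (x, max 0 (y - s)) \<partial>lborel)" for y
  have H: "(\<integral>\<^sup>+u. g (al * max 0 (s - y) + sqrt s * u, max 0 (y - s)) \<partial>std_gauss) = H y" for y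
    unfolding H_def by (rule gauss) measurable
  have [measurable]: "H \<in> borel_measurable borel" unfolding H_def by measurable
  have H0: "H 0 = (\<integral>\<^sup>+x. ?n (al * s) x * g (x, 0) \<partial>lborel)" using s by (simp add: H_def)
  let ?ed = "\<lambda>y. ennreal (exponential_density lam y)"
  have "(\<integral>\<^sup>+y. H y \<partial>exp_law) = (\<integral>\<^sup>+y. ?ed y * (indicator {..<s} y * H y) + ?ed y * (indicator {s..} y * H y) \<partial>lborel)"
    by (subst nn_integral_exp_law) (auto intro!: nn_integral_cong split: split_indicator)
  also have "\<dots> = (\<integral>\<^sup>+y. ?ed y * (indicator {..<s} y * H y) \<partial>lborel) + (\<integral>\<^sup>+y. ?ed y * (indicator {s..} y * H y) \<partial>lborel)"
    by (rule nn_integral_add) measurable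
  also have "(\<integral>\<^sup>+y. ?ed y * (indicator {..<s} y * H y) \<partial>lborel) =
     (\<integral>\<^sup>+x. ennreal (exp (- lam * s) * normal_density 0 (sqrt s) x * jump_odds s x) * g (x, 0) \<partial>lborel)"
  proof -
    have "(\<integral>\<^sup>+y. ?ed y * (indicator {..<s} y * H y) \<partial>lborel) =
       (\<integral>\<^sup>+y. (\<integral>\<^sup>+x. ?ed y * (indicator {..<s} y * ?n (al * (s - y)) x) * g (x, 0) \<partial>lborel) \<partial>lborel)"
    proof (rule nn_integral_cong)
      fix y
      have "?ed y * (indicator {..<s} y * H y) = (?ed y * indicator {..<s} y) * (\<integral>\<^sup>+x. ?n (al * (s - y)) x * g (x, 0) \<partial>lborel)"
        by (auto simp: H_def split: split_indicator)
      also have "\<dots> = (\<integral>\<^sup>+x. (?ed y * indicator {..<s} y) * (?n (al * (s - y)) x * g (x, 0)) \<partial>lborel)"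
        by (rule nn_integral_cmult[symmetric]) measurable
      finally show "?ed y * (indicator {..<s} y * H y) = (\<integral>\<^sup>+x. ?ed y * (indicator {..<s} y * ?n (al * (s - y)) x) * g (x, 0) \<partial>lborel)"
        by (simp add: mult.assoc)
    qed
    also have "\<dots> = (\<integral>\<^sup>+x. (\<integral>\<^sup>+y. ?ed y * (indicator {..<s} y * ?n (al * (s - y)) x) * g (x, 0) \<partial>lborel) \<partial>lborel)"
      by (rule lborel_pair.Fubini') measurable
    also have "\<dots> = (\<integral>\<^sup>+x. (\<integral>\<^sup>+y. ?ed y * (indicator {..<s} y * ?n (al * (s - y)) x) \<partial>lborel) * g (x, 0) \<partial>lborel)"
      by (intro nn_integral_cong nn_integral_multc) measurable
    finally show ?thesis unfolding nn_integral_jump_odds[OF s] .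
  qed
  also have "(\<integral>\<^sup>+y. ?ed y * (indicator {s..} y * H y) \<partial>lborel) =
     (\<integral>\<^sup>+x. ennreal (exp (- lam * s) * normal_density 0 (sqrt s) x) * (\<integral>\<^sup>+y. g (x, y) \<partial>exp_law) \<partial>lborel)"
  proof -
    have m: "(\<lambda>y. ?ed y * (indicator {s..} y * H y)) \<in> borel_measurable borel" by measurable
    have "(\<integral>\<^sup>+y. ?ed y * (indicator {s..} y * H y) \<partial>lborel) =
       ennreal \<bar>1\<bar> * (\<integral>\<^sup>+y. ?ed (s + 1 * y) * (indicator {s..} (s + 1 * y) * H (s + 1 * y)) \<partial>lborel)"
      by (rule nn_integral_real_affine[OF m]) simp
    also have "\<dots> = (\<integral>\<^sup>+y. (\<integral>\<^sup>+x. ennreal (exp (- lam * s)) * ?n 0 x * (?ed y * g (x, y)) \<partial>lborel) \<partial>lborel)"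
    proof (simp, rule nn_integral_cong)
      fix y
      show "?ed (s + y) * (indicator {s..} (s + y) * H (s + y)) = (\<integral>\<^sup>+x. ennreal (exp (- (lam * s))) * ?n 0 x * (?ed y * g (x, y)) \<partial>lborel)"
      proof (cases "0 \<le> y")
        case True
        have "exponential_density lam (s + y) = exp (- (lam * s)) * exponential_density lam y"
          using True s by (simp add: exponential_density_def exp_add[symmetric] algebra_simps)
        then have e: "?ed (s + y) = ennreal (exp (- (lam * s))) * ?ed y" by (simp add: ennreal_mult')
        have "?ed (s + y) * (indicator {s..} (s + y) * H (s + y)) = (ennreal (exp (- (lam * s))) * ?ed y) * (\<integral>\<^sup>+x. ?n 0 x * g (x, y) \<partial>lborel)"
          using True s unfolding e by (simp add: H_def)
        also have "\<dots> = (\<integral>\<^sup>+x. (ennreal (exp (- (lam * s))) * ?ed y) * (?n 0 x * g (x, y)) \<partial>lborel)"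
          by (rule nn_integral_cmult[symmetric]) measurable
        finally show ?thesis by (simp add: mult_ac)
      next
        case False
        then show ?thesis by (simp add: exponential_density_def)
      qed
    qed
    also have "\<dots> = (\<integral>\<^sup>+x. (\<integral>\<^sup>+y. ennreal (exp (- lam * s)) * ?n 0 x * (?ed y * g (x, y)) \<partial>lborel) \<partial>lborel)"
      by (rule lborel_pair.Fubini') measurable
    also have "\<dots> = (\<integral>\<^sup>+x. ennreal (exp (- lam * s)) * ?n 0 x * (\<integral>\<^sup>+y. g (x, y) \<partial>exp_law) \<partial>lborel)"
      by (intro nn_integral_cong) (simp add: nn_integral_exp_law nn_integral_cmult)
    finally show ?thesis by (simp add: ennreal_mult')
  qed
  finally have HE: "(\<integral>\<^sup>+y. H y \<partial>exp_law) =
     (\<integral>\<^sup>+x. ennreal (exp (- lam * s) * normal_density 0 (sqrt s) x * jump_odds s x) * g (x, 0) \<partial>lborel) +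
     (\<integral>\<^sup>+x. ennreal (exp (- lam * s) * normal_density 0 (sqrt s) x) * (\<integral>\<^sup>+y. g (x, y) \<partial>exp_law) \<partial>lborel)" .
  have [measurable]: "(\<lambda>x. \<integral>\<^sup>+y. g (x, y) \<partial>exp_law) \<in> borel_measurable borel"
    by (rule E.borel_measurable_nn_integral) measurable
  have "state_avg p (\<lambda>y. \<integral>\<^sup>+u. g (al * max 0 (s - y) + sqrt s * u, max 0 (y - s)) \<partial>std_gauss) =
     (\<integral>\<^sup>+x. ennreal p * (?n (al * s) x * g (x, 0)) + ennreal (1 - p) *
        (ennreal (exp (- lam * s) * normal_density 0 (sqrt s) x * jump_odds s x) * g (x, 0)
         + ennreal (exp (- lam * s) * normal_density 0 (sqrt s) x) * (\<integral>\<^sup>+y. g (x, y) \<partial>exp_law)) \<partial>lborel)"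
    unfolding state_avg_def H H0 HE
    by (subst (1 2) nn_integral_cmult[symmetric] nn_integral_add[symmetric], (measurable)[2])+
       (simp add: nn_integral_cmult nn_integral_add)
  also have "\<dots> = (\<integral>\<^sup>+x. ennreal (lik s p x) * state_avg (bayes s p x) (\<lambda>y. g (x, y)) \<partial>lborel)"
  proof (rule nn_integral_cong)
    fix x
    have b: "0 \<le> bayes s p x" "0 \<le> 1 - bayes s p x" using bayes_range[OF s p, of x] by auto
    have l: "0 \<le> lik s p x" using lik_nonneg(3)[OF s p, of x] by simp
    have J: "0 \<le> jump_odds s x" using jump_odds_nonneg s by simp
    have p': "0 \<le> p" "0 \<le> 1 - p" using p by auto
    have "ennreal (lik s p x) * state_avg (bayes s p x) (\<lambda>y. g (x, y)) =
       ennreal (lik_after s p x) * g (x, 0) + ennreal (lik_before s p x) * (\<integral>\<^sup>+y. g (x, y) \<partial>exp_law)"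
      unfolding state_avg_def distrib_left lik_bayes[OF s p, symmetric]
      using l b by (simp add: ennreal_mult mult.assoc)
    also have "\<dots> = ennreal p * (?n (al * s) x * g (x, 0)) + ennreal (1 - p) *
        (ennreal (exp (- lam * s) * normal_density 0 (sqrt s) x * jump_odds s x) * g (x, 0)
         + ennreal (exp (- lam * s) * normal_density 0 (sqrt s) x) * (\<integral>\<^sup>+y. g (x, y) \<partial>exp_law))"
      unfolding lik_after_def lik_before_def using p' J
      by (simp add: ennreal_plus ennreal_mult distrib_left distrib_right mult_ac add_ac)
    finally show "ennreal p * (?n (al * s) x * g (x, 0)) + ennreal (1 - p) *
        (ennreal (exp (- lam * s) * normal_density 0 (sqrt s) x * jump_odds s x) * g (x, 0)
         + ennreal (exp (- lam * s) * normal_density 0 (sqrt s) x) * (\<integral>\<^sup>+y. g (x, y) \<partial>exp_law)) =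
      ennreal (lik s p x) * state_avg (bayes s p x) (\<lambda>y. g (x, y))" by simp
  qed
  finally show ?thesis .
qed

end

section \<open>The filter along predictable observation times\<close>

text \<open>
  The Doob--Dynkin lemma: a quantity measurable in what has been observed is a function of the
  observation.
\<close>

lemma factor_through_vimage_algebra:
  assumes h: "h \<in> X \<rightarrow> space N" and f: "f \<in> borel_measurable (vimage_algebra X h N)"
  obtains g :: "'b \<Rightarrow> ennreal" where "g \<in> borel_measurable N" "\<And>x. x \<in> X \<Longrightarrow> f x = g (h x)"
proof -
  have "\<exists>g\<in>borel_measurable N. \<forall>x\<in>X. f x = g (h x)"
    using f
  proof (induction rule: borel_measurable_induct)
    case (cong f g)
    then show ?case by simp
  next
    case (set A)
    then obtain C where "C \<in> sets N" "A = h -` C \<inter> X" using sets_vimage_algebra2[OF h] by auto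
    then show ?case by (intro bexI[of _ "indicator C"]) (auto split: split_indicator)
  next
    case (mult u c)
    then obtain g where "g \<in> borel_measurable N" "\<forall>x\<in>X. u x = g (h x)" by blast
    then show ?case by (intro bexI[of _ "\<lambda>y. c * g y"]) auto
  next
    case (add u v)
    then obtain g g' where "g \<in> borel_measurable N" "\<forall>x\<in>X. u x = g (h x)"
      "g' \<in> borel_measurable N" "\<forall>x\<in>X. v x = g' (h x)" by blast
    then show ?case by (intro bexI[of _ "\<lambda>y. g' y + g y"]) auto
  next
    case (seq U)
    then obtain G where G: "\<And>i. G i \<in> borel_measurable N" "\<And>i. \<forall>x\<in>X. U i x = G i (h x)" by metis
    have *: "(SUP i. U i) x = (SUP i. G i (h x))" if "x \<in> X" for x
      unfolding SUP_apply using G(2) that by (simp cong: SUP_cong)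
    show ?case
    proof (rule bexI, rule ballI, rule *)
      show "(\<lambda>y. SUP i. G i y) \<in> borel_measurable N"
        by (intro borel_measurable_SUP G(1)) auto
    qed
  qed
  then show thesis using that by auto
qed

lemma factor_through:
  assumes h: "h \<in> X \<rightarrow> space N" and i: "(\<lambda>x. x) \<in> measurable (vimage_algebra X h N) L"
    and f: "f \<in> borel_measurable L"
  obtains g :: "'b \<Rightarrow> ennreal" where "g \<in> borel_measurable N" "\<And>x. x \<in> X \<Longrightarrow> f x = g (h x)"
  using factor_through_vimage_algebra[OF h measurable_compose[OF i f]] by metis

context detection_params begin

lemma measurable_state_avg:
  assumes f: "f \<in> borel_measurable (K \<Otimes>\<^sub>M borel)" and b: "b \<in> borel_measurable K"
  shows "(\<lambda>\<omega>. state_avg (b \<omega>) (\<lambda>y. f (\<omega>, y))) \<in> borel_measurable K"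
proof -
  interpret E: prob_space exp_law by (rule prob_space_exp_law)
  note f[measurable] b[measurable]
  have "case_prod (\<lambda>\<omega> y. f (\<omega>, y)) \<in> borel_measurable (K \<Otimes>\<^sub>M exp_law)" by (simp add: f cong: measurable_cong_sets)
  from E.borel_measurable_nn_integral[OF this] show ?thesis unfolding state_avg_def by measurable
qed

lemma state_avg_cong: "(\<And>y. f y = g y) \<Longrightarrow> state_avg p f = state_avg p g"
  by (simp add: state_avg_def)

lemma emeasure_exp_law: "emeasure exp_law {..t} = ennreal (if 0 \<le> t then 1 - exp (- lam * t) else 0)"
proof (cases "0 \<le> t")
  case True
  then show ?thesis using emeasure_erlang_density[OF rate_pos, of 0 t] by (simp add: erlang_CDF_0)
next
  case False
  have "emeasure exp_law {..t} = (\<integral>\<^sup>+y. ennreal (exponential_density lam y) * indicator {..t} y \<partial>lborel)"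
    by (rule emeasure_density) auto
  also have "\<dots> = 0"
    using False by (subst nn_integral_0_iff_AE) (auto simp: exponential_density_def split: split_indicator)
  finally show ?thesis using False by simp
qed

lemma state_avg_atMost:
  assumes "p \<in> {0..1}"
  shows "state_avg p (indicator {..t}) = ennreal (if 0 \<le> t then 1 - (1 - p) * exp (- lam * t) else 0)"
proof -
  have "state_avg p (indicator {..t}) = ennreal p * indicator {..t} 0 + ennreal (1 - p) * emeasure exp_law {..t}"
    by (simp add: state_avg_def)
  also have "\<dots> = ennreal (if 0 \<le> t then p + (1 - p) * (1 - exp (- lam * t)) else 0)"
    using assms rate_pos by (auto simp: emeasure_exp_law ennreal_mult ennreal_plus split: split_indicator)
  finally show ?thesis by (simp add: algebra_simps)
qed

end

locale detection =
  fixes D :: "'a detection_model" and \<pi> :: real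
  assumes qd: "quickest_detection D" and pi: "\<pi> \<in> {0..1}"

sublocale detection \<subseteq> detection_params D
  using qd unfolding quickest_detection_def by unfold_locales auto

sublocale detection \<subseteq> brownian "law D \<pi>" "bm D"
  using qd pi unfolding quickest_detection_def by (intro brownian.intro brownian_axioms.intro) auto

context detection begin

abbreviation "M \<equiv> law D \<pi>"
abbreviation "\<Theta> \<equiv> change_time D"
abbreviation "\<Omega> \<equiv> sample_space D"

lemma space_M [simp]: "space M = \<Omega>"
  using qd pi unfolding quickest_detection_def by (intro sets_eq_imp_space_eq) blast

lemma change_time_measurable [measurable]: "\<Theta> \<in> borel_measurable M"
  using qd pi unfolding quickest_detection_def by blast

lemma change_time_nonneg: "\<omega> \<in> \<Omega> \<Longrightarrow> 0 \<le> \<Theta> \<omega>"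
  using qd unfolding quickest_detection_def by auto

text \<open>
  The given probabilities fix the distribution function of the change time. It is also that of a
  variable which a coin sets to \<open>0\<close> or to an exponential value.
\<close>

lemma change_time_law:
  assumes f [measurable]: "f \<in> borel_measurable borel"
  shows "(\<integral>\<^sup>+\<omega>. f (\<Theta> \<omega>) \<partial>M) = state_avg \<pi> f"
proof -
  interpret E: prob_space exp_law by (rule prob_space_exp_law)
  \<comment> \<open>the coin together with an independent exponential variable\<close>
  define B where "B = point_measure (UNIV :: bool set) (\<lambda>b. ennreal (if b then \<pi> else 1 - \<pi>))"
  define N where "N = distr (B \<Otimes>\<^sub>M exp_law) borel (\<lambda>z. if fst z then 0 else snd z)"
  have [measurable_cong]: "sets B = sets (count_space UNIV)" by (simp add: B_def sets_point_measure)
  have [measurable]: "(\<lambda>z. if fst z then 0 else snd z) \<in> borel_measurable (B \<Otimes>\<^sub>M exp_law)" by measurable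
  have N: "(\<integral>\<^sup>+y. g y \<partial>N) = state_avg \<pi> g" if [measurable]: "g \<in> borel_measurable borel" for g
  proof -
    have "(\<integral>\<^sup>+y. g y \<partial>N) = (\<integral>\<^sup>+z. g (if fst z then 0 else snd z) \<partial>(B \<Otimes>\<^sub>M exp_law))"
      unfolding N_def by (rule nn_integral_distr) measurable
    also have "\<dots> = (\<integral>\<^sup>+b. \<integral>\<^sup>+y. g (if b then 0 else y) \<partial>exp_law \<partial>B)"
      by (subst E.nn_integral_fst[symmetric]) (simp_all only: fst_conv snd_conv, measurable)
    also have "\<dots> = ennreal (1 - \<pi>) * (\<integral>\<^sup>+y. g y \<partial>exp_law) + ennreal \<pi> * g 0"
      unfolding B_def using E.emeasure_space_1
      by (subst nn_integral_point_measure_finite) (auto simp: UNIV_bool mult.commute)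
    finally show ?thesis by (simp add: state_avg_def add.commute)
  qed
  have "distr M borel \<Theta> = N"
  proof (rule cdf_unique)
    show "real_distribution (distr M borel \<Theta>)" by simp
    have 1: "emeasure N UNIV = 1"
      using N[of "\<lambda>_. 1"] state_avg_const[OF pi, of 1] by (simp add: N_def)
    then show "real_distribution N"
      by (intro real_distribution.intro prob_spaceI real_distribution_axioms.intro) (auto simp: N_def)
    show "cdf (distr M borel \<Theta>) = cdf N"
    proof
      fix t
      have "emeasure N {..t} = state_avg \<pi> (indicator {..t})"
        using N[of "indicator {..t}"] by (simp add: N_def)
      then have 2: "cdf N t = (if 0 \<le> t then 1 - (1 - \<pi>) * exp (- lam * t) else 0)"
        using pi rate_pos unfolding cdf_def measure_def state_avg_atMost[OF pi]
        by (auto simp: mult_le_one)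
      have 3: "cdf (distr M borel \<Theta>) t = measure M {\<omega>\<in>space M. \<Theta> \<omega> \<le> t}"
        by (simp add: cdf_def measure_distr vimage_def Int_def conj_commute)
      show "cdf (distr M borel \<Theta>) t = cdf N t"
      proof (cases "0 \<le> t")
        case True
        have "{\<omega>\<in>space M. \<Theta> \<omega> \<le> t} = space M - {\<omega>\<in>space M. \<Theta> \<omega> > t}" by auto
        moreover have "measure M {\<omega>\<in>space M. \<Theta> \<omega> > t} = (1 - \<pi>) * exp (- lam * t)"
          using qd pi True unfolding quickest_detection_def by blast
        moreover have "{\<omega>\<in>space M. \<Theta> \<omega> > t} \<in> sets M" by measurable
        ultimately show ?thesis using True 2 3 prob_compl[of "{\<omega>\<in>space M. \<Theta> \<omega> > t}"] by simp
      next
        case False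
        then have "{\<omega>\<in>space M. \<Theta> \<omega> \<le> t} = {}" using change_time_nonneg by fastforce
        then show ?thesis using False 2 3 by (metis measure_empty)
      qed
    qed
  qed
  then show ?thesis using N[OF f] by (subst (asm) eq_commute) (simp add: nn_integral_distr)
qed

lemma fresh_change_time: "fresh_after M (bm D) (vimage_algebra \<Omega> \<Theta> borel) (\<lambda>_. 0)"
proof -
  have "indep_set (sets (vimage_algebra (space M) \<Theta> (borel :: real measure)))
      (sets (vimage_algebra (space M) (\<lambda>\<omega>. \<lambda>t\<in>{0..}. bm D t \<omega>) (PiM {0..} (\<lambda>_. borel))))"
    using qd pi unfolding quickest_detection_def by blast
  from fresh_initial[OF change_time_measurable this] show ?thesis by simp
qed

definition gain :: "(nat \<Rightarrow> 'a \<Rightarrow> real) \<Rightarrow> nat \<Rightarrow> 'a \<Rightarrow> real" where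
  "gain S k \<omega> = X_obs D (S (Suc k) \<omega>) \<omega> - X_obs D (S k \<omega>) \<omega>"

definition gap :: "(nat \<Rightarrow> 'a \<Rightarrow> real) \<Rightarrow> nat \<Rightarrow> 'a \<Rightarrow> real" where
  "gap S k \<omega> = S (Suc k) \<omega> - S k \<omega>"

text \<open>
  What the observer knows after \<open>k\<close> observations. The increments alone generate it, because the
  observation times are functions of earlier increments.
\<close>

primrec hist :: "(nat \<Rightarrow> 'a \<Rightarrow> real) \<Rightarrow> nat \<Rightarrow> 'a measure" where
  "hist S 0 = vimage_algebra \<Omega> (\<lambda>_. ()) (count_space UNIV)"
| "hist S (Suc k) = vimage_algebra \<Omega> (\<lambda>\<omega>. (\<omega>, gain S k \<omega>)) (hist S k \<Otimes>\<^sub>M borel)"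

text \<open>
  An informant's knowledge: the change time and the Brownian increments. The next Brownian increment is independent
  even of this, and it contains the observer's history.
\<close>

primrec full :: "(nat \<Rightarrow> 'a \<Rightarrow> real) \<Rightarrow> nat \<Rightarrow> 'a measure" where
  "full S 0 = vimage_algebra \<Omega> \<Theta> borel"
| "full S (Suc k) = vimage_algebra \<Omega> (\<lambda>\<omega>. (\<omega>, bm D (S (Suc k) \<omega>) \<omega> - bm D (S k \<omega>) \<omega>)) (full S k \<Otimes>\<^sub>M borel)"

primrec belief :: "(nat \<Rightarrow> 'a \<Rightarrow> real) \<Rightarrow> nat \<Rightarrow> 'a \<Rightarrow> real" where
  "belief S 0 \<omega> = \<pi>"
| "belief S (Suc k) \<omega> = bayes (gap S k \<omega>) (belief S k \<omega>) (gain S k \<omega>)"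

text \<open>
  Finite times only, so that the filter always advances by a positive amount; sequences with infinite times are
  reduced to these below.
\<close>

definition predictable :: "(nat \<Rightarrow> 'a \<Rightarrow> real) \<Rightarrow> bool" where
  "predictable S \<longleftrightarrow> (\<forall>\<omega>\<in>\<Omega>. S 0 \<omega> = 0 \<and> (\<forall>k. S k \<omega> < S (Suc k) \<omega>)) \<and>
     (\<forall>k. S (Suc k) \<in> borel_measurable (hist S k))"

definition lag :: "(nat \<Rightarrow> 'a \<Rightarrow> real) \<Rightarrow> nat \<Rightarrow> 'a \<Rightarrow> real" where
  "lag S k \<omega> = max 0 (\<Theta> \<omega> - S k \<omega>)"

lemma space_hist [simp]: "space (hist S k) = \<Omega>" by (cases k) simp_all
lemma space_full [simp]: "space (full S k) = \<Omega>" by (cases k) simp_all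

lemma hist_pair_space: "(\<lambda>\<omega>. (\<omega>, f \<omega>)) \<in> \<Omega> \<rightarrow> space (hist S k \<Otimes>\<^sub>M borel)"
  and full_pair_space: "(\<lambda>\<omega>. (\<omega>, f \<omega>)) \<in> \<Omega> \<rightarrow> space (full S k \<Otimes>\<^sub>M borel)"
  by (auto simp: space_pair_measure)

lemma hist_Suc:
  "(\<lambda>\<omega>. \<omega>) \<in> measurable (hist S (Suc k)) (hist S k)" "gain S k \<in> borel_measurable (hist S (Suc k))"
  using measurable_compose[OF measurable_vimage_algebra1[OF hist_pair_space] measurable_fst]
    measurable_compose[OF measurable_vimage_algebra1[OF hist_pair_space] measurable_snd] by simp_all

lemma hist_mono: "i \<le> k \<Longrightarrow> f \<in> measurable (hist S i) N \<Longrightarrow> f \<in> measurable (hist S k) N"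
proof (induction k)
  case (Suc k)
  then show ?case
    using measurable_compose[OF hist_Suc(1)] by (cases "i = Suc k") auto
qed simp

lemma full_Suc:
  "(\<lambda>\<omega>. \<omega>) \<in> measurable (full S (Suc k)) (full S k)"
  "(\<lambda>\<omega>. bm D (S (Suc k) \<omega>) \<omega> - bm D (S k \<omega>) \<omega>) \<in> borel_measurable (full S (Suc k))"
  using measurable_compose[OF measurable_vimage_algebra1[OF full_pair_space] measurable_fst]
    measurable_compose[OF measurable_vimage_algebra1[OF full_pair_space] measurable_snd] by simp_all

lemma change_time_full: "\<Theta> \<in> borel_measurable (full S k)"
proof (induction k)
  case 0
  then show ?case by (simp add: measurable_vimage_algebra1)
next
  case (Suc k)
  then show ?case using measurable_compose[OF full_Suc(1)] by auto
qed

context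
  fixes S assumes S: "predictable S"
begin

lemma S_0: "\<omega> \<in> \<Omega> \<Longrightarrow> S 0 \<omega> = 0"
  and S_less: "\<omega> \<in> \<Omega> \<Longrightarrow> S k \<omega> < S (Suc k) \<omega>"
  and S_Suc_hist: "S (Suc k) \<in> borel_measurable (hist S k)"
  using S unfolding predictable_def by auto

lemma gap_pos: "\<omega> \<in> \<Omega> \<Longrightarrow> 0 < gap S k \<omega>"
  using S_less by (simp add: gap_def)

lemma S_hist: "S k \<in> borel_measurable (hist S k)"
proof (cases k)
  case 0
  have "(\<lambda>_. 0 :: real) \<in> borel_measurable (hist S 0)" by simp
  then show ?thesis unfolding 0 by (rule measurable_cong[THEN iffD1, rotated]) (simp add: S_0)
next
  case (Suc j)
  then show ?thesis using hist_mono[OF _ S_Suc_hist, of j k] by auto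
qed

lemma gap_hist: "gap S k \<in> borel_measurable (hist S k)"
  using S_hist S_Suc_hist unfolding gap_def[abs_def] by measurable

text \<open>
  The two claims support each other: the next wait is measurable in the observer's, hence in the
  informant's history, so \<open>fresh_step\<close> applies; and the new observation is a function of the change time,
  the observation times and the new Brownian increment.
\<close>

lemma full_fresh:
  "fresh_after M (bm D) (full S k) (S k) \<and> (\<lambda>\<omega>. \<omega>) \<in> measurable (full S k) (hist S k)"
proof (induction k)
  case 0
  have "fresh_after M (bm D) (full S 0) (S 0)"
  proof -
    have "S 0 \<in> borel_measurable (full S 0) \<longleftrightarrow> (\<lambda>_. 0 :: real) \<in> borel_measurable (full S 0)"
      by (rule measurable_cong) (simp add: S_0)
    moreover have "(\<integral>\<^sup>+\<omega>. indicator A \<omega> * ennreal (\<Prod>i<n. g i (bm D (S 0 \<omega> + t (Suc i)) \<omega> - bm D (S 0 \<omega> + t i) \<omega>)) \<partial>M)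
      = (\<integral>\<^sup>+\<omega>. indicator A \<omega> * ennreal (\<Prod>i<n. g i (bm D (0 + t (Suc i)) \<omega> - bm D (0 + t i) \<omega>)) \<partial>M)" for n t g A
      by (intro nn_integral_cong) (simp add: S_0)
    ultimately show ?thesis using fresh_change_time unfolding fresh_after_def by (simp add: S_0)
  qed
  moreover have "(\<lambda>\<omega>. \<omega>) \<in> measurable (full S 0) (hist S 0)"
    unfolding hist.simps by (rule measurable_vimage_algebra2) auto
  ultimately show ?case by simp
next
  case (Suc k)
  then have fr: "fresh_after M (bm D) (full S k) (S k)" and id: "(\<lambda>\<omega>. \<omega>) \<in> measurable (full S k) (hist S k)" by auto
  have "fresh_after M (bm D) (full S (Suc k)) (S (Suc k))"
    using fresh_step(1)[OF fr measurable_compose[OF id gap_hist] gap_pos] by (simp add: gap_def)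
  moreover have "(\<lambda>\<omega>. \<omega>) \<in> measurable (full S (Suc k)) (hist S (Suc k))"
    unfolding hist.simps
  proof (rule measurable_vimage_algebra2)
    have 1: "(\<lambda>\<omega>. \<omega>) \<in> measurable (full S (Suc k)) (hist S k)"
      using measurable_compose[OF full_Suc(1) id] by simp
    note [measurable] = measurable_compose[OF 1 S_hist] measurable_compose[OF 1 S_Suc_hist] change_time_full
      full_Suc(2)[of S k]
    have "gain S k \<omega> = al * (max 0 (S (Suc k) \<omega> - \<Theta> \<omega>) - max 0 (S k \<omega> - \<Theta> \<omega>))
         + (bm D (S (Suc k) \<omega>) \<omega> - bm D (S k \<omega>) \<omega>)" for \<omega>
      by (simp add: gain_def X_obs_def algebra_simps)
    then have "gain S k = (\<lambda>\<omega>. al * (max 0 (S (Suc k) \<omega> - \<Theta> \<omega>) - max 0 (S k \<omega> - \<Theta> \<omega>))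
         + (bm D (S (Suc k) \<omega>) \<omega> - bm D (S k \<omega>) \<omega>))" by auto
    also have "\<dots> \<in> borel_measurable (full S (Suc k))" by measurable
    finally show "(\<lambda>\<omega>. (\<omega>, gain S k \<omega>)) \<in> measurable (full S (Suc k)) (hist S k \<Otimes>\<^sub>M borel)"
      by (intro measurable_Pair 1)
  qed auto
  ultimately show ?case by simp
qed

lemma sub_full: "subalgebra M (full S k)"
  using full_fresh[of k] unfolding fresh_after_def by auto

lemma full_M: "f \<in> measurable (full S k) N \<Longrightarrow> f \<in> measurable M N"
  by (rule measurable_from_subalg[OF sub_full])

lemma hist_M: "f \<in> measurable (hist S k) N \<Longrightarrow> f \<in> measurable M N"
  using full_fresh[of k] measurable_compose[of "\<lambda>\<omega>. \<omega>" "full S k" "hist S k" f N] full_M by auto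

lemma belief_range: "\<omega> \<in> \<Omega> \<Longrightarrow> belief S k \<omega> \<in> {0..1}"
proof (induction k)
  case 0
  then show ?case using pi by simp
next
  case (Suc k)
  then show ?case using bayes_range[OF gap_pos] by simp
qed

lemma belief_hist: "belief S k \<in> borel_measurable (hist S k)"
proof (induction k)
  case (Suc k)
  have "(\<lambda>\<omega>. bayes (gap S k \<omega>) (belief S k \<omega>) (gain S k \<omega>)) \<in> borel_measurable (hist S (Suc k))"
    using hist_mono[OF _ Suc, of "Suc k"] hist_mono[OF _ gap_hist[of k], of "Suc k"] hist_Suc(2)[of S k]
    by (intro measurable_lik) auto
  then show ?case by simp
qed simp

text \<open>
  Given the informant's history the Brownian increment is Gaussian and can be integrated out. What is left depends
  on the observer's history and the time left until the change, whose conditional law is the hypothesis; then Bayes'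
  formula applies pointwise.
\<close>

lemma joint_step_law:
  assumes IH: "\<And>f. f \<in> borel_measurable (hist S k \<Otimes>\<^sub>M borel) \<Longrightarrow>
      (\<integral>\<^sup>+\<omega>. f (\<omega>, lag S k \<omega>) \<partial>M) = (\<integral>\<^sup>+\<omega>. state_avg (belief S k \<omega>) (\<lambda>y. f (\<omega>, y)) \<partial>M)"
    and f: "f \<in> borel_measurable (hist S k \<Otimes>\<^sub>M (borel \<Otimes>\<^sub>M borel))"
  shows "(\<integral>\<^sup>+\<omega>. f (\<omega>, (gain S k \<omega>, lag S (Suc k) \<omega>)) \<partial>M) =
    (\<integral>\<^sup>+\<omega>. (\<integral>\<^sup>+x. ennreal (lik (gap S k \<omega>) (belief S k \<omega>) x) *
        state_avg (bayes (gap S k \<omega>) (belief S k \<omega>) x) (\<lambda>y. f (\<omega>, (x, y))) \<partial>lborel) \<partial>M)"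
proof -
  interpret N: prob_space std_gauss by (rule prob_space_std_gauss)
  have fr: "fresh_after M (bm D) (full S k) (S k)" and id: "(\<lambda>\<omega>. \<omega>) \<in> measurable (full S k) (hist S k)"
    using full_fresh by auto
  define R where "R = gap S k"
  have R: "R \<in> borel_measurable (full S k)" "R \<in> borel_measurable (hist S k)"
    using measurable_compose[OF id gap_hist] gap_hist by (simp_all add: R_def)
  have R0: "0 < R \<omega>" if "\<omega> \<in> \<Omega>" for \<omega> using gap_pos[OF that] by (simp add: R_def)
  have SR: "S k \<omega> + R \<omega> = S (Suc k) \<omega>" for \<omega> by (simp add: R_def gap_def)
  \<comment> \<open>the new data as a function of the old ones and the Brownian increment\<close>
  define F where "F z = f (fst z, (al * max 0 (R (fst z) - lag S k (fst z)) + snd z, max 0 (lag S k (fst z) - R (fst z))))" for z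
  have lagf: "lag S k \<in> borel_measurable (full S k)"
    using measurable_compose[OF id S_hist] change_time_full[of S k] unfolding lag_def[abs_def] by measurable
  have F: "F \<in> borel_measurable (full S k \<Otimes>\<^sub>M borel)"
  proof -
    note [measurable] = R(1) lagf
    have "(\<lambda>z. (fst z, (al * max 0 (R (fst z) - lag S k (fst z)) + snd z, max 0 (lag S k (fst z) - R (fst z)))))
       \<in> measurable (full S k \<Otimes>\<^sub>M borel) (hist S k \<Otimes>\<^sub>M (borel \<Otimes>\<^sub>M borel))"
      by (intro measurable_Pair measurable_compose[OF measurable_fst id]) measurable
    from measurable_compose[OF this f] show ?thesis by (simp add: F_def[abs_def])
  qed
  have "(\<integral>\<^sup>+\<omega>. f (\<omega>, (gain S k \<omega>, lag S (Suc k) \<omega>)) \<partial>M) = (\<integral>\<^sup>+\<omega>. F (\<omega>, bm D (S k \<omega> + R \<omega>) \<omega> - bm D (S k \<omega>) \<omega>) \<partial>M)"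
  proof (rule nn_integral_cong)
    fix \<omega> assume "\<omega> \<in> space M"
    then have \<omega>: "0 < R \<omega>" using R0 by simp
    have 1: "lag S (Suc k) \<omega> = max 0 (lag S k \<omega> - R \<omega>)"
      using \<omega> unfolding lag_def SR[symmetric] by auto
    have "max 0 (S k \<omega> + R \<omega> - \<Theta> \<omega>) - max 0 (S k \<omega> - \<Theta> \<omega>) = max 0 (R \<omega> - lag S k \<omega>)"
      using \<omega> unfolding lag_def by (auto simp: max_def)
    moreover have "gain S k \<omega> = al * (max 0 (S k \<omega> + R \<omega> - \<Theta> \<omega>) - max 0 (S k \<omega> - \<Theta> \<omega>))
        + (bm D (S k \<omega> + R \<omega>) \<omega> - bm D (S k \<omega>) \<omega>)"
      unfolding gain_def X_obs_def SR[symmetric] by (simp add: right_diff_distrib)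
    ultimately have 2: "gain S k \<omega> = al * max 0 (R \<omega> - lag S k \<omega>) + (bm D (S k \<omega> + R \<omega>) \<omega> - bm D (S k \<omega>) \<omega>)"
      by (simp only:)
    show "f (\<omega>, (gain S k \<omega>, lag S (Suc k) \<omega>)) = F (\<omega>, bm D (S k \<omega> + R \<omega>) \<omega> - bm D (S k \<omega>) \<omega>)"
      unfolding F_def 1 2 by simp
  qed
  also have "\<dots> = (\<integral>\<^sup>+\<omega>. (\<integral>\<^sup>+u. F (\<omega>, sqrt (R \<omega>) * u) \<partial>std_gauss) \<partial>M)"
    using R0 by (intro fresh_step(2)[OF fr R(1) _ F]) simp
  also have "\<dots> = (\<integral>\<^sup>+\<omega>. (\<lambda>(\<omega>, y). \<integral>\<^sup>+u. f (\<omega>, (al * max 0 (R \<omega> - y) + sqrt (R \<omega>) * u, max 0 (y - R \<omega>))) \<partial>std_gauss) (\<omega>, lag S k \<omega>) \<partial>M)"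
    by (simp add: F_def)
  also have "\<dots> = (\<integral>\<^sup>+\<omega>. state_avg (belief S k \<omega>) (\<lambda>y. (\<lambda>(\<omega>, y). \<integral>\<^sup>+u. f (\<omega>, (al * max 0 (R \<omega> - y) + sqrt (R \<omega>) * u, max 0 (y - R \<omega>))) \<partial>std_gauss) (\<omega>, y)) \<partial>M)"
  proof (rule IH)
    note [measurable] = R(2) f
    have "(\<lambda>z. \<integral>\<^sup>+u. f (fst z, (al * max 0 (R (fst z) - snd z) + sqrt (R (fst z)) * u, max 0 (snd z - R (fst z)))) \<partial>std_gauss) \<in> borel_measurable (hist S k \<Otimes>\<^sub>M borel)"
      by (rule N.borel_measurable_nn_integral) measurable
    then show "(\<lambda>(\<omega>, y). \<integral>\<^sup>+u. f (\<omega>, (al * max 0 (R \<omega> - y) + sqrt (R \<omega>) * u, max 0 (y - R \<omega>))) \<partial>std_gauss) \<in> borel_measurable (hist S k \<Otimes>\<^sub>M borel)"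
      by (simp add: split_beta')
  qed
  also have "\<dots> = (\<integral>\<^sup>+\<omega>. (\<integral>\<^sup>+x. ennreal (lik (R \<omega>) (belief S k \<omega>) x) *
        state_avg (bayes (R \<omega>) (belief S k \<omega>) x) (\<lambda>y. f (\<omega>, (x, y))) \<partial>lborel) \<partial>M)"
  proof (rule nn_integral_cong)
    fix \<omega> assume \<omega>: "\<omega> \<in> space M"
    have "(\<lambda>z. f (\<omega>, z)) \<in> borel_measurable (borel \<Otimes>\<^sub>M borel)"
      by (rule measurable_compose[OF measurable_Pair1' f]) (use \<omega> in simp)
    from one_step_bayes[OF R0 belief_range this, of \<omega> \<omega> k] \<omega>
    show "state_avg (belief S k \<omega>) (\<lambda>y. (\<lambda>(\<omega>, y). \<integral>\<^sup>+u. f (\<omega>, (al * max 0 (R \<omega> - y) + sqrt (R \<omega>) * u, max 0 (y - R \<omega>))) \<partial>std_gauss) (\<omega>, y))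
       = (\<integral>\<^sup>+x. ennreal (lik (R \<omega>) (belief S k \<omega>) x) *
        state_avg (bayes (R \<omega>) (belief S k \<omega>) x) (\<lambda>y. f (\<omega>, (x, y))) \<partial>lborel)"
      by simp
  qed
  finally show ?thesis by (simp add: R_def)
qed

text \<open>
  The conditional law of the time left, given the observations, is the one described by the
  belief. It is stated as an identity of integrals, which suits the induction better than conditional
  expectations.
\<close>

lemma filter_law:
  "f \<in> borel_measurable (hist S k \<Otimes>\<^sub>M borel) \<Longrightarrow>
      (\<integral>\<^sup>+\<omega>. f (\<omega>, lag S k \<omega>) \<partial>M) = (\<integral>\<^sup>+\<omega>. state_avg (belief S k \<omega>) (\<lambda>y. f (\<omega>, y)) \<partial>M)"
proof (induction k arbitrary: f)
  case 0
  obtain g :: "real \<Rightarrow> ennreal" where g: "g \<in> borel_measurable borel" "\<And>z. z \<in> \<Omega> \<times> UNIV \<Longrightarrow> f z = g (snd z)"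
  proof (rule factor_through[OF _ _ 0])
    show "snd \<in> \<Omega> \<times> UNIV \<rightarrow> space (borel :: real measure)" by simp
    let ?V = "vimage_algebra (\<Omega> \<times> UNIV) snd (borel :: real measure)"
    have "(\<lambda>z. fst z) \<in> measurable ?V (hist S 0)"
      unfolding hist.simps by (rule measurable_vimage_algebra2) auto
    moreover have "(\<lambda>z. snd z) \<in> measurable ?V borel" by (rule measurable_vimage_algebra1) auto
    ultimately have "(\<lambda>z. (fst z, snd z)) \<in> measurable ?V (hist S 0 \<Otimes>\<^sub>M borel)" by (rule measurable_Pair)
    then show "(\<lambda>z. z) \<in> measurable ?V (hist S 0 \<Otimes>\<^sub>M borel)" by simp
  qed (rule that)
  have "(\<integral>\<^sup>+\<omega>. f (\<omega>, lag S 0 \<omega>) \<partial>M) = (\<integral>\<^sup>+\<omega>. g (\<Theta> \<omega>) \<partial>M)"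
    by (intro nn_integral_cong) (simp add: g(2) lag_def S_0 change_time_nonneg max_def)
  also have "\<dots> = state_avg \<pi> g" by (rule change_time_law[OF g(1)])
  also have "\<dots> = (\<integral>\<^sup>+\<omega>. state_avg \<pi> g \<partial>M)" using emeasure_space_1 by simp
  also have "\<dots> = (\<integral>\<^sup>+\<omega>. state_avg (belief S 0 \<omega>) (\<lambda>y. f (\<omega>, y)) \<partial>M)"
    by (intro nn_integral_cong) (auto simp: g(2) intro!: state_avg_cong)
  finally show ?case .
next
  case (Suc k)
  let ?N = "hist S k \<Otimes>\<^sub>M (borel \<Otimes>\<^sub>M (borel :: real measure))"
  let ?h = "\<lambda>(\<omega>, y). (\<omega>, (gain S k \<omega>, y))"
  obtain g where g: "g \<in> borel_measurable ?N" "\<And>z. z \<in> \<Omega> \<times> UNIV \<Longrightarrow> f z = g (?h z)"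
  proof (rule factor_through[OF _ _ Suc.prems])
    show h: "?h \<in> \<Omega> \<times> UNIV \<rightarrow> space ?N" by (auto simp: space_pair_measure)
    let ?V = "vimage_algebra (\<Omega> \<times> UNIV) ?h ?N"
    have hV: "?h \<in> measurable ?V ?N" by (rule measurable_vimage_algebra1[OF h])
    have "(\<lambda>z. (fst (?h z), fst (snd (?h z)))) \<in> measurable ?V (hist S k \<Otimes>\<^sub>M borel)"
      by (intro measurable_Pair measurable_compose[OF hV]) measurable
    then have "(\<lambda>z. fst z) \<in> measurable ?V (hist S (Suc k))"
      unfolding hist.simps by (intro measurable_vimage_algebra2) (auto simp: split_beta')
    moreover have "(\<lambda>z. snd (snd (?h z))) \<in> measurable ?V borel"
      by (intro measurable_compose[OF hV]) measurable
    then have "(\<lambda>z. snd z) \<in> measurable ?V borel" by (simp add: split_beta')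
    ultimately have "(\<lambda>z. (fst z, snd z)) \<in> measurable ?V (hist S (Suc k) \<Otimes>\<^sub>M borel)" by (rule measurable_Pair)
    then show "(\<lambda>z. z) \<in> measurable ?V (hist S (Suc k) \<Otimes>\<^sub>M borel)" by simp
  qed (rule that)
  let ?b = "\<lambda>\<omega> x. bayes (gap S k \<omega>) (belief S k \<omega>) x"
  \<comment> \<open>\<open>h\<close> averages \<open>g\<close> over the time left under the new belief. It does not depend on that time any more, so averaging it
      again changes nothing, and \<open>g\<close> and \<open>h\<close> have the same integral\<close>
  define h where "h z = state_avg (?b (fst z) (fst (snd z))) (\<lambda>y. g (fst z, (fst (snd z), y)))" for z :: "'a \<times> (real \<times> real)"
  have [measurable]: "gap S k \<in> borel_measurable (hist S k)" "belief S k \<in> borel_measurable (hist S k)"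
    by (rule gap_hist belief_hist)+
  have h: "h \<in> borel_measurable ?N"
  proof -
    have "(\<lambda>\<omega>. state_avg ((\<lambda>z. ?b (fst z) (fst (snd z))) \<omega>) (\<lambda>y. (\<lambda>(z, y). g (fst z, (fst (snd z), y))) (\<omega>, y))) \<in> borel_measurable ?N"
    proof (rule measurable_state_avg)
      note [measurable] = g(1)
      show "(\<lambda>(z, y). g (fst z, (fst (snd z), y))) \<in> borel_measurable (?N \<Otimes>\<^sub>M borel)" by measurable
      show "(\<lambda>z. ?b (fst z) (fst (snd z))) \<in> borel_measurable ?N" by measurable
    qed
    then show ?thesis by (simp add: h_def[abs_def])
  qed
  have "(\<integral>\<^sup>+\<omega>. f (\<omega>, lag S (Suc k) \<omega>) \<partial>M) = (\<integral>\<^sup>+\<omega>. g (\<omega>, (gain S k \<omega>, lag S (Suc k) \<omega>)) \<partial>M)"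
    by (intro nn_integral_cong) (simp add: g(2))
  also have "\<dots> = (\<integral>\<^sup>+\<omega>. (\<integral>\<^sup>+x. ennreal (lik (gap S k \<omega>) (belief S k \<omega>) x) *
        state_avg (?b \<omega> x) (\<lambda>y. g (\<omega>, (x, y))) \<partial>lborel) \<partial>M)"
    by (rule joint_step_law[OF Suc.IH g(1)])
  also have "\<dots> = (\<integral>\<^sup>+\<omega>. (\<integral>\<^sup>+x. ennreal (lik (gap S k \<omega>) (belief S k \<omega>) x) *
        state_avg (?b \<omega> x) (\<lambda>y. h (\<omega>, (x, y))) \<partial>lborel) \<partial>M)"
    by (intro nn_integral_cong arg_cong2[where f="(*)"] refl)
       (simp add: h_def state_avg_const[OF bayes_range[OF gap_pos belief_range]])
  also have "\<dots> = (\<integral>\<^sup>+\<omega>. h (\<omega>, (gain S k \<omega>, lag S (Suc k) \<omega>)) \<partial>M)"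
    by (rule joint_step_law[OF Suc.IH h, symmetric])
  also have "\<dots> = (\<integral>\<^sup>+\<omega>. state_avg (belief S (Suc k) \<omega>) (\<lambda>y. f (\<omega>, y)) \<partial>M)"
    by (intro nn_integral_cong) (auto simp: h_def g(2) intro!: state_avg_cong)
  finally show ?case .
qed

text \<open>
  The predictive law of the next increment: \<open>joint_step_law\<close> for functions that ignore the time left.
\<close>

lemma gain_law:
  assumes f: "f \<in> borel_measurable (hist S k \<Otimes>\<^sub>M borel)"
  shows "(\<integral>\<^sup>+\<omega>. f (\<omega>, gain S k \<omega>) \<partial>M) =
    (\<integral>\<^sup>+\<omega>. (\<integral>\<^sup>+x. ennreal (lik (gap S k \<omega>) (belief S k \<omega>) x) * f (\<omega>, x) \<partial>lborel) \<partial>M)"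
proof -
  have "(\<lambda>z. f (fst z, fst (snd z))) \<in> borel_measurable (hist S k \<Otimes>\<^sub>M (borel \<Otimes>\<^sub>M (borel :: real measure)))"
    using f by measurable
  from joint_step_law[OF filter_law this]
  have "(\<integral>\<^sup>+\<omega>. f (\<omega>, gain S k \<omega>) \<partial>M) = (\<integral>\<^sup>+\<omega>. (\<integral>\<^sup>+x. ennreal (lik (gap S k \<omega>) (belief S k \<omega>) x) *
        state_avg (bayes (gap S k \<omega>) (belief S k \<omega>) x) (\<lambda>y. f (\<omega>, x)) \<partial>lborel) \<partial>M)"
    by simp
  also have "\<dots> = (\<integral>\<^sup>+\<omega>. (\<integral>\<^sup>+x. ennreal (lik (gap S k \<omega>) (belief S k \<omega>) x) * f (\<omega>, x) \<partial>lborel) \<partial>M)"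
    by (intro nn_integral_cong arg_cong2[where f="(*)"] refl state_avg_const bayes_range gap_pos belief_range) auto
  finally show ?thesis .
qed

end

end

section \<open>Value iteration for the posterior\<close>

definition concave_unit :: "(real \<Rightarrow> real) \<Rightarrow> bool" where
  "concave_unit f \<longleftrightarrow> (\<forall>p\<in>{0..1}. \<forall>q\<in>{0..1}. \<forall>\<theta>\<in>{0..1}. \<theta> * f p + (1 - \<theta>) * f q \<le> f (\<theta> * p + (1 - \<theta>) * q))"

lemma concave_unitD:
  "concave_unit f \<Longrightarrow> p \<in> {0..1} \<Longrightarrow> q \<in> {0..1} \<Longrightarrow> \<theta> \<in> {0..1} \<Longrightarrow> \<theta> * f p + (1 - \<theta>) * f q \<le> f (\<theta> * p + (1 - \<theta>) * q)"
  by (simp add: concave_unit_def)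

lemma unit_convex:
  assumes "p \<in> {0..1}" "q \<in> {0..1}" "\<theta> \<in> {0..1::real}"
  shows "\<theta> * p + (1 - \<theta>) * q \<in> {0..1}"
proof -
  have "0 \<le> \<theta> * p" "0 \<le> (1 - \<theta>) * q" "\<theta> * p \<le> \<theta>" "(1 - \<theta>) * q \<le> (1 - \<theta>)"
    using assms by (auto intro: mult_nonneg_nonneg mult_left_le)
  then show ?thesis by simp
qed

lemma concave_unit_INF:
  assumes "T \<noteq> {}" "\<And>t. t \<in> T \<Longrightarrow> concave_unit (g t)" "\<And>t p. t \<in> T \<Longrightarrow> p \<in> {0..1} \<Longrightarrow> 0 \<le> g t p"
  shows "concave_unit (\<lambda>p. INF t\<in>T. g t p :: real)"
  unfolding concave_unit_def
proof (intro ballI cINF_greatest assms(1))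
  fix p q \<theta> :: real and t assume A: "p \<in> {0..1}" "q \<in> {0..1}" "\<theta> \<in> {0..1}" "t \<in> T"
  have "(INF t\<in>T. g t p) \<le> g t p" "(INF t\<in>T. g t q) \<le> g t q"
    using assms(3) A by (auto intro!: cINF_lower bdd_belowI[of _ 0])
  then have "\<theta> * (INF t\<in>T. g t p) + (1 - \<theta>) * (INF t\<in>T. g t q) \<le> \<theta> * g t p + (1 - \<theta>) * g t q"
    using A by (intro add_mono mult_left_mono) auto
  also have "\<dots> \<le> g t (\<theta> * p + (1 - \<theta>) * q)" by (rule concave_unitD[OF assms(2)]) (use A in auto)
  finally show "\<theta> * (INF t\<in>T. g t p) + (1 - \<theta>) * (INF t\<in>T. g t q) \<le> g t (\<theta> * p + (1 - \<theta>) * q)" .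
qed

lemma concave_unit_min:
  assumes "concave_unit f" "concave_unit g"
  shows "concave_unit (\<lambda>p. min (f p) (g p))"
  unfolding concave_unit_def
proof (intro ballI min.boundedI)
  fix p q \<theta> :: real assume A: "p \<in> {0..1}" "q \<in> {0..1}" "\<theta> \<in> {0..1}"
  have "\<theta> * min (f p) (g p) + (1 - \<theta>) * min (f q) (g q) \<le> \<theta> * f p + (1 - \<theta>) * f q"
    using A by (intro add_mono mult_left_mono) auto
  also have "\<dots> \<le> f (\<theta> * p + (1 - \<theta>) * q)" by (rule concave_unitD[OF assms(1) A])
  finally show "\<theta> * min (f p) (g p) + (1 - \<theta>) * min (f q) (g q) \<le> f (\<theta> * p + (1 - \<theta>) * q)" .
  have "\<theta> * min (f p) (g p) + (1 - \<theta>) * min (f q) (g q) \<le> \<theta> * g p + (1 - \<theta>) * g q"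
    using A by (intro add_mono mult_left_mono) auto
  also have "\<dots> \<le> g (\<theta> * p + (1 - \<theta>) * q)" by (rule concave_unitD[OF assms(2) A])
  finally show "\<theta> * min (f p) (g p) + (1 - \<theta>) * min (f q) (g q) \<le> g (\<theta> * p + (1 - \<theta>) * q)" .
qed

lemma concave_unit_cong: "concave_unit f \<Longrightarrow> (\<And>p. p \<in> {0..1} \<Longrightarrow> f p = g p) \<Longrightarrow> concave_unit g"
  unfolding concave_unit_def using unit_convex by (metis (no_types, lifting))

text \<open>
  Only the open interval: a concave function may jump at \<open>0\<close> and at \<open>1\<close>.
\<close>

lemma concave_unit_continuous:
  assumes "concave_unit f"
  shows "continuous_on {0<..<1} f"
proof -
  have "convex_on {0<..<1} (\<lambda>x. - f x)"
  proof (rule convex_onI)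
    fix t x y :: real assume "0 < t" "t < 1" "x \<in> {0<..<1}" "y \<in> {0<..<1}"
    then have "t * f y + (1 - t) * f x \<le> f (t * y + (1 - t) * x)"
      by (intro concave_unitD[OF assms]) auto
    then show "- f ((1 - t) *\<^sub>R x + t *\<^sub>R y) \<le> (1 - t) * - f x + t * - f y"
      by (simp add: add.commute)
  qed auto
  then have "continuous_on {0<..<1} (\<lambda>x. - f x)" by (intro convex_on_continuous) auto
  from continuous_on_minus[OF this] show ?thesis by simp
qed

lemma concave_unit_measurable:
  assumes "concave_unit f" "\<And>p. p \<notin> {0..1} \<Longrightarrow> f p = 0"
  shows "f \<in> borel_measurable borel"
proof -
  have "(\<lambda>x. indicator {0<..<1} x *\<^sub>R f x) \<in> borel_measurable borel"
    by (rule borel_measurable_continuous_on_indicator[OF _ concave_unit_continuous[OF assms(1)]]) auto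
  then have "(\<lambda>x. indicator {0<..<1} x *\<^sub>R f x + indicator {0} x * f 0 + indicator {1} x * f 1) \<in> borel_measurable borel"
    by measurable
  moreover have "indicator {0<..<1} x *\<^sub>R f x + indicator {0} x * f 0 + indicator {1} x * f 1 = f x" for x
    using assms(2)[of x] by (auto split: split_indicator)
  ultimately show ?thesis by simp
qed

text \<open>
  The tent with apex \<open>(p, f p)\<close> and feet at \<open>0\<close> and \<open>1\<close> lies below a nonnegative concave function. It is a continuous
  minorant that touches \<open>f\<close> at \<open>p\<close>, also for \<open>p = 0\<close>, where \<open>f\<close> itself need not be continuous.
\<close>

lemma concave_unit_tent:
  assumes "concave_unit f" "\<And>p. p \<in> {0..1} \<Longrightarrow> 0 \<le> f p" "p \<in> {0..<1}" "x \<in> {0..1}"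
  shows "f p * (if p \<le> x then (1 - x) / (1 - p) else x / p) \<le> f x"
proof (cases "p \<le> x")
  case True
  let ?t = "(1 - x) / (1 - p)"
  have t: "?t \<in> {0..1}" using assms True by (auto simp: divide_le_eq)
  have "?t * (1 - p) = 1 - x" using assms by simp
  moreover have "t * p + (1 - t) * 1 = x" if "t * (1 - p) = 1 - x" for t using that by (simp add: algebra_simps)
  ultimately have "?t * p + (1 - ?t) * 1 = x" by blast
  then have "?t * f p + (1 - ?t) * f 1 \<le> f x" using concave_unitD[OF assms(1), of p 1 ?t] t assms by auto
  moreover have "0 \<le> (1 - ?t) * f 1" using t assms(2)[of 1] by (intro mult_nonneg_nonneg) auto
  ultimately show ?thesis using True by (simp add: mult.commute)
next
  case False
  let ?t = "x / p"
  have t: "?t \<in> {0..1}" using assms False by auto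
  have "?t * p + (1 - ?t) * 0 = x" using assms False by auto
  then have "?t * f p + (1 - ?t) * f 0 \<le> f x" using concave_unitD[OF assms(1), of p 0 ?t] t assms by auto
  moreover have "0 \<le> (1 - ?t) * f 0" using t assms(2)[of 0] by (intro mult_nonneg_nonneg) auto
  ultimately show ?thesis using False by (simp add: mult.commute)
qed

context detection_params begin

text \<open>
  The mean of \<open>(s - y)\<^sup>+\<close> under \<open>state_avg p\<close>: the expected detection delay that builds up during a wait \<open>s\<close>.
\<close>

definition delay :: "real \<Rightarrow> real \<Rightarrow> real" where
  "delay s p = s - (1 - p) * ((1 - exp (- lam * s)) / lam)"

lemma one_minus_exp: "(1 - exp (- lam * s)) / lam \<le> s"
  using exp_ge_add_one_self[of "- lam * s"] rate_pos by (simp add: divide_le_eq mult.commute)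

lemma one_minus_exp': "0 \<le> s \<Longrightarrow> 0 \<le> (1 - exp (- lam * s)) / lam" "(1 - exp (- lam * s)) / lam \<le> 1 / lam"
  using rate_pos by (auto intro!: divide_nonneg_nonneg divide_right_mono)

lemma delay_nonneg: "0 \<le> s \<Longrightarrow> p \<in> {0..1} \<Longrightarrow> 0 \<le> delay s p"
proof -
  assume s: "0 \<le> s" "p \<in> {0..1}"
  have "(1 - p) * ((1 - exp (- lam * s)) / lam) \<le> 1 * ((1 - exp (- lam * s)) / lam)"
    using s one_minus_exp'(1)[of s] by (intro mult_right_mono) auto
  then show ?thesis using one_minus_exp[of s] unfolding delay_def by simp
qed

lemma delay_lower: "0 \<le> s \<Longrightarrow> p \<in> {0..1} \<Longrightarrow> s - 1 / lam \<le> delay s p"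
proof -
  assume s: "0 \<le> s" "p \<in> {0..1}"
  have "(1 - p) * ((1 - exp (- lam * s)) / lam) \<le> 1 * ((1 - exp (- lam * s)) / lam)"
    using s one_minus_exp'(1)[of s] by (intro mult_right_mono) auto
  then show ?thesis using one_minus_exp'(2)[of s] unfolding delay_def by simp
qed

lemma delay_affine: "delay s (\<theta> * p + (1 - \<theta>) * q) = \<theta> * delay s p + (1 - \<theta>) * delay s q"
proof -
  have "s - (1 - (\<theta> * p + (1 - \<theta>) * q)) * E = \<theta> * (s - (1 - p) * E) + (1 - \<theta>) * (s - (1 - q) * E)" for E
    by (simp add: algebra_simps)
  then show ?thesis unfolding delay_def .
qed

lemma exp_law_delay:
  assumes s: "0 \<le> s"
  shows "(\<integral>\<^sup>+y. ennreal (max 0 (s - y)) \<partial>exp_law) = ennreal (s - (1 - exp (- lam * s)) / lam)"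
proof -
  let ?G = "\<lambda>y. - (s - y) * exp (- lam * y) + exp (- lam * y) / lam"
  have "(\<integral>\<^sup>+y. ennreal (max 0 (s - y)) \<partial>exp_law) = (\<integral>\<^sup>+y. ennreal (exponential_density lam y) * ennreal (max 0 (s - y)) \<partial>lborel)"
    by (rule nn_integral_exp_law) measurable
  also have "\<dots> = (\<integral>\<^sup>+y. ennreal (lam * exp (- lam * y) * (s - y)) * indicator {0..s} y \<partial>lborel)"
    using rate_pos by (intro nn_integral_cong)
      (auto simp: exponential_density_def ennreal_mult[symmetric] mult_ac max_def split: split_indicator)
  also have "\<dots> = ennreal (?G s - ?G 0)"
  proof (rule nn_integral_FTC_Icc)
    show "(?G has_real_derivative lam * exp (- lam * y) * (s - y)) (at y)" for y
      using rate_pos by (auto intro!: derivative_eq_intros simp: field_simps)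
  qed (use s rate_pos in auto)
  also have "?G s - ?G 0 = s - (1 - exp (- lam * s)) / lam" by (simp add: diff_divide_distrib)
  finally show ?thesis .
qed

lemma state_avg_delay:
  assumes s: "0 \<le> s" and p: "p \<in> {0..1}"
  shows "state_avg p (\<lambda>y. ennreal (max 0 (s - y))) = ennreal (delay s p)"
proof -
  have "0 \<le> s - (1 - exp (- lam * s)) / lam" using one_minus_exp[of s] by simp
  then have "state_avg p (\<lambda>y. ennreal (max 0 (s - y))) = ennreal (p * s + (1 - p) * (s - (1 - exp (- lam * s)) / lam))"
    unfolding state_avg_def exp_law_delay[OF s] using s p by (simp add: ennreal_mult ennreal_plus)
  also have "p * s + (1 - p) * (s - (1 - exp (- lam * s)) / lam) = delay s p"
    by (simp add: delay_def algebra_simps)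
  finally show ?thesis .
qed

lemma state_avg_survival:
  assumes r: "0 \<le> r" and p: "p \<in> {0..1}"
  shows "state_avg p (indicator {r<..}) = ennreal ((1 - p) * exp (- lam * r))"
proof -
  interpret E: prob_space exp_law by (rule prob_space_exp_law)
  have "measure exp_law {..r} = 1 - exp (- lam * r)"
    using emeasure_exp_law[of r] r rate_pos by (simp add: measure_def)
  moreover have "{r<..} = space exp_law - {..r}" by auto
  ultimately have "emeasure exp_law {r<..} = ennreal (exp (- lam * r))"
    using E.prob_compl[of "{..r}"] by (simp add: E.emeasure_eq_measure)
  then show ?thesis using r p by (simp add: state_avg_def ennreal_mult)
qed

text \<open>
  The conditional cost of making no further observation and raising the alarm after a further time \<open>t\<close>:
  probability of a false alarm plus cost of the delay.
\<close>

definition stop_cost :: "real \<Rightarrow> real \<Rightarrow> real" where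
  "stop_cost t p = (1 - p) * exp (- lam * t) + cc * delay t p"

lemma F_fun_eq: "F_fun D p = (INF t\<in>{0..}. stop_cost t p)"
  unfolding F_fun_def stop_cost_def delay_def by (intro INF_cong refl) (simp add: algebra_simps)

lemma stop_cost_nonneg: "0 \<le> t \<Longrightarrow> p \<in> {0..1} \<Longrightarrow> 0 \<le> stop_cost t p"
  unfolding stop_cost_def using delay_nonneg delay_pos by (intro add_nonneg_nonneg mult_nonneg_nonneg) auto

lemma F_fun_le: "0 \<le> t \<Longrightarrow> p \<in> {0..1} \<Longrightarrow> F_fun D p \<le> stop_cost t p"
  unfolding F_fun_eq using stop_cost_nonneg by (intro cINF_lower bdd_belowI[of _ 0]) auto

lemma F_fun_nonneg: "p \<in> {0..1} \<Longrightarrow> 0 \<le> F_fun D p"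
  unfolding F_fun_eq using stop_cost_nonneg by (intro cINF_greatest) auto

lemma F_fun_le_one_minus: "p \<in> {0..1} \<Longrightarrow> F_fun D p \<le> 1 - p"
  using F_fun_le[of 0 p] by (simp add: stop_cost_def delay_def)

text \<open>
  The zero of the derivative of \<open>stop_cost\<close> in \<open>t\<close>, cut off at \<open>0\<close>. At \<open>p = 1\<close> the default \<open>ln 0 = 0\<close> gives the
  right value \<open>0\<close>.
\<close>

definition idle_time :: "real \<Rightarrow> real" where
  "idle_time p = max 0 (ln ((lam + cc) * (1 - p) / cc) / lam)"

lemma idle_time_measurable [measurable]: "idle_time \<in> borel_measurable borel"
  unfolding idle_time_def[abs_def] by measurable

lemma idle_time_nonneg: "0 \<le> idle_time p" by (simp add: idle_time_def)

text \<open>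
  Up to a constant, \<open>stop_cost\<close> is \<open>A exp (- lam t) + cc t\<close>, a convex function; the tangent
  inequality \<open>1 + x \<le> exp x\<close> at the candidate replaces the discussion of derivatives.
\<close>

lemma F_fun_attained:
  assumes p: "p \<in> {0..1}"
  shows "F_fun D p = stop_cost (idle_time p) p"
proof (rule antisym[OF F_fun_le[OF idle_time_nonneg p]])
  define A where "A = (1 - p) * (lam + cc) / lam"
  have A0: "0 \<le> A" unfolding A_def using p rate_pos delay_pos by (intro divide_nonneg_nonneg mult_nonneg_nonneg) auto
  have sc: "stop_cost t p = A * exp (- lam * t) + cc * t - cc * (1 - p) / lam" for t
    unfolding stop_cost_def delay_def A_def using rate_pos by (simp add: field_simps)
  have arg: "(lam + cc) * (1 - p) / cc = A * lam / cc" unfolding A_def using rate_pos by (simp add: mult.commute)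
  have "stop_cost (idle_time p) p \<le> stop_cost t p" if t: "0 \<le> t" for t
  proof (cases "A * lam \<le> cc")
    case True
    have "A * lam / cc \<le> 1" "0 \<le> A * lam / cc" using True delay_pos A0 rate_pos by auto
    moreover have "ln z \<le> 0" if "z \<le> 1" "0 \<le> z" for z :: real
      using that by (cases "z = 0") auto
    ultimately have "ln (A * lam / cc) \<le> 0" by blast
    then have "ln (A * lam / cc) / lam \<le> 0" using rate_pos by (simp add: divide_le_0_iff)
    then have "idle_time p = 0" unfolding idle_time_def arg by (rule max_absorb1)
    moreover have "A * (- lam * t) \<le> A * (exp (- lam * t) - 1)"
      using exp_ge_add_one_self[of "- lam * t"] A0 by (intro mult_left_mono) auto
    moreover have "A * lam * t \<le> cc * t" using True t by (intro mult_right_mono)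
    ultimately show ?thesis unfolding sc by (simp add: algebra_simps)
  next
    case False
    define t0 where "t0 = ln (A * lam / cc) / lam"
    have "1 < A * lam / cc" using False delay_pos by simp
    then have "0 < t0" unfolding t0_def using rate_pos by (intro divide_pos_pos ln_gt_zero)
    then have i: "idle_time p = t0" unfolding idle_time_def arg t0_def[symmetric] by simp
    have "exp (- lam * t0) = cc / (A * lam)"
      unfolding t0_def using rate_pos \<open>1 < A * lam / cc\<close> by (simp add: exp_minus exp_ln)
    then have e0: "A * exp (- lam * t0) = cc / lam" using False delay_pos by auto
    have "exp (- lam * t) = exp (- lam * t0) * exp (- lam * (t - t0))"
      unfolding exp_add[symmetric] by (simp add: algebra_simps)
    then have e1: "A * exp (- lam * t) = cc / lam * exp (- lam * (t - t0))"
      using e0 by (simp add: mult.assoc[symmetric])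
    have "cc / lam * (1 + - lam * (t - t0)) \<le> cc / lam * exp (- lam * (t - t0))"
      using exp_ge_add_one_self[of "- lam * (t - t0)"] delay_pos rate_pos by (intro mult_left_mono) auto
    moreover have "cc / lam * (1 + - lam * (t - t0)) = cc / lam - cc * (t - t0)"
      using rate_pos by (simp add: field_simps)
    ultimately show ?thesis unfolding sc i e0 e1 by (simp add: algebra_simps)
  qed
  then show "stop_cost (idle_time p) p \<le> F_fun D p"
    unfolding F_fun_eq by (intro cINF_greatest) auto
qed

lemma stop_cost_affine: "stop_cost t (\<theta> * p + (1 - \<theta>) * q) = \<theta> * stop_cost t p + (1 - \<theta>) * stop_cost t q"
  unfolding stop_cost_def delay_affine by (simp add: algebra_simps)

lemma F_fun_concave_unit: "concave_unit (F_fun D)"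
  unfolding F_fun_eq[abs_def] by (intro concave_unit_INF) (auto simp: concave_unit_def stop_cost_affine stop_cost_nonneg)

text \<open>
  Stopping at once costs at most \<open>1\<close>, so all value functions have this range.
\<close>

definition unit_fun :: "(real \<Rightarrow> real) \<Rightarrow> bool" where
  "unit_fun f \<longleftrightarrow> f \<in> borel_measurable borel \<and> (\<forall>p. 0 \<le> f p \<and> f p \<le> 1)"

definition next_avg :: "(real \<Rightarrow> real) \<Rightarrow> real \<Rightarrow> real \<Rightarrow> real" where
  "next_avg f s p = (\<integral>x. lik s p x * f (bayes s p x) \<partial>lborel)"

text \<open>
  The operator of dynamic programming: one observation after a wait \<open>s\<close>, then \<open>f\<close> at the updated posterior.
\<close>

definition obs_value :: "(real \<Rightarrow> real) \<Rightarrow> real \<Rightarrow> real \<Rightarrow> real" where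
  "obs_value f s p = dd + next_avg f s p + cc * delay s p"

lemma nn_integral_lik:
  assumes "0 < s" "p \<in> {0..1}"
  shows "(\<integral>\<^sup>+x. ennreal (lik s p x) \<partial>lborel) = 1"
proof -
  interpret N: prob_space std_gauss by (rule prob_space_std_gauss)
  have "(\<integral>\<^sup>+x. ennreal (lik s p x) * state_avg (bayes s p x) (\<lambda>y. 1) \<partial>lborel) = state_avg p (\<lambda>y. \<integral>\<^sup>+u. 1 \<partial>std_gauss)"
    by (rule one_step_bayes[OF assms, symmetric]) simp
  then show ?thesis using N.emeasure_space_1
    by (simp add: state_avg_const[OF bayes_range[OF assms]] state_avg_const[OF assms(2)])
qed

lemma next_avg_integrable:
  assumes s: "0 < s" "p \<in> {0..1}" and f: "unit_fun f"
  shows "integrable lborel (\<lambda>x. lik s p x * f (bayes s p x))"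
    "ennreal (next_avg f s p) = (\<integral>\<^sup>+x. ennreal (lik s p x) * ennreal (f (bayes s p x)) \<partial>lborel)"
    "0 \<le> next_avg f s p" "next_avg f s p \<le> 1"
proof -
  have [measurable]: "f \<in> borel_measurable borel" and f01: "\<And>p. 0 \<le> f p" "\<And>p. f p \<le> 1"
    using f by (auto simp: unit_fun_def)
  have l: "0 \<le> lik s p x" for x using lik_nonneg(3)[OF s, of x] by simp
  have il: "integrable lborel (lik s p)"
    by (rule integrableI_nonneg) (use l nn_integral_lik[OF s] in auto)
  have nn: "0 \<le> lik s p x * f (bayes s p x)" for x using l f01 by simp
  show i: "integrable lborel (\<lambda>x. lik s p x * f (bayes s p x))"
    by (rule Bochner_Integration.integrable_bound[OF il]) (use l f01 in \<open>auto simp: abs_mult intro!: AE_I2 mult_left_le\<close>)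
  show e: "ennreal (next_avg f s p) = (\<integral>\<^sup>+x. ennreal (lik s p x) * ennreal (f (bayes s p x)) \<partial>lborel)"
    unfolding next_avg_def using nn l f01
    by (subst nn_integral_eq_integral[OF i, symmetric]) (auto simp: ennreal_mult)
  show "0 \<le> next_avg f s p" unfolding next_avg_def using nn by (intro integral_nonneg_AE) auto
  have "(\<integral>\<^sup>+x. ennreal (lik s p x) * ennreal (f (bayes s p x)) \<partial>lborel) \<le> (\<integral>\<^sup>+x. ennreal (lik s p x) * 1 \<partial>lborel)"
    using f01 by (intro nn_integral_mono mult_left_mono) (auto simp: ennreal_le_1)
  then show "next_avg f s p \<le> 1" unfolding e[symmetric] using nn_integral_lik[OF s] by (simp add: ennreal_le_1)
qed

text \<open>
  The factor \<open>K\<close> is there to let a multiple of a tent serve as a minorant.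
\<close>

lemma next_avg_mono:
  assumes s: "0 < s" "p \<in> {0..1}" and f: "unit_fun f" and g: "unit_fun g" and le: "\<And>x. x \<in> {0..1} \<Longrightarrow> K * f x \<le> g x"
  shows "K * next_avg f s p \<le> next_avg g s p"
proof -
  have "K * next_avg f s p = (\<integral>x. K * (lik s p x * f (bayes s p x)) \<partial>lborel)"
    unfolding next_avg_def by simp
  also have "\<dots> \<le> next_avg g s p"
    unfolding next_avg_def
  proof (rule integral_mono)
    fix x
    have "lik s p x * (K * f (bayes s p x)) \<le> lik s p x * g (bayes s p x)"
      using lik_nonneg(3)[OF s, of x] by (intro mult_left_mono le bayes_range s) auto
    then show "K * (lik s p x * f (bayes s p x)) \<le> lik s p x * g (bayes s p x)" by (simp add: mult.left_commute)
  qed (use next_avg_integrable[OF s f] next_avg_integrable[OF s g] in auto)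
  finally show ?thesis .
qed

lemma lik_affine:
  "lik_after s (\<theta> * p + (1 - \<theta>) * q) x = \<theta> * lik_after s p x + (1 - \<theta>) * lik_after s q x"
  "lik s (\<theta> * p + (1 - \<theta>) * q) x = \<theta> * lik s p x + (1 - \<theta>) * lik s q x"
  unfolding lik_def lik_after_def lik_before_def by (simp_all add: algebra_simps)

text \<open>
  For fixed \<open>x\<close> the density \<open>lik\<close> is affine in the prior, and the posterior of a mixture is the mean of the
  posteriors weighted by their densities. So \<open>lik * f (bayes)\<close> is concave for concave \<open>f\<close>.
\<close>

lemma next_avg_concave_unit:
  assumes s: "0 < s" and f: "unit_fun f" and c: "concave_unit f"
  shows "concave_unit (next_avg f s)"
  unfolding concave_unit_def
proof (intro ballI)
  fix p q \<theta> :: real assume A: "p \<in> {0..1}" "q \<in> {0..1}" "\<theta> \<in> {0..1}"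
  let ?r = "\<theta> * p + (1 - \<theta>) * q"
  have r: "?r \<in> {0..1}" by (rule unit_convex[OF A])
  note i = next_avg_integrable(1)[OF s _ f]
  have "\<theta> * next_avg f s p + (1 - \<theta>) * next_avg f s q =
     (\<integral>x. \<theta> * (lik s p x * f (bayes s p x)) + (1 - \<theta>) * (lik s q x * f (bayes s q x)) \<partial>lborel)"
    unfolding next_avg_def using i[OF A(1)] i[OF A(2)] by (subst Bochner_Integration.integral_add) auto
  also have "\<dots> \<le> next_avg f s ?r"
    unfolding next_avg_def
  proof (rule integral_mono)
    fix x
    have L: "0 < lik s p x" "0 < lik s q x" "0 < lik s ?r x" using lik_nonneg(3)[OF s] A r by auto
    let ?t = "\<theta> * lik s p x / lik s ?r x"
    have t1: "1 - ?t = (1 - \<theta>) * lik s q x / lik s ?r x"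
    proof -
      have "lik s ?r x - \<theta> * lik s p x = (1 - \<theta>) * lik s q x" unfolding lik_affine(2) by simp
      moreover have "1 - ?t = (lik s ?r x - \<theta> * lik s p x) / lik s ?r x"
        using L(3) by (simp only: diff_divide_distrib) simp
      ultimately show ?thesis by (simp only:)
    qed
    have "0 \<le> 1 - ?t" unfolding t1 using A L by auto
    then have t: "?t \<in> {0..1}" using A L by auto
    have "?t * bayes s p x + (1 - ?t) * bayes s q x = (\<theta> * (lik s p x * bayes s p x) + (1 - \<theta>) * (lik s q x * bayes s q x)) / lik s ?r x"
      unfolding t1 by (simp add: add_divide_distrib)
    also have "\<dots> = bayes s ?r x"
      using lik_bayes(1)[OF s] A by (simp add: bayes_def lik_affine(1))
    finally have "?t * f (bayes s p x) + (1 - ?t) * f (bayes s q x) \<le> f (bayes s ?r x)"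
      using concave_unitD[OF c bayes_range[OF s A(1)] bayes_range[OF s A(2)] t, of x x] by simp
    then have "lik s ?r x * (?t * f (bayes s p x) + (1 - ?t) * f (bayes s q x)) \<le> lik s ?r x * f (bayes s ?r x)"
      using L by (intro mult_left_mono) auto
    moreover have "lik s ?r x * (?t * f (bayes s p x) + (1 - ?t) * f (bayes s q x)) =
       \<theta> * (lik s p x * f (bayes s p x)) + (1 - \<theta>) * (lik s q x * f (bayes s q x))"
      unfolding t1 using L(3) by (simp add: distrib_left)
    ultimately show "\<theta> * (lik s p x * f (bayes s p x)) + (1 - \<theta>) * (lik s q x * f (bayes s q x)) \<le> lik s ?r x * f (bayes s ?r x)"
      by simp
  qed (use i A r in auto)
  finally show "\<theta> * next_avg f s p + (1 - \<theta>) * next_avg f s q \<le> next_avg f s ?r" .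
qed

lemma obs_value_concave_unit:
  assumes s: "0 < s" and f: "unit_fun f" and c: "concave_unit f"
  shows "concave_unit (obs_value f s)"
  unfolding concave_unit_def
proof (intro ballI)
  fix p q \<theta> :: real assume A: "p \<in> {0..1}" "q \<in> {0..1}" "\<theta> \<in> {0..1}"
  have "\<theta> * next_avg f s p + (1 - \<theta>) * next_avg f s q \<le> next_avg f s (\<theta> * p + (1 - \<theta>) * q)"
    by (rule concave_unitD[OF next_avg_concave_unit[OF s f c] A])
  moreover have "dd = \<theta> * dd + (1 - \<theta>) * dd" by (simp add: algebra_simps)
  ultimately show "\<theta> * obs_value f s p + (1 - \<theta>) * obs_value f s q \<le> obs_value f s (\<theta> * p + (1 - \<theta>) * q)"
    unfolding obs_value_def delay_affine by (simp add: algebra_simps)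
qed

lemma obs_value_nonneg: "0 < s \<Longrightarrow> p \<in> {0..1} \<Longrightarrow> unit_fun f \<Longrightarrow> 0 \<le> obs_value f s p"
  unfolding obs_value_def using obs_pos delay_pos
  by (intro add_nonneg_nonneg mult_nonneg_nonneg delay_nonneg next_avg_integrable(3)) auto

text \<open>
  The value when at most \<open>n\<close> further observations are allowed. The value \<open>0\<close> off the unit interval makes it a Borel
  function on the line.
\<close>

primrec value_iter :: "nat \<Rightarrow> real \<Rightarrow> real" where
  "value_iter 0 p = (if p \<in> {0..1} then F_fun D p else 0)"
| "value_iter (Suc n) p = (if p \<in> {0..1} then min (F_fun D p) (INF s\<in>{0<..}. obs_value (value_iter n) s p) else 0)"

lemma value_iter_props: "unit_fun (value_iter n) \<and> concave_unit (value_iter n) \<and> (\<forall>p\<in>{0..1}. value_iter n p \<le> F_fun D p)"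
proof (induction n)
  case 0
  have c: "concave_unit (value_iter 0)" by (rule concave_unit_cong[OF F_fun_concave_unit]) simp
  moreover have "value_iter 0 \<in> borel_measurable borel" by (rule concave_unit_measurable[OF c]) auto
  moreover have "0 \<le> value_iter 0 p \<and> value_iter 0 p \<le> 1" for p
    using F_fun_nonneg[of p] F_fun_le_one_minus[of p] by auto
  moreover have "value_iter 0 p \<le> F_fun D p" if "p \<in> {0..1}" for p using that by simp
  ultimately show ?case unfolding unit_fun_def by blast
next
  case (Suc n)
  then have f: "unit_fun (value_iter n)" "concave_unit (value_iter n)" by auto
  have "concave_unit (\<lambda>p. min (F_fun D p) (INF s\<in>{0<..}. obs_value (value_iter n) s p))"
    by (intro concave_unit_min F_fun_concave_unit concave_unit_INF obs_value_concave_unit f) (auto intro: obs_value_nonneg f)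
  then have c: "concave_unit (value_iter (Suc n))" by (rule concave_unit_cong) simp
  moreover have "value_iter (Suc n) \<in> borel_measurable borel" by (rule concave_unit_measurable[OF c]) auto
  moreover have "0 \<le> value_iter (Suc n) p \<and> value_iter (Suc n) p \<le> 1" for p
  proof (cases "p \<in> {0..1}")
    case True
    have "0 \<le> (INF s\<in>{0<..}. obs_value (value_iter n) s p)"
      using True by (intro cINF_greatest obs_value_nonneg f) auto
    then show ?thesis using F_fun_nonneg[OF True] F_fun_le_one_minus[OF True] True by (auto simp: min_def)
  qed auto
  moreover have "value_iter (Suc n) p \<le> F_fun D p" if "p \<in> {0..1}" for p using that by simp
  ultimately show ?case unfolding unit_fun_def by blast
qed

lemma value_iter_unit: "unit_fun (value_iter n)" and value_iter_concave_unit: "concave_unit (value_iter n)"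
  using value_iter_props by auto

lemma obs_value_mono:
  assumes "0 < s" "p \<in> {0..1}" "unit_fun f" "unit_fun g" "\<And>x. x \<in> {0..1} \<Longrightarrow> f x \<le> g x"
  shows "obs_value f s p \<le> obs_value g s p"
  using next_avg_mono[OF assms(1-4), of 1] assms(5) unfolding obs_value_def by simp

lemma INF_obs_value_le: "0 < s \<Longrightarrow> p \<in> {0..1} \<Longrightarrow> unit_fun f \<Longrightarrow> (INF s\<in>{0<..}. obs_value f s p) \<le> obs_value f s p"
  by (intro cINF_lower bdd_belowI[of _ 0]) (auto intro: obs_value_nonneg)

lemma value_iter_decreasing: "value_iter (Suc n) p \<le> value_iter n p"
proof (induction n arbitrary: p)
  case 0
  then show ?case by simp
next
  case (Suc n)
  have "(INF s\<in>{0<..}. obs_value (value_iter (Suc n)) s p) \<le> (INF s\<in>{0<..}. obs_value (value_iter n) s p)" if p: "p \<in> {0..1}"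
  proof (rule cINF_greatest)
    fix s :: real assume s: "s \<in> {0<..}"
    have "(INF s\<in>{0<..}. obs_value (value_iter (Suc n)) s p) \<le> obs_value (value_iter (Suc n)) s p"
      using s by (intro INF_obs_value_le p value_iter_unit) auto
    also have "\<dots> \<le> obs_value (value_iter n) s p"
      using s by (intro obs_value_mono p value_iter_unit Suc) auto
    finally show "(INF s\<in>{0<..}. obs_value (value_iter (Suc n)) s p) \<le> obs_value (value_iter n) s p" .
  qed auto
  then show ?case by (subst (1 2) value_iter.simps(2)) (auto intro: min.mono)
qed

definition val :: "real \<Rightarrow> real" where
  "val p = (INF n. value_iter n p)"

lemma value_iter_bounds: "0 \<le> value_iter n p" "value_iter n p \<le> 1"
  using value_iter_unit[of n] by (auto simp: unit_fun_def)

lemma val_le: "val p \<le> value_iter n p"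
  unfolding val_def by (intro cINF_lower bdd_belowI[of _ 0]) (auto simp: value_iter_bounds)

lemma val_tendsto: "(\<lambda>n. value_iter n p) \<longlonglongrightarrow> val p"
  unfolding val_def
  by (intro LIMSEQ_decseq_INF bdd_belowI[of _ 0] decseq_SucI value_iter_decreasing) (auto simp: value_iter_bounds)

lemma val_nonneg: "0 \<le> val p"
  unfolding val_def by (intro cINF_greatest) (auto simp: value_iter_bounds)

lemma val_le_F: "p \<in> {0..1} \<Longrightarrow> val p \<le> F_fun D p"
  using val_le[of p 0] by simp

lemma val_le_1: "val p \<le> 1"
  using val_le[of p 0] value_iter_bounds(2)[of 0 p] by simp

lemma val_concave_unit: "concave_unit val"
  unfolding val_def[abs_def] by (intro concave_unit_INF value_iter_concave_unit) (auto simp: value_iter_bounds)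

lemma val_unit: "unit_fun val"
proof -
  have "val \<in> borel_measurable borel"
  proof (rule concave_unit_measurable[OF val_concave_unit])
    show "val p = 0" if "p \<notin> {0..1}" for p
      using val_le[of p 0] val_nonneg[of p] that by (auto split: if_splits)
  qed
  then show ?thesis using val_nonneg val_le_1 by (simp add: unit_fun_def)
qed

lemma val_measurable [measurable]: "val \<in> borel_measurable borel"
  using val_unit by (simp add: unit_fun_def)

text \<open>
  The iterates decrease to \<open>val\<close>, so dominated convergence carries the recursion to the limit.
\<close>

lemma val_le_obs:
  assumes s: "0 < s" and p: "p \<in> {0..1}"
  shows "val p \<le> obs_value val s p"
proof (rule LIMSEQ_le_const)
  have [measurable]: "value_iter n \<in> borel_measurable borel" for n using value_iter_unit[of n] by (simp add: unit_fun_def)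
  have l: "0 \<le> lik s p x" for x using lik_nonneg(3)[OF s p, of x] by simp
  have il: "integrable lborel (lik s p)"
    by (rule integrableI_nonneg) (use l nn_integral_lik[OF s p] in auto)
  have "(\<lambda>n. next_avg (value_iter n) s p) \<longlonglongrightarrow> next_avg val s p"
    unfolding next_avg_def
  proof (rule integral_dominated_convergence[where w="lik s p"])
    show "AE x in lborel. (\<lambda>n. lik s p x * value_iter n (bayes s p x)) \<longlonglongrightarrow> lik s p x * val (bayes s p x)"
      by (intro AE_I2 tendsto_mult tendsto_const val_tendsto)
    show "AE x in lborel. norm (lik s p x * value_iter n (bayes s p x)) \<le> lik s p x" for n
      using l value_iter_bounds by (intro AE_I2) (auto simp: abs_mult intro!: mult_left_le)
  qed (use il in auto)
  then show "(\<lambda>n. obs_value (value_iter n) s p) \<longlonglongrightarrow> obs_value val s p"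
    unfolding obs_value_def by (intro tendsto_intros)
  have "val p \<le> obs_value (value_iter n) s p" for n
  proof -
    have "val p \<le> value_iter (Suc n) p" by (rule val_le)
    also have "\<dots> \<le> (INF s\<in>{0<..}. obs_value (value_iter n) s p)" using p by simp
    also have "\<dots> \<le> obs_value (value_iter n) s p" by (rule INF_obs_value_le[OF s p value_iter_unit])
    finally show ?thesis .
  qed
  then show "\<exists>N. \<forall>n\<ge>N. val p \<le> obs_value (value_iter n) s p" by blast
qed

text \<open>
  The dynamic programming equation. The lower bound holds because the operator is monotone and \<open>val\<close> lies below
  every iterate.
\<close>

lemma val_fixed_point:
  assumes p: "p \<in> {0..1}"
  shows "val p = min (F_fun D p) (INF s\<in>{0<..}. obs_value val s p)"
proof (rule antisym)
  show "val p \<le> min (F_fun D p) (INF s\<in>{0<..}. obs_value val s p)"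
    using p by (intro min.boundedI val_le_F cINF_greatest val_le_obs) auto
  show "min (F_fun D p) (INF s\<in>{0<..}. obs_value val s p) \<le> val p"
    unfolding val_def
  proof (rule cINF_greatest)
    fix n
    show "min (F_fun D p) (INF s\<in>{0<..}. obs_value (\<lambda>p. INF n. value_iter n p) s p) \<le> value_iter n p"
      unfolding val_def[abs_def, symmetric]
    proof (cases n)
      case (Suc m)
      have "(INF s\<in>{0<..}. obs_value val s p) \<le> (INF s\<in>{0<..}. obs_value (value_iter m) s p)"
      proof (rule cINF_greatest)
        fix s :: real assume s: "s \<in> {0<..}"
        have "(INF s\<in>{0<..}. obs_value val s p) \<le> obs_value val s p"
          using s by (intro INF_obs_value_le p val_unit) auto
        also have "\<dots> \<le> obs_value (value_iter m) s p"
          using s by (intro obs_value_mono p val_unit value_iter_unit val_le) auto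
        finally show "(INF s\<in>{0<..}. obs_value val s p) \<le> obs_value (value_iter m) s p" .
      qed auto
      then show "min (F_fun D p) (INF s\<in>{0<..}. obs_value val s p) \<le> value_iter n p"
        using p Suc by (auto intro: min.mono)
    qed (use p in auto)
  qed auto
qed

lemma state_avg_tendsto:
  assumes g: "\<And>n. g n \<in> borel_measurable borel" "\<And>n y. g n y \<le> 1" and l: "\<And>y. (\<lambda>n. g n y) \<longlonglongrightarrow> h y"
  shows "(\<lambda>n. state_avg p (g n)) \<longlonglongrightarrow> state_avg p h"
proof -
  interpret E: prob_space exp_law by (rule prob_space_exp_law)
  have h: "h \<in> borel_measurable borel" by (rule borel_measurable_LIMSEQ_order[OF l g(1)])
  have "(\<lambda>n. \<integral>\<^sup>+y. g n y \<partial>exp_law) \<longlonglongrightarrow> (\<integral>\<^sup>+y. h y \<partial>exp_law)"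
    using E.emeasure_space_1 g h l
    by (intro nn_integral_dominated_convergence[where w="\<lambda>_. 1"]) auto
  then show ?thesis unfolding state_avg_def
    by (intro tendsto_add ennreal_tendsto_cmult l) auto
qed

definition odds :: "real \<Rightarrow> real \<Rightarrow> real \<Rightarrow> real" where
  "odds s p x = exp (al * x + (lam - al\<^sup>2 / 2) * s) * (p / (1 - p)) + jump_odds s x"

lemma bayes_odds:
  assumes s: "0 < s" and p: "p \<in> {0..<1}"
  shows "bayes s p x = odds s p x / (1 + odds s p x)"
  using posterior_update_eq_bayes[OF s, of p x] p
  unfolding posterior_update_def j_fun_eq[OF s] odds_def by auto

lemma odds_nonneg: "0 \<le> s \<Longrightarrow> p \<in> {0..<1} \<Longrightarrow> 0 \<le> odds s p x"
  unfolding odds_def using jump_odds_nonneg[of s x] by (intro add_nonneg_nonneg mult_nonneg_nonneg) auto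

lemma odds_pos: "0 < s \<Longrightarrow> p \<in> {0..<1} \<Longrightarrow> 0 < odds s p x"
  unfolding odds_def using jump_odds_pos[of s x] by (intro add_nonneg_pos mult_nonneg_nonneg) auto

text \<open>
  In terms of odds the posterior extends continuously to a wait of length \<open>0\<close>.
\<close>

lemma bayes_tendsto:
  assumes s: "\<And>n. 0 < s n" "s \<longlonglongrightarrow> s0" "0 \<le> s0" and p: "p \<in> {0..<1}" and x: "x \<longlonglongrightarrow> x0"
  shows "(\<lambda>n. bayes (s n) p (x n)) \<longlonglongrightarrow> odds s0 p x0 / (1 + odds s0 p x0)"
  unfolding bayes_odds[OF s(1) p]
proof (intro tendsto_divide tendsto_add tendsto_const)
  show "(\<lambda>n. odds (s n) p (x n)) \<longlonglongrightarrow> odds s0 p x0"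
    unfolding odds_def by (intro tendsto_intros jump_odds_tendsto s(2) x)
  then show "(\<lambda>n. odds (s n) p (x n)) \<longlonglongrightarrow> odds s0 p x0" .
  show "1 + odds s0 p x0 \<noteq> 0" using odds_nonneg[OF s(3) p, of x0] by simp
qed

text \<open>
  An average over the predictive density becomes one over fixed Gaussian and exponential variables. The wait
  \<open>s\<close> is then only in the integrand, so dominated convergence works also for \<open>s\<close> tending to \<open>0\<close>, where the density
  degenerates.
\<close>

lemma next_avg_state:
  assumes s: "0 < s" and p: "p \<in> {0..1}" and f: "unit_fun f"
  shows "ennreal (next_avg f s p) = state_avg p (\<lambda>y. \<integral>\<^sup>+u. ennreal (f (bayes s p (al * max 0 (s - y) + sqrt s * u))) \<partial>std_gauss)"
proof -
  have [measurable]: "f \<in> borel_measurable borel" using f by (simp add: unit_fun_def)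
  have "state_avg p (\<lambda>y. \<integral>\<^sup>+u. (\<lambda>(x, y). ennreal (f (bayes s p x))) (al * max 0 (s - y) + sqrt s * u, max 0 (y - s)) \<partial>std_gauss) =
    (\<integral>\<^sup>+x. ennreal (lik s p x) * state_avg (bayes s p x) (\<lambda>y. (\<lambda>(x, y). ennreal (f (bayes s p x))) (x, y)) \<partial>lborel)"
    by (rule one_step_bayes[OF s p]) measurable
  then show ?thesis
    unfolding next_avg_integrable(2)[OF s p f] by (simp add: state_avg_const[OF bayes_range[OF s p]])
qed

lemma state_avg_max: "state_avg p g = state_avg p (\<lambda>y. g (max 0 y))"
proof -
  have "AE y in exp_law. 0 \<le> y"
    by (subst AE_density) (auto simp: exponential_density_def)
  then have "(\<integral>\<^sup>+y. g y \<partial>exp_law) = (\<integral>\<^sup>+y. g (max 0 y) \<partial>exp_law)"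
    by (intro nn_integral_cong_AE) (auto simp: max_def)
  then show ?thesis by (simp add: state_avg_def)
qed

lemma next_avg_tendsto:
  assumes s: "\<And>n. 0 < s n" "s \<longlonglongrightarrow> s0" "0 \<le> s0" and p: "p \<in> {0..<1}" and f: "unit_fun f"
    and c: "\<And>x0. isCont f (odds s0 p x0 / (1 + odds s0 p x0))"
  shows "(\<lambda>n. ennreal (next_avg f (s n) p)) \<longlonglongrightarrow>
    state_avg p (\<lambda>y. \<integral>\<^sup>+u. ennreal (f (odds s0 p (al * max 0 (s0 - max 0 y) + sqrt s0 * u) / (1 + odds s0 p (al * max 0 (s0 - max 0 y) + sqrt s0 * u)))) \<partial>std_gauss)"
proof -
  interpret N: prob_space std_gauss by (rule prob_space_std_gauss)
  have [measurable]: "f \<in> borel_measurable borel" and f01: "\<And>p. 0 \<le> f p" "\<And>p. f p \<le> 1"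
    using f by (auto simp: unit_fun_def)
  have p': "p \<in> {0..1}" using p by auto
  define h where "h y u = f (odds s0 p (al * max 0 (s0 - y) + sqrt s0 * u) / (1 + odds s0 p (al * max 0 (s0 - y) + sqrt s0 * u)))" for y u
  have [measurable]: "(\<lambda>u. h y u) \<in> borel_measurable borel" for y
    unfolding h_def odds_def by measurable
  have lim: "(\<lambda>n. f (bayes (s n) p (al * max 0 (s n - y) + sqrt (s n) * u))) \<longlonglongrightarrow> h y u" for y u
    unfolding h_def
  proof (rule isCont_tendsto_compose[OF _ bayes_tendsto[OF s p]])
    show "isCont f (odds s0 p (al * max 0 (s0 - y) + sqrt s0 * u) / (1 + odds s0 p (al * max 0 (s0 - y) + sqrt s0 * u)))"
      by (rule c)
    show "(\<lambda>n. al * max 0 (s n - y) + sqrt (s n) * u) \<longlonglongrightarrow> al * max 0 (s0 - y) + sqrt s0 * u"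
      by (intro tendsto_intros s(2))
  qed
  define G where "G n y = (\<integral>\<^sup>+u. ennreal (f (bayes (s n) p (al * max 0 (s n - max 0 y) + sqrt (s n) * u))) \<partial>std_gauss)" for n y
  have "(\<lambda>n. state_avg p (G n)) \<longlonglongrightarrow> state_avg p (\<lambda>y. \<integral>\<^sup>+u. ennreal (h (max 0 y) u) \<partial>std_gauss)"
  proof (rule state_avg_tendsto)
    show "G n \<in> borel_measurable borel" for n unfolding G_def by measurable
    show "G n y \<le> 1" for n y
    proof -
      have "G n y \<le> (\<integral>\<^sup>+u. 1 \<partial>std_gauss)"
        unfolding G_def using f01 by (intro nn_integral_mono) (auto simp: ennreal_le_1)
      then show ?thesis using N.emeasure_space_1 by simp
    qed
    show "(\<lambda>n. G n y) \<longlonglongrightarrow> (\<integral>\<^sup>+u. ennreal (h (max 0 y) u) \<partial>std_gauss)" for y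
      unfolding G_def
    proof (rule nn_integral_dominated_convergence[where w="\<lambda>_. 1"])
      show "(\<integral>\<^sup>+u. 1 \<partial>std_gauss) < \<infinity>" using N.emeasure_space_1 by simp
      show "AE u in std_gauss. (\<lambda>n. ennreal (f (bayes (s n) p (al * max 0 (s n - max 0 y) + sqrt (s n) * u)))) \<longlonglongrightarrow> ennreal (h (max 0 y) u)"
        by (intro AE_I2 tendsto_ennrealI lim)
      show "AE u in std_gauss. ennreal (f (bayes (s n) p (al * max 0 (s n - max 0 y) + sqrt (s n) * u))) \<le> 1" for n
        using f01 by (auto simp: ennreal_le_1)
    qed auto
  qed
  also have "(\<lambda>n. state_avg p (G n)) = (\<lambda>n. ennreal (next_avg f (s n) p))"
    unfolding next_avg_state[OF s(1) p' f] G_def[abs_def] by (subst (2) state_avg_max) simp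
  finally show ?thesis unfolding h_def .
qed

lemma tendsto_of_ennreal:
  assumes "(\<lambda>n. ennreal (f n)) \<longlonglongrightarrow> ennreal x" "\<And>n. 0 \<le> f n" "0 \<le> x"
  shows "f \<longlonglongrightarrow> x"
  using tendsto_enn2real[OF assms(1)] assms(2,3) by simp

lemma val_isCont: "0 < x \<Longrightarrow> x < 1 \<Longrightarrow> isCont val x"
  using concave_unit_continuous[OF val_concave_unit] continuous_on_eq_continuous_at[of "{0<..<1}" val] by auto

lemma next_avg_val_continuous:
  assumes p: "p \<in> {0..<1}"
  shows "continuous_on {0<..} (\<lambda>s. next_avg val s p)"
proof (rule continuous_on_sequentiallyI)
  fix s s0 assume "\<forall>n. s n \<in> {0<..}" "s0 \<in> {0::real<..}" "s \<longlonglongrightarrow> s0"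
  then have s: "\<And>n. 0 < s n" "s \<longlonglongrightarrow> s0" "0 < s0" by auto
  have p': "p \<in> {0..1}" using p by auto
  have c: "isCont val (odds s0 p x0 / (1 + odds s0 p x0))" for x0
    using odds_pos[OF s(3) p, of x0] by (intro val_isCont) (auto simp: divide_less_eq)
  have "ennreal (next_avg val s0 p) =
    state_avg p (\<lambda>y. \<integral>\<^sup>+u. ennreal (val (odds s0 p (al * max 0 (s0 - max 0 y) + sqrt s0 * u) / (1 + odds s0 p (al * max 0 (s0 - max 0 y) + sqrt s0 * u)))) \<partial>std_gauss)"
    unfolding next_avg_state[OF s(3) p' val_unit] bayes_odds[OF s(3) p] by (rule state_avg_max)
  with next_avg_tendsto[OF s(1,2) less_imp_le[OF s(3)] p val_unit c]
  have "(\<lambda>n. ennreal (next_avg val (s n) p)) \<longlonglongrightarrow> ennreal (next_avg val s0 p)" by simp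
  then show "(\<lambda>n. next_avg val (s n) p) \<longlonglongrightarrow> next_avg val s0 p"
    by (rule tendsto_of_ennreal) (intro next_avg_integrable(3) p' val_unit s)+
qed

lemma delay_continuous: "continuous_on A (\<lambda>s. delay s p)"
  unfolding delay_def using rate_pos by (auto intro!: continuous_intros)

lemma obs_value_continuous: "p \<in> {0..<1} \<Longrightarrow> continuous_on {0<..} (\<lambda>s. obs_value val s p)"
  unfolding obs_value_def by (intro continuous_intros next_avg_val_continuous delay_continuous)

text \<open>
  The function of \<open>concave_unit_tent\<close>, continued to the line as a continuous function with values in the unit interval.
\<close>

definition tent :: "real \<Rightarrow> real \<Rightarrow> real" where
  "tent p x = max 0 (min 1 (min ((1 - x) / (1 - p)) (if p = 0 then 1 else x / p)))"

lemma tent_eq: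
  assumes "p \<in> {0..<1}" "x \<in> {0..1}"
  shows "tent p x = (if p \<le> x then (1 - x) / (1 - p) else x / p)"
proof (cases "p \<le> x")
  case True
  have "(1 - x) / (1 - p) \<le> 1" "0 \<le> (1 - x) / (1 - p)" "p \<noteq> 0 \<Longrightarrow> 1 \<le> x / p"
    using assms True by (auto simp: divide_le_eq le_divide_eq)
  then show ?thesis using True by (auto simp: tent_def)
next
  case False
  have "1 \<le> (1 - x) / (1 - p)" "0 \<le> x / p" "x / p \<le> 1" "p \<noteq> 0"
    using assms False by (auto simp: le_divide_eq)
  then show ?thesis using False by (auto simp: tent_def)
qed

lemma tent_cont: "p < 1 \<Longrightarrow> continuous_on UNIV (tent p)"
  unfolding tent_def[abs_def] by (cases "p = 0") (auto intro!: continuous_intros)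

lemma tent_unit: "p < 1 \<Longrightarrow> unit_fun (tent p)"
  unfolding unit_fun_def using tent_cont[of p]
  by (auto intro: borel_measurable_continuous_onI simp: tent_def)

text \<open>
  For short waits the posterior stays near \<open>p\<close>, so the tent below \<open>val\<close> has nearly its full height \<open>val p\<close>
  there, and on top of it the observation has to be paid. This keeps the minimisers away from \<open>0\<close>.
\<close>

lemma obs_value_near_zero:
  assumes p: "p \<in> {0..<1}"
  shows "\<exists>\<delta>>0. \<forall>s. 0 < s \<and> s < \<delta> \<longrightarrow> val p + dd / 2 \<le> obs_value val s p"
proof (rule ccontr)
  assume neg: "\<not> ?thesis"
  interpret N: prob_space std_gauss by (rule prob_space_std_gauss)
  have "\<exists>s. 0 < s \<and> s < 1 / real (Suc n) \<and> obs_value val s p < val p + dd / 2" for n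
    using neg by (auto simp: not_le dest!: spec[of _ "1 / real (Suc n)"])
  then obtain s where s: "\<And>n. 0 < s n" "\<And>n. s n < 1 / real (Suc n)" "\<And>n. obs_value val (s n) p < val p + dd / 2"
    by metis
  have lim: "s \<longlonglongrightarrow> 0"
    by (rule real_tendsto_sandwich[OF _ _ tendsto_const LIMSEQ_Suc[OF lim_const_over_n[of 1]]])
       (use s in \<open>auto intro!: always_eventually less_imp_le\<close>)
  have p1: "p < 1" "p \<in> {0..1}" using p by auto
  \<comment> \<open>a wait of length \<open>0\<close> with increment \<open>0\<close> leaves the posterior at \<open>p\<close>\<close>
  have o: "odds 0 p 0 / (1 + odds 0 p 0) = p"
    using p1 by (simp add: odds_def jump_odds_def field_simps)
  have m: "max 0 (- max 0 y) = 0" for y :: real by simp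
  have t: "tent p p = 1" using tent_eq[OF p p1(2)] p1 by simp
  have c: "isCont (tent p) x" for x
    using tent_cont[OF p1(1)] continuous_on_eq_continuous_at[OF open_UNIV] by blast
  have "(\<lambda>n. ennreal (next_avg (tent p) (s n) p)) \<longlonglongrightarrow> state_avg p (\<lambda>y. \<integral>\<^sup>+u. ennreal 1 \<partial>std_gauss)"
    using next_avg_tendsto[OF s(1) lim order_refl p tent_unit[OF p1(1)] c] by (simp add: o t m)
  then have "(\<lambda>n. ennreal (next_avg (tent p) (s n) p)) \<longlonglongrightarrow> ennreal 1"
    using N.emeasure_space_1 by (simp add: state_avg_const[OF p1(2)])
  then have n1: "(\<lambda>n. next_avg (tent p) (s n) p) \<longlonglongrightarrow> 1"
    by (rule tendsto_of_ennreal) (auto intro!: next_avg_integrable(3) tent_unit s p1)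
  have "dd + val p * next_avg (tent p) (s n) p \<le> val p + dd / 2" for n
  proof -
    have "val p * tent p x \<le> val x" if "x \<in> {0..1}" for x
      using concave_unit_tent[OF val_concave_unit val_nonneg p that] tent_eq[OF p that] by simp
    then have "val p * next_avg (tent p) (s n) p \<le> next_avg val (s n) p"
      by (intro next_avg_mono s p1 tent_unit val_unit)
    moreover have "0 \<le> cc * delay (s n) p"
      using delay_pos s(1)[of n] p1 by (intro mult_nonneg_nonneg delay_nonneg) auto
    ultimately show ?thesis using s(3)[of n] unfolding obs_value_def by linarith
  qed
  moreover have "(\<lambda>n. dd + val p * next_avg (tent p) (s n) p) \<longlonglongrightarrow> dd + val p * 1"
    by (intro tendsto_intros n1)
  ultimately have "dd + val p * 1 \<le> val p + dd / 2" by (intro LIMSEQ_le_const2) auto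
  then show False using obs_pos by simp
qed

definition cont_region :: "real set" where
  "cont_region = {p\<in>{0..1}. val p < F_fun D p}"

definition minimizers :: "real \<Rightarrow> real set" where
  "minimizers p = {s. 0 < s \<and> obs_value val s p = val p}"

lemma cont_region_lt_1: "p \<in> cont_region \<Longrightarrow> p \<in> {0..<1}"
  using F_fun_le_one_minus[of p] val_nonneg[of p] unfolding cont_region_def by auto

lemma cont_region_INF: "p \<in> cont_region \<Longrightarrow> (INF s\<in>{0<..}. obs_value val s p) = val p"
  using val_fixed_point[of p] unfolding cont_region_def by (auto simp: min_def split: if_splits)

lemma obs_value_minimum:
  assumes p: "p \<in> {0..<1}" and ab: "0 < a" "a \<le> b"
  shows "\<exists>s0\<in>{a..b}. \<forall>s\<in>{a..b}. obs_value val s0 p \<le> obs_value val s p"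
proof (rule continuous_attains_inf)
  show "continuous_on {a..b} (\<lambda>s. obs_value val s p)"
    by (rule continuous_on_subset[OF obs_value_continuous[OF p]]) (use ab in auto)
qed (use ab in auto)

text \<open>
  Short waits lose by \<open>obs_value_near_zero\<close>, long waits by the linear growth of the delay; on the compact interval
  between them a continuous function attains its infimum.
\<close>

lemma minimizers_nonempty:
  assumes p: "p \<in> cont_region"
  shows "minimizers p \<noteq> {}"
proof -
  have p1: "p \<in> {0..<1}" by (rule cont_region_lt_1[OF p])
  then have p': "p \<in> {0..1}" by auto
  obtain \<delta> where \<delta>: "\<delta> > 0" "\<And>s. 0 < s \<Longrightarrow> s < \<delta> \<Longrightarrow> val p + dd / 2 \<le> obs_value val s p"
    using obs_value_near_zero[OF p1] by auto
  \<comment> \<open>beyond \<open>B\<close> the delay alone costs at least \<open>val p + 1\<close>\<close>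
  define B where "B = max \<delta> (1 / lam + (val p + 1) / cc)"
  have B: "val p + 1 \<le> obs_value val s p" if s: "B \<le> s" for s
  proof -
    have s0: "0 < s" using s \<delta> unfolding B_def by auto
    have "(val p + 1) / cc \<le> s - 1 / lam" using s unfolding B_def by simp
    also have "\<dots> \<le> delay s p" by (rule delay_lower) (use s0 p' in auto)
    finally have "val p + 1 \<le> cc * delay s p" using delay_pos by (simp add: divide_le_eq mult.commute)
    then show ?thesis
      using next_avg_integrable(3)[OF s0 p' val_unit] obs_pos unfolding obs_value_def by linarith
  qed
  obtain s0 where s0: "s0 \<in> {\<delta>..B}" "\<And>s. s \<in> {\<delta>..B} \<Longrightarrow> obs_value val s0 p \<le> obs_value val s p"
    using obs_value_minimum[OF p1 \<delta>(1), of B] by (auto simp: B_def)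
  have "obs_value val s0 p = val p"
  proof (rule antisym)
    show "val p \<le> obs_value val s0 p" by (rule val_le_obs) (use s0 \<delta> p' in auto)
    show "obs_value val s0 p \<le> val p"
    proof (rule ccontr)
      assume "\<not> obs_value val s0 p \<le> val p"
      moreover have "min (obs_value val s0 p) (min (val p + dd / 2) (val p + 1)) \<le> (INF s\<in>{0<..}. obs_value val s p)"
      proof (rule cINF_greatest)
        fix s :: real assume "s \<in> {0<..}"
        then consider "0 < s" "s < \<delta>" | "s \<in> {\<delta>..B}" | "B \<le> s" by fastforce
        then show "min (obs_value val s0 p) (min (val p + dd / 2) (val p + 1)) \<le> obs_value val s p"
        proof cases
          case 1
          then show ?thesis using \<delta>(2)[of s] by (simp add: min_le_iff_disj)
        next
          case 2
          then show ?thesis using s0(2)[of s] by (simp add: min_le_iff_disj)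
        next
          case 3
          then show ?thesis using B[of s] by (simp add: min_le_iff_disj)
        qed
      qed auto
      ultimately show False unfolding cont_region_INF[OF p] using obs_pos by (simp add: min_def split: if_splits)
    qed
  qed
  moreover have "0 < s0" using s0(1) \<delta>(1) by auto
  ultimately show ?thesis unfolding minimizers_def by blast
qed

lemma minimizers_bound:
  assumes p: "p \<in> {0..<1}"
  obtains \<delta> where "\<delta> > 0" "minimizers p = {s\<in>{\<delta>..}. obs_value val s p = val p}"
proof -
  obtain \<delta> where \<delta>: "\<delta> > 0" "\<And>s. 0 < s \<Longrightarrow> s < \<delta> \<Longrightarrow> val p + dd / 2 \<le> obs_value val s p"
    using obs_value_near_zero[OF p] by auto
  have "\<delta> \<le> s" if "0 < s" "obs_value val s p = val p" for s
    using \<delta>(2)[OF that(1)] that(2) obs_pos by (intro leI) auto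
  then have "minimizers p = {s\<in>{\<delta>..}. obs_value val s p = val p}"
    unfolding minimizers_def using \<delta>(1) by auto
  with \<delta>(1) show thesis by (rule that)
qed

definition wait_time :: "real \<Rightarrow> real" where
  "wait_time p = Inf (minimizers p)"

lemma wait_time_minimizer:
  assumes p: "p \<in> cont_region"
  shows "wait_time p \<in> minimizers p"
proof -
  obtain \<delta> where \<delta>: "\<delta> > 0" "minimizers p = {s\<in>{\<delta>..}. obs_value val s p = val p}"
    using minimizers_bound[OF cont_region_lt_1[OF p]] by blast
  have "continuous_on {\<delta>..} (\<lambda>s. obs_value val s p)"
    by (rule continuous_on_subset[OF obs_value_continuous[OF cont_region_lt_1[OF p]]]) (use \<delta> in auto)
  then have "closed (minimizers p)"
    unfolding \<delta>(2) by (intro continuous_closed_preimage_constant) auto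
  moreover have "bdd_below (minimizers p)" unfolding \<delta>(2) by (auto intro!: bdd_belowI[of _ \<delta>])
  ultimately show ?thesis
    unfolding wait_time_def by (intro closed_contains_Inf minimizers_nonempty[OF p])
qed

lemma wait_time_le: "p \<in> cont_region \<Longrightarrow> s \<in> minimizers p \<Longrightarrow> wait_time p \<le> s"
  unfolding wait_time_def by (intro cInf_lower) (auto intro!: bdd_belowI[of _ 0] simp: minimizers_def)

lemma F_fun_measurable: "(\<lambda>p. if p \<in> {0..1} then F_fun D p else 0) \<in> borel_measurable borel"
proof (rule concave_unit_measurable)
  show "concave_unit (\<lambda>p. if p \<in> {0..1} then F_fun D p else 0)" by (rule concave_unit_cong[OF F_fun_concave_unit]) simp
qed (simp del: atLeastAtMost_iff)

lemma cont_region_measurable [measurable]: "cont_region \<in> sets borel"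
proof -
  note [measurable] = F_fun_measurable
  have "cont_region = {p\<in>space borel. p \<in> {0..1} \<and> val p < (if p \<in> {0..1} then F_fun D p else 0)}"
    unfolding cont_region_def by auto
  also have "\<dots> \<in> sets borel" by measurable
  finally show ?thesis .
qed

lemma obs_value_measurable: "(\<lambda>p. obs_value val s p) \<in> borel_measurable borel"
  unfolding obs_value_def next_avg_def delay_def by measurable

text \<open>
  Measurability of the least minimiser: by continuity and compactness its being at most \<open>a\<close> is seen from nearly
  optimal rational waits up to \<open>a\<close>.
\<close>

lemma wait_time_le_iff:
  assumes p: "p \<in> cont_region"
  shows "wait_time p \<le> a \<longleftrightarrow> (\<forall>n. \<exists>s\<in>{s\<in>\<rat>. 0 < s \<and> s \<le> a}. obs_value val s p < val p + 1 / real (Suc n))"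
proof
  have p1: "p \<in> {0..<1}" by (rule cont_region_lt_1[OF p])
  then have p': "p \<in> {0..1}" by auto
  {
    assume "wait_time p \<le> a"
    moreover define w where "w = wait_time p"
    ultimately have w: "0 < w" "w \<le> a" "obs_value val w p = val p"
      using wait_time_minimizer[OF p] by (auto simp: minimizers_def)
    show "\<forall>n. \<exists>s\<in>{s\<in>\<rat>. 0 < s \<and> s \<le> a}. obs_value val s p < val p + 1 / real (Suc n)"
    proof
      fix n
      have "isCont (\<lambda>s. obs_value val s p) w"
        using continuous_on_eq_continuous_at[THEN iffD1, OF open_greaterThan obs_value_continuous[OF p1]] w by auto
      then have "eventually (\<lambda>s. obs_value val s p < val p + 1 / real (Suc n)) (at w)"
        using w(3) by (intro order_tendstoD(2)[where y="val p"]) (auto simp: isCont_def)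
      then obtain \<epsilon> where \<epsilon>: "\<epsilon> > 0" "\<And>s. s \<noteq> w \<Longrightarrow> dist s w < \<epsilon> \<Longrightarrow> obs_value val s p < val p + 1 / real (Suc n)"
        unfolding eventually_at by auto
      obtain q where q: "q \<in> \<rat>" "max 0 (w - \<epsilon>) < q" "q < w"
        using Rats_dense_in_real[of "max 0 (w - \<epsilon>)" w] w \<epsilon> by auto
      then show "\<exists>s\<in>{s\<in>\<rat>. 0 < s \<and> s \<le> a}. obs_value val s p < val p + 1 / real (Suc n)"
        using \<epsilon>(2)[of q] w by (intro bexI[of _ q]) (auto simp: dist_real_def)
    qed
  }
  assume R: "\<forall>n. \<exists>s\<in>{s\<in>\<rat>. 0 < s \<and> s \<le> a}. obs_value val s p < val p + 1 / real (Suc n)"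
  obtain \<delta> where \<delta>: "\<delta> > 0" "\<And>s. 0 < s \<Longrightarrow> s < \<delta> \<Longrightarrow> val p + dd / 2 \<le> obs_value val s p"
    using obs_value_near_zero[OF p1] by auto
  obtain N where N: "1 / real (Suc N) < dd / 2" using nat_approx_posE[of "dd / 2"] obs_pos by auto
  obtain s where s: "0 < s" "s \<le> a" "obs_value val s p < val p + 1 / real (Suc N)" using R by auto
  have "\<delta> \<le> a" using \<delta>(2)[of s] s N by (cases "s < \<delta>") auto
  then obtain s0 where s0: "s0 \<in> {\<delta>..a}" "\<And>s. s \<in> {\<delta>..a} \<Longrightarrow> obs_value val s0 p \<le> obs_value val s p"
    using obs_value_minimum[OF p1 \<delta>(1), of a] by auto
  have "obs_value val s0 p \<le> val p"
  proof (rule ccontr)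
    assume "\<not> obs_value val s0 p \<le> val p"
    then have "0 < min (obs_value val s0 p - val p) (dd / 2)" using obs_pos by simp
    then obtain n where n: "1 / real (Suc n) < min (obs_value val s0 p - val p) (dd / 2)" using nat_approx_posE by blast
    obtain s where s: "0 < s" "s \<le> a" "obs_value val s p < val p + 1 / real (Suc n)" using R by auto
    have "\<delta> \<le> s" using \<delta>(2)[of s] s n by (cases "s < \<delta>") auto
    then show False using s0(2)[of s] s n by auto
  qed
  moreover have "val p \<le> obs_value val s0 p" by (rule val_le_obs) (use s0 \<delta> p' in auto)
  ultimately have "s0 \<in> minimizers p" using s0 \<delta> by (auto simp: minimizers_def)
  from wait_time_le[OF p this] s0 show "wait_time p \<le> a" by auto
qed

definition wait :: "real \<Rightarrow> ennreal" where
  "wait p = (if p \<in> cont_region then ennreal (wait_time p) else \<infinity>)"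

lemma wait_measurable [measurable]: "wait \<in> borel_measurable borel"
proof -
  have "(\<lambda>p. if p \<in> cont_region then wait_time p else 0) \<in> borel_measurable borel"
  proof (rule borel_measurableI_le)
    fix a :: real
    note [measurable] = obs_value_measurable
    have c: "countable {s\<in>\<rat>. 0 < s \<and> s \<le> a}" by (rule countable_subset[OF _ countable_rat]) auto
    have "{p\<in>space borel. (if p \<in> cont_region then wait_time p else 0) \<le> a} =
      {p\<in>space borel. p \<in> cont_region \<and> (\<forall>n. \<exists>s\<in>{s\<in>\<rat>. 0 < s \<and> s \<le> a}. obs_value val s p < val p + 1 / real (Suc n))} \<union>
      {p\<in>space borel. p \<notin> cont_region \<and> 0 \<le> a}"
      using wait_time_le_iff by auto
    also have "\<dots> \<in> sets borel"
      using c by measurable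
    finally show "{p\<in>space borel. (if p \<in> cont_region then wait_time p else 0) \<le> a} \<in> sets borel" .
  qed
  then have "(\<lambda>p. if p \<in> cont_region then ennreal (if p \<in> cont_region then wait_time p else 0) else \<infinity>) \<in> borel_measurable borel"
    by measurable
  moreover have "wait = (\<lambda>p. if p \<in> cont_region then ennreal (if p \<in> cont_region then wait_time p else 0) else \<infinity>)"
    by (auto simp: wait_def)
  ultimately show ?thesis by simp
qed

end

section \<open>Observation sequences with infinite times\<close>

context detection begin

text \<open>
  The filter needs times that advance for ever. An infinite time is replaced by the previous time plus
  \<open>1\<close>; statements are afterwards restricted to the observations that are really made.
\<close>

primrec real_times :: "'a time_seq \<Rightarrow> nat \<Rightarrow> 'a \<Rightarrow> real" where
  "real_times \<sigma> 0 \<omega> = 0"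
| "real_times \<sigma> (Suc k) \<omega> = (if \<sigma> (Suc k) \<omega> = \<infinity> then real_times \<sigma> k \<omega> + 1 else enn2real (\<sigma> (Suc k) \<omega>))"

text \<open>
  Frozen from the first infinite time on, like the posterior component of the optimal strategy.
\<close>

primrec obs_belief :: "'a time_seq \<Rightarrow> nat \<Rightarrow> 'a \<Rightarrow> real" where
  "obs_belief \<sigma> 0 \<omega> = \<pi>"
| "obs_belief \<sigma> (Suc k) \<omega> = (if \<sigma> (Suc k) \<omega> = \<infinity> then obs_belief \<sigma> k \<omega>
     else bayes (enn2real (\<sigma> (Suc k) \<omega>) - enn2real (\<sigma> k \<omega>)) (obs_belief \<sigma> k \<omega>)
            (X_at D (\<sigma> (Suc k) \<omega>) \<omega> - X_at D (\<sigma> k \<omega>) \<omega>))"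

lemma space_obs_sigma [simp]: "space (obs_sigma D \<sigma> k) = \<Omega>" by (simp add: obs_sigma_def)
lemma space_obs_filtration [simp]: "space (obs_filtration D \<sigma> t) = \<Omega>" by (simp add: obs_filtration_def)

lemma obs_sigma_map_space:
  "(\<lambda>\<omega>. \<lambda>i\<in>{1..k}. (\<sigma> i \<omega>, X_at D (\<sigma> i \<omega>) \<omega>)) \<in> \<Omega> \<rightarrow> space (PiM {1..k} (\<lambda>_. borel \<Otimes>\<^sub>M borel))"
  by (auto simp: space_PiM space_pair_measure)

lemma obs_sigma_component:
  assumes "1 \<le> i" "i \<le> k"
  shows "\<sigma> i \<in> borel_measurable (obs_sigma D \<sigma> k)" "(\<lambda>\<omega>. X_at D (\<sigma> i \<omega>) \<omega>) \<in> borel_measurable (obs_sigma D \<sigma> k)"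
proof -
  have "(\<lambda>\<omega>. \<lambda>i\<in>{1..k}. (\<sigma> i \<omega>, X_at D (\<sigma> i \<omega>) \<omega>)) \<in> measurable (obs_sigma D \<sigma> k) (PiM {1..k} (\<lambda>_. borel \<Otimes>\<^sub>M borel))"
    unfolding obs_sigma_def by (rule measurable_vimage_algebra1[OF obs_sigma_map_space])
  from measurable_compose[OF this measurable_component_singleton[of i]] assms
  have "(\<lambda>\<omega>. (\<sigma> i \<omega>, X_at D (\<sigma> i \<omega>) \<omega>)) \<in> measurable (obs_sigma D \<sigma> k) (borel \<Otimes>\<^sub>M borel)" by simp
  from measurable_compose[OF this measurable_fst] measurable_compose[OF this measurable_snd]
  show "\<sigma> i \<in> borel_measurable (obs_sigma D \<sigma> k)" "(\<lambda>\<omega>. X_at D (\<sigma> i \<omega>) \<omega>) \<in> borel_measurable (obs_sigma D \<sigma> k)"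
    by simp_all
qed

lemma obs_sigma_universal:
  assumes "space K = \<Omega>"
    and "\<And>i. 1 \<le> i \<Longrightarrow> i \<le> k \<Longrightarrow> \<sigma> i \<in> borel_measurable K"
    and "\<And>i. 1 \<le> i \<Longrightarrow> i \<le> k \<Longrightarrow> (\<lambda>\<omega>. X_at D (\<sigma> i \<omega>) \<omega>) \<in> borel_measurable K"
  shows "(\<lambda>\<omega>. \<omega>) \<in> measurable K (obs_sigma D \<sigma> k)"
  unfolding obs_sigma_def using assms
  by (intro measurable_vimage_algebra2 measurable_restrict measurable_Pair) auto

lemma obs_sigma_mono:
  assumes "i \<le> k" "f \<in> measurable (obs_sigma D \<sigma> i) N"
  shows "f \<in> measurable (obs_sigma D \<sigma> k) N"
proof -
  have "(\<lambda>\<omega>. \<omega>) \<in> measurable (obs_sigma D \<sigma> k) (obs_sigma D \<sigma> i)"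
    using assms(1) by (intro obs_sigma_universal obs_sigma_component) auto
  from measurable_compose[OF this assms(2)] show ?thesis .
qed

lemma measurable_id_sets:
  assumes "(\<lambda>x. x) \<in> measurable K L" "space K = space L" "A \<in> sets L"
  shows "A \<in> sets K"
proof -
  have "(\<lambda>x. x) -` A \<inter> space K \<in> sets K" using assms by (intro measurable_sets)
  moreover have "(\<lambda>x. x) -` A \<inter> space K = A" using sets.sets_into_space[OF assms(3)] assms(2) by auto
  ultimately show ?thesis by simp
qed

lemma obs_sigma_mono_sets: "i \<le> k \<Longrightarrow> A \<in> sets (obs_sigma D \<sigma> i) \<Longrightarrow> A \<in> sets (obs_sigma D \<sigma> k)"
  by (rule measurable_id_sets[OF obs_sigma_universal, of "obs_sigma D \<sigma> k" i \<sigma>]) (auto intro: obs_sigma_component)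

context
  fixes \<sigma> assumes \<sigma>: "\<sigma> \<in> obs_seqs D"
begin

lemma seq_0: "\<omega> \<in> \<Omega> \<Longrightarrow> \<sigma> 0 \<omega> = 0"
  and seq_less: "\<omega> \<in> \<Omega> \<Longrightarrow> \<sigma> k \<omega> < \<infinity> \<Longrightarrow> \<sigma> k \<omega> < \<sigma> (Suc k) \<omega>"
  and seq_top: "\<omega> \<in> \<Omega> \<Longrightarrow> \<sigma> k \<omega> = \<infinity> \<Longrightarrow> \<sigma> (Suc k) \<omega> = \<infinity>"
  using \<sigma> unfolding obs_seqs_def by blast+

lemma seq_finite: "\<omega> \<in> \<Omega> \<Longrightarrow> \<sigma> (Suc k) \<omega> < \<infinity> \<Longrightarrow> \<sigma> k \<omega> < \<infinity>"
  using seq_top[of \<omega> k] by (auto simp: less_top[symmetric])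

lemma seq_le_Suc: "\<omega> \<in> \<Omega> \<Longrightarrow> \<sigma> k \<omega> \<le> \<sigma> (Suc k) \<omega>"
  using seq_top[of \<omega> k] seq_less[of \<omega> k] by (cases "\<sigma> k \<omega> = \<infinity>") (auto simp: less_top[symmetric])

lemma seq_mono: "\<omega> \<in> \<Omega> \<Longrightarrow> i \<le> j \<Longrightarrow> \<sigma> i \<omega> \<le> \<sigma> j \<omega>"
  by (rule lift_Suc_mono_le[of "\<lambda>i. \<sigma> i \<omega>"]) (auto intro: seq_le_Suc)

lemma seq_Suc_obs: "\<sigma> (Suc k) \<in> borel_measurable (obs_sigma D \<sigma> k)"
proof (cases k)
  case 0
  obtain s where s: "\<And>\<omega>. \<omega> \<in> \<Omega> \<Longrightarrow> \<sigma> 1 \<omega> = s" using \<sigma> unfolding obs_seqs_def by blast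
  have "(\<lambda>_. s) \<in> borel_measurable (obs_sigma D \<sigma> 0)" by simp
  then show ?thesis unfolding 0 by (rule measurable_cong[THEN iffD1, rotated]) (simp add: s[unfolded One_nat_def])
next
  case (Suc j)
  have "\<And>j. j \<ge> 2 \<Longrightarrow> \<sigma> j \<in> borel_measurable (obs_sigma D \<sigma> (j - 1))" using \<sigma> unfolding obs_seqs_def by blast
  from this[of "Suc k"] show ?thesis using Suc by simp
qed

lemma X_at_0: "\<omega> \<in> \<Omega> \<Longrightarrow> X_at D (\<sigma> 0 \<omega>) \<omega> = 0"
  using bm_0[of \<omega>] change_time_nonneg[of \<omega>] by (simp add: seq_0 X_at_def X_obs_def)

lemma seq_obs: "i \<le> Suc k \<Longrightarrow> \<sigma> i \<in> borel_measurable (obs_sigma D \<sigma> k)"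
proof (cases i)
  case 0
  have "(\<lambda>_. 0 :: ennreal) \<in> borel_measurable (obs_sigma D \<sigma> k)" by simp
  then show ?thesis unfolding 0 by (rule measurable_cong[THEN iffD1, rotated]) (simp add: seq_0)
next
  case (Suc j)
  then show "i \<le> Suc k \<Longrightarrow> ?thesis" using obs_sigma_mono[OF _ seq_Suc_obs, of j k] by simp
qed

lemma X_at_obs: "i \<le> k \<Longrightarrow> (\<lambda>\<omega>. X_at D (\<sigma> i \<omega>) \<omega>) \<in> borel_measurable (obs_sigma D \<sigma> k)"
proof (cases "i = 0")
  case True
  have "(\<lambda>_. 0 :: real) \<in> borel_measurable (obs_sigma D \<sigma> k)" by simp
  then show ?thesis unfolding True by (rule measurable_cong[THEN iffD1, rotated]) (simp add: X_at_0)
next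
  case False
  then show "i \<le> k \<Longrightarrow> ?thesis" by (intro obs_sigma_component) auto
qed

lemma real_times_eq: "\<omega> \<in> \<Omega> \<Longrightarrow> \<sigma> k \<omega> < \<infinity> \<Longrightarrow> real_times \<sigma> k \<omega> = enn2real (\<sigma> k \<omega>)"
  by (cases k) (auto simp: seq_0)

lemma real_times_less: "\<omega> \<in> \<Omega> \<Longrightarrow> real_times \<sigma> k \<omega> < real_times \<sigma> (Suc k) \<omega>"
proof (cases "\<sigma> (Suc k) \<omega> = \<infinity>")
  case False
  assume \<omega>: "\<omega> \<in> \<Omega>"
  have f: "\<sigma> (Suc k) \<omega> < \<infinity>" "\<sigma> k \<omega> < \<infinity>" using False seq_finite[OF \<omega>, of k] by (auto simp: less_top[symmetric])
  then have "enn2real (\<sigma> k \<omega>) < enn2real (\<sigma> (Suc k) \<omega>)" using seq_less[OF \<omega> f(2)] by (simp add: enn2real_less_iff)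
  then show ?thesis using real_times_eq[OF \<omega> f(2)] real_times_eq[OF \<omega> f(1)] by simp
qed simp

abbreviation "H k \<equiv> hist (real_times \<sigma>) k"

text \<open>
  All six claims go through one induction: a time is decided by earlier observations, the observation made
  then is the previous one plus a new increment, and it in turn decides the next time.
\<close>

lemma real_times_adapted:
  "(\<forall>i\<le>k. \<sigma> i \<in> borel_measurable (H k) \<and> (\<lambda>\<omega>. X_at D (\<sigma> i \<omega>) \<omega>) \<in> borel_measurable (H k)) \<and>
   real_times \<sigma> k \<in> borel_measurable (H k) \<and> (\<lambda>\<omega>. X_obs D (real_times \<sigma> k \<omega>) \<omega>) \<in> borel_measurable (H k)
   \<and> \<sigma> (Suc k) \<in> borel_measurable (H k) \<and> real_times \<sigma> (Suc k) \<in> borel_measurable (H k)"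
proof (induction k)
  case 0
  have 1: "\<sigma> 0 \<in> borel_measurable (H 0)"
  proof -
    have "(\<lambda>_. 0 :: ennreal) \<in> borel_measurable (H 0)" by simp
    then show ?thesis by (rule measurable_cong[THEN iffD1, rotated]) (simp add: seq_0)
  qed
  have 2: "(\<lambda>\<omega>. X_at D (\<sigma> 0 \<omega>) \<omega>) \<in> borel_measurable (H 0)"
  proof -
    have "(\<lambda>_. 0 :: real) \<in> borel_measurable (H 0)" by simp
    then show ?thesis by (rule measurable_cong[THEN iffD1, rotated]) (simp add: X_at_0)
  qed
  have 3: "(\<lambda>\<omega>. X_obs D (real_times \<sigma> 0 \<omega>) \<omega>) \<in> borel_measurable (H 0)"
    using 2 by (rule measurable_cong[THEN iffD1, rotated]) (simp add: X_at_def seq_0)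
  have "(\<lambda>\<omega>. \<omega>) \<in> measurable (H 0) (obs_sigma D \<sigma> 0)"
    by (rule obs_sigma_universal) auto
  from measurable_compose[OF this seq_Suc_obs] have 4: "\<sigma> (Suc 0) \<in> borel_measurable (H 0)" by simp
  have 5: "real_times \<sigma> 0 \<in> borel_measurable (H 0)" by (simp add: measurable_const[of 0, unfolded fun_eq_iff] cong: measurable_cong)
  have "(\<lambda>\<omega>. if \<sigma> (Suc 0) \<omega> = \<infinity> then real_times \<sigma> 0 \<omega> + 1 else enn2real (\<sigma> (Suc 0) \<omega>)) \<in> borel_measurable (H 0)"
    using 4 5 by measurable
  then have 6: "real_times \<sigma> (Suc 0) \<in> borel_measurable (H 0)"
    by (rule measurable_cong[THEN iffD1, rotated]) simp
  show ?case using 1 2 3 4 5 6 by simp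
next
  case (Suc k)
  have Ik: "\<forall>i\<le>k. \<sigma> i \<in> borel_measurable (H k) \<and> (\<lambda>\<omega>. X_at D (\<sigma> i \<omega>) \<omega>) \<in> borel_measurable (H k)"
    using Suc by blast
  have m: "f \<in> borel_measurable (H (Suc k))" if "f \<in> borel_measurable (H k)" for f :: "'a \<Rightarrow> 'x :: topological_space"
    by (rule hist_mono[OF _ that]) simp
  have 1: "\<sigma> (Suc k) \<in> borel_measurable (H (Suc k))" "real_times \<sigma> (Suc k) \<in> borel_measurable (H (Suc k))"
    using Suc m by blast+
  have "(\<lambda>\<omega>. X_obs D (real_times \<sigma> k \<omega>) \<omega> + gain (real_times \<sigma>) k \<omega>) \<in> borel_measurable (H (Suc k))"
    using Suc m hist_Suc(2)[of "real_times \<sigma>" k] by (intro borel_measurable_add) blast+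
  then have 2: "(\<lambda>\<omega>. X_obs D (real_times \<sigma> (Suc k) \<omega>) \<omega>) \<in> borel_measurable (H (Suc k))"
    by (simp add: gain_def del: real_times.simps)
  have "(\<lambda>\<omega>. if \<sigma> (Suc k) \<omega> = \<infinity> then 0 else X_obs D (real_times \<sigma> (Suc k) \<omega>) \<omega>) \<in> borel_measurable (H (Suc k))"
    using 1 2 by measurable
  moreover have "(\<lambda>\<omega>. if \<sigma> (Suc k) \<omega> = \<infinity> then 0 else X_obs D (real_times \<sigma> (Suc k) \<omega>) \<omega>) = (\<lambda>\<omega>. X_at D (\<sigma> (Suc k) \<omega>) \<omega>)"
    by (auto simp: X_at_def fun_eq_iff)
  ultimately have 3: "(\<lambda>\<omega>. X_at D (\<sigma> (Suc k) \<omega>) \<omega>) \<in> borel_measurable (H (Suc k))" by simp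
  have 4: "\<sigma> i \<in> borel_measurable (H (Suc k))" "(\<lambda>\<omega>. X_at D (\<sigma> i \<omega>) \<omega>) \<in> borel_measurable (H (Suc k))" if "i \<le> Suc k" for i
    using that le_SucE[OF that] m[OF conjunct1[OF Ik[rule_format, of i]]] m[OF conjunct2[OF Ik[rule_format, of i]]] 1 3
    by blast+
  have "(\<lambda>\<omega>. \<omega>) \<in> measurable (H (Suc k)) (obs_sigma D \<sigma> (Suc k))"
    using 4 by (intro obs_sigma_universal) auto
  from measurable_compose[OF this seq_Suc_obs] have 5: "\<sigma> (Suc (Suc k)) \<in> borel_measurable (H (Suc k))" by simp
  have "(\<lambda>\<omega>. if \<sigma> (Suc (Suc k)) \<omega> = \<infinity> then real_times \<sigma> (Suc k) \<omega> + 1 else enn2real (\<sigma> (Suc (Suc k)) \<omega>)) \<in> borel_measurable (H (Suc k))"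
    using 5 1(2) by measurable
  then have 6: "real_times \<sigma> (Suc (Suc k)) \<in> borel_measurable (H (Suc k))"
    by (rule measurable_cong[THEN iffD1, rotated]) simp
  show ?case using 1(2) 2 4 5 6 by blast
qed

lemma obs_sigma_hist: "(\<lambda>\<omega>. \<omega>) \<in> measurable (H k) (obs_sigma D \<sigma> k)"
  using real_times_adapted[of k] by (intro obs_sigma_universal) auto

lemma real_times_predictable: "predictable (real_times \<sigma>)"
  unfolding predictable_def using real_times_less real_times_adapted by (auto simp del: real_times.simps(2))

lemma obs_M: "f \<in> measurable (obs_sigma D \<sigma> k) N \<Longrightarrow> f \<in> measurable M N"
  by (rule hist_M[OF real_times_predictable measurable_compose[OF obs_sigma_hist, where g=f]])

lemma obs_sets_M: "A \<in> sets (obs_sigma D \<sigma> k) \<Longrightarrow> A \<in> sets M"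
proof (rule measurable_id_sets)
  show "(\<lambda>\<omega>. \<omega>) \<in> measurable M (obs_sigma D \<sigma> k)" by (rule obs_M[of _ k]) simp
qed simp

lemma seq_M: "\<sigma> k \<in> borel_measurable M"
  by (rule obs_M[OF seq_obs[of k k]]) simp

lemma X_at_M: "(\<lambda>\<omega>. X_at D (\<sigma> k \<omega>) \<omega>) \<in> borel_measurable M"
  by (rule obs_M[OF X_at_obs[of k k]]) simp

lemma obs_belief_obs: "obs_belief \<sigma> k \<in> borel_measurable (obs_sigma D \<sigma> k)"
proof (induction k)
  case 0
  have "(\<lambda>_. \<pi>) \<in> borel_measurable (obs_sigma D \<sigma> 0)" by simp
  then show ?case by (rule measurable_cong[THEN iffD1, rotated]) simp
next
  case (Suc k)
  let ?F = "obs_sigma D \<sigma> (Suc k)"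
  have b: "obs_belief \<sigma> k \<in> borel_measurable ?F" by (rule obs_sigma_mono[OF _ Suc]) simp
  have t: "\<sigma> k \<in> borel_measurable ?F" "\<sigma> (Suc k) \<in> borel_measurable ?F"
    by (rule seq_obs, simp)+
  have x: "(\<lambda>\<omega>. X_at D (\<sigma> k \<omega>) \<omega>) \<in> borel_measurable ?F" "(\<lambda>\<omega>. X_at D (\<sigma> (Suc k) \<omega>) \<omega>) \<in> borel_measurable ?F"
    by (rule X_at_obs, simp)+
  have "(\<lambda>\<omega>. bayes (enn2real (\<sigma> (Suc k) \<omega>) - enn2real (\<sigma> k \<omega>)) (obs_belief \<sigma> k \<omega>)
            (X_at D (\<sigma> (Suc k) \<omega>) \<omega> - X_at D (\<sigma> k \<omega>) \<omega>)) \<in> borel_measurable ?F"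
    by (intro measurable_lik borel_measurable_diff b x
        borel_measurable_enn2real[OF t(1)] borel_measurable_enn2real[OF t(2)])
  moreover have "{\<omega>\<in>space ?F. \<sigma> (Suc k) \<omega> = \<infinity>} \<in> sets ?F"
    using measurable_sets[OF t(2), of "{\<infinity>}"] by (auto simp: vimage_def Int_def conj_commute)
  ultimately have "(\<lambda>\<omega>. if \<sigma> (Suc k) \<omega> = \<infinity> then obs_belief \<sigma> k \<omega>
     else bayes (enn2real (\<sigma> (Suc k) \<omega>) - enn2real (\<sigma> k \<omega>)) (obs_belief \<sigma> k \<omega>)
            (X_at D (\<sigma> (Suc k) \<omega>) \<omega> - X_at D (\<sigma> k \<omega>) \<omega>)) \<in> borel_measurable ?F"
    using b by (intro measurable_If)
  then show ?case by (rule measurable_cong[THEN iffD1, rotated]) simp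
qed

lemma gap_eq: "\<omega> \<in> \<Omega> \<Longrightarrow> \<sigma> (Suc k) \<omega> < \<infinity> \<Longrightarrow>
    gap (real_times \<sigma>) k \<omega> = enn2real (\<sigma> (Suc k) \<omega>) - enn2real (\<sigma> k \<omega>)"
  unfolding gap_def using real_times_eq seq_finite by (simp del: real_times.simps)

lemma obs_belief_eq: "\<omega> \<in> \<Omega> \<Longrightarrow> \<sigma> k \<omega> < \<infinity> \<Longrightarrow> obs_belief \<sigma> k \<omega> = belief (real_times \<sigma>) k \<omega>"
proof (induction k)
  case (Suc k)
  have f: "\<sigma> k \<omega> < \<infinity>" using Suc seq_finite by blast
  have n: "\<sigma> (Suc k) \<omega> \<noteq> \<infinity>" "\<sigma> k \<omega> \<noteq> \<infinity>" using Suc.prems(2) f by auto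
  have "X_at D (\<sigma> (Suc k) \<omega>) \<omega> - X_at D (\<sigma> k \<omega>) \<omega> = gain (real_times \<sigma>) k \<omega>"
    unfolding gain_def real_times_eq[OF Suc.prems] real_times_eq[OF Suc.prems(1) f] X_at_def if_not_P[OF n(1)] if_not_P[OF n(2)] ..
  then show ?case
    unfolding obs_belief.simps if_not_P[OF n(1)] by (simp add: Suc.IH[OF Suc.prems(1) f] gap_eq[OF Suc.prems])
qed simp

lemma obs_belief_range: "\<omega> \<in> \<Omega> \<Longrightarrow> obs_belief \<sigma> k \<omega> \<in> {0..1}"
proof (induction k)
  case 0
  then show ?case using pi by simp
next
  case (Suc k)
  show ?case
  proof (cases "\<sigma> (Suc k) \<omega> = \<infinity>")
    case False
    then show ?thesis using obs_belief_eq[OF Suc.prems, of "Suc k"] belief_range[OF real_times_predictable Suc.prems, of "Suc k"]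
      by (simp add: less_top[symmetric])
  qed (use Suc in simp)
qed

text \<open>
  Where the time is infinite, \<open>obs_belief\<close> is frozen while the belief along \<open>real_times\<close> moves on; so the
  integrand has to vanish there.
\<close>

lemma obs_filter_law:
  assumes f: "f \<in> borel_measurable (obs_sigma D \<sigma> k \<Otimes>\<^sub>M borel)" and fin: "\<And>\<omega> y. \<omega> \<in> \<Omega> \<Longrightarrow> \<sigma> k \<omega> = \<infinity> \<Longrightarrow> f (\<omega>, y) = 0"
  shows "(\<integral>\<^sup>+\<omega>. f (\<omega>, max 0 (\<Theta> \<omega> - enn2real (\<sigma> k \<omega>))) \<partial>M) = (\<integral>\<^sup>+\<omega>. state_avg (obs_belief \<sigma> k \<omega>) (\<lambda>y. f (\<omega>, y)) \<partial>M)"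
proof -
  have "(\<lambda>z. (fst z, snd z)) \<in> measurable (H k \<Otimes>\<^sub>M borel) (obs_sigma D \<sigma> k \<Otimes>\<^sub>M borel)"
    by (intro measurable_Pair measurable_compose[OF measurable_fst obs_sigma_hist] measurable_snd)
  from measurable_compose[OF this f] have f': "f \<in> borel_measurable (H k \<Otimes>\<^sub>M borel)" by simp
  have "(\<integral>\<^sup>+\<omega>. f (\<omega>, max 0 (\<Theta> \<omega> - enn2real (\<sigma> k \<omega>))) \<partial>M) = (\<integral>\<^sup>+\<omega>. f (\<omega>, lag (real_times \<sigma>) k \<omega>) \<partial>M)"
    by (intro nn_integral_cong) (metis fin real_times_eq lag_def less_top infinity_ennreal_def space_M)
  also have "\<dots> = (\<integral>\<^sup>+\<omega>. state_avg (belief (real_times \<sigma>) k \<omega>) (\<lambda>y. f (\<omega>, y)) \<partial>M)"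
    by (rule filter_law[OF real_times_predictable f'])
  also have "\<dots> = (\<integral>\<^sup>+\<omega>. state_avg (obs_belief \<sigma> k \<omega>) (\<lambda>y. f (\<omega>, y)) \<partial>M)"
  proof (rule nn_integral_cong)
    fix \<omega> assume "\<omega> \<in> space M"
    then have \<omega>: "\<omega> \<in> \<Omega>" by simp
    show "state_avg (belief (real_times \<sigma>) k \<omega>) (\<lambda>y. f (\<omega>, y)) = state_avg (obs_belief \<sigma> k \<omega>) (\<lambda>y. f (\<omega>, y))"
      using obs_belief_eq[OF \<omega>, of k] fin[OF \<omega>] by (cases "\<sigma> k \<omega> = \<infinity>") (simp_all add: state_avg_def less_top[symmetric])
  qed
  finally show ?thesis .
qed

text \<open>
  The expected value after the next observation, on an event known before it.
\<close>

lemma obs_gain_law: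
  assumes A: "A \<in> sets (obs_sigma D \<sigma> k)" "\<And>\<omega>. \<omega> \<in> A \<Longrightarrow> \<sigma> (Suc k) \<omega> < \<infinity>" and f: "unit_fun f"
  shows "(\<integral>\<^sup>+\<omega>. indicator A \<omega> * ennreal (f (obs_belief \<sigma> (Suc k) \<omega>)) \<partial>M) =
    (\<integral>\<^sup>+\<omega>. indicator A \<omega> * ennreal (next_avg f (enn2real (\<sigma> (Suc k) \<omega>) - enn2real (\<sigma> k \<omega>)) (obs_belief \<sigma> k \<omega>)) \<partial>M)"
proof -
  have A\<Omega>: "A \<subseteq> \<Omega>" using sets.sets_into_space[OF A(1)] by simp
  have [measurable]: "f \<in> borel_measurable borel" using f by (simp add: unit_fun_def)
  have AH [measurable]: "A \<in> sets (H k)"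
    by (rule measurable_id_sets[OF obs_sigma_hist _ A(1)]) simp
  let ?b = "belief (real_times \<sigma>) k" and ?g = "gap (real_times \<sigma>) k"
  have [measurable]: "?b \<in> borel_measurable (H k)" "?g \<in> borel_measurable (H k)"
    using belief_hist[OF real_times_predictable] gap_hist[OF real_times_predictable] by auto
  have "(\<integral>\<^sup>+\<omega>. indicator A \<omega> * ennreal (f (obs_belief \<sigma> (Suc k) \<omega>)) \<partial>M) =
    (\<integral>\<^sup>+\<omega>. (\<lambda>z. indicator A (fst z) * ennreal (f (bayes (?g (fst z)) (?b (fst z)) (snd z)))) (\<omega>, gain (real_times \<sigma>) k \<omega>) \<partial>M)"
  proof (rule nn_integral_cong)
    fix \<omega>
    show "indicator A \<omega> * ennreal (f (obs_belief \<sigma> (Suc k) \<omega>)) = (\<lambda>z. indicator A (fst z) * ennreal (f (bayes (?g (fst z)) (?b (fst z)) (snd z)))) (\<omega>, gain (real_times \<sigma>) k \<omega>)"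
      using A(2)[of \<omega>] A\<Omega> obs_belief_eq[of \<omega> "Suc k"] by (auto split: split_indicator simp del: obs_belief.simps)
  qed
  also have "\<dots> = (\<integral>\<^sup>+\<omega>. (\<integral>\<^sup>+x. ennreal (lik (?g \<omega>) (?b \<omega>) x) * (\<lambda>z. indicator A (fst z) * ennreal (f (bayes (?g (fst z)) (?b (fst z)) (snd z)))) (\<omega>, x) \<partial>lborel) \<partial>M)"
    by (rule gain_law[OF real_times_predictable]) measurable
  also have "\<dots> = (\<integral>\<^sup>+\<omega>. indicator A \<omega> * ennreal (next_avg f (enn2real (\<sigma> (Suc k) \<omega>) - enn2real (\<sigma> k \<omega>)) (obs_belief \<sigma> k \<omega>)) \<partial>M)"
  proof (rule nn_integral_cong)
    fix \<omega> assume "\<omega> \<in> space M"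
    then have \<omega>: "\<omega> \<in> \<Omega>" by simp
    show "(\<integral>\<^sup>+x. ennreal (lik (?g \<omega>) (?b \<omega>) x) * (\<lambda>z. indicator A (fst z) * ennreal (f (bayes (?g (fst z)) (?b (fst z)) (snd z)))) (\<omega>, x) \<partial>lborel)
      = indicator A \<omega> * ennreal (next_avg f (enn2real (\<sigma> (Suc k) \<omega>) - enn2real (\<sigma> k \<omega>)) (obs_belief \<sigma> k \<omega>))"
    proof (cases "\<omega> \<in> A")
      case True
      have fin: "\<sigma> (Suc k) \<omega> < \<infinity>" "\<sigma> k \<omega> < \<infinity>" using A(2)[OF True] seq_finite[OF \<omega>] by auto
      show ?thesis
        using True next_avg_integrable(2)[OF gap_pos[OF real_times_predictable \<omega>] belief_range[OF real_times_predictable \<omega>] f, of k k]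
        unfolding gap_eq[OF \<omega> fin(1), symmetric] obs_belief_eq[OF \<omega> fin(2)] by simp
    qed simp
  qed
  finally show ?thesis .
qed

end

end

section \<open>The observation filtration and the posterior at stopping times\<close>

context detection begin

context
  fixes \<sigma> assumes \<sigma>: "\<sigma> \<in> obs_seqs D"
begin

abbreviation "obsk k \<equiv> obs_sigma D \<sigma> k"
abbreviation "filt t \<equiv> obs_filtration D \<sigma> t"

definition mask :: "ennreal \<Rightarrow> 'a \<Rightarrow> nat \<Rightarrow> ennreal \<times> real" where
  "mask t \<omega> = (\<lambda>k\<in>{1..}. if \<sigma> k \<omega> \<le> t then (\<sigma> k \<omega>, X_at D (\<sigma> k \<omega>) \<omega>) else (\<infinity>, 0))"

lemma mask_space: "mask t \<in> \<Omega> \<rightarrow> space (PiM {1..} (\<lambda>_. borel \<Otimes>\<^sub>M borel))"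
  by (auto simp: mask_def space_PiM space_pair_measure)

lemma filt_eq: "filt t = vimage_algebra \<Omega> (mask t) (PiM {1..} (\<lambda>_. borel \<Otimes>\<^sub>M borel))"
  unfolding obs_filtration_def mask_def ..

lemma mask_measurable: "mask t \<in> measurable (filt t) (PiM {1..} (\<lambda>_. borel \<Otimes>\<^sub>M borel))"
  unfolding filt_eq by (rule measurable_vimage_algebra1[OF mask_space])

lemma mask_component:
  assumes "1 \<le> k"
  shows "(\<lambda>\<omega>. if \<sigma> k \<omega> \<le> t then (\<sigma> k \<omega>, X_at D (\<sigma> k \<omega>) \<omega>) else (\<infinity>, 0)) \<in> measurable (filt t) (borel \<Otimes>\<^sub>M borel)"
  using measurable_compose[OF mask_measurable measurable_component_singleton[of k]] assms by (simp add: mask_def)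

lemma filt_time_le: "{\<omega>\<in>\<Omega>. \<sigma> k \<omega> \<le> t} \<in> sets (filt t)"
proof (cases "k = 0 \<or> t = \<infinity>")
  case True
  then have "{\<omega>\<in>\<Omega>. \<sigma> k \<omega> \<le> t} = space (filt t)" by (auto simp: seq_0[OF \<sigma>])
  then show ?thesis by (metis sets.top)
next
  case False
  then have k: "1 \<le> k" and t: "t < \<infinity>" by (auto simp: less_top[symmetric])
  from measurable_compose[OF mask_component[OF k] measurable_fst]
  have "(\<lambda>\<omega>. if \<sigma> k \<omega> \<le> t then \<sigma> k \<omega> else \<infinity>) \<in> borel_measurable (filt t)"
    by (rule measurable_cong[THEN iffD1, rotated]) simp
  then have "{\<omega>\<in>space (filt t). (if \<sigma> k \<omega> \<le> t then \<sigma> k \<omega> else \<infinity>) \<le> t} \<in> sets (filt t)"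
    by (rule borel_measurable_le) simp
  moreover have "{\<omega>\<in>space (filt t). (if \<sigma> k \<omega> \<le> t then \<sigma> k \<omega> else \<infinity>) \<le> t} = {\<omega>\<in>\<Omega>. \<sigma> k \<omega> \<le> t}"
    using t by (auto split: if_splits)
  ultimately show ?thesis by simp
qed

text \<open>
  Once the \<open>k\<close>-th observation is made, masking leaves the first \<open>k\<close> observations untouched.
\<close>

lemma filt_of_obs:
  assumes A: "A \<in> sets (obsk k)"
  shows "{\<omega>\<in>A. \<sigma> k \<omega> \<le> t} \<in> sets (filt t)"
proof -
  obtain C where C: "C \<in> sets (PiM {1..k} (\<lambda>_. borel \<Otimes>\<^sub>M borel))"
    and AC: "A = (\<lambda>\<omega>. \<lambda>i\<in>{1..k}. (\<sigma> i \<omega>, X_at D (\<sigma> i \<omega>) \<omega>)) -` C \<inter> \<Omega>"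
    using A unfolding obs_sigma_def sets_vimage_algebra2[OF obs_sigma_map_space] by blast
  let ?m = "\<lambda>\<omega>. \<lambda>i\<in>{1..k}. if \<sigma> i \<omega> \<le> t then (\<sigma> i \<omega>, X_at D (\<sigma> i \<omega>) \<omega>) else (\<infinity>, 0)"
  have "?m \<in> measurable (filt t) (PiM {1..k} (\<lambda>_. borel \<Otimes>\<^sub>M borel))"
    by (rule measurable_restrict) (auto intro: mask_component)
  from measurable_sets[OF this C] have "?m -` C \<inter> \<Omega> \<in> sets (filt t)" by simp
  then have "(?m -` C \<inter> \<Omega>) \<inter> {\<omega>\<in>\<Omega>. \<sigma> k \<omega> \<le> t} \<in> sets (filt t)" using filt_time_le by blast
  moreover have "(?m -` C \<inter> \<Omega>) \<inter> {\<omega>\<in>\<Omega>. \<sigma> k \<omega> \<le> t} = {\<omega>\<in>A. \<sigma> k \<omega> \<le> t}"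
  proof -
    have "?m \<omega> = (\<lambda>i\<in>{1..k}. (\<sigma> i \<omega>, X_at D (\<sigma> i \<omega>) \<omega>))" if "\<omega> \<in> \<Omega>" "\<sigma> k \<omega> \<le> t" for \<omega>
      using seq_mono[OF \<sigma> that(1), of _ k] that(2) by (intro restrict_ext) (auto dest: order_trans)
    then show ?thesis unfolding AC by auto
  qed
  ultimately show ?thesis by simp
qed

text \<open>
  Between the \<open>k\<close>-th observation and the next one the mask shows the first \<open>k\<close> observations and nothing
  else.
\<close>

lemma obs_of_filt:
  assumes B: "B \<in> sets (filt t)"
  shows "{\<omega>\<in>B. \<sigma> k \<omega> \<le> t \<and> t < \<sigma> (Suc k) \<omega>} \<in> sets (obsk k)"
proof -
  obtain C where C: "C \<in> sets (PiM {1..} (\<lambda>_. borel \<Otimes>\<^sub>M borel))" and BC: "B = mask t -` C \<inter> \<Omega>"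
    using B unfolding filt_eq sets_vimage_algebra2[OF mask_space] by blast
  let ?m = "\<lambda>\<omega>. \<lambda>i\<in>{1..}. if i \<le> k then (\<sigma> i \<omega>, X_at D (\<sigma> i \<omega>) \<omega>) else (\<infinity>, 0)"
  have "?m \<in> measurable (obsk k) (PiM {1..} (\<lambda>_. borel \<Otimes>\<^sub>M borel))"
  proof (rule measurable_restrict)
    fix i :: nat assume "i \<in> {1..}"
    then show "(\<lambda>\<omega>. if i \<le> k then (\<sigma> i \<omega>, X_at D (\<sigma> i \<omega>) \<omega>) else (\<infinity>, 0)) \<in> measurable (obsk k) (borel \<Otimes>\<^sub>M borel)"
      by (cases "i \<le> k") (auto intro!: measurable_Pair obs_sigma_component)
  qed
  from measurable_sets[OF this C] have 1: "?m -` C \<inter> \<Omega> \<in> sets (obsk k)" by simp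
  have 2: "{\<omega>\<in>\<Omega>. \<sigma> k \<omega> \<le> t} \<in> sets (obsk k)" "{\<omega>\<in>\<Omega>. t < \<sigma> (Suc k) \<omega>} \<in> sets (obsk k)"
    using borel_measurable_le[OF seq_obs[OF \<sigma>, of k k] borel_measurable_const[of t]]
      borel_measurable_less[OF borel_measurable_const[of t] seq_obs[OF \<sigma>, of "Suc k" k]] by auto
  have "{\<omega>\<in>B. \<sigma> k \<omega> \<le> t \<and> t < \<sigma> (Suc k) \<omega>} = (?m -` C \<inter> \<Omega>) \<inter> ({\<omega>\<in>\<Omega>. \<sigma> k \<omega> \<le> t} \<inter> {\<omega>\<in>\<Omega>. t < \<sigma> (Suc k) \<omega>})"
  proof -
    have "?m \<omega> = mask t \<omega>" if \<omega>: "\<omega> \<in> \<Omega>" "\<sigma> k \<omega> \<le> t" "t < \<sigma> (Suc k) \<omega>" for \<omega>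
      unfolding mask_def
    proof (rule restrict_ext)
      fix i :: nat
      show "(if i \<le> k then (\<sigma> i \<omega>, X_at D (\<sigma> i \<omega>) \<omega>) else (\<infinity>, 0)) = (if \<sigma> i \<omega> \<le> t then (\<sigma> i \<omega>, X_at D (\<sigma> i \<omega>) \<omega>) else (\<infinity>, 0))"
      proof (cases "i \<le> k")
        case True
        have "\<sigma> i \<omega> \<le> t" using seq_mono[OF \<sigma> \<omega>(1) True] \<omega>(2) by (rule order_trans)
        then show ?thesis using True by simp
      next
        case False
        then have "t < \<sigma> i \<omega>" using seq_mono[OF \<sigma> \<omega>(1), of "Suc k" i] \<omega>(3) by (auto intro: less_le_trans)
        then show ?thesis using False by auto
      qed
    qed
    then show ?thesis unfolding BC by auto
  qed
  with 1 2 show ?thesis by auto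
qed

text \<open>
  An earlier mask is obtained from a later one by masking again.
\<close>

lemma filtration_filt: "filtration \<Omega> (obs_filtration D \<sigma>)"
proof
  show "space (filt i) = \<Omega>" for i by simp
  fix s t :: ennreal assume st: "s \<le> t"
  have "(\<lambda>\<omega>. \<omega>) \<in> measurable (filt t) (filt s)"
    unfolding filt_eq[of s]
  proof (rule measurable_vimage_algebra2)
    have "mask s \<in> measurable (filt t) (PiM {1..} (\<lambda>_. borel \<Otimes>\<^sub>M borel))"
      unfolding mask_def
    proof (rule measurable_restrict)
      fix k :: nat assume k: "k \<in> {1..}"
      let ?c = "\<lambda>t \<omega>. if \<sigma> k \<omega> \<le> t then (\<sigma> k \<omega>, X_at D (\<sigma> k \<omega>) \<omega>) else (\<infinity>, 0)"
      show "?c s \<in> measurable (filt t) (borel \<Otimes>\<^sub>M borel)"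
      proof (cases "s = \<infinity>")
        case True
        then have "s = t" using st by (simp add: top_unique)
        then show ?thesis using mask_component[of k t] k by simp
      next
        case False
        have c: "?c t \<in> measurable (filt t) (borel \<Otimes>\<^sub>M borel)" using mask_component[of k t] k by simp
        let ?g = "\<lambda>z :: ennreal \<times> real. if fst z \<le> s then z else (\<infinity>, 0)"
        have "?g \<in> measurable (borel \<Otimes>\<^sub>M borel) (borel \<Otimes>\<^sub>M borel)" by measurable
        from measurable_compose[OF c this] show ?thesis
          by (rule measurable_cong[THEN iffD1, rotated]) (use st False in \<open>auto simp: top_unique dest: order_trans\<close>)
      qed
    qed
    then show "(\<lambda>\<omega>. mask s \<omega>) \<in> measurable (filt t) (PiM {1..} (\<lambda>_. borel \<Otimes>\<^sub>M borel))" by simp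
  qed simp
  then show "sets (filt s) \<subseteq> sets (filt t)"
    using measurable_id_sets[of "filt t" "filt s"] by auto
qed

lemma filt_sets_M: "A \<in> sets (filt t) \<Longrightarrow> A \<in> sets M"
proof (rule measurable_id_sets)
  show "(\<lambda>\<omega>. \<omega>) \<in> measurable M (filt t)"
    unfolding filt_eq
  proof (rule measurable_vimage_algebra2)
    show "(\<lambda>\<omega>. mask t \<omega>) \<in> measurable M (PiM {1..} (\<lambda>_. borel \<Otimes>\<^sub>M borel))"
      unfolding mask_def
    proof (rule measurable_restrict)
      fix k :: nat
      show "(\<lambda>\<omega>. if \<sigma> k \<omega> \<le> t then (\<sigma> k \<omega>, X_at D (\<sigma> k \<omega>) \<omega>) else (\<infinity>, 0)) \<in> measurable M (borel \<Otimes>\<^sub>M borel)"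
        by (intro measurable_If measurable_Pair seq_M[OF \<sigma>] X_at_M[OF \<sigma>] measurable_const
            borel_measurable_le[OF seq_M[OF \<sigma>] borel_measurable_const]) (simp_all add: space_pair_measure)
    qed
  qed simp
qed simp

lemma seq_stop_time: "\<sigma> k \<in> stop_times D \<sigma>"
  unfolding stop_times_def stopping_time_def using filt_time_le by (simp add: pred_def)

context
  fixes \<tau> assumes \<tau>: "\<tau> \<in> stop_times D \<sigma>"
begin

lemma stopT: "stopping_time (obs_filtration D \<sigma>) \<tau>" using \<tau> by (simp add: stop_times_def)

lemma stop_le: "{\<omega>\<in>\<Omega>. \<tau> \<omega> \<le> t} \<in> sets (filt t)"
  using stopping_timeD[OF stopT, of t] by (simp add: pred_def)

definition pre :: "'a measure" where
  "pre = filtration.pre_sigma \<Omega> (obs_filtration D \<sigma>) \<tau>"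

lemma space_pre: "space pre = \<Omega>"
  unfolding pre_def by (rule filtration.space_pre_sigma[OF filtration_filt])

lemma sets_pre: "A \<in> sets pre \<longleftrightarrow> (\<forall>t. {\<omega>\<in>A. \<tau> \<omega> \<le> t} \<in> sets (filt t))"
  unfolding pre_def filtration.sets_pre_sigma[OF filtration_filt stopT] by simp

lemma pre_sets_M: "A \<in> sets pre \<Longrightarrow> A \<in> sets M"
proof -
  assume "A \<in> sets pre"
  then have "{\<omega>\<in>A. \<tau> \<omega> \<le> \<infinity>} \<in> sets M" unfolding sets_pre by (blast intro: filt_sets_M)
  moreover have "{\<omega>\<in>A. \<tau> \<omega> \<le> \<infinity>} = A" by auto
  ultimately show ?thesis by (simp only:)
qed

lemma stop_pre: "\<tau> \<in> borel_measurable pre"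
  unfolding pre_def by (rule filtration.measurable_stopping_time_pre_sigma[OF filtration_filt stopT])

lemma stop_M: "\<tau> \<in> borel_measurable M"
proof (rule borel_measurableI_le)
  show "{\<omega>\<in>space M. \<tau> \<omega> \<le> t} \<in> sets M" for t using filt_sets_M[OF stop_le] by simp
qed

text \<open>
  On stage \<open>k\<close> the decision to stop rests on exactly the first \<open>k\<close> observations: there the \<open>\<sigma>\<close>-algebra of the
  stopping time has the same trace as \<open>obs_sigma\<close>. On \<open>reach k\<close> the \<open>k\<close>-th observation is made and paid for.
\<close>

definition stage :: "nat \<Rightarrow> 'a set" where
  "stage k = {\<omega>\<in>\<Omega>. \<sigma> k \<omega> \<le> \<tau> \<omega> \<and> \<tau> \<omega> < \<sigma> (Suc k) \<omega>}"

definition reach :: "nat \<Rightarrow> 'a set" where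
  "reach k = {\<omega>\<in>\<Omega>. \<sigma> k \<omega> < \<infinity> \<and> \<sigma> k \<omega> \<le> \<tau> \<omega>}"

text \<open>
  Stopping before the next observation is witnessed by one of countably many times \<open>t\<close> that lies between the last
  event and the next observation; for each of them \<open>obs_of_filt\<close> applies.
\<close>

lemma before_next:
  assumes A: "A \<in> sets pre"
  shows "{\<omega>\<in>A. \<sigma> k \<omega> < \<infinity> \<and> \<tau> \<omega> < \<sigma> (Suc k) \<omega>} \<in> sets (obsk k)"
proof -
  \<comment> \<open>a countable set that separates the points of the time axis\<close>
  obtain B :: "ennreal set" where B: "countable B" "\<And>x y. x < y \<Longrightarrow> \<exists>b\<in>B. x \<le> b \<and> b < y"
    using countable_separating_set_linorder2 by blast
  have A\<Omega>: "A \<subseteq> \<Omega>" using sets.sets_into_space[OF A] by (simp add: space_pre)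
  have "{\<omega>\<in>A. \<sigma> k \<omega> < \<infinity> \<and> \<tau> \<omega> < \<sigma> (Suc k) \<omega>} =
     (\<Union>t\<in>B. {\<omega>\<in>{\<omega>\<in>A. \<tau> \<omega> \<le> t}. \<sigma> k \<omega> \<le> t \<and> t < \<sigma> (Suc k) \<omega>})" (is "?L = ?R")
  proof (intro set_eqI iffI)
    fix \<omega> assume \<omega>: "\<omega> \<in> ?L"
    then have "max (\<tau> \<omega>) (\<sigma> k \<omega>) < \<sigma> (Suc k) \<omega>" using seq_less[OF \<sigma>, of \<omega> k] A\<Omega> by auto
    from B(2)[OF this] \<omega> show "\<omega> \<in> ?R" by auto
  next
    fix \<omega> assume "\<omega> \<in> ?R"
    then obtain t where t: "\<omega> \<in> A" "\<tau> \<omega> \<le> t" "\<sigma> k \<omega> \<le> t" "t < \<sigma> (Suc k) \<omega>" by auto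
    then show "\<omega> \<in> ?L" using order.strict_trans1[of t _ top] by (auto intro: le_less_trans less_le_trans[OF _ top_greatest])
  qed
  moreover have "?R \<in> sets (obsk k)"
    using A unfolding sets_pre by (intro sets.countable_UN''[OF B(1)] obs_of_filt) blast
  ultimately show ?thesis by simp
qed

lemma reach_obs: "reach k \<in> sets (obsk k)" "reach (Suc k) \<in> sets (obsk k)"
proof -
  have top: "\<Omega> \<in> sets pre" using sets.top[of pre] by (simp add: space_pre)
  have fin: "{\<omega>\<in>\<Omega>. \<sigma> (Suc k) \<omega> < \<infinity>} \<in> sets (obsk k)" for k
    using borel_measurable_less[OF seq_obs[OF \<sigma>, of "Suc k" k] borel_measurable_const[of \<infinity>]] by simp
  have Suc: "reach (Suc k) \<in> sets (obsk k)" for k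
  proof -
    have "reach (Suc k) = {\<omega>\<in>\<Omega>. \<sigma> (Suc k) \<omega> < \<infinity>} - {\<omega>\<in>\<Omega>. \<sigma> k \<omega> < \<infinity> \<and> \<tau> \<omega> < \<sigma> (Suc k) \<omega>}"
      unfolding reach_def using seq_finite[OF \<sigma>] by (auto simp: not_less)
    then show ?thesis using fin before_next[OF top] by auto
  qed
  then show "reach (Suc k) \<in> sets (obsk k)" .
  show "reach k \<in> sets (obsk k)"
  proof (cases k)
    case 0
    have "reach 0 = space (obsk 0)" by (auto simp: reach_def seq_0[OF \<sigma>])
    then show ?thesis unfolding 0 by (metis sets.top)
  next
    case (Suc j)
    then show ?thesis using Suc obs_sigma_mono_sets[OF _ \<open>reach (Suc j) \<in> sets (obsk j)\<close>, of k] by simp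
  qed
qed

lemma stage_sub_reach: "stage k \<subseteq> reach k - reach (Suc k)"
  unfolding stage_def reach_def by (auto intro: le_less_trans less_le_trans[OF _ top_greatest])

lemma pre_stage_obs:
  assumes A: "A \<in> sets pre"
  shows "A \<inter> stage k \<in> sets (obsk k)"
proof -
  have A\<Omega>: "A \<subseteq> \<Omega>" using sets.sets_into_space[OF A] by (simp add: space_pre)
  have "A \<inter> stage k = {\<omega>\<in>A. \<sigma> k \<omega> < \<infinity> \<and> \<tau> \<omega> < \<sigma> (Suc k) \<omega>} \<inter> reach k"
    unfolding stage_def reach_def using A\<Omega> by (auto intro: le_less_trans less_le_trans[OF _ top_greatest])
  then show ?thesis using before_next[OF A] reach_obs(1) by auto
qed

lemma stage_obs: "stage k \<in> sets (obsk k)"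
proof -
  have "\<Omega> \<in> sets pre" using sets.top[of pre] by (simp add: space_pre)
  from pre_stage_obs[OF this, of k] show ?thesis by (simp add: stage_def Int_def conj_commute)
qed

lemma obs_stage_pre:
  assumes A: "A \<in> sets (obsk k)" "A \<subseteq> stage k"
  shows "A \<in> sets pre" "{\<omega>\<in>A. \<tau> \<omega> \<le> t} \<in> sets (obsk k)"
proof -
  have A\<Omega>: "A \<subseteq> \<Omega>" using sets.sets_into_space[OF A(1)] by simp
  have *: "{\<omega>\<in>A. \<tau> \<omega> \<le> t} \<in> sets (obsk k)" for t
  proof -
    have "{\<omega>\<in>A. \<tau> \<omega> \<le> t} = A \<inter> ({\<omega>\<in>\<Omega>. \<sigma> (Suc k) \<omega> \<le> t} \<union> {\<omega>\<in>{\<omega>\<in>\<Omega>. \<tau> \<omega> \<le> t}. \<sigma> k \<omega> \<le> t \<and> t < \<sigma> (Suc k) \<omega>})"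
      using A(2) A\<Omega> unfolding stage_def by (auto simp: not_le intro: order_trans less_imp_le dest: order_trans)
    moreover have "{\<omega>\<in>\<Omega>. \<sigma> (Suc k) \<omega> \<le> t} \<in> sets (obsk k)"
      using borel_measurable_le[OF seq_obs[OF \<sigma>, of "Suc k" k] borel_measurable_const[of t]] by simp
    ultimately show ?thesis using A(1) obs_of_filt[OF stop_le, of t k] by auto
  qed
  then show "{\<omega>\<in>A. \<tau> \<omega> \<le> t} \<in> sets (obsk k)" .
  show "A \<in> sets pre"
    unfolding sets_pre
  proof
    fix t
    have "{\<omega>\<in>{\<omega>\<in>A. \<tau> \<omega> \<le> t}. \<sigma> k \<omega> \<le> t} \<in> sets (filt t)" by (rule filt_of_obs[OF *])
    moreover have "{\<omega>\<in>{\<omega>\<in>A. \<tau> \<omega> \<le> t}. \<sigma> k \<omega> \<le> t} = {\<omega>\<in>A. \<tau> \<omega> \<le> t}"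
      using A(2) unfolding stage_def by (auto intro: order_trans)
    ultimately show "{\<omega>\<in>A. \<tau> \<omega> \<le> t} \<in> sets (filt t)" by simp
  qed
qed

lemma stage_disjoint: "\<omega> \<in> stage i \<Longrightarrow> \<omega> \<in> stage j \<Longrightarrow> i = j"
proof (induction i j rule: linorder_wlog)
  case (le i j)
  show ?case
  proof (rule ccontr)
    assume "i \<noteq> j"
    then have "Suc i \<le> j" using le by simp
    then have "\<sigma> (Suc i) \<omega> \<le> \<sigma> j \<omega>" using le by (intro seq_mono[OF \<sigma>]) (auto simp: stage_def)
    then show False using le unfolding stage_def by (auto simp: not_le[symmetric] dest: order_trans)
  qed
qed auto

lemma stop_stage_measurable: "(\<lambda>\<omega>. if \<omega> \<in> stage k then \<tau> \<omega> else 0) \<in> borel_measurable (obsk k)"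
proof (rule borel_measurableI_le)
  fix t
  have "{\<omega>\<in>space (obsk k). (if \<omega> \<in> stage k then \<tau> \<omega> else 0) \<le> t} = {\<omega>\<in>stage k. \<tau> \<omega> \<le> t} \<union> (space (obsk k) - stage k)"
    by (auto simp: stage_def)
  then show "{\<omega>\<in>space (obsk k). (if \<omega> \<in> stage k then \<tau> \<omega> else 0) \<le> t} \<in> sets (obsk k)"
    by (simp only: sets.Un[OF obs_stage_pre(2)[OF stage_obs order_refl] sets.compl_sets[OF stage_obs]])
qed

text \<open>
  At \<open>\<tau> = \<infinity>\<close> the value is \<open>1\<close>, because \<open>\<Theta> \<le> \<tau>\<close> is certain there.
\<close>

definition stage_post :: "'a \<Rightarrow> real" where
  "stage_post \<omega> = (if \<tau> \<omega> = \<infinity> then 1 else (\<Sum>k. indicator (stage k) \<omega> * obs_belief \<sigma> k \<omega>))"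

lemma stage_post_eq: "\<omega> \<in> stage k \<Longrightarrow> stage_post \<omega> = obs_belief \<sigma> k \<omega>"
proof -
  assume \<omega>: "\<omega> \<in> stage k"
  then have "\<tau> \<omega> < \<infinity>" unfolding stage_def by (auto intro: less_le_trans[OF _ top_greatest])
  then have n: "\<tau> \<omega> \<noteq> \<infinity>" by auto
  have "(\<Sum>j. indicator (stage j) \<omega> * obs_belief \<sigma> j \<omega>) = (\<Sum>j\<in>{k}. indicator (stage j) \<omega> * obs_belief \<sigma> j \<omega>)"
    by (rule suminf_finite) (auto dest: stage_disjoint[OF \<omega>] split: split_indicator)
  then show ?thesis unfolding stage_post_def if_not_P[OF n] using \<omega> by simp
qed

lemma stage_post_measurable: "stage_post \<in> borel_measurable pre"
proof -
  have "(\<lambda>\<omega>. indicator (stage k) \<omega> * obs_belief \<sigma> k \<omega>) \<in> borel_measurable pre" for k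
  proof (rule borel_measurableI_le)
    fix a :: real
    have 1: "stage k \<in> sets pre" by (rule obs_stage_pre(1)[OF stage_obs order_refl])
    have "{\<omega>\<in>space (obsk k). obs_belief \<sigma> k \<omega> \<le> a} \<in> sets (obsk k)"
      by (rule borel_measurable_le[OF obs_belief_obs[OF \<sigma>] borel_measurable_const])
    then have 2: "stage k \<inter> {\<omega>\<in>space (obsk k). obs_belief \<sigma> k \<omega> \<le> a} \<in> sets pre"
      using stage_obs by (intro obs_stage_pre(1)) auto
    have "{\<omega>\<in>space pre. indicator (stage k) \<omega> * obs_belief \<sigma> k \<omega> \<le> a} =
       (stage k \<inter> {\<omega>\<in>space (obsk k). obs_belief \<sigma> k \<omega> \<le> a}) \<union> (if 0 \<le> a then space pre - stage k else {})"
      by (auto simp: space_pre stage_def split: split_indicator)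
    then show "{\<omega>\<in>space pre. indicator (stage k) \<omega> * obs_belief \<sigma> k \<omega> \<le> a} \<in> sets pre"
      using 1 2 by auto
  qed
  then have s: "(\<lambda>\<omega>. \<Sum>k. indicator (stage k) \<omega> * obs_belief \<sigma> k \<omega>) \<in> borel_measurable pre"
    by (rule borel_measurable_suminf)
  have "{\<omega>\<in>space pre. \<tau> \<omega> = \<infinity>} \<in> sets pre"
    using measurable_sets[OF stop_pre, of "{\<infinity>}"] by (auto simp: vimage_def Int_def conj_commute)
  then show ?thesis unfolding stage_post_def[abs_def] using s by (intro measurable_If) auto
qed

lemma stage_post_range: "\<omega> \<in> \<Omega> \<Longrightarrow> 0 \<le> stage_post \<omega> \<and> stage_post \<omega> \<le> 1"
proof (cases "\<exists>k. \<omega> \<in> stage k")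
  case True
  assume "\<omega> \<in> \<Omega>"
  with True show ?thesis using stage_post_eq obs_belief_range[OF \<sigma>] by fastforce
next
  case False
  then show ?thesis by (simp add: stage_post_def)
qed

end

lemma state_avg_zero: "p \<in> {0..1} \<Longrightarrow> state_avg p (indicator {..0}) = ennreal p"
  using state_avg_atMost[of p 0] by simp

text \<open>
  The conditional expectation is characterised by its integrals over events of the stopped
  \<open>\<sigma>\<close>-algebra. Cut along the stages, such an event belongs to \<open>obs_sigma\<close>, and on stage \<open>k\<close> the stopping
  time is \<open>\<sigma> k\<close>, so \<open>obs_filter_law\<close> gives the integral.
\<close>

lemma posterior_stage:
  assumes \<tau>: "\<tau> \<in> stop_times0 D \<pi> \<sigma>"
  shows "AE \<omega> in M. \<forall>k. \<omega> \<in> stage \<tau> k \<longrightarrow> \<tau> \<omega> = \<sigma> k \<omega> \<and> posterior D \<pi> \<sigma> \<tau> \<omega> = obs_belief \<sigma> k \<omega>"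
proof -
  have \<tau>1: "\<tau> \<in> stop_times D \<sigma>" and ae: "AE \<omega> in M. \<exists>k. \<tau> \<omega> = \<sigma> k \<omega>"
    using \<tau> by (auto simp: stop_times0_def)
  let ?F = "pre \<tau>"
  have sub: "subalgebra M ?F" unfolding subalgebra_def using pre_sets_M[OF \<tau>1] space_pre[OF \<tau>1] by auto
  interpret P: finite_measure_subalgebra M ?F by unfold_locales (rule sub)
  let ?I = "{\<omega>\<in>\<Omega>. ennreal (\<Theta> \<omega>) \<le> \<tau> \<omega>}"
  have [measurable]: "\<tau> \<in> borel_measurable M" by (rule stop_M[OF \<tau>1])
  have I [measurable]: "?I \<in> sets M"
  proof -
    have "{\<omega>\<in>space M. ennreal (\<Theta> \<omega>) \<le> \<tau> \<omega>} \<in> sets M" by measurable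
    then show ?thesis by simp
  qed
  have [measurable]: "stage_post \<tau> \<in> borel_measurable M"
    by (rule measurable_from_subalg[OF sub stage_post_measurable[OF \<tau>1]])
  have post: "posterior D \<pi> \<sigma> \<tau> = real_cond_exp M ?F (indicator ?I)"
    unfolding posterior_def pre_def[OF \<tau>1] ..
  have st: "AE \<omega> in M. \<forall>k. \<omega> \<in> stage \<tau> k \<longrightarrow> \<tau> \<omega> = \<sigma> k \<omega>"
    using ae
  proof (eventually_elim, intro allI impI)
    fix \<omega> k assume "\<exists>j. \<tau> \<omega> = \<sigma> j \<omega>" and k: "\<omega> \<in> stage \<tau> k"
    then obtain j where j: "\<tau> \<omega> = \<sigma> j \<omega>" by auto
    have \<omega>: "\<omega> \<in> \<Omega>" and lt: "\<sigma> k \<omega> \<le> \<tau> \<omega>" "\<tau> \<omega> < \<sigma> (Suc k) \<omega>" using k by (auto simp: stage_def[OF \<tau>1])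
    have "j \<le> k"
    proof (rule ccontr)
      assume "\<not> j \<le> k"
      then have "\<sigma> (Suc k) \<omega> \<le> \<sigma> j \<omega>" by (intro seq_mono[OF \<sigma> \<omega>]) simp
      then show False using lt(2) j by simp
    qed
    then have "\<sigma> j \<omega> \<le> \<sigma> k \<omega>" by (rule seq_mono[OF \<sigma> \<omega>])
    then show "\<tau> \<omega> = \<sigma> k \<omega>" using lt j by simp
  qed
  have cover: "AE \<omega> in M. \<tau> \<omega> = \<infinity> \<or> (\<exists>k. \<omega> \<in> stage \<tau> k)"
    using ae
  proof (rule AE_mp, intro AE_I2 impI)
    fix \<omega> assume "\<omega> \<in> space M" and "\<exists>k. \<tau> \<omega> = \<sigma> k \<omega>"
    then obtain k where k: "\<tau> \<omega> = \<sigma> k \<omega>" and \<omega>: "\<omega> \<in> \<Omega>" by auto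
    show "\<tau> \<omega> = \<infinity> \<or> (\<exists>k. \<omega> \<in> stage \<tau> k)"
    proof (cases "\<tau> \<omega> = \<infinity>")
      case False
      then have "\<sigma> k \<omega> < \<infinity>" using k by (simp add: less_top[symmetric])
      from seq_less[OF \<sigma> \<omega> this] have "\<omega> \<in> stage \<tau> k" using k \<omega> by (simp add: stage_def[OF \<tau>1])
      then show ?thesis by blast
    qed simp
  qed
  have eq: "(\<integral>\<^sup>+\<omega>. indicator A \<omega> * ennreal (indicator ?I \<omega>) \<partial>M) = (\<integral>\<^sup>+\<omega>. indicator A \<omega> * ennreal (stage_post \<tau> \<omega>) \<partial>M)"
    if A: "A \<in> sets ?F" for A
  proof -
    have AM [measurable]: "A \<in> sets M" by (rule pre_sets_M[OF \<tau>1 A])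
    have SM [measurable]: "stage \<tau> k \<in> sets M" for k by (rule obs_sets_M[OF \<sigma> stage_obs[OF \<tau>1]])
    have piece: "(\<integral>\<^sup>+\<omega>. indicator (A \<inter> stage \<tau> k) \<omega> * ennreal (indicator ?I \<omega>) \<partial>M) =
       (\<integral>\<^sup>+\<omega>. indicator (A \<inter> stage \<tau> k) \<omega> * ennreal (stage_post \<tau> \<omega>) \<partial>M)" for k
    proof -
      let ?B = "A \<inter> stage \<tau> k"
      have B [measurable]: "?B \<in> sets (obsk k)" by (rule pre_stage_obs[OF \<tau>1 A])
      have B\<Omega>: "\<omega> \<in> \<Omega>" "\<sigma> k \<omega> < \<infinity>" if "\<omega> \<in> ?B" for \<omega>
        using that stage_sub_reach[OF \<tau>1, of k] by (auto simp: reach_def[OF \<tau>1])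
      let ?f = "\<lambda>z :: 'a \<times> real. indicator ?B (fst z) * indicator {..0} (snd z) :: ennreal"
      have f: "?f \<in> borel_measurable (obsk k \<Otimes>\<^sub>M borel)" by measurable
      have "(\<integral>\<^sup>+\<omega>. indicator ?B \<omega> * ennreal (indicator ?I \<omega>) \<partial>M) = (\<integral>\<^sup>+\<omega>. ?f (\<omega>, max 0 (\<Theta> \<omega> - enn2real (\<sigma> k \<omega>))) \<partial>M)"
      proof (rule nn_integral_cong_AE, use st in eventually_elim)
        fix \<omega> assume s: "\<forall>k. \<omega> \<in> stage \<tau> k \<longrightarrow> \<tau> \<omega> = \<sigma> k \<omega>"
        show "indicator ?B \<omega> * ennreal (indicator ?I \<omega>) = ?f (\<omega>, max 0 (\<Theta> \<omega> - enn2real (\<sigma> k \<omega>)))"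
        proof (cases "\<omega> \<in> ?B")
          case True
          have e: "\<tau> \<omega> = \<sigma> k \<omega>" using s True by blast
          obtain r where r: "\<sigma> k \<omega> = ennreal r" "0 \<le> r" using B\<Omega>(2)[OF True] by (cases "\<sigma> k \<omega>") auto
          have "ennreal (\<Theta> \<omega>) \<le> \<tau> \<omega> \<longleftrightarrow> \<Theta> \<omega> \<le> r" unfolding e r(1) using r(2) by (simp add: ennreal_le_iff)
          moreover have "max 0 (\<Theta> \<omega> - enn2real (\<sigma> k \<omega>)) \<in> {..0} \<longleftrightarrow> \<Theta> \<omega> \<le> r" using r by simp
          ultimately show ?thesis using True B\<Omega>(1)[OF True] by (auto split: split_indicator)
        qed simp
      qed
      also have "\<dots> = (\<integral>\<^sup>+\<omega>. state_avg (obs_belief \<sigma> k \<omega>) (\<lambda>y. ?f (\<omega>, y)) \<partial>M)"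
        by (rule obs_filter_law[OF \<sigma> f]) (use B\<Omega>(2) in \<open>force split: split_indicator\<close>)
      also have "\<dots> = (\<integral>\<^sup>+\<omega>. indicator ?B \<omega> * ennreal (stage_post \<tau> \<omega>) \<partial>M)"
      proof (rule nn_integral_cong)
        fix \<omega> assume "\<omega> \<in> space M"
        then have \<omega>: "\<omega> \<in> \<Omega>" by simp
        show "state_avg (obs_belief \<sigma> k \<omega>) (\<lambda>y. ?f (\<omega>, y)) = indicator ?B \<omega> * ennreal (stage_post \<tau> \<omega>)"
        proof (cases "\<omega> \<in> ?B")
          case True
          then have "stage_post \<tau> \<omega> = obs_belief \<sigma> k \<omega>" by (intro stage_post_eq[OF \<tau>1]) auto
          moreover have "(\<lambda>y. ?f (\<omega>, y)) = indicator {..0}" using True by (auto simp: fun_eq_iff)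
          ultimately show ?thesis using True state_avg_zero[OF obs_belief_range[OF \<sigma> \<omega>], of k] by simp
        next
          case False
          then show ?thesis by (simp add: state_avg_def)
        qed
      qed
      finally show ?thesis .
    qed
    \<comment> \<open>an integral over \<open>A\<close> is cut along the stages and \<open>\<tau> = \<infinity>\<close>\<close>
    have split: "(\<integral>\<^sup>+\<omega>. indicator A \<omega> * g \<omega> \<partial>M) =
        (\<integral>\<^sup>+\<omega>. indicator (A \<inter> {\<omega>\<in>\<Omega>. \<tau> \<omega> = \<infinity>}) \<omega> * g \<omega> \<partial>M) + (\<Sum>k. \<integral>\<^sup>+\<omega>. indicator (A \<inter> stage \<tau> k) \<omega> * g \<omega> \<partial>M)"
      if g [measurable]: "g \<in> borel_measurable M" for g
    proof -
      have T [measurable]: "{\<omega>\<in>\<Omega>. \<tau> \<omega> = \<infinity>} \<in> sets M"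
      proof -
        have "{\<omega>\<in>space M. \<tau> \<omega> = \<infinity>} \<in> sets M" by measurable
        then show ?thesis by simp
      qed
      have "(\<integral>\<^sup>+\<omega>. indicator A \<omega> * g \<omega> \<partial>M) =
        (\<integral>\<^sup>+\<omega>. indicator (A \<inter> {\<omega>\<in>\<Omega>. \<tau> \<omega> = \<infinity>}) \<omega> * g \<omega> + (\<Sum>k. indicator (A \<inter> stage \<tau> k) \<omega> * g \<omega>) \<partial>M)"
      proof (rule nn_integral_cong_AE, use cover in \<open>rule AE_mp\<close>, intro AE_I2 impI)
        fix \<omega> assume "\<omega> \<in> space M" and c: "\<tau> \<omega> = \<infinity> \<or> (\<exists>k. \<omega> \<in> stage \<tau> k)"
        then have \<omega>: "\<omega> \<in> \<Omega>" by simp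
        show "indicator A \<omega> * g \<omega> = indicator (A \<inter> {\<omega>\<in>\<Omega>. \<tau> \<omega> = \<infinity>}) \<omega> * g \<omega> + (\<Sum>k. indicator (A \<inter> stage \<tau> k) \<omega> * g \<omega>)"
        proof (cases "\<exists>k. \<omega> \<in> stage \<tau> k")
          case True
          then obtain k where k: "\<omega> \<in> stage \<tau> k" by auto
          have "\<tau> \<omega> < \<infinity>" using k unfolding stage_def[OF \<tau>1] by (auto intro: less_le_trans[OF _ top_greatest])
          then have n: "\<omega> \<notin> A \<inter> {\<omega>\<in>\<Omega>. \<tau> \<omega> = \<infinity>}" by auto
          have "(\<Sum>j. indicator (A \<inter> stage \<tau> j) \<omega> * g \<omega>) = (\<Sum>j\<in>{k}. indicator (A \<inter> stage \<tau> j) \<omega> * g \<omega>)"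
            by (rule suminf_finite) (auto dest: stage_disjoint[OF \<tau>1 k] split: split_indicator)
          also have "\<dots> = indicator (A \<inter> stage \<tau> k) \<omega> * g \<omega>"
          proof -
            have "sum F {k} = F k" for F :: "nat \<Rightarrow> ennreal" by simp
            then show ?thesis .
          qed
          also have "\<dots> = indicator A \<omega> * g \<omega>" using k by (auto split: split_indicator)
          finally show ?thesis using n by (simp only: indicator_simps) simp
        next
          case False
          then show ?thesis using c \<omega> by (auto split: split_indicator)
        qed
      qed
      also have "\<dots> = (\<integral>\<^sup>+\<omega>. indicator (A \<inter> {\<omega>\<in>\<Omega>. \<tau> \<omega> = \<infinity>}) \<omega> * g \<omega> \<partial>M) + (\<integral>\<^sup>+\<omega>. (\<Sum>k. indicator (A \<inter> stage \<tau> k) \<omega> * g \<omega>) \<partial>M)"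
        by (rule nn_integral_add) measurable
      also have "(\<integral>\<^sup>+\<omega>. (\<Sum>k. indicator (A \<inter> stage \<tau> k) \<omega> * g \<omega>) \<partial>M) = (\<Sum>k. \<integral>\<^sup>+\<omega>. indicator (A \<inter> stage \<tau> k) \<omega> * g \<omega> \<partial>M)"
        by (rule nn_integral_suminf) measurable
      finally show ?thesis .
    qed
    have inf: "(\<integral>\<^sup>+\<omega>. indicator (A \<inter> {\<omega>\<in>\<Omega>. \<tau> \<omega> = \<infinity>}) \<omega> * ennreal (indicator ?I \<omega>) \<partial>M) =
      (\<integral>\<^sup>+\<omega>. indicator (A \<inter> {\<omega>\<in>\<Omega>. \<tau> \<omega> = \<infinity>}) \<omega> * ennreal (stage_post \<tau> \<omega>) \<partial>M)"
      by (intro nn_integral_cong) (auto simp: stage_post_def[OF \<tau>1] split: split_indicator)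
    have m: "(\<lambda>\<omega>. ennreal (indicator ?I \<omega>)) \<in> borel_measurable M" "(\<lambda>\<omega>. ennreal (stage_post \<tau> \<omega>)) \<in> borel_measurable M"
      by measurable
    show ?thesis unfolding split[OF m(1)] split[OF m(2)] piece inf ..
  qed
  have int: "integrable M (indicator ?I :: 'a \<Rightarrow> real)"
    by (rule integrable_const_bound[where B=1]) (use I in \<open>auto split: split_indicator\<close>)
  have int2: "integrable M (stage_post \<tau>)"
    using stage_post_range[OF \<tau>1] by (intro integrable_const_bound[where B=1]) auto
  have "AE \<omega> in M. real_cond_exp M ?F (indicator ?I) \<omega> = stage_post \<tau> \<omega>"
  proof (rule P.real_cond_exp_charact[OF _ int int2 stage_post_measurable[OF \<tau>1]])
    fix A assume A: "A \<in> sets ?F"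
    have [measurable]: "A \<in> sets M" by (rule pre_sets_M[OF \<tau>1 A])
    have e: "(\<integral>\<omega>\<in>A. f \<omega> \<partial>M) = enn2real (\<integral>\<^sup>+\<omega>. indicator A \<omega> * ennreal (f \<omega>) \<partial>M)"
      if [measurable]: "f \<in> borel_measurable M" and f: "\<And>\<omega>. \<omega> \<in> \<Omega> \<Longrightarrow> 0 \<le> f \<omega>" for f
      unfolding set_lebesgue_integral_def using f
      by (subst integral_eq_nn_integral) (auto intro!: arg_cong[where f=enn2real] nn_integral_cong split: split_indicator)
    show "(\<integral>\<omega>\<in>A. indicator ?I \<omega> \<partial>M) = (\<integral>\<omega>\<in>A. stage_post \<tau> \<omega> \<partial>M)"
      using stage_post_range[OF \<tau>1] by (subst (1 2) e) (simp_all add: eq[OF A])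
  qed
  with st show ?thesis
    unfolding post by eventually_elim (metis stage_post_eq[OF \<tau>1])
qed

text \<open>
  Each observation time is itself an admissible stopping time.
\<close>

lemma posterior_seq:
  "AE \<omega> in M. \<forall>k. \<sigma> k \<omega> < \<infinity> \<longrightarrow> posterior D \<pi> \<sigma> (\<sigma> k) \<omega> = obs_belief \<sigma> k \<omega>"
  unfolding AE_all_countable
proof
  fix k
  have st: "\<sigma> k \<in> stop_times0 D \<pi> \<sigma>" using seq_stop_time by (auto simp: stop_times0_def)
  from posterior_stage[OF this]
  show "AE \<omega> in M. \<sigma> k \<omega> < \<infinity> \<longrightarrow> posterior D \<pi> \<sigma> (\<sigma> k) \<omega> = obs_belief \<sigma> k \<omega>"
  proof (rule AE_mp, intro AE_I2 impI)
    fix \<omega> assume "\<omega> \<in> space M" and f: "\<sigma> k \<omega> < \<infinity>"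
      and post: "\<forall>j. \<omega> \<in> stage (\<sigma> k) j \<longrightarrow> \<sigma> k \<omega> = \<sigma> j \<omega> \<and> posterior D \<pi> \<sigma> (\<sigma> k) \<omega> = obs_belief \<sigma> j \<omega>"
    then have \<omega>: "\<omega> \<in> \<Omega>" by simp
    have "\<omega> \<in> stage (\<sigma> k) k"
      unfolding stage_def[OF seq_stop_time] using \<omega> seq_less[OF \<sigma> \<omega> f] by blast
    from post[rule_format, OF this] show "posterior D \<pi> \<sigma> (\<sigma> k) \<omega> = obs_belief \<sigma> k \<omega>" by (rule conjunct2)
  qed
qed

end

end

section \<open>Cost accounting along a strategy\<close>

context detection begin

context
  fixes \<sigma> \<tau> assumes \<sigma>: "\<sigma> \<in> obs_seqs D" and \<tau>: "\<tau> \<in> stop_times D \<sigma>"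
begin

abbreviation "obs_k k \<equiv> obs_sigma D \<sigma> k"
abbreviation "R k \<equiv> reach \<sigma> \<tau> k"
abbreviation "Q k \<equiv> stage \<sigma> \<tau> k"
abbreviation "bel k \<equiv> obs_belief \<sigma> k"
abbreviation "tm k \<omega> \<equiv> enn2real (\<sigma> k \<omega>)"

lemma R_def: "R k = {\<omega>\<in>\<Omega>. \<sigma> k \<omega> < \<infinity> \<and> \<sigma> k \<omega> \<le> \<tau> \<omega>}" by (rule reach_def[OF \<sigma> \<tau>])
lemma Q_def: "Q k = {\<omega>\<in>\<Omega>. \<sigma> k \<omega> \<le> \<tau> \<omega> \<and> \<tau> \<omega> < \<sigma> (Suc k) \<omega>}" by (rule stage_def[OF \<sigma> \<tau>])

lemma R_0: "R 0 = \<Omega>" by (auto simp: R_def seq_0[OF \<sigma>])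

lemma R_Suc_subset: "R (Suc k) \<subseteq> R k"
  using seq_finite[OF \<sigma>] by (auto simp: R_def intro: order_trans[OF seq_le_Suc[OF \<sigma>]])

lemma R_mono: "i \<le> j \<Longrightarrow> R j \<subseteq> R i"
  by (rule lift_Suc_antimono_le[of R]) (auto intro: R_Suc_subset[THEN subsetD])

lemma R_finite: "\<omega> \<in> R k \<Longrightarrow> \<sigma> k \<omega> < \<infinity>" "\<omega> \<in> R k \<Longrightarrow> \<omega> \<in> \<Omega>" by (auto simp: R_def)

lemma R_obs: "R k \<in> sets (obs_k k)" "R (Suc k) \<in> sets (obs_k k)" "R k - R (Suc k) \<in> sets (obs_k k)"
  using reach_obs[OF \<sigma> \<tau>, of k] by auto

lemma Q_obs: "Q k \<in> sets (obs_k k)" by (rule stage_obs[OF \<sigma> \<tau>])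

lemma R_M [measurable]: "R k \<in> sets M" "Q k \<in> sets M"
  using obs_sets_M[OF \<sigma>] R_obs Q_obs by auto

lemma Q_R: "Q k \<subseteq> R k - R (Suc k)" by (rule stage_sub_reach[OF \<sigma> \<tau>])

lemma R_diff_Q: "\<omega> \<in> R k - R (Suc k) \<Longrightarrow> \<tau> \<omega> < \<infinity> \<Longrightarrow> \<omega> \<in> Q k"
  by (cases "\<sigma> (Suc k) \<omega> = \<infinity>") (auto simp: R_def Q_def less_top[symmetric] not_le)

lemma bel_range: "\<omega> \<in> \<Omega> \<Longrightarrow> bel k \<omega> \<in> {0..1}" by (rule obs_belief_range[OF \<sigma>])

lemma gap_positive: "\<omega> \<in> R (Suc k) \<Longrightarrow> 0 < tm (Suc k) \<omega> - tm k \<omega>"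
  using gap_pos[OF real_times_predictable[OF \<sigma>], of \<omega> k] gap_eq[OF \<sigma>, of \<omega> k] R_finite[of \<omega> "Suc k"] by simp

lemma F_bel_measurable: "(\<lambda>\<omega>. F_fun D (bel k \<omega>)) \<in> borel_measurable (obs_k k)"
proof -
  have "(\<lambda>\<omega>. (\<lambda>p. if p \<in> {0..1} then F_fun D p else 0) (bel k \<omega>)) \<in> borel_measurable (obs_k k)"
    by (rule measurable_compose[OF obs_belief_obs[OF \<sigma>] F_fun_measurable])
  then show ?thesis by (rule measurable_cong[THEN iffD1, rotated]) (use bel_range in simp)
qed

lemma tm_obs: "i \<le> Suc k \<Longrightarrow> (\<lambda>\<omega>. tm i \<omega>) \<in> borel_measurable (obs_k k)"
  by (rule borel_measurable_enn2real[OF seq_obs[OF \<sigma>]])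

lemma delay_measurable [measurable (raw)]:
  assumes [measurable]: "f \<in> borel_measurable N" "g \<in> borel_measurable N"
  shows "(\<lambda>x. delay (f x) (g x)) \<in> borel_measurable N"
  unfolding delay_def by measurable

lemma delay_bel_measurable: "(\<lambda>\<omega>. delay (tm (Suc k) \<omega> - tm k \<omega>) (bel k \<omega>)) \<in> borel_measurable (obs_k k)"
  by (intro delay_measurable borel_measurable_diff tm_obs obs_belief_obs[OF \<sigma>]) auto

lemmas bel_M = obs_M[OF \<sigma> obs_belief_obs[OF \<sigma>]]

lemma F_bel_M: "(\<lambda>\<omega>. F_fun D (bel k \<omega>)) \<in> borel_measurable M"
  by (rule obs_M[OF \<sigma> F_bel_measurable])

lemma tm_M: "(\<lambda>\<omega>. tm k \<omega>) \<in> borel_measurable M"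
  by (rule obs_M[OF \<sigma> tm_obs[of k k]]) simp

lemma delay_bel_M: "(\<lambda>\<omega>. delay (tm (Suc k) \<omega> - tm k \<omega>) (bel k \<omega>)) \<in> borel_measurable M"
  by (rule obs_M[OF \<sigma> delay_bel_measurable])

text \<open>
  The expected cost is distributed over the observations. \<open>stop_part k\<close> is paid if the \<open>k\<close>-th observation is the last,
  \<open>move_part k\<close> for the delay up to the next observation and for that observation; \<open>val_part k\<close> is the value
  that is still to be paid after the \<open>k\<close>-th observation.
\<close>

definition stop_part :: "nat \<Rightarrow> ennreal" where
  "stop_part k = (\<integral>\<^sup>+\<omega>. indicator (R k - R (Suc k)) \<omega> * ennreal (F_fun D (bel k \<omega>)) \<partial>M)"

definition move_part :: "nat \<Rightarrow> ennreal" where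
  "move_part k = (\<integral>\<^sup>+\<omega>. indicator (R (Suc k)) \<omega> * ennreal (dd + cc * delay (tm (Suc k) \<omega> - tm k \<omega>) (bel k \<omega>)) \<partial>M)"

definition val_part :: "nat \<Rightarrow> ennreal" where
  "val_part k = (\<integral>\<^sup>+\<omega>. indicator (R k) \<omega> * ennreal (val (bel k \<omega>)) \<partial>M)"

lemma val_part_split:
  "val_part k = (\<integral>\<^sup>+\<omega>. indicator (R k - R (Suc k)) \<omega> * ennreal (val (bel k \<omega>)) \<partial>M) +
     (\<integral>\<^sup>+\<omega>. indicator (R (Suc k)) \<omega> * ennreal (val (bel k \<omega>)) \<partial>M)"
proof -
  note [measurable] = bel_M[of k]
  have "val_part k = (\<integral>\<^sup>+\<omega>. indicator (R k - R (Suc k)) \<omega> * ennreal (val (bel k \<omega>)) + indicator (R (Suc k)) \<omega> * ennreal (val (bel k \<omega>)) \<partial>M)"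
    unfolding val_part_def using R_Suc_subset[of k] by (intro nn_integral_cong) (auto split: split_indicator)
  also have "\<dots> = (\<integral>\<^sup>+\<omega>. indicator (R k - R (Suc k)) \<omega> * ennreal (val (bel k \<omega>)) \<partial>M) +
     (\<integral>\<^sup>+\<omega>. indicator (R (Suc k)) \<omega> * ennreal (val (bel k \<omega>)) \<partial>M)"
    by (rule nn_integral_add) measurable
  finally show ?thesis .
qed

text \<open>
  Averaging the next value over the next observation completes the moving part to \<open>obs_value\<close>.
\<close>

lemma move_val_part:
  "move_part k + val_part (Suc k) =
     (\<integral>\<^sup>+\<omega>. indicator (R (Suc k)) \<omega> * ennreal (obs_value val (tm (Suc k) \<omega> - tm k \<omega>) (bel k \<omega>)) \<partial>M)"
proof -
  note [measurable] = delay_bel_M[of k] bel_M[of k] tm_M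
  have nm: "(\<lambda>\<omega>. next_avg val (tm (Suc k) \<omega> - tm k \<omega>) (bel k \<omega>)) \<in> borel_measurable M"
    unfolding next_avg_def by measurable
  have "val_part (Suc k) = (\<integral>\<^sup>+\<omega>. indicator (R (Suc k)) \<omega> * ennreal (next_avg val (tm (Suc k) \<omega> - tm k \<omega>) (bel k \<omega>)) \<partial>M)"
    unfolding val_part_def by (rule obs_gain_law[OF \<sigma> R_obs(2) R_finite(1) val_unit])
  then have "move_part k + val_part (Suc k) =
     (\<integral>\<^sup>+\<omega>. indicator (R (Suc k)) \<omega> * ennreal (dd + cc * delay (tm (Suc k) \<omega> - tm k \<omega>) (bel k \<omega>)) +
          indicator (R (Suc k)) \<omega> * ennreal (next_avg val (tm (Suc k) \<omega> - tm k \<omega>) (bel k \<omega>)) \<partial>M)"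
    unfolding move_part_def using nm by (subst nn_integral_add) auto
  also have "\<dots> = (\<integral>\<^sup>+\<omega>. indicator (R (Suc k)) \<omega> * ennreal (obs_value val (tm (Suc k) \<omega> - tm k \<omega>) (bel k \<omega>)) \<partial>M)"
  proof (rule nn_integral_cong)
    fix \<omega>
    show "indicator (R (Suc k)) \<omega> * ennreal (dd + cc * delay (tm (Suc k) \<omega> - tm k \<omega>) (bel k \<omega>)) +
          indicator (R (Suc k)) \<omega> * ennreal (next_avg val (tm (Suc k) \<omega> - tm k \<omega>) (bel k \<omega>)) =
          indicator (R (Suc k)) \<omega> * ennreal (obs_value val (tm (Suc k) \<omega> - tm k \<omega>) (bel k \<omega>))"
    proof (cases "\<omega> \<in> R (Suc k)")
      case True
      note g = gap_positive[OF True] and b = bel_range[OF R_finite(2)[OF True], of k]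
      have "0 \<le> cc * delay (tm (Suc k) \<omega> - tm k \<omega>) (bel k \<omega>)"
        using delay_pos g by (intro mult_nonneg_nonneg delay_nonneg b) auto
      then show ?thesis using True next_avg_integrable(3)[OF g b val_unit] obs_pos
        by (simp add: obs_value_def ennreal_plus[symmetric] del: ennreal_plus)
    qed simp
  qed
  finally show ?thesis .
qed

text \<open>
  The dynamic programming equation, used as two inequalities: \<open>val \<le> F\<close> where the strategy stops and
  \<open>val \<le> obs_value\<close> where it goes on.
\<close>

lemma val_part_step: "val_part k \<le> stop_part k + move_part k + val_part (Suc k)"
proof -
  have "(\<integral>\<^sup>+\<omega>. indicator (R k - R (Suc k)) \<omega> * ennreal (val (bel k \<omega>)) \<partial>M) \<le> stop_part k"
    unfolding stop_part_def
    by (intro nn_integral_mono mult_left_mono ennreal_leI val_le_F bel_range) auto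
  moreover have "(\<integral>\<^sup>+\<omega>. indicator (R (Suc k)) \<omega> * ennreal (val (bel k \<omega>)) \<partial>M) \<le> move_part k + val_part (Suc k)"
    unfolding move_val_part
    by (intro nn_integral_mono) (auto split: split_indicator intro!: ennreal_leI val_le_obs gap_positive bel_range)
  ultimately show ?thesis unfolding val_part_split[of k] by (simp add: add_mono add.assoc)
qed

lemma val_part_0: "val_part 0 = ennreal (val \<pi>)"
proof -
  have "val_part 0 = (\<integral>\<^sup>+\<omega>. ennreal (val \<pi>) \<partial>M)"
    unfolding val_part_def by (intro nn_integral_cong) (simp add: R_0)
  then show ?thesis using emeasure_space_1 by simp
qed

lemma val_le_partial: "ennreal (val \<pi>) \<le> (\<Sum>k<n. stop_part k + move_part k) + val_part n"
proof (induction n)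
  case 0
  then show ?case by (simp add: val_part_0)
next
  case (Suc n)
  have "(\<Sum>k<n. stop_part k + move_part k) + val_part n \<le>
     (\<Sum>k<n. stop_part k + move_part k) + (stop_part n + move_part n + val_part (Suc n))"
    by (intro add_left_mono val_part_step)
  from order_trans[OF Suc this] show ?case by (simp add: add.assoc)
qed

lemma val_part_le: "val_part k \<le> emeasure M (R k)"
proof -
  have "val_part k \<le> (\<integral>\<^sup>+\<omega>. indicator (R k) \<omega> \<partial>M)"
    unfolding val_part_def using val_le_1 by (intro nn_integral_mono) (auto simp: ennreal_le_1 split: split_indicator)
  then show ?thesis by simp
qed

text \<open>
  Each observation costs \<open>dd\<close>, so the probabilities of making the \<open>k\<close>-th one are summable if the cost is
  finite.
\<close>

lemma reach_vanishes:
  assumes "(\<Sum>k. stop_part k + move_part k) < \<infinity>"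
  shows "(\<lambda>k. emeasure M (R k)) \<longlonglongrightarrow> 0"
proof -
  have 1: "ennreal dd * emeasure M (R (Suc k)) \<le> stop_part k + move_part k" for k
  proof -
    have "ennreal dd * emeasure M (R (Suc k)) = (\<integral>\<^sup>+\<omega>. ennreal dd * indicator (R (Suc k)) \<omega> \<partial>M)"
      by (rule nn_integral_cmult_indicator[symmetric]) (rule R_M)
    also have "\<dots> \<le> move_part k"
      unfolding move_part_def
    proof (rule nn_integral_mono)
      fix \<omega>
      show "ennreal dd * indicator (R (Suc k)) \<omega> \<le> indicator (R (Suc k)) \<omega> * ennreal (dd + cc * delay (tm (Suc k) \<omega> - tm k \<omega>) (bel k \<omega>))"
      proof (cases "\<omega> \<in> R (Suc k)")
        case True
        have "0 \<le> cc * delay (tm (Suc k) \<omega> - tm k \<omega>) (bel k \<omega>)"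
          using delay_pos gap_positive[OF True] by (intro mult_nonneg_nonneg delay_nonneg bel_range[OF R_finite(2)[OF True]]) auto
        then show ?thesis using True by (simp add: ennreal_leI)
      qed simp
    qed
    also have "\<dots> \<le> stop_part k + move_part k" by simp
    finally show ?thesis .
  qed
  have "(\<Sum>k. ennreal dd * emeasure M (R (Suc k))) < \<infinity>"
    by (rule le_less_trans[OF _ assms]) (rule suminf_le[OF 1], auto)
  then have "ennreal dd * (\<Sum>k. emeasure M (R (Suc k))) < \<infinity>" by simp
  then have fin: "(\<Sum>k. emeasure M (R (Suc k))) < \<infinity>"
    using obs_pos by (auto simp: ennreal_mult_less_top)
  have "(\<Sum>k. ennreal (measure M (R (Suc k)))) \<noteq> \<infinity>"
    using fin by (simp add: emeasure_eq_measure less_top[symmetric])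
  then have "summable (\<lambda>k. measure M (R (Suc k)))"
    by (intro summable_suminf_not_top) (auto simp: infinity_ennreal_def)
  then have "(\<lambda>k. measure M (R (Suc k))) \<longlonglongrightarrow> 0" by (rule summable_LIMSEQ_zero)
  then have "(\<lambda>k. measure M (R k)) \<longlonglongrightarrow> 0" by (rule LIMSEQ_imp_Suc)
  then show ?thesis unfolding emeasure_eq_measure using tendsto_ennrealI[of "\<lambda>k. measure M (R k)" 0] by simp
qed

lemma val_le_total: "ennreal (val \<pi>) \<le> (\<Sum>k. stop_part k + move_part k)"
proof (cases "(\<Sum>k. stop_part k + move_part k) < \<infinity>")
  case True
  have "(\<lambda>n. (\<Sum>k<n. stop_part k + move_part k) + emeasure M (R n)) \<longlonglongrightarrow> (\<Sum>k. stop_part k + move_part k) + 0"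
    by (intro tendsto_add reach_vanishes[OF True] summable_LIMSEQ) auto
  moreover have "ennreal (val \<pi>) \<le> (\<Sum>k<n. stop_part k + move_part k) + emeasure M (R n)" for n
    using val_le_partial[of n] add_left_mono[OF val_part_le[of n], of "\<Sum>k<n. stop_part k + move_part k"] by (rule order_trans)
  ultimately show ?thesis by (intro LIMSEQ_le_const[where X="\<lambda>n. (\<Sum>k<n. stop_part k + move_part k) + emeasure M (R n)"]) auto
next
  case False
  then show ?thesis by (simp add: not_less top_unique)
qed

text \<open>
  If the strategy stops only where \<open>val = F\<close> and waits for minimisers of \<open>obs_value\<close>, every step is an
  equality.
\<close>

lemma total_le_val:
  assumes stop: "\<And>k \<omega>. \<omega> \<in> R k - R (Suc k) \<Longrightarrow> F_fun D (bel k \<omega>) = val (bel k \<omega>)"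
    and move: "\<And>k \<omega>. \<omega> \<in> R (Suc k) \<Longrightarrow> obs_value val (tm (Suc k) \<omega> - tm k \<omega>) (bel k \<omega>) = val (bel k \<omega>)"
  shows "(\<Sum>k. stop_part k + move_part k) \<le> ennreal (val \<pi>)"
proof (rule suminf_le_const)
  have step: "val_part k = stop_part k + move_part k + val_part (Suc k)" for k
  proof -
    have "(\<integral>\<^sup>+\<omega>. indicator (R k - R (Suc k)) \<omega> * ennreal (val (bel k \<omega>)) \<partial>M) = stop_part k"
      unfolding stop_part_def using stop by (intro nn_integral_cong) (auto split: split_indicator)
    moreover have "(\<integral>\<^sup>+\<omega>. indicator (R (Suc k)) \<omega> * ennreal (val (bel k \<omega>)) \<partial>M) = move_part k + val_part (Suc k)"
      unfolding move_val_part using move by (intro nn_integral_cong) (auto split: split_indicator)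
    ultimately show ?thesis unfolding val_part_split[of k] by (simp add: add.assoc)
  qed
  have "ennreal (val \<pi>) = (\<Sum>k<n. stop_part k + move_part k) + val_part n" for n
  proof (induction n)
    case (Suc n)
    then show ?case using step[of n] by (simp add: add.assoc)
  qed (simp add: val_part_0)
  then show "(\<Sum>k<n. stop_part k + move_part k) \<le> ennreal (val \<pi>)" for n
    by (metis add_increasing2 order_refl zero_le)
qed auto

abbreviation "lagk k \<omega> \<equiv> max 0 (\<Theta> \<omega> - tm k \<omega>)"
abbreviation "late k \<omega> \<equiv> enn2real (\<tau> \<omega>) - tm k \<omega>"

text \<open>
  The same distribution of the cost for each sample point, before conditioning on the observations.
\<close>

definition stop_term :: "nat \<Rightarrow> 'a \<Rightarrow> ennreal" where
  "stop_term k \<omega> = indicator (Q k) \<omega> * (indicator {late k \<omega><..} (lagk k \<omega>) + ennreal cc * ennreal (max 0 (late k \<omega> - lagk k \<omega>)))"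

definition move_term :: "nat \<Rightarrow> 'a \<Rightarrow> ennreal" where
  "move_term k \<omega> = indicator (R (Suc k)) \<omega> * (ennreal dd + ennreal cc * ennreal (max 0 (tm (Suc k) \<omega> - tm k \<omega> - lagk k \<omega>)))"

lemma late_obs: "(\<lambda>\<omega>. indicator (Q k) \<omega> * late k \<omega>) \<in> borel_measurable (obs_k k)"
proof -
  have "(\<lambda>\<omega>. indicator (Q k) \<omega> * (enn2real (if \<omega> \<in> Q k then \<tau> \<omega> else 0) - tm k \<omega>)) \<in> borel_measurable (obs_k k)"
    by (intro borel_measurable_times borel_measurable_indicator Q_obs borel_measurable_diff
        borel_measurable_enn2real stop_stage_measurable[OF \<sigma> \<tau>] tm_obs) simp
  moreover have "(\<lambda>\<omega>. indicator (Q k) \<omega> * (enn2real (if \<omega> \<in> Q k then \<tau> \<omega> else 0) - tm k \<omega>)) = (\<lambda>\<omega>. indicator (Q k) \<omega> * late k \<omega>)"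
    by (auto split: split_indicator)
  ultimately show ?thesis by simp
qed

lemma late_nonneg: "\<omega> \<in> Q k \<Longrightarrow> 0 \<le> late k \<omega>"
proof -
  assume "\<omega> \<in> Q k"
  then have "\<sigma> k \<omega> \<le> \<tau> \<omega>" "\<tau> \<omega> < \<infinity>" unfolding Q_def by (auto intro: less_le_trans[OF _ top_greatest])
  then show ?thesis by (simp add: enn2real_mono)
qed

text \<open>
  Conditioning on the first \<open>k\<close> observations turns the realised cost of stopping into \<open>stop_cost\<close> of the belief.
\<close>

lemma stop_term_integral:
  "(\<integral>\<^sup>+\<omega>. stop_term k \<omega> \<partial>M) = (\<integral>\<^sup>+\<omega>. indicator (Q k) \<omega> * ennreal (stop_cost (late k \<omega>) (bel k \<omega>)) \<partial>M)"
proof -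
  define r where "r = (\<lambda>\<omega>. indicator (Q k) \<omega> * late k \<omega>)"
  note late_obs[of k, folded r_def, measurable] Q_obs[of k, measurable]
  define f where "f z = indicator (Q k) (fst z) * (indicator {r (fst z)<..} (snd z) + ennreal cc * ennreal (max 0 (r (fst z) - snd z)))" for z :: "'a \<times> real"
  have "Measurable.pred (obs_k k \<Otimes>\<^sub>M borel) (\<lambda>z. r (fst z) < snd z)" by measurable
  then have "(\<lambda>z. if r (fst z) < snd z then 1 else 0 :: ennreal) \<in> borel_measurable (obs_k k \<Otimes>\<^sub>M borel)"
    by measurable
  moreover have "(\<lambda>z. if r (fst z) < snd z then 1 else 0 :: ennreal) = (\<lambda>z. indicator {r (fst z)<..} (snd z))"
    by (auto simp: fun_eq_iff)
  ultimately have [measurable]: "(\<lambda>z. indicator {r (fst z)<..} (snd z) :: ennreal) \<in> borel_measurable (obs_k k \<Otimes>\<^sub>M borel)"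
    by simp
  have f: "f \<in> borel_measurable (obs_k k \<Otimes>\<^sub>M borel)" unfolding f_def by measurable
  have "(\<integral>\<^sup>+\<omega>. stop_term k \<omega> \<partial>M) = (\<integral>\<^sup>+\<omega>. f (\<omega>, lagk k \<omega>) \<partial>M)"
    by (intro nn_integral_cong) (auto simp: stop_term_def f_def r_def split: split_indicator)
  also have "\<dots> = (\<integral>\<^sup>+\<omega>. state_avg (bel k \<omega>) (\<lambda>y. f (\<omega>, y)) \<partial>M)"
    by (rule obs_filter_law[OF \<sigma> f]) (use Q_R[of k] in \<open>auto simp: f_def R_def split: split_indicator\<close>)
  also have "\<dots> = (\<integral>\<^sup>+\<omega>. indicator (Q k) \<omega> * ennreal (stop_cost (late k \<omega>) (bel k \<omega>)) \<partial>M)"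
  proof (rule nn_integral_cong)
    fix \<omega> assume "\<omega> \<in> space M"
    then have \<omega>: "\<omega> \<in> \<Omega>" by simp
    show "state_avg (bel k \<omega>) (\<lambda>y. f (\<omega>, y)) = indicator (Q k) \<omega> * ennreal (stop_cost (late k \<omega>) (bel k \<omega>))"
    proof (cases "\<omega> \<in> Q k")
      case True
      let ?l = "late k \<omega>" and ?b = "bel k \<omega>"
      note l = late_nonneg[OF True] and b = bel_range[OF \<omega>, of k]
      have "state_avg ?b (\<lambda>y. f (\<omega>, y)) = state_avg ?b (\<lambda>y. indicator {?l<..} y + ennreal cc * ennreal (max 0 (?l - y)))"
        using True by (simp add: f_def r_def)
      also have "\<dots> = state_avg ?b (indicator {?l<..}) + ennreal cc * state_avg ?b (\<lambda>y. ennreal (max 0 (?l - y)))"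
        unfolding state_avg_def by (subst nn_integral_add) (auto simp: nn_integral_cmult distrib_left mult_ac add_ac)
      also have "\<dots> = ennreal (stop_cost ?l ?b)"
        unfolding state_avg_survival[OF l b] state_avg_delay[OF l b] stop_cost_def
        using b delay_pos delay_nonneg[OF l b] by (simp add: ennreal_mult ennreal_plus)
      finally show ?thesis using True by simp
    qed (simp add: f_def state_avg_def)
  qed
  finally show ?thesis .
qed

lemma move_term_integral: "(\<integral>\<^sup>+\<omega>. move_term k \<omega> \<partial>M) = move_part k"
proof -
  let ?g = "\<lambda>\<omega>. tm (Suc k) \<omega> - tm k \<omega>"
  have [measurable]: "?g \<in> borel_measurable (obs_k k)" by (intro borel_measurable_diff tm_obs) auto
  note R_obs(2)[of k, measurable]
  define f where "f z = indicator (R (Suc k)) (fst z) * (ennreal dd + ennreal cc * ennreal (max 0 (?g (fst z) - snd z)))" for z :: "'a \<times> real"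
  have f: "f \<in> borel_measurable (obs_k k \<Otimes>\<^sub>M borel)" unfolding f_def by measurable
  have "(\<integral>\<^sup>+\<omega>. move_term k \<omega> \<partial>M) = (\<integral>\<^sup>+\<omega>. f (\<omega>, lagk k \<omega>) \<partial>M)"
    by (intro nn_integral_cong) (simp add: move_term_def f_def)
  also have "\<dots> = (\<integral>\<^sup>+\<omega>. state_avg (bel k \<omega>) (\<lambda>y. f (\<omega>, y)) \<partial>M)"
    by (rule obs_filter_law[OF \<sigma> f]) (use R_Suc_subset[of k] in \<open>auto simp: f_def R_def split: split_indicator\<close>)
  also have "\<dots> = move_part k"
    unfolding move_part_def
  proof (rule nn_integral_cong)
    fix \<omega> assume "\<omega> \<in> space M"
    then have \<omega>: "\<omega> \<in> \<Omega>" by simp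
    show "state_avg (bel k \<omega>) (\<lambda>y. f (\<omega>, y)) = indicator (R (Suc k)) \<omega> * ennreal (dd + cc * delay (?g \<omega>) (bel k \<omega>))"
    proof (cases "\<omega> \<in> R (Suc k)")
      case True
      let ?b = "bel k \<omega>"
      have l: "0 \<le> ?g \<omega>" using gap_positive[OF True] by simp
      note b = bel_range[OF \<omega>, of k]
      have "state_avg ?b (\<lambda>y. f (\<omega>, y)) = state_avg ?b (\<lambda>y. ennreal dd + ennreal cc * ennreal (max 0 (?g \<omega> - y)))"
        using True by (simp add: f_def)
      also have "\<dots> = state_avg ?b (\<lambda>y. ennreal dd) + ennreal cc * state_avg ?b (\<lambda>y. ennreal (max 0 (?g \<omega> - y)))"
        unfolding state_avg_def by (subst nn_integral_add) (auto simp: nn_integral_cmult distrib_left mult_ac add_ac)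
      also have "\<dots> = ennreal (dd + cc * delay (?g \<omega>) ?b)"
        unfolding state_avg_const[OF b] state_avg_delay[OF l b]
        using obs_pos delay_pos delay_nonneg[OF l b] by (simp add: ennreal_mult ennreal_plus)
      finally show ?thesis using True by simp
    qed (simp add: f_def state_avg_def)
  qed
  finally show ?thesis .
qed

lemma reach_iff_stage: "\<omega> \<in> Q n \<Longrightarrow> \<omega> \<in> R j \<longleftrightarrow> j \<le> n"
  using R_mono[of j n] R_mono[of "Suc n" j] Q_R[of n] by (cases "j \<le> n") auto

lemma Q_unique: "\<omega> \<in> Q n \<Longrightarrow> \<omega> \<in> Q j \<longleftrightarrow> j = n"
  using stage_disjoint[OF \<sigma> \<tau>] by auto

text \<open>
  The delay after the \<open>k\<close>-th observation, measured with the time left until the change, is the increase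
  of \<open>(t - \<Theta>)\<^sup>+\<close>; these increases add up.
\<close>

lemma delay_telescope:
  assumes \<omega>: "\<omega> \<in> \<Omega>" and fin: "\<tau> \<omega> < \<infinity>"
  shows "(\<Sum>k<n. indicator (Q k) \<omega> * max 0 (late k \<omega> - lagk k \<omega>) + indicator (R (Suc k)) \<omega> * max 0 (tm (Suc k) \<omega> - tm k \<omega> - lagk k \<omega>)) =
    max 0 ((if \<omega> \<in> R n then tm n \<omega> else enn2real (\<tau> \<omega>)) - \<Theta> \<omega>)"
proof (induction n)
  case 0
  then show ?case using \<omega> change_time_nonneg[OF \<omega>] by (simp add: R_0 seq_0[OF \<sigma>])
next
  case (Suc n)
  consider "\<omega> \<notin> R n" | "\<omega> \<in> R (Suc n)" | "\<omega> \<in> R n - R (Suc n)" by blast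
  then show ?case
  proof cases
    case 1
    then have "\<omega> \<notin> R (Suc n)" "\<omega> \<notin> Q n" using R_Suc_subset[of n] Q_R[of n] by auto
    then show ?thesis using 1 Suc by simp
  next
    case 2
    then have "\<omega> \<in> R n" "\<omega> \<notin> Q n" using R_Suc_subset[of n] Q_R[of n] by auto
    then show ?thesis using 2 Suc gap_positive[OF 2] by (simp add: max_def)
  next
    case 3
    then have Q: "\<omega> \<in> Q n" using R_diff_Q fin by blast
    then show ?thesis using 3 Suc late_nonneg[OF Q] by (simp add: max_def)
  qed
qed

lemma count_eq:
  assumes \<omega>: "\<omega> \<in> \<Omega>" and fin: "\<tau> \<omega> < \<infinity>"
  shows "of_bool (\<sigma> (Suc k) \<omega> \<le> \<tau> \<omega>) = (indicator (R (Suc k)) \<omega> :: ennreal)"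
  using \<omega> fin by (auto simp: R_def split: split_indicator intro: le_less_trans)

lemma overshoot_eq:
  assumes \<omega>: "\<omega> \<in> \<Omega>" and fin: "\<tau> \<omega> < \<infinity>"
  shows "\<tau> \<omega> - ennreal (\<Theta> \<omega>) = ennreal (max 0 (enn2real (\<tau> \<omega>) - \<Theta> \<omega>))"
    "\<tau> \<omega> < ennreal (\<Theta> \<omega>) \<longleftrightarrow> enn2real (\<tau> \<omega>) < \<Theta> \<omega>"
proof -
  obtain r where r: "\<tau> \<omega> = ennreal r" "0 \<le> r" using fin by (cases "\<tau> \<omega>") auto
  show "\<tau> \<omega> - ennreal (\<Theta> \<omega>) = ennreal (max 0 (enn2real (\<tau> \<omega>) - \<Theta> \<omega>))"
    unfolding r(1) using r(2) change_time_nonneg[OF \<omega>] by (simp add: ennreal_minus max_def ennreal_neg)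
  show "\<tau> \<omega> < ennreal (\<Theta> \<omega>) \<longleftrightarrow> enn2real (\<tau> \<omega>) < \<Theta> \<omega>"
    unfolding r(1) using r(2) by (simp add: ennreal_less_iff)
qed

lemma late_lag: "\<omega> \<in> Q k \<Longrightarrow> lagk k \<omega> \<in> {late k \<omega><..} \<longleftrightarrow> enn2real (\<tau> \<omega>) < \<Theta> \<omega>"
  using late_nonneg[of \<omega> k] by auto

abbreviation "cost_at \<omega> \<equiv> indicator {\<omega>\<in>\<Omega>. \<tau> \<omega> < ennreal (\<Theta> \<omega>)} \<omega> +
   (ennreal cc * (\<tau> \<omega> - ennreal (\<Theta> \<omega>)) + ennreal dd * (\<Sum>k. of_bool (\<sigma> (Suc k) \<omega> \<le> \<tau> \<omega>)))"

lemma terms_sum: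
  assumes \<omega>: "\<omega> \<in> \<Omega>" and fin: "\<tau> \<omega> < \<infinity>"
  shows "(\<Sum>k<n. stop_term k \<omega> + move_term k \<omega>) =
    indicator (\<Union>k<n. Q k) \<omega> * indicator {\<omega>\<in>\<Omega>. \<tau> \<omega> < ennreal (\<Theta> \<omega>)} \<omega> +
    (ennreal cc * ennreal (max 0 ((if \<omega> \<in> R n then tm n \<omega> else enn2real (\<tau> \<omega>)) - \<Theta> \<omega>)) +
     ennreal dd * (\<Sum>k<n. of_bool (\<sigma> (Suc k) \<omega> \<le> \<tau> \<omega>)))"
proof -
  let ?I = "indicator {\<omega>\<in>\<Omega>. \<tau> \<omega> < ennreal (\<Theta> \<omega>)} \<omega> :: ennreal"
  let ?a = "\<lambda>k. indicator (Q k) \<omega> * max 0 (late k \<omega> - lagk k \<omega>) + indicator (R (Suc k)) \<omega> * max 0 (tm (Suc k) \<omega> - tm k \<omega> - lagk k \<omega>)"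
  have "stop_term k \<omega> + move_term k \<omega> = indicator (Q k) \<omega> * ?I + (ennreal cc * ennreal (?a k) + ennreal dd * of_bool (\<sigma> (Suc k) \<omega> \<le> \<tau> \<omega>))" for k
  proof -
    have "\<not> (\<omega> \<in> Q k \<and> \<omega> \<in> R (Suc k))" using Q_R[of k] by auto
    then consider "\<omega> \<in> Q k" "\<omega> \<notin> R (Suc k)" | "\<omega> \<notin> Q k" "\<omega> \<in> R (Suc k)" | "\<omega> \<notin> Q k" "\<omega> \<notin> R (Suc k)" by blast
    then show ?thesis
    proof cases
      case 1
      have "indicator {late k \<omega><..} (lagk k \<omega>) = ?I"
        using late_lag[OF 1(1)] overshoot_eq(2)[OF \<omega> fin] \<omega> by (simp add: indicator_def)
      then show ?thesis using 1 by (simp add: stop_term_def move_term_def count_eq[OF \<omega> fin])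
    next
      case 2
      then show ?thesis by (simp add: stop_term_def move_term_def count_eq[OF \<omega> fin] add.commute)
    next
      case 3
      then show ?thesis by (simp add: stop_term_def move_term_def count_eq[OF \<omega> fin])
    qed
  qed
  then have "(\<Sum>k<n. stop_term k \<omega> + move_term k \<omega>) =
     (\<Sum>k<n. indicator (Q k) \<omega>) * ?I + (ennreal cc * (\<Sum>k<n. ennreal (?a k)) + ennreal dd * (\<Sum>k<n. of_bool (\<sigma> (Suc k) \<omega> \<le> \<tau> \<omega>)))"
    by (simp only: sum.distrib sum_distrib_left sum_distrib_right)
  also have "(\<Sum>k<n. ennreal (?a k)) = ennreal (\<Sum>k<n. ?a k)" by (intro sum_ennreal) auto
  also note delay_telescope[OF \<omega> fin]
  also have "(\<Sum>k<n. indicator (Q k) \<omega> :: ennreal) = indicator (\<Union>k<n. Q k) \<omega>"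
  proof (cases "\<omega> \<in> (\<Union>k<n. Q k)")
    case True
    then obtain j where j: "j < n" "\<omega> \<in> Q j" by auto
    have "(\<Sum>k<n. indicator (Q k) \<omega> :: ennreal) = (\<Sum>k<n. if k = j then 1 else 0)"
      using Q_unique[OF j(2)] by (intro sum.cong) (auto split: split_indicator)
    then show ?thesis using True j by simp
  qed (auto intro!: sum.neutral split: split_indicator)
  finally show ?thesis .
qed

text \<open>
  Only an inequality: where infinitely many observations precede \<open>\<tau>\<close>, no stage is entered and the terms miss the false
  alarm and part of the delay.
\<close>

lemma terms_le_cost:
  assumes \<omega>: "\<omega> \<in> \<Omega>" and fin: "\<tau> \<omega> < \<infinity>"
  shows "(\<Sum>k. stop_term k \<omega> + move_term k \<omega>) \<le> cost_at \<omega>"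
proof (rule suminf_le_const)
  show "(\<Sum>k<n. stop_term k \<omega> + move_term k \<omega>) \<le> cost_at \<omega>" for n
    unfolding terms_sum[OF \<omega> fin] overshoot_eq(1)[OF \<omega> fin]
  proof (intro add_mono mult_left_mono ennreal_leI)
    have "tm n \<omega> \<le> enn2real (\<tau> \<omega>)" if "\<omega> \<in> R n"
      using that fin by (auto simp: R_def intro!: enn2real_mono)
    then show "max 0 ((if \<omega> \<in> R n then tm n \<omega> else enn2real (\<tau> \<omega>)) - \<Theta> \<omega>) \<le> max 0 (enn2real (\<tau> \<omega>) - \<Theta> \<omega>)" by auto
    show "(\<Sum>k<n. of_bool (\<sigma> (Suc k) \<omega> \<le> \<tau> \<omega>)) \<le> (\<Sum>k. of_bool (\<sigma> (Suc k) \<omega> \<le> \<tau> \<omega>) :: ennreal)"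
      by (rule sum_le_suminf) auto
  qed (auto split: split_indicator)
qed auto

lemma terms_eq_cost:
  assumes n: "\<omega> \<in> Q n"
  shows "(\<Sum>k. stop_term k \<omega> + move_term k \<omega>) = cost_at \<omega>"
proof -
  have \<omega>: "\<omega> \<in> \<Omega>" and fin: "\<tau> \<omega> < \<infinity>" using n unfolding Q_def by (auto intro: less_le_trans[OF _ top_greatest])
  have later: "\<omega> \<notin> R (Suc k)" "\<omega> \<notin> Q k" if "Suc n \<le> k" for k
    using reach_iff_stage[OF n, of "Suc k"] Q_unique[OF n, of k] that by auto
  have s: "(\<Sum>k. of_bool (\<sigma> (Suc k) \<omega> \<le> \<tau> \<omega>) :: ennreal) = (\<Sum>k<Suc n. of_bool (\<sigma> (Suc k) \<omega> \<le> \<tau> \<omega>))"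
    unfolding count_eq[OF \<omega> fin] using later by (intro suminf_finite) (auto split: split_indicator)
  have "(\<Sum>k. stop_term k \<omega> + move_term k \<omega>) = (\<Sum>k<Suc n. stop_term k \<omega> + move_term k \<omega>)"
    using later by (intro suminf_finite) (auto simp: stop_term_def move_term_def)
  also have "\<dots> = cost_at \<omega>"
  proof -
    have 1: "\<omega> \<in> (\<Union>k<Suc n. Q k)" using n by auto
    have 2: "\<omega> \<notin> R (Suc n)" using Q_R[of n] n by auto
    show ?thesis unfolding terms_sum[OF \<omega> fin] overshoot_eq(1)[OF \<omega> fin] s if_not_P[OF 2] using 1
      by (simp only: indicator_simps mult_1_left)
  qed
  finally show ?thesis .
qed

lemma term_measurable: "stop_term k \<in> borel_measurable M" "move_term k \<in> borel_measurable M"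
proof -
  have [measurable]: "(\<lambda>\<omega>. indicator (Q k) \<omega> * late k \<omega>) \<in> borel_measurable M" by (rule obs_M[OF \<sigma> late_obs])
  note [measurable] = tm_M
  have "Measurable.pred M (\<lambda>\<omega>. indicator (Q k) \<omega> * late k \<omega> < lagk k \<omega>)" by measurable
  then have "(\<lambda>\<omega>. indicator (Q k) \<omega> * ((if indicator (Q k) \<omega> * late k \<omega> < lagk k \<omega> then 1 else 0) +
      ennreal cc * ennreal (max 0 (indicator (Q k) \<omega> * late k \<omega> - lagk k \<omega>)))) \<in> borel_measurable M"
    by measurable
  moreover have "(\<lambda>\<omega>. indicator (Q k) \<omega> * ((if indicator (Q k) \<omega> * late k \<omega> < lagk k \<omega> then 1 else 0) +
      ennreal cc * ennreal (max 0 (indicator (Q k) \<omega> * late k \<omega> - lagk k \<omega>)))) = stop_term k"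
    by (auto simp: stop_term_def fun_eq_iff split: split_indicator)
  ultimately show "stop_term k \<in> borel_measurable M" by (simp only:)
  show "move_term k \<in> borel_measurable M" unfolding move_term_def[abs_def] by measurable
qed

lemma detection_cost_eq: "detection_cost D \<pi> \<sigma> \<tau> = (\<integral>\<^sup>+\<omega>. cost_at \<omega> \<partial>M)"
proof -
  note [measurable] = stop_M[OF \<sigma> \<tau>] seq_M[OF \<sigma>]
  have "{\<omega>\<in>space M. \<tau> \<omega> < ennreal (\<Theta> \<omega>)} \<in> sets M" by measurable
  then have [measurable]: "{\<omega>\<in>\<Omega>. \<tau> \<omega> < ennreal (\<Theta> \<omega>)} \<in> sets M" by simp
  have "(\<lambda>\<omega>. of_bool (\<sigma> (Suc k) \<omega> \<le> \<tau> \<omega>) :: ennreal) \<in> borel_measurable M" for k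
    unfolding of_bool_def by measurable
  then have m: "(\<lambda>\<omega>. ennreal cc * (\<tau> \<omega> - ennreal (\<Theta> \<omega>)) + ennreal dd * (\<Sum>k. of_bool (\<sigma> (Suc k) \<omega> \<le> \<tau> \<omega>))) \<in> borel_measurable M"
    by measurable
  have "(\<integral>\<^sup>+\<omega>. cost_at \<omega> \<partial>M) = (\<integral>\<^sup>+\<omega>. indicator {\<omega>\<in>\<Omega>. \<tau> \<omega> < ennreal (\<Theta> \<omega>)} \<omega> \<partial>M) +
     (\<integral>\<^sup>+\<omega>. ennreal cc * (\<tau> \<omega> - ennreal (\<Theta> \<omega>)) + ennreal dd * (\<Sum>k. of_bool (\<sigma> (Suc k) \<omega> \<le> \<tau> \<omega>)) \<partial>M)"
    by (rule nn_integral_add[OF _ m]) measurable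
  then show ?thesis unfolding detection_cost_def by simp
qed

lemma terms_integral:
  "(\<integral>\<^sup>+\<omega>. (\<Sum>k. stop_term k \<omega> + move_term k \<omega>) \<partial>M) =
     (\<Sum>k. (\<integral>\<^sup>+\<omega>. indicator (Q k) \<omega> * ennreal (stop_cost (late k \<omega>) (bel k \<omega>)) \<partial>M) + move_part k)"
  using term_measurable
  by (simp add: nn_integral_suminf nn_integral_add stop_term_integral move_term_integral)

lemma stop_part_Q:
  assumes "AE \<omega> in M. \<tau> \<omega> < \<infinity>"
  shows "stop_part k = (\<integral>\<^sup>+\<omega>. indicator (Q k) \<omega> * ennreal (F_fun D (bel k \<omega>)) \<partial>M)"
  unfolding stop_part_def
proof (rule nn_integral_cong_AE, use assms in eventually_elim)
  fix \<omega> assume "\<tau> \<omega> < \<infinity>"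
  then have "\<omega> \<in> R k - R (Suc k) \<longleftrightarrow> \<omega> \<in> Q k" using R_diff_Q Q_R[of k] by blast
  then show "indicator (R k - R (Suc k)) \<omega> * ennreal (F_fun D (bel k \<omega>)) = indicator (Q k) \<omega> * ennreal (F_fun D (bel k \<omega>))"
    by (simp add: indicator_def)
qed

text \<open>
  If \<open>\<tau>\<close> is infinite with positive probability the delay already costs \<open>\<infinity>\<close>. Otherwise each stopping term costs at
  least \<open>F\<close>, the minimum over all further idling, and \<open>val_le_total\<close> applies.
\<close>

lemma val_le_detection_cost: "ennreal (val \<pi>) \<le> detection_cost D \<pi> \<sigma> \<tau>"
proof (cases "AE \<omega> in M. \<tau> \<omega> < \<infinity>")
  case True
  have "ennreal (val \<pi>) \<le> (\<Sum>k. stop_part k + move_part k)" by (rule val_le_total)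
  also have "\<dots> \<le> (\<Sum>k. (\<integral>\<^sup>+\<omega>. indicator (Q k) \<omega> * ennreal (stop_cost (late k \<omega>) (bel k \<omega>)) \<partial>M) + move_part k)"
  proof (rule suminf_le)
    fix k
    have "stop_part k \<le> (\<integral>\<^sup>+\<omega>. indicator (Q k) \<omega> * ennreal (stop_cost (late k \<omega>) (bel k \<omega>)) \<partial>M)"
      unfolding stop_part_Q[OF True]
      by (intro nn_integral_mono) (auto split: split_indicator intro!: ennreal_leI F_fun_le late_nonneg bel_range)
    then show "stop_part k + move_part k \<le> (\<integral>\<^sup>+\<omega>. indicator (Q k) \<omega> * ennreal (stop_cost (late k \<omega>) (bel k \<omega>)) \<partial>M) + move_part k"
      by (rule add_right_mono)
  qed auto
  also have "\<dots> = (\<integral>\<^sup>+\<omega>. (\<Sum>k. stop_term k \<omega> + move_term k \<omega>) \<partial>M)" by (rule terms_integral[symmetric])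
  also have "\<dots> \<le> (\<integral>\<^sup>+\<omega>. cost_at \<omega> \<partial>M)"
  proof (rule nn_integral_mono_AE, use True in \<open>rule AE_mp\<close>, intro AE_I2 impI)
    fix \<omega> assume "\<omega> \<in> space M" "\<tau> \<omega> < \<infinity>"
    then show "(\<Sum>k. stop_term k \<omega> + move_term k \<omega>) \<le> cost_at \<omega>" by (intro terms_le_cost) simp_all
  qed
  also have "\<dots> = detection_cost D \<pi> \<sigma> \<tau>" by (rule detection_cost_eq[symmetric])
  finally show ?thesis .
next
  case False
  have "detection_cost D \<pi> \<sigma> \<tau> = \<infinity>"
  proof (rule ccontr)
    assume "detection_cost D \<pi> \<sigma> \<tau> \<noteq> \<infinity>"
    note [measurable] = stop_M[OF \<sigma> \<tau>]
    have "(\<integral>\<^sup>+\<omega>. ennreal cc * (\<tau> \<omega> - ennreal (\<Theta> \<omega>)) \<partial>M) \<le> (\<integral>\<^sup>+\<omega>. cost_at \<omega> \<partial>M)"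
    proof (rule nn_integral_mono)
      have "x \<le> a + (x + b)" for a b x :: ennreal
        by (rule add_increasing[OF zero_le add_increasing2[OF zero_le order_refl]])
      then show "ennreal cc * (\<tau> \<omega> - ennreal (\<Theta> \<omega>)) \<le> cost_at \<omega>" for \<omega> .
    qed
    with \<open>detection_cost D \<pi> \<sigma> \<tau> \<noteq> \<infinity>\<close> have "(\<integral>\<^sup>+\<omega>. ennreal cc * (\<tau> \<omega> - ennreal (\<Theta> \<omega>)) \<partial>M) \<noteq> \<infinity>"
      unfolding detection_cost_eq by (auto simp: top_unique)
    then have "AE \<omega> in M. ennreal cc * (\<tau> \<omega> - ennreal (\<Theta> \<omega>)) \<noteq> \<infinity>"
      by (intro nn_integral_PInf_AE) measurable
    then have "AE \<omega> in M. \<tau> \<omega> < \<infinity>"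
    proof eventually_elim
      fix \<omega> assume "ennreal cc * (\<tau> \<omega> - ennreal (\<Theta> \<omega>)) \<noteq> \<infinity>"
      then show "\<tau> \<omega> < \<infinity>" using delay_pos by (cases "\<tau> \<omega> = \<infinity>") (auto simp: ennreal_mult_top less_top[symmetric])
    qed
    with False show False by simp
  qed
  then show ?thesis by simp
qed

text \<open>
  The sum subtracted in \<open>K\<close> turns the elapsed time into the sum of the delays of the individual waits.
\<close>

lemma K_integrand:
  assumes n: "\<omega> \<in> Q n" and eq: "\<tau> \<omega> = \<sigma> n \<omega>" and post: "posterior D \<pi> \<sigma> \<tau> \<omega> = bel n \<omega>"
    "\<And>k. \<sigma> k \<omega> < \<infinity> \<Longrightarrow> posterior D \<pi> \<sigma> (\<sigma> k) \<omega> = bel k \<omega>"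
  shows "(if \<tau> \<omega> = \<infinity> then \<infinity> else
        ennreal (F_fun D (posterior D \<pi> \<sigma> \<tau> \<omega>) + cc * enn2real (\<tau> \<omega>)
          - cc / lam *
              (\<Sum>k. (1 - posterior D \<pi> \<sigma> (\<sigma> k) \<omega>) *
                    (1 - exp (- lam * (enn2real (\<sigma> (Suc k) \<omega>) - enn2real (\<sigma> k \<omega>)))) *
                    of_bool (\<sigma> (Suc k) \<omega> \<le> \<tau> \<omega>))) +
        ennreal dd * (\<Sum>k. of_bool (\<sigma> (Suc k) \<omega> \<le> \<tau> \<omega>))) =
      (\<Sum>k. indicator (Q k) \<omega> * ennreal (F_fun D (bel k \<omega>)) + indicator (R (Suc k)) \<omega> * ennreal (dd + cc * delay (tm (Suc k) \<omega> - tm k \<omega>) (bel k \<omega>)))"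
    (is "?K = ?S")
    and "(\<Sum>k. indicator (Q k) \<omega> * ennreal (F_fun D (bel k \<omega>)) + indicator (R (Suc k)) \<omega> * ennreal (dd + cc * delay (tm (Suc k) \<omega> - tm k \<omega>) (bel k \<omega>))) =
       ennreal (F_fun D (bel n \<omega>) + cc * enn2real (\<tau> \<omega>)
            - cc / lam * (\<Sum>k<n. (1 - bel k \<omega>) * (1 - exp (- lam * (tm (Suc k) \<omega> - tm k \<omega>)))) + dd * real n)"
proof -
  have \<omega>: "\<omega> \<in> \<Omega>" and fin: "\<tau> \<omega> < \<infinity>" using n unfolding Q_def by (auto intro: less_le_trans[OF _ top_greatest])
  have ne: "\<tau> \<omega> \<noteq> \<infinity>" using fin by auto
  have le: "\<sigma> (Suc k) \<omega> \<le> \<tau> \<omega> \<longleftrightarrow> k < n" for k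
    using reach_iff_stage[OF n, of "Suc k"] \<omega> fin by (auto simp: R_def intro: le_less_trans)
  have R: "\<omega> \<in> R k \<longleftrightarrow> k \<le> n" for k by (rule reach_iff_stage[OF n])
  let ?e = "\<lambda>k. (1 - bel k \<omega>) * (1 - exp (- lam * (tm (Suc k) \<omega> - tm k \<omega>)))"
  let ?d = "\<lambda>k. delay (tm (Suc k) \<omega> - tm k \<omega>) (bel k \<omega>)"
  have d0: "0 \<le> ?d k" if "k < n" for k
    using gap_positive[of \<omega> k] R[of "Suc k"] that by (intro delay_nonneg bel_range \<omega>) auto
  have "(\<Sum>k<n. cc * ?d k) = cc * (tm n \<omega> - tm 0 \<omega>) - cc / lam * (\<Sum>k<n. ?e k)"
  proof -
    have "(\<Sum>k<n. cc * ?d k) = (\<Sum>k<n. cc * (tm (Suc k) \<omega> - tm k \<omega>) - cc / lam * ?e k)"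
    proof (rule sum.cong[OF refl])
      have "cc * (g - (1 - b) * (E / lam)) = cc * g - cc / lam * ((1 - b) * E)" for g b E
        by (simp add: right_diff_distrib)
      then show "cc * ?d k = cc * (tm (Suc k) \<omega> - tm k \<omega>) - cc / lam * ?e k" for k
        unfolding delay_def .
    qed
    also have "\<dots> = cc * (\<Sum>k<n. tm (Suc k) \<omega> - tm k \<omega>) - cc / lam * (\<Sum>k<n. ?e k)"
      unfolding sum_distrib_left by (rule sum_subtractf)
    finally show ?thesis by (simp only: sum_lessThan_telescope[of "\<lambda>k. tm k \<omega>" n])
  qed
  then have tele: "(\<Sum>k<n. cc * ?d k) = cc * enn2real (\<tau> \<omega>) - cc / lam * (\<Sum>k<n. ?e k)"
    by (simp add: eq seq_0[OF \<sigma> \<omega>])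
  have F0: "0 \<le> F_fun D (bel n \<omega>)" by (intro F_fun_nonneg bel_range \<omega>)
  have D0: "0 \<le> (\<Sum>k<n. cc * ?d k)" using d0 delay_pos by (intro sum_nonneg mult_nonneg_nonneg) auto
  have "?S = (\<Sum>k<Suc n. indicator (Q k) \<omega> * ennreal (F_fun D (bel k \<omega>)) + indicator (R (Suc k)) \<omega> * ennreal (dd + cc * ?d k))"
    using Q_unique[OF n] R by (intro suminf_finite) (auto split: split_indicator)
  also have "\<dots> = ennreal (F_fun D (bel n \<omega>)) + (\<Sum>k<n. ennreal (dd + cc * ?d k))"
  proof -
    have "(\<Sum>k<n. indicator (Q k) \<omega> * ennreal (F_fun D (bel k \<omega>)) + indicator (R (Suc k)) \<omega> * ennreal (dd + cc * ?d k)) = (\<Sum>k<n. ennreal (dd + cc * ?d k))"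
      using Q_unique[OF n] R by (intro sum.cong) (auto split: split_indicator)
    then show ?thesis using n R[of "Suc n"] by (simp add: add.commute)
  qed
  also have "(\<Sum>k<n. ennreal (dd + cc * ?d k)) = ennreal (\<Sum>k<n. dd + cc * ?d k)"
    using d0 delay_pos obs_pos by (intro sum_ennreal add_nonneg_nonneg mult_nonneg_nonneg) auto
  also have "(\<Sum>k<n. dd + cc * ?d k) = dd * real n + (\<Sum>k<n. cc * ?d k)"
    by (simp add: sum.distrib mult.commute)
  also have "ennreal (F_fun D (bel n \<omega>)) + ennreal (dd * real n + (\<Sum>k<n. cc * ?d k)) = ennreal (F_fun D (bel n \<omega>) + (dd * real n + (\<Sum>k<n. cc * ?d k)))"
    using F0 D0 obs_pos by (intro ennreal_plus[symmetric] add_nonneg_nonneg mult_nonneg_nonneg) auto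
  finally have S: "?S = ennreal (F_fun D (bel n \<omega>) + (dd * real n + (\<Sum>k<n. cc * ?d k)))" .
  show "?S = ennreal (F_fun D (bel n \<omega>) + cc * enn2real (\<tau> \<omega>)
            - cc / lam * (\<Sum>k<n. ?e k) + dd * real n)"
    unfolding S tele by (simp add: algebra_simps)
  have s1: "(\<Sum>k. (1 - posterior D \<pi> \<sigma> (\<sigma> k) \<omega>) * (1 - exp (- lam * (enn2real (\<sigma> (Suc k) \<omega>) - enn2real (\<sigma> k \<omega>)))) *
                    of_bool (\<sigma> (Suc k) \<omega> \<le> \<tau> \<omega>)) = (\<Sum>k<n. ?e k)"
  proof -
    have "(\<Sum>k. (1 - posterior D \<pi> \<sigma> (\<sigma> k) \<omega>) * (1 - exp (- lam * (enn2real (\<sigma> (Suc k) \<omega>) - enn2real (\<sigma> k \<omega>)))) *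
                    of_bool (\<sigma> (Suc k) \<omega> \<le> \<tau> \<omega>)) =
       (\<Sum>k<n. (1 - posterior D \<pi> \<sigma> (\<sigma> k) \<omega>) * (1 - exp (- lam * (enn2real (\<sigma> (Suc k) \<omega>) - enn2real (\<sigma> k \<omega>)))) *
                    of_bool (\<sigma> (Suc k) \<omega> \<le> \<tau> \<omega>))"
      unfolding le by (rule suminf_finite) auto
    also have "\<dots> = (\<Sum>k<n. ?e k)"
    proof (rule sum.cong[OF refl])
      fix k assume "k \<in> {..<n}"
      then have k: "k < n" by simp
      have "\<sigma> k \<omega> < \<infinity>" using R[of k] k R_finite(1) by auto
      then show "(1 - posterior D \<pi> \<sigma> (\<sigma> k) \<omega>) * (1 - exp (- lam * (enn2real (\<sigma> (Suc k) \<omega>) - enn2real (\<sigma> k \<omega>)))) *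
                    of_bool (\<sigma> (Suc k) \<omega> \<le> \<tau> \<omega>) = ?e k"
        using k unfolding le by (simp add: post(2))
    qed
    finally show ?thesis .
  qed
  have s2: "(\<Sum>k. of_bool (\<sigma> (Suc k) \<omega> \<le> \<tau> \<omega>) :: ennreal) = of_nat n"
  proof -
    have "(\<Sum>k. of_bool (\<sigma> (Suc k) \<omega> \<le> \<tau> \<omega>) :: ennreal) = (\<Sum>k<n. of_bool (\<sigma> (Suc k) \<omega> \<le> \<tau> \<omega>))"
      unfolding le by (rule suminf_finite) auto
    also have "\<dots> = (\<Sum>k<n. 1)" unfolding le by (intro sum.cong) auto
    finally show ?thesis by simp
  qed
  have "?K = ennreal (F_fun D (bel n \<omega>) + cc * enn2real (\<tau> \<omega>) - cc / lam * (\<Sum>k<n. ?e k)) + ennreal dd * of_nat n"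
    unfolding if_not_P[OF ne] s1 s2 post(1) ..
  also have "F_fun D (bel n \<omega>) + cc * enn2real (\<tau> \<omega>) - cc / lam * (\<Sum>k<n. ?e k) = F_fun D (bel n \<omega>) + (\<Sum>k<n. cc * ?d k)"
    unfolding tele by simp
  also have "ennreal (F_fun D (bel n \<omega>) + (\<Sum>k<n. cc * ?d k)) + ennreal dd * of_nat n = ennreal (F_fun D (bel n \<omega>) + (\<Sum>k<n. cc * ?d k)) + ennreal (dd * real n)"
    using obs_pos by (simp add: ennreal_mult ennreal_of_nat_eq_real_of_nat)
  also have "\<dots> = ennreal ((F_fun D (bel n \<omega>) + (\<Sum>k<n. cc * ?d k)) + dd * real n)"
    using F0 D0 obs_pos by (intro ennreal_plus[symmetric] add_nonneg_nonneg mult_nonneg_nonneg) auto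
  also have "\<dots> = ?S" unfolding S by (simp add: algebra_simps)
  finally show "?K = ?S" .
qed

lemma stop0_stage:
  assumes \<tau>0: "\<tau> \<in> stop_times0 D \<pi> \<sigma>" and fin: "AE \<omega> in M. \<tau> \<omega> < \<infinity>"
  shows "AE \<omega> in M. \<exists>n. \<omega> \<in> Q n \<and> \<tau> \<omega> = \<sigma> n \<omega> \<and> posterior D \<pi> \<sigma> \<tau> \<omega> = bel n \<omega> \<and>
     (\<forall>k. \<sigma> k \<omega> < \<infinity> \<longrightarrow> posterior D \<pi> \<sigma> (\<sigma> k) \<omega> = bel k \<omega>)"
proof -
  have ae: "AE \<omega> in M. \<exists>k. \<tau> \<omega> = \<sigma> k \<omega>" using \<tau>0 by (simp add: stop_times0_def)
  have "AE \<omega> in M. \<omega> \<in> \<Omega>" by (rule AE_I2) simp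
  then show ?thesis
    using ae fin posterior_stage[OF \<sigma> \<tau>0] posterior_seq[OF \<sigma>]
  proof eventually_elim
    fix \<omega> assume \<omega>: "\<omega> \<in> \<Omega>" and ex: "\<exists>k. \<tau> \<omega> = \<sigma> k \<omega>" and f: "\<tau> \<omega> < \<infinity>"
      and p: "\<forall>k. \<omega> \<in> Q k \<longrightarrow> \<tau> \<omega> = \<sigma> k \<omega> \<and> posterior D \<pi> \<sigma> \<tau> \<omega> = bel k \<omega>"
      and q: "\<forall>k. \<sigma> k \<omega> < \<infinity> \<longrightarrow> posterior D \<pi> \<sigma> (\<sigma> k) \<omega> = bel k \<omega>"
    from ex obtain n where n: "\<tau> \<omega> = \<sigma> n \<omega>" by auto
    then have "\<sigma> n \<omega> < \<infinity>" using f by simp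
    from seq_less[OF \<sigma> \<omega> this] have Q: "\<omega> \<in> Q n" unfolding Q_def using n \<omega> by simp
    show "\<exists>n. \<omega> \<in> Q n \<and> \<tau> \<omega> = \<sigma> n \<omega> \<and> posterior D \<pi> \<sigma> \<tau> \<omega> = bel n \<omega> \<and>
     (\<forall>k. \<sigma> k \<omega> < \<infinity> \<longrightarrow> posterior D \<pi> \<sigma> (\<sigma> k) \<omega> = bel k \<omega>)"
      by (rule exI[of _ n]) (intro conjI Q n conjunct2[OF p[rule_format, OF Q]] q)
  qed
qed

lemma K_fun_eq:
  assumes \<tau>0: "\<tau> \<in> stop_times0 D \<pi> \<sigma>" and fin: "AE \<omega> in M. \<tau> \<omega> < \<infinity>"
  shows "K_fun D \<pi> \<sigma> \<tau> = (\<Sum>k. stop_part k + move_part k)"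
proof -
  have "K_fun D \<pi> \<sigma> \<tau> = (\<integral>\<^sup>+\<omega>. (\<Sum>k. indicator (Q k) \<omega> * ennreal (F_fun D (bel k \<omega>)) + indicator (R (Suc k)) \<omega> * ennreal (dd + cc * delay (tm (Suc k) \<omega> - tm k \<omega>) (bel k \<omega>))) \<partial>M)"
    unfolding K_fun_def
  proof (rule nn_integral_cong_AE, use stop0_stage[OF \<tau>0 fin] in eventually_elim, elim exE conjE)
    fix \<omega> n assume "\<omega> \<in> Q n" "\<tau> \<omega> = \<sigma> n \<omega>" "posterior D \<pi> \<sigma> \<tau> \<omega> = bel n \<omega>"
      "\<forall>k. \<sigma> k \<omega> < \<infinity> \<longrightarrow> posterior D \<pi> \<sigma> (\<sigma> k) \<omega> = bel k \<omega>"
    then show "(if \<tau> \<omega> = \<infinity> then \<infinity> else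
        ennreal (F_fun D (posterior D \<pi> \<sigma> \<tau> \<omega>) + cc * enn2real (\<tau> \<omega>)
          - cc / lam *
              (\<Sum>k. (1 - posterior D \<pi> \<sigma> (\<sigma> k) \<omega>) *
                    (1 - exp (- lam * (enn2real (\<sigma> (Suc k) \<omega>) - enn2real (\<sigma> k \<omega>)))) *
                    of_bool (\<sigma> (Suc k) \<omega> \<le> \<tau> \<omega>))) +
        ennreal dd * (\<Sum>k. of_bool (\<sigma> (Suc k) \<omega> \<le> \<tau> \<omega>))) =
      (\<Sum>k. indicator (Q k) \<omega> * ennreal (F_fun D (bel k \<omega>)) + indicator (R (Suc k)) \<omega> * ennreal (dd + cc * delay (tm (Suc k) \<omega> - tm k \<omega>) (bel k \<omega>)))"
      by (intro K_integrand(1)) auto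
  qed
  also have "\<dots> = (\<Sum>k. stop_part k + move_part k)"
  proof -
    note [measurable] = F_bel_M delay_bel_M
    show ?thesis unfolding stop_part_Q[OF fin] move_part_def
      by (subst nn_integral_suminf, measurable) (subst nn_integral_add, measurable)
  qed
  finally show ?thesis .
qed

lemma val_le_K:
  assumes \<tau>0: "\<tau> \<in> stop_times0 D \<pi> \<sigma>"
  shows "ennreal (val \<pi>) \<le> K_fun D \<pi> \<sigma> \<tau>"
proof (cases "AE \<omega> in M. \<tau> \<omega> < \<infinity>")
  case True
  then show ?thesis using K_fun_eq[OF \<tau>0 True] val_le_total by simp
next
  case False
  note [measurable] = stop_M[OF \<sigma> \<tau>]
  have m: "{\<omega>\<in>space M. \<tau> \<omega> = \<infinity>} \<in> sets M" by measurable
  have "emeasure M {\<omega>\<in>space M. \<tau> \<omega> = \<infinity>} \<noteq> 0"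
    using False m AE_iff_measurable[OF m, of "\<lambda>\<omega>. \<tau> \<omega> < \<infinity>"] by (auto simp: less_top[symmetric])
  then have "\<infinity> = (\<integral>\<^sup>+\<omega>. \<infinity> * indicator {\<omega>\<in>space M. \<tau> \<omega> = \<infinity>} \<omega> \<partial>M)"
    by (subst nn_integral_cmult_indicator[OF m]) (simp add: ennreal_top_mult)
  also have "\<dots> \<le> K_fun D \<pi> \<sigma> \<tau>"
    unfolding K_fun_def by (intro nn_integral_mono) (auto split: split_indicator)
  finally show ?thesis by (simp add: top_unique)
qed

end

end

section \<open>The optimal feedback strategy\<close>

context detection_params begin

lemma wait_less_top: "wait p < \<infinity> \<longleftrightarrow> p \<in> cont_region"
  by (simp add: wait_def)

lemma wait_pos: "0 < wait p"
  using wait_time_minimizer[of p] by (auto simp: wait_def minimizers_def)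

lemma wait_time_pos: "p \<in> cont_region \<Longrightarrow> 0 < wait_time p"
  using wait_time_minimizer[of p] by (auto simp: minimizers_def)

lemma wait_gap:
  assumes "s < \<infinity>" "p \<in> cont_region"
  shows "enn2real (s + wait p) - enn2real s = wait_time p"
  using assms wait_time_pos[OF assms(2)] by (cases s) (auto simp: wait_def ennreal_plus[symmetric] simp del: ennreal_plus)

lemma val_eq_F: "p \<in> {0..1} \<Longrightarrow> p \<notin> cont_region \<Longrightarrow> F_fun D p = val p"
  using val_le_F[of p] by (auto simp: cont_region_def)

end

context detection begin

text \<open>
  The recursion of the optimal strategy with the waiting time computed from \<open>val\<close>. It can be analysed before \<open>V = val\<close>
  is known; \<open>opt_eq\<close> identifies the two afterwards.
\<close>

primrec fb_state :: "nat \<Rightarrow> 'a \<Rightarrow> ennreal \<times> real" where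
  "fb_state 0 \<omega> = (0, \<pi>)"
| "fb_state (Suc k) \<omega> =
     (let (s, p) = fb_state k \<omega>; s' = s + wait p
      in (s', if s' = \<infinity> then p
              else bayes (enn2real s' - enn2real s) p (X_at D s' \<omega> - X_at D s \<omega>)))"

definition feedback :: "nat \<Rightarrow> 'a \<Rightarrow> ennreal" where "feedback k \<omega> = fst (fb_state k \<omega>)"
definition fb_post :: "nat \<Rightarrow> 'a \<Rightarrow> real" where "fb_post k \<omega> = snd (fb_state k \<omega>)"

lemma fb_0: "feedback 0 \<omega> = 0" "fb_post 0 \<omega> = \<pi>" by (simp_all add: feedback_def fb_post_def)

lemma fb_Suc: "feedback (Suc k) \<omega> = feedback k \<omega> + wait (fb_post k \<omega>)"
  "fb_post (Suc k) \<omega> = (if feedback (Suc k) \<omega> = \<infinity> then fb_post k \<omega>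
     else bayes (enn2real (feedback (Suc k) \<omega>) - enn2real (feedback k \<omega>)) (fb_post k \<omega>) (X_at D (feedback (Suc k) \<omega>) \<omega> - X_at D (feedback k \<omega>) \<omega>))"
  by (simp_all add: feedback_def fb_post_def split_beta' Let_def)

lemma fb_Suc_finite: "feedback (Suc k) \<omega> < \<infinity> \<longleftrightarrow> feedback k \<omega> < \<infinity> \<and> fb_post k \<omega> \<in> cont_region"
  unfolding fb_Suc(1) infinity_ennreal_def ennreal_add_less_top wait_less_top[unfolded infinity_ennreal_def] ..

lemma fb_gap: "feedback (Suc k) \<omega> < \<infinity> \<Longrightarrow> enn2real (feedback (Suc k) \<omega>) - enn2real (feedback k \<omega>) = wait_time (fb_post k \<omega>)"
  unfolding fb_Suc_finite by (subst fb_Suc(1), rule wait_gap) auto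

text \<open>
  The feedback strategy goes on exactly as long as the posterior stays in the continuation region.
\<close>

lemma fb_finite_iff: "feedback k \<omega> < \<infinity> \<longleftrightarrow> (\<forall>j<k. fb_post j \<omega> \<in> cont_region)"
proof (induction k)
  case (Suc k)
  then show ?case unfolding fb_Suc_finite by (auto simp: less_Suc_eq)
qed (simp add: fb_0)

lemma fb_post_range: "fb_post k \<omega> \<in> {0..1}"
proof (induction k)
  case 0
  then show ?case using pi by (simp add: fb_0)
next
  case (Suc k)
  show ?case
  proof (cases "feedback (Suc k) \<omega> = \<infinity>")
    case True
    show ?thesis unfolding fb_Suc(2) if_P[OF True] by (rule Suc)
  next
    case False
    then have f: "feedback (Suc k) \<omega> < \<infinity>" by (simp add: less_top[symmetric])
    then have "fb_post k \<omega> \<in> cont_region" using fb_Suc_finite by blast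
    then show ?thesis unfolding fb_Suc(2) if_not_P[OF False] fb_gap[OF f]
      by (intro bayes_range Suc wait_time_pos)
  qed
qed

text \<open>
  By induction the posterior component is a function of the observations, so the next wait may use it.
\<close>

lemma fb_observable:
  "feedback k \<in> borel_measurable (obs_sigma D feedback k)" "fb_post k \<in> borel_measurable (obs_sigma D feedback k)"
  "(\<lambda>\<omega>. X_at D (feedback k \<omega>) \<omega>) \<in> borel_measurable (obs_sigma D feedback k)"
proof -
  have 1: "feedback k \<in> borel_measurable (obs_sigma D feedback k)" for k
  proof (cases k)
    case 0
    have "feedback 0 = (\<lambda>_. 0)" by (auto simp: fb_0)
    then show ?thesis unfolding 0 by simp
  next
    case (Suc j)
    then show ?thesis by (intro obs_sigma_component) auto
  qed
  have 2: "(\<lambda>\<omega>. X_at D (feedback k \<omega>) \<omega>) \<in> borel_measurable (obs_sigma D feedback k)" for k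
  proof (cases k)
    case 0
    have "(\<lambda>_. 0 :: real) \<in> borel_measurable (obs_sigma D feedback 0)" by simp
    then show ?thesis unfolding 0
      by (rule measurable_cong[THEN iffD1, rotated])
         (use bm_0 change_time_nonneg in \<open>auto simp: fb_0 X_at_def X_obs_def\<close>)
  next
    case (Suc j)
    then show ?thesis by (intro obs_sigma_component) auto
  qed
  show "feedback k \<in> borel_measurable (obs_sigma D feedback k)" "(\<lambda>\<omega>. X_at D (feedback k \<omega>) \<omega>) \<in> borel_measurable (obs_sigma D feedback k)"
    by (rule 1 2)+
  show "fb_post k \<in> borel_measurable (obs_sigma D feedback k)"
  proof (induction k)
    case 0
    have "fb_post 0 = (\<lambda>_. \<pi>)" by (auto simp: fb_0)
    then show ?case by simp
  next
    case (Suc k)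
    let ?F = "obs_sigma D feedback (Suc k)"
    have t: "feedback k \<in> borel_measurable ?F" "feedback (Suc k) \<in> borel_measurable ?F"
      using obs_sigma_mono[OF _ 1, of k "Suc k"] 1[of "Suc k"] by auto
    have x: "(\<lambda>\<omega>. X_at D (feedback k \<omega>) \<omega>) \<in> borel_measurable ?F" "(\<lambda>\<omega>. X_at D (feedback (Suc k) \<omega>) \<omega>) \<in> borel_measurable ?F"
      using obs_sigma_mono[OF _ 2, of k "Suc k"] 2[of "Suc k"] by auto
    have b: "fb_post k \<in> borel_measurable ?F" using obs_sigma_mono[OF _ Suc, of "Suc k"] by auto
    have "(\<lambda>\<omega>. bayes (enn2real (feedback (Suc k) \<omega>) - enn2real (feedback k \<omega>)) (fb_post k \<omega>)
            (X_at D (feedback (Suc k) \<omega>) \<omega> - X_at D (feedback k \<omega>) \<omega>)) \<in> borel_measurable ?F"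
      by (intro measurable_lik borel_measurable_diff b x borel_measurable_enn2real t)
    moreover have "{\<omega>\<in>space ?F. feedback (Suc k) \<omega> = \<infinity>} \<in> sets ?F"
      using measurable_sets[OF t(2), of "{\<infinity>}"] by (auto simp: vimage_def Int_def conj_commute)
    ultimately have "(\<lambda>\<omega>. if feedback (Suc k) \<omega> = \<infinity> then fb_post k \<omega>
       else bayes (enn2real (feedback (Suc k) \<omega>) - enn2real (feedback k \<omega>)) (fb_post k \<omega>)
            (X_at D (feedback (Suc k) \<omega>) \<omega> - X_at D (feedback k \<omega>) \<omega>)) \<in> borel_measurable ?F"
      using b by (intro measurable_If)
    then show ?case by (rule measurable_cong[THEN iffD1, rotated]) (rule fb_Suc(2)[symmetric])
  qed
qed

lemma fb_obs_seqs: "feedback \<in> obs_seqs D"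
  unfolding obs_seqs_def
proof (intro CollectI conjI ballI allI impI)
  show "feedback 0 \<omega> = 0" for \<omega> by (rule fb_0)
  show "\<exists>s>0. \<forall>\<omega>\<in>\<Omega>. feedback 1 \<omega> = s"
    by (intro exI[of _ "wait \<pi>"] conjI wait_pos) (simp add: fb_Suc(1) fb_0)
  show "feedback j \<in> borel_measurable (obs_sigma D feedback (j - 1))" if j2: "j \<ge> 2" for j
  proof -
    obtain k where k: "j = Suc k" using j2 by (cases j) auto
    have "(\<lambda>\<omega>. feedback k \<omega> + wait (fb_post k \<omega>)) \<in> borel_measurable (obs_sigma D feedback k)"
      using fb_observable[of k] by measurable
    then show ?thesis unfolding k fb_Suc(1)[abs_def] by simp
  qed
  fix \<omega> k
  show "feedback k \<omega> < feedback (Suc k) \<omega>" if "feedback k \<omega> < \<infinity>"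
    using that wait_pos[of "fb_post k \<omega>"] unfolding fb_Suc(1) by (cases "feedback k \<omega>"; cases "wait (fb_post k \<omega>)") (auto simp: ennreal_plus[symmetric] ennreal_less_iff simp del: ennreal_plus)
  show "feedback (Suc k) \<omega> = \<infinity>" if "feedback k \<omega> = \<infinity>" using that by (simp add: fb_Suc(1))
qed

lemma obs_belief_fb: "obs_belief feedback k \<omega> = fb_post k \<omega>"
proof (induction k)
  case (Suc k)
  then show ?case unfolding obs_belief.simps fb_Suc(2) by simp
qed (simp add: fb_0)

definition fb_count :: "'a \<Rightarrow> enat" where
  "fb_count \<omega> = (INF k\<in>{k. fb_post k \<omega> \<notin> cont_region}. enat k)"

lemma fb_count_cases:
  "fb_count \<omega> = enat n \<longleftrightarrow> feedback n \<omega> < \<infinity> \<and> fb_post n \<omega> \<notin> cont_region"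
  "fb_count \<omega> = \<infinity> \<longleftrightarrow> (\<forall>k. fb_post k \<omega> \<in> cont_region)"
proof -
  let ?A = "{k. fb_post k \<omega> \<notin> cont_region}"
  have least: "fb_count \<omega> = enat (LEAST k. k \<in> ?A)" if "k \<in> ?A" for k
    unfolding fb_count_def
  proof (rule antisym)
    have "(LEAST k. k \<in> ?A) \<in> ?A" using that by (rule LeastI)
    then show "(INF k\<in>?A. enat k) \<le> enat (LEAST k. k \<in> ?A)" by (rule INF_lower)
    show "enat (LEAST k. k \<in> ?A) \<le> (INF k\<in>?A. enat k)"
      by (rule INF_greatest) (simp add: Least_le)
  qed
  show 2: "fb_count \<omega> = \<infinity> \<longleftrightarrow> (\<forall>k. fb_post k \<omega> \<in> cont_region)"
  proof
    assume "fb_count \<omega> = \<infinity>"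
    then show "\<forall>k. fb_post k \<omega> \<in> cont_region" using least by auto
  next
    assume "\<forall>k. fb_post k \<omega> \<in> cont_region"
    then have "?A = {}" by auto
    then show "fb_count \<omega> = \<infinity>" unfolding fb_count_def by (simp add: top_enat_def)
  qed
  show "fb_count \<omega> = enat n \<longleftrightarrow> feedback n \<omega> < \<infinity> \<and> fb_post n \<omega> \<notin> cont_region"
  proof
    assume n: "fb_count \<omega> = enat n"
    then have "\<not> (\<forall>k. fb_post k \<omega> \<in> cont_region)" using 2 by auto
    then obtain k where k: "k \<in> ?A" by auto
    have "n = (LEAST k. k \<in> ?A)" using least[OF k] n by simp
    moreover have "(LEAST k. k \<in> ?A) \<in> ?A" by (rule LeastI) (rule k)
    moreover have "j \<notin> ?A" if "j < (LEAST k. k \<in> ?A)" for j using that by (rule not_less_Least)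
    ultimately have "n \<in> ?A" "\<And>j. j < n \<Longrightarrow> j \<notin> ?A" by (simp_all only: not_False_eq_True)
    then show "feedback n \<omega> < \<infinity> \<and> fb_post n \<omega> \<notin> cont_region" unfolding fb_finite_iff by blast
  next
    assume "feedback n \<omega> < \<infinity> \<and> fb_post n \<omega> \<notin> cont_region"
    then have n: "n \<in> ?A" "\<And>j. j < n \<Longrightarrow> j \<notin> ?A" unfolding fb_finite_iff by auto
    have "(LEAST k. k \<in> ?A) = n" using n by (intro Least_equality) (auto simp: not_less[symmetric])
    then show "fb_count \<omega> = enat n" using least[OF n(1)] by simp
  qed
qed

text \<open>
  A further idle time \<open>x\<close>, chosen from the last posterior, follows the last observation. The choice \<open>idle_time\<close> is optimal for
  the detection cost; the choice \<open>0\<close> is the stopping time of the theorem.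
\<close>

definition fb_stop :: "(real \<Rightarrow> ennreal) \<Rightarrow> 'a \<Rightarrow> ennreal" where
  "fb_stop x \<omega> = (case fb_count \<omega> of enat n \<Rightarrow> feedback n \<omega> + x (fb_post n \<omega>) | \<infinity> \<Rightarrow> \<infinity>)"

text \<open>
  Stopping by time \<open>t\<close> means that for some \<open>n\<close> the posterior after \<open>n\<close> observations leaves the
  continuation region and the idle time ends by \<open>t\<close>; this is decided by these observations.
\<close>

lemma fb_stop_time:
  assumes x [measurable]: "x \<in> borel_measurable borel"
  shows "fb_stop x \<in> stop_times D feedback"
  unfolding stop_times_def stopping_time_def
proof (intro CollectI allI)
  fix t
  show "Measurable.pred (obs_filtration D feedback t) (\<lambda>\<omega>. fb_stop x \<omega> \<le> t)"
  proof (cases "t = \<infinity>")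
    case True
    then show ?thesis by simp
  next
    case False
    define A where "A n = {\<omega>\<in>\<Omega>. feedback n \<omega> < \<infinity> \<and> fb_post n \<omega> \<notin> cont_region \<and> feedback n \<omega> + x (fb_post n \<omega>) \<le> t}" for n
    have A: "A n \<in> sets (obs_sigma D feedback n)" for n
    proof -
      note [measurable] = fb_observable[of n]
      have "{\<omega>\<in>space (obs_sigma D feedback n). feedback n \<omega> < \<infinity> \<and> fb_post n \<omega> \<notin> cont_region \<and> feedback n \<omega> + x (fb_post n \<omega>) \<le> t} \<in> sets (obs_sigma D feedback n)"
        by measurable
      then show ?thesis by (simp add: A_def)
    qed
    have "{\<omega>\<in>\<Omega>. fb_stop x \<omega> \<le> t} = (\<Union>n. {\<omega>\<in>A n. feedback n \<omega> \<le> t})"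
    proof (intro set_eqI iffI)
      fix \<omega> assume "\<omega> \<in> {\<omega>\<in>\<Omega>. fb_stop x \<omega> \<le> t}"
      then have \<omega>: "\<omega> \<in> \<Omega>" "fb_stop x \<omega> \<le> t" by auto
      then obtain n where n: "fb_count \<omega> = enat n"
        using False by (cases "fb_count \<omega>") (auto simp: fb_stop_def top_unique)
      then have "feedback n \<omega> + x (fb_post n \<omega>) \<le> t" using \<omega>(2) by (simp add: fb_stop_def)
      moreover then have "feedback n \<omega> \<le> t" by (rule order_trans[rotated]) (rule add_increasing2[OF zero_le order_refl])
      ultimately show "\<omega> \<in> (\<Union>n. {\<omega>\<in>A n. feedback n \<omega> \<le> t})"
        using \<omega>(1) fb_count_cases(1)[THEN iffD1, OF n] by (auto simp: A_def)
    next
      fix \<omega> assume "\<omega> \<in> (\<Union>n. {\<omega>\<in>A n. feedback n \<omega> \<le> t})"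
      then obtain n where n: "\<omega> \<in> A n" by auto
      then have "fb_count \<omega> = enat n" using fb_count_cases(1) by (auto simp: A_def)
      then show "\<omega> \<in> {\<omega>\<in>\<Omega>. fb_stop x \<omega> \<le> t}" using n by (simp add: A_def fb_stop_def)
    qed
    moreover have "(\<Union>n. {\<omega>\<in>A n. feedback n \<omega> \<le> t}) \<in> sets (obs_filtration D feedback t)"
      by (intro sets.countable_UN'' filt_of_obs[OF fb_obs_seqs] A) auto
    ultimately show ?thesis by (simp add: pred_def)
  qed
qed

lemma fb_stop_ge: "\<omega> \<in> \<Omega> \<Longrightarrow> feedback k \<omega> < \<infinity> \<Longrightarrow> feedback k \<omega> \<le> fb_stop x \<omega>"
proof (cases "fb_count \<omega>")
  case (enat n)
  assume \<omega>: "\<omega> \<in> \<Omega>" and k: "feedback k \<omega> < \<infinity>"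
  have "fb_post n \<omega> \<notin> cont_region" using fb_count_cases(1) enat by blast
  then have "k \<le> n" using k unfolding fb_finite_iff by (auto simp: not_less[symmetric])
  then have "feedback k \<omega> \<le> feedback n \<omega>" by (rule seq_mono[OF fb_obs_seqs \<omega>])
  also have "\<dots> \<le> fb_stop x \<omega>" by (simp add: fb_stop_def enat add_increasing2)
  finally show ?thesis .
qed (simp add: fb_stop_def)

context
  fixes x :: "real \<Rightarrow> ennreal"
  assumes x: "x \<in> borel_measurable borel" and x_fin: "\<And>p. x p < \<infinity>"
begin

lemmas fb_st = fb_stop_time[OF x]
lemmas fbs = fb_obs_seqs

lemma fb_reach: "reach feedback (fb_stop x) k = {\<omega>\<in>\<Omega>. feedback k \<omega> < \<infinity>}"
  unfolding R_def[OF fbs fb_st] using fb_stop_ge by auto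

lemma fb_stage: "\<omega> \<in> stage feedback (fb_stop x) n \<longleftrightarrow> \<omega> \<in> \<Omega> \<and> fb_count \<omega> = enat n"
proof
  assume "\<omega> \<in> stage feedback (fb_stop x) n"
  then have \<omega>: "\<omega> \<in> \<Omega>" "feedback n \<omega> \<le> fb_stop x \<omega>" "fb_stop x \<omega> < feedback (Suc n) \<omega>" unfolding Q_def[OF fbs fb_st] by auto
  have f: "feedback n \<omega> < \<infinity>" using \<omega> by (auto intro: le_less_trans less_le_trans[OF _ top_greatest])
  have "fb_post n \<omega> \<notin> cont_region"
  proof
    assume "fb_post n \<omega> \<in> cont_region"
    then have "feedback (Suc n) \<omega> < \<infinity>" using f fb_Suc_finite by blast
    from fb_stop_ge[OF \<omega>(1) this, of x] \<omega>(3) show False by simp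
  qed
  then show "\<omega> \<in> \<Omega> \<and> fb_count \<omega> = enat n" using f \<omega>(1) fb_count_cases(1) by blast
next
  assume \<omega>: "\<omega> \<in> \<Omega> \<and> fb_count \<omega> = enat n"
  then have n: "feedback n \<omega> < \<infinity>" "fb_post n \<omega> \<notin> cont_region" using fb_count_cases(1) by blast+
  then have "feedback (Suc n) \<omega> = \<infinity>" using fb_Suc_finite[of n \<omega>] by (auto simp: less_top[symmetric])
  moreover have "fb_stop x \<omega> < \<infinity>" using \<omega> n(1) x_fin by (simp add: fb_stop_def)
  ultimately show "\<omega> \<in> stage feedback (fb_stop x) n"
    unfolding Q_def[OF fbs fb_st] using \<omega> fb_stop_ge[of \<omega> n x] n(1) by simp
qed

text \<open>
  The feedback strategy satisfies the two hypotheses of \<open>total_le_val\<close> by construction.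
\<close>

lemma fb_total: "(\<Sum>k. stop_part feedback (fb_stop x) k + move_part feedback (fb_stop x) k) = ennreal (val \<pi>)"
proof (rule antisym[OF total_le_val[OF fbs fb_st] val_le_total[OF fbs fb_st]])
  fix k \<omega>
  {
    assume "\<omega> \<in> reach feedback (fb_stop x) k - reach feedback (fb_stop x) (Suc k)"
    then have "feedback k \<omega> < \<infinity>" "\<not> feedback (Suc k) \<omega> < \<infinity>" unfolding fb_reach by auto
    then have "fb_post k \<omega> \<notin> cont_region" using fb_Suc_finite by blast
    then show "F_fun D (obs_belief feedback k \<omega>) = val (obs_belief feedback k \<omega>)"
      unfolding obs_belief_fb by (intro val_eq_F fb_post_range)
  }
  assume "\<omega> \<in> reach feedback (fb_stop x) (Suc k)"
  then have f: "feedback (Suc k) \<omega> < \<infinity>" unfolding fb_reach by auto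
  then have "fb_post k \<omega> \<in> cont_region" using fb_Suc_finite by blast
  from wait_time_minimizer[OF this]
  show "obs_value val (enn2real (feedback (Suc k) \<omega>) - enn2real (feedback k \<omega>)) (obs_belief feedback k \<omega>) = val (obs_belief feedback k \<omega>)"
    unfolding obs_belief_fb fb_gap[OF f] by (simp add: minimizers_def)
qed

text \<open>
  The total cost is finite, so \<open>reach_vanishes\<close> excludes infinitely many observations.
\<close>

lemma fb_count_finite: "AE \<omega> in M. fb_count \<omega> \<noteq> \<infinity>"
proof -
  have lim: "(\<lambda>k. emeasure M (reach feedback (fb_stop x) k)) \<longlonglongrightarrow> 0"
    by (rule reach_vanishes[OF fbs fb_st]) (simp add: fb_total)
  let ?N = "\<Inter>k. reach feedback (fb_stop x) k"
  have N: "?N \<in> sets M" using R_M(1)[OF fbs fb_st] by auto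
  have "emeasure M ?N \<le> emeasure M (reach feedback (fb_stop x) k)" for k
    by (rule emeasure_mono) (use R_M(1)[OF fbs fb_st] in auto)
  then have "emeasure M ?N \<le> 0" by (intro LIMSEQ_le_const[OF lim]) auto
  then have "?N \<in> null_sets M" using N by auto
  moreover have "{\<omega>\<in>space M. \<not> fb_count \<omega> \<noteq> \<infinity>} \<subseteq> ?N"
    unfolding fb_reach fb_finite_iff using fb_count_cases(2) by auto
  ultimately show ?thesis by (rule AE_I')
qed

lemma fb_stop_finite: "AE \<omega> in M. fb_stop x \<omega> < \<infinity>"
  using fb_count_finite
proof eventually_elim
  fix \<omega> assume "fb_count \<omega> \<noteq> \<infinity>"
  then obtain n where n: "fb_count \<omega> = enat n" by auto
  then show "fb_stop x \<omega> < \<infinity>" using fb_count_cases(1)[of \<omega> n] x_fin by (simp add: fb_stop_def)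
qed

end

text \<open>
  The lower bound holds for every strategy. It is attained by the feedback strategy followed by the idle time that attains
  \<open>F\<close>.
\<close>

lemma V_fun_eq_val: "V_fun D \<pi> = ennreal (val \<pi>)"
proof (rule antisym)
  let ?x = "\<lambda>p. ennreal (idle_time p)"
  let ?t = "fb_stop ?x"
  have x: "?x \<in> borel_measurable borel" "\<And>p. ?x p < \<infinity>" by auto
  note st = fb_stop_time[OF x(1)]
  have "V_fun D \<pi> \<le> detection_cost D \<pi> feedback ?t"
    unfolding V_fun_def by (intro INF_lower2[OF fb_obs_seqs] INF_lower st)
  also have "\<dots> = (\<integral>\<^sup>+\<omega>. (\<Sum>k. stop_term feedback ?t k \<omega> + move_term feedback ?t k \<omega>) \<partial>M)"
    unfolding detection_cost_eq[OF fb_obs_seqs st]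
  proof (rule nn_integral_cong_AE, use fb_count_finite[OF x] in \<open>rule AE_mp\<close>, intro AE_I2 impI)
    fix \<omega> assume \<omega>: "\<omega> \<in> space M" "fb_count \<omega> \<noteq> \<infinity>"
    then obtain n where n: "fb_count \<omega> = enat n" by auto
    have "\<omega> \<in> stage feedback ?t n" using fb_stage[OF x] \<omega>(1) n by simp
    from terms_eq_cost[OF fb_obs_seqs st this]
    show "indicator {\<omega>\<in>\<Omega>. ?t \<omega> < ennreal (\<Theta> \<omega>)} \<omega> +
       (ennreal cc * (?t \<omega> - ennreal (\<Theta> \<omega>)) + ennreal dd * (\<Sum>k. of_bool (feedback (Suc k) \<omega> \<le> ?t \<omega>))) =
       (\<Sum>k. stop_term feedback ?t k \<omega> + move_term feedback ?t k \<omega>)" by (rule sym)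
  qed
  also have "\<dots> = (\<Sum>k. (\<integral>\<^sup>+\<omega>. indicator (stage feedback ?t k) \<omega> *
       ennreal (stop_cost (enn2real (?t \<omega>) - enn2real (feedback k \<omega>)) (obs_belief feedback k \<omega>)) \<partial>M) + move_part feedback ?t k)"
    by (rule terms_integral[OF fb_obs_seqs st])
  also have "\<dots> = (\<Sum>k. stop_part feedback ?t k + move_part feedback ?t k)"
  proof (intro suminf_cong arg_cong2[where f="(+)"] refl)
    fix k
    show "(\<integral>\<^sup>+\<omega>. indicator (stage feedback ?t k) \<omega> *
       ennreal (stop_cost (enn2real (?t \<omega>) - enn2real (feedback k \<omega>)) (obs_belief feedback k \<omega>)) \<partial>M) = stop_part feedback ?t k"
      unfolding stop_part_Q[OF fb_obs_seqs st fb_stop_finite[OF x]]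
    proof (rule nn_integral_cong)
      fix \<omega>
      show "indicator (stage feedback ?t k) \<omega> * ennreal (stop_cost (enn2real (?t \<omega>) - enn2real (feedback k \<omega>)) (obs_belief feedback k \<omega>)) =
        indicator (stage feedback ?t k) \<omega> * ennreal (F_fun D (obs_belief feedback k \<omega>))"
      proof (cases "\<omega> \<in> stage feedback ?t k")
        case True
        then have n: "fb_count \<omega> = enat k" using fb_stage[OF x] by blast
        then obtain r where r: "feedback k \<omega> = ennreal r" "0 \<le> r" using fb_count_cases(1)[of \<omega> k] by (cases "feedback k \<omega>") auto
        have "enn2real (?t \<omega>) - enn2real (feedback k \<omega>) = idle_time (fb_post k \<omega>)"
          using r idle_time_nonneg by (simp add: fb_stop_def n ennreal_plus[symmetric] del: ennreal_plus)
        then show ?thesis unfolding obs_belief_fb using F_fun_attained[OF fb_post_range[of k \<omega>]] by simp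
      qed simp
    qed
  qed
  also have "\<dots> = ennreal (val \<pi>)" by (rule fb_total[OF x])
  finally show "V_fun D \<pi> \<le> ennreal (val \<pi>)" .
  show "ennreal (val \<pi>) \<le> V_fun D \<pi>"
    unfolding V_fun_def by (intro INF_greatest val_le_detection_cost)
qed

text \<open>
  The model is the same for every prior, so the previous result may be used at all posteriors.
\<close>

lemma V_fun_val: "p \<in> {0..1} \<Longrightarrow> V_fun D p = ennreal (val p)"
  by (rule detection.V_fun_eq_val) (rule detection.intro[OF qd])

lemma J0V_obs_value:
  assumes t: "0 < t"
  shows "J0V D \<pi> t = ennreal (obs_value val t \<pi>)"
proof -
  \<comment> \<open>only the first step of this equidistant sequence is used\<close>
  define S where "S = (\<lambda>(k::nat) (\<omega>::'a). real k * t)"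
  have S: "predictable S" unfolding predictable_def S_def using t by auto
  have X0: "X_obs D 0 \<omega> = 0" if "\<omega> \<in> \<Omega>" for \<omega>
    using bm_0[of \<omega>] change_time_nonneg[of \<omega>] that by (simp add: X_obs_def)
  have gp: "gap S 0 \<omega> = t" for \<omega> by (simp add: gap_def S_def)
  have gn: "gain S 0 \<omega> = X_obs D t \<omega>" if "\<omega> \<in> \<Omega>" for \<omega> using X0[OF that] by (simp add: gain_def S_def)
  have "(\<integral>\<^sup>+\<omega>. V_fun D (posterior_update D t \<pi> (X_obs D t \<omega>)) \<partial>M) =
    (\<integral>\<^sup>+\<omega>. (\<lambda>z. ennreal (val (bayes t \<pi> (snd z)))) (\<omega>, gain S 0 \<omega>) \<partial>M)"
    by (intro nn_integral_cong)
       (simp add: posterior_update_eq_bayes[OF t pi] V_fun_val[OF bayes_range[OF t pi]] gn)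
  also have "\<dots> = (\<integral>\<^sup>+\<omega>. (\<integral>\<^sup>+x. ennreal (lik (gap S 0 \<omega>) (belief S 0 \<omega>) x) * (\<lambda>z. ennreal (val (bayes t \<pi> (snd z)))) (\<omega>, x) \<partial>lborel) \<partial>M)"
    by (rule gain_law[OF S]) measurable
  also have "\<dots> = (\<integral>\<^sup>+\<omega>. ennreal (next_avg val t \<pi>) \<partial>M)"
    unfolding next_avg_integrable(2)[OF t pi val_unit] gp by simp
  also have "\<dots> = ennreal (next_avg val t \<pi>)" using emeasure_space_1 by simp
  finally have avg: "(\<integral>\<^sup>+\<omega>. V_fun D (posterior_update D t \<pi> (X_obs D t \<omega>)) \<partial>M) = ennreal (next_avg val t \<pi>)" .
  have "J0V D \<pi> t = ennreal dd + ennreal (next_avg val t \<pi>) + ennreal (cc * delay t \<pi>)"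
  proof -
    have "cc * t - cc * (1 - \<pi>) * E = cc * (t - (1 - \<pi>) * E)" for E by (simp add: algebra_simps)
    then have "cc * t - cc * (1 - \<pi>) * ((1 - exp (- lam * t)) / lam) = cc * delay t \<pi>" unfolding delay_def .
    then show ?thesis unfolding J0V_def avg using t by simp
  qed
  moreover have "0 \<le> cc * delay t \<pi>" using t delay_pos pi by (intro mult_nonneg_nonneg delay_nonneg) auto
  ultimately show ?thesis
    unfolding obs_value_def using obs_pos next_avg_integrable(3)[OF t pi val_unit] by (simp add: ennreal_plus)
qed

lemma J0V_val: "0 < t \<Longrightarrow> p \<in> {0..1} \<Longrightarrow> J0V D p t = ennreal (obs_value val t p)"
  by (rule detection.J0V_obs_value) (rule detection.intro[OF qd])

lemma continuation_set_eq: "continuation_set D = cont_region"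
  unfolding continuation_set_def cont_region_def
  using V_fun_val val_nonneg by (auto simp: ennreal_less_iff)

text \<open>
  \<open>J0V\<close> agrees with \<open>obs_value\<close> for positive times; at time \<open>0\<close> it exceeds the infimum by the
  observation cost, so \<open>0\<close> is not a minimiser.
\<close>

lemma t_opt_eq:
  assumes p: "p \<in> cont_region"
  shows "t_opt D p = wait_time p"
proof -
  have p': "p \<in> {0..1}" using p by (simp add: cont_region_def)
  have J0: "J0V D p 0 = ennreal (dd + val p)"
    using V_fun_val[OF p'] obs_pos val_nonneg[of p] by (simp add: J0V_def ennreal_plus)
  have w: "0 < wait_time p" "obs_value val (wait_time p) p = val p"
    using wait_time_minimizer[OF p] by (auto simp: minimizers_def)
  have inf: "(INF s\<in>{0..}. J0V D p s) = ennreal (val p)"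
  proof (rule antisym)
    have "(INF s\<in>{0..}. J0V D p s) \<le> J0V D p (wait_time p)" using w(1) by (intro INF_lower) simp
    then show "(INF s\<in>{0..}. J0V D p s) \<le> ennreal (val p)" using J0V_val[OF w(1) p'] w(2) by simp
    show "ennreal (val p) \<le> (INF s\<in>{0..}. J0V D p s)"
    proof (rule INF_greatest)
      fix s :: real assume "s \<in> {0..}"
      then consider "s = 0" | "0 < s" by fastforce
      then show "ennreal (val p) \<le> J0V D p s"
      proof cases
        case 1
        then show ?thesis using J0 obs_pos by (simp add: ennreal_leI)
      next
        case 2
        then show ?thesis using J0V_val[OF 2 p'] val_le_obs[OF 2 p'] by (simp add: ennreal_leI)
      qed
    qed
  qed
  have "{t. 0 \<le> t \<and> (INF s\<in>{0..}. J0V D p s) = J0V D p t} = minimizers p"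
  proof (rule set_eqI)
    fix t :: real
    consider "t < 0" | "t = 0" | "0 < t" by linarith
    then show "t \<in> {t. 0 \<le> t \<and> (INF s\<in>{0..}. J0V D p s) = J0V D p t} \<longleftrightarrow> t \<in> minimizers p"
    proof cases
      case 2
      have "ennreal (val p) \<noteq> ennreal (dd + val p)"
        using obs_pos val_nonneg[of p] by (subst ennreal_inj) auto
      then show ?thesis unfolding inf using 2 J0 by (auto simp: minimizers_def)
    next
      case 3
      have "0 \<le> obs_value val t p" by (rule obs_value_nonneg[OF 3 p' val_unit])
      then show ?thesis unfolding inf using 3 J0V_val[OF 3 p'] val_nonneg[of p] by (auto simp: minimizers_def)
    qed (auto simp: minimizers_def)
  qed
  then show ?thesis unfolding t_opt_def wait_time_def by simp
qed

lemma t_star_eq: "t_star D = wait"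
  unfolding t_star_def[abs_def] wait_def[abs_def] continuation_set_eq using t_opt_eq by auto

lemma opt_state_eq: "opt_state D \<pi> k \<omega> = fb_state k \<omega>"
proof (induction k)
  case (Suc k)
  have e: "fb_state k \<omega> = (feedback k \<omega>, fb_post k \<omega>)" by (simp add: feedback_def fb_post_def)
  have "posterior_update D (enn2real (feedback k \<omega> + wait (fb_post k \<omega>)) - enn2real (feedback k \<omega>)) (fb_post k \<omega>) x =
     bayes (enn2real (feedback k \<omega> + wait (fb_post k \<omega>)) - enn2real (feedback k \<omega>)) (fb_post k \<omega>) x"
    if "feedback k \<omega> + wait (fb_post k \<omega>) \<noteq> \<infinity>" for x
  proof -
    have f: "feedback (Suc k) \<omega> < \<infinity>" using that by (simp add: fb_Suc(1) less_top[symmetric])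
    then have "fb_post k \<omega> \<in> cont_region" using fb_Suc_finite by blast
    then show ?thesis using fb_gap[OF f] unfolding fb_Suc(1)
      by (simp only:) (intro posterior_update_eq_bayes wait_time_pos fb_post_range)
  qed
  then show ?case unfolding opt_state.simps fb_state.simps Suc e t_star_eq by (auto simp: Let_def)
qed simp

text \<open>
  Once \<open>V = val\<close>, the continuation set and the waiting times in the definition of the optimal strategy are those of the
  feedback strategy.
\<close>

lemma opt_eq:
  "opt_seq D \<pi> = feedback" "opt_post D \<pi> = fb_post" "n_star D \<pi> = fb_count" "opt_stop D \<pi> = fb_stop (\<lambda>_. 0)"
proof -
  show s: "opt_seq D \<pi> = feedback" by (intro ext) (simp add: opt_seq_def feedback_def opt_state_eq)
  show p: "opt_post D \<pi> = fb_post" by (intro ext) (simp add: opt_post_def fb_post_def opt_state_eq)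
  show n: "n_star D \<pi> = fb_count" by (intro ext) (simp add: n_star_def fb_count_def p continuation_set_eq)
  show "opt_stop D \<pi> = fb_stop (\<lambda>_. 0)"
    by (intro ext) (simp add: opt_stop_def fb_stop_def n s split: enat.split)
qed

abbreviation "opt_tau \<equiv> fb_stop (\<lambda>_. 0)"

lemma zero_wait: "(\<lambda>_. 0 :: ennreal) \<in> borel_measurable borel" "(0 :: ennreal) < \<infinity>" by auto

lemma opt_stop_times0: "opt_tau \<in> stop_times0 D \<pi> feedback"
  unfolding stop_times0_def
proof (intro CollectI conjI fb_stop_time zero_wait(1))
  show "AE \<omega> in M. \<exists>k. opt_tau \<omega> = feedback k \<omega>"
    using fb_count_finite[OF zero_wait] by eventually_elim (auto simp: fb_stop_def)
qed

lemma K_opt: "K_fun D \<pi> feedback opt_tau = ennreal (val \<pi>)"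
  using K_fun_eq[OF fb_obs_seqs fb_stop_time[OF zero_wait(1)] opt_stop_times0 fb_stop_finite[OF zero_wait]]
    fb_total[OF zero_wait] by simp

text \<open>
  Both forms of the problem have the value \<open>val \<pi>\<close>, with the feedback strategy attaining it.
\<close>

lemma V_fun_INF_K: "V_fun D \<pi> = (INF \<sigma>\<in>obs_seqs D. INF \<tau>\<in>stop_times0 D \<pi> \<sigma>. K_fun D \<pi> \<sigma> \<tau>)"
proof (rule antisym)
  show "V_fun D \<pi> \<le> (INF \<sigma>\<in>obs_seqs D. INF \<tau>\<in>stop_times0 D \<pi> \<sigma>. K_fun D \<pi> \<sigma> \<tau>)"
    unfolding V_fun_eq_val
  proof (intro INF_greatest)
    fix \<sigma> \<tau> assume "\<sigma> \<in> obs_seqs D" and \<tau>: "\<tau> \<in> stop_times0 D \<pi> \<sigma>"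
    moreover have "\<tau> \<in> stop_times D \<sigma>" using \<tau> by (simp add: stop_times0_def)
    ultimately show "ennreal (val \<pi>) \<le> K_fun D \<pi> \<sigma> \<tau>" by (intro val_le_K)
  qed
  have "(INF \<sigma>\<in>obs_seqs D. INF \<tau>\<in>stop_times0 D \<pi> \<sigma>. K_fun D \<pi> \<sigma> \<tau>) \<le> K_fun D \<pi> feedback opt_tau"
    by (intro INF_lower2[OF fb_obs_seqs] INF_lower opt_stop_times0)
  then show "(INF \<sigma>\<in>obs_seqs D. INF \<tau>\<in>stop_times0 D \<pi> \<sigma>. K_fun D \<pi> \<sigma> \<tau>) \<le> V_fun D \<pi>"
    unfolding K_opt V_fun_eq_val .
qed

lemma K_opt_formula:
  "K_fun D \<pi> feedback opt_tau =
      (\<integral>\<^sup>+\<omega>. (case fb_count \<omega> of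
          \<infinity> \<Rightarrow> \<infinity>
        | enat n \<Rightarrow> ennreal (F_fun D (fb_post n \<omega>) + cc * enn2real (opt_tau \<omega>)
            - cc / lam *
                (\<Sum>k<n. (1 - fb_post k \<omega>) *
                  (1 - exp (- lam * (enn2real (feedback (Suc k) \<omega>) - enn2real (feedback k \<omega>)))))
            + dd * real n)) \<partial>M)"
  unfolding K_fun_def
proof (rule nn_integral_cong_AE, use stop0_stage[OF fb_obs_seqs fb_stop_time[OF zero_wait(1)] opt_stop_times0 fb_stop_finite[OF zero_wait]] in eventually_elim, elim exE conjE)
  fix \<omega> n assume n: "\<omega> \<in> stage feedback opt_tau n" and e: "opt_tau \<omega> = feedback n \<omega>" "posterior D \<pi> feedback opt_tau \<omega> = obs_belief feedback n \<omega>"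
      "\<forall>k. feedback k \<omega> < \<infinity> \<longrightarrow> posterior D \<pi> feedback (feedback k) \<omega> = obs_belief feedback k \<omega>"
  have c: "fb_count \<omega> = enat n" using n fb_stage[OF zero_wait] by blast
  note K = K_integrand[OF fb_obs_seqs fb_stop_time[OF zero_wait(1)] n e(1,2) e(3)[rule_format]]
  show "(if opt_tau \<omega> = \<infinity> then \<infinity> else
        ennreal (F_fun D (posterior D \<pi> feedback opt_tau \<omega>) + cc * enn2real (opt_tau \<omega>)
          - cc / lam *
              (\<Sum>k. (1 - posterior D \<pi> feedback (feedback k) \<omega>) *
                    (1 - exp (- lam * (enn2real (feedback (Suc k) \<omega>) - enn2real (feedback k \<omega>)))) *
                    of_bool (feedback (Suc k) \<omega> \<le> opt_tau \<omega>))) +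
        ennreal dd * (\<Sum>k. of_bool (feedback (Suc k) \<omega> \<le> opt_tau \<omega>))) =
     (case fb_count \<omega> of
          \<infinity> \<Rightarrow> \<infinity>
        | enat n \<Rightarrow> ennreal (F_fun D (fb_post n \<omega>) + cc * enn2real (opt_tau \<omega>)
            - cc / lam *
                (\<Sum>k<n. (1 - fb_post k \<omega>) *
                  (1 - exp (- lam * (enn2real (feedback (Suc k) \<omega>) - enn2real (feedback k \<omega>)))))
            + dd * real n))"
    using trans[OF K] unfolding c enat.case obs_belief_fb .
qed

end

theorem theorem3p1:
  fixes D :: "'a detection_model" and \<pi> :: real
  assumes "quickest_detection D"
    and "\<pi> \<in> {0..1}"
  shows "opt_seq D \<pi> \<in> obs_seqs D
    \<and> opt_stop D \<pi> \<in> stop_times0 D \<pi> (opt_seq D \<pi>)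
    \<and> V_fun D \<pi> = (INF \<sigma>\<in>obs_seqs D. INF \<tau>\<in>stop_times0 D \<pi> \<sigma>. K_fun D \<pi> \<sigma> \<tau>)
    \<and> V_fun D \<pi> = K_fun D \<pi> (opt_seq D \<pi>) (opt_stop D \<pi>)
    \<and> K_fun D \<pi> (opt_seq D \<pi>) (opt_stop D \<pi>) =
      (\<integral>\<^sup>+\<omega>. (case n_star D \<pi> \<omega> of
          \<infinity> \<Rightarrow> \<infinity>
        | enat n \<Rightarrow> ennreal (F_fun D (opt_post D \<pi> n \<omega>) + delay_cost D * enn2real (opt_stop D \<pi> \<omega>)
            - delay_cost D / rate D *
                (\<Sum>k<n. (1 - opt_post D \<pi> k \<omega>) *
                  (1 - exp (- rate D * (enn2real (opt_seq D \<pi> (Suc k) \<omega>) - enn2real (opt_seq D \<pi> k \<omega>)))))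
            + obs_cost D * real n)) \<partial>law D \<pi>)"
proof -
  interpret detection D \<pi> by (rule detection.intro[OF assms])
  show ?thesis
    unfolding opt_eq using fb_obs_seqs opt_stop_times0 V_fun_INF_K V_fun_eq_val K_opt K_opt_formula
    by (intro conjI) simp_all
qed

end
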